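(* There exists a $\mathbb{Q}$-factorial complete non-projective toric variety $X$ of dimension $3$ and Picard number $3$ which admits no non-trivial numerically effective divisor class, i.e. such that $\operatorname{Nef}(X)=0$. Explicitly, let $\mathbf{v}_1,\dots,\mathbf{v}_6\in\mathbb{Z}^3$ be the columns of $$V=\begin{pmatrix}1&0&0&0&-1&1\\0&1&0&-1&-1&3\\0&0&1&-1&0&2\end{pmatrix},$$ and let $\Sigma$ be the collection consisting of the following eight cones and all of their faces, where $\langle i,j,k\rangle$ denotes the cone in $\mathbb{R}^3$ generated by $\mathbf{v}_i,\mathbf{v}_j,\mathbf{v}_k$: $$\langle2,4,5\rangle,\ \langle2,3,5\rangle,\ \langle1,4,5\rangle,\ \langle1,3,5\rangle,\ \langle2,4,6\rangle,\ \langle2,3,6\rangle,\ \langle1,4,6\rangle,\ \langle1,3,6\rangle.$$ Then $\Sigma$ is a rational, simplicial and complete fan, and the associated toric variety $X=X(\Sigma)$ has dimension $3$ and Picard number $3$, is not projective, and satisfies $\operatorname{Nef}(X)=0$.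
   Context: Toric varieties are over $\mathbb{C}$ and associated with rational fans in $N\otimes\mathbb{R}$ (here $N=\mathbb{Z}^3$). The toric variety of a rational, simplicial and complete fan is $\mathbb{Q}$-factorial and complete. The Picard number of $X$ is $\operatorname{rk}(\operatorname{Pic}(X))$. $\operatorname{Nef}(X)\subseteq \operatorname{Cl}(X)\otimes\mathbb{R}$ denotes the cone generated by the classes of numerically effective (nef) divisors; $\operatorname{Nef}(X)=0$ means that this cone reduces to the origin. *)

theory Defs
  imports
    "HOL-Analysis.Analysis"
    "HOL-Algebra.Coset"
    "HOL-Algebra.FiniteProduct"
    "HOL-Algebra.Generated_Groups"
begin

section \<open>Spaces with functions\<close>

text \<open>
  Complex algebraic varieties are modelled as sets of closed points with a Zariski topology and a
  sheaf of \<open>\<complex>\<close>-valued regular functions.  A regular function on \<open>U\<close> is a total function of which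
  only the values on \<open>U\<close> matter; \<open>reg X U\<close> is only meaningful for open \<open>U\<close>.
\<close>

record 'a fun_space =
  zar :: "'a topology"
  reg :: "'a set \<Rightarrow> ('a \<Rightarrow> complex) set"

abbreviation points :: "'a fun_space \<Rightarrow> 'a set"
  where "points X \<equiv> topspace (zar X)"

text \<open>The structure induced on a (locally closed) subset: regular functions are those which locally
  extend to regular functions of the ambient space.\<close>

definition fsubspace :: "'a fun_space \<Rightarrow> 'a set \<Rightarrow> 'a fun_space" where
  "fsubspace X V =
     \<lparr>zar = subtopology (zar X) V,
      reg = (\<lambda>U. {f. \<forall>p\<in>U. \<exists>W g. openin (zar X) W \<and> p \<in> W \<and> g \<in> reg X W \<and>
                              (\<forall>q\<in>W \<inter> U. f q = g q)})\<rparr>"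

definition fs_iso :: "'a fun_space \<Rightarrow> 'b fun_space \<Rightarrow> ('a \<Rightarrow> 'b) \<Rightarrow> bool" where
  "fs_iso X Y \<phi> \<longleftrightarrow>
     homeomorphic_map (zar X) (zar Y) \<phi> \<and>
     (\<forall>V f. openin (zar Y) V \<longrightarrow> (f \<in> reg Y V \<longleftrightarrow> f \<circ> \<phi> \<in> reg X {x \<in> points X. \<phi> x \<in> V}))"

definition fs_isomorphic :: "'a fun_space \<Rightarrow> 'b fun_space \<Rightarrow> bool" where
  "fs_isomorphic X Y \<longleftrightarrow> (\<exists>\<phi>. fs_iso X Y \<phi>)"

section \<open>Affine and projective space\<close>

definition poly_funs :: "nat \<Rightarrow> ((nat \<Rightarrow> complex) \<Rightarrow> complex) set" where
  "poly_funs n = {(\<lambda>z. \<Sum>e\<in>E. c e * (\<Prod>i<n. z i ^ e i)) | (E :: (nat \<Rightarrow> nat) set) c. finite E}"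

definition affine_space :: "nat \<Rightarrow> (nat \<Rightarrow> complex) fun_space" where
  "affine_space n =
    (let A = {z. \<forall>i\<ge>n. z i = 0} in
     \<lparr>zar = topology_generated_by {{z \<in> A. f z \<noteq> 0} | f. f \<in> poly_funs n},
      reg = (\<lambda>U. {f. \<forall>p\<in>U. \<exists>a\<in>poly_funs n. \<exists>b\<in>poly_funs n.
                       b p \<noteq> 0 \<and> (\<forall>q\<in>U. b q \<noteq> 0 \<longrightarrow> f q = a q / b q)})\<rparr>)"

text \<open>Forms of degree \<open>d\<close> in the \<open>n + 1\<close> variables \<open>z 0, \<dots>, z n\<close>.\<close>

definition forms :: "nat \<Rightarrow> nat \<Rightarrow> ((nat \<Rightarrow> complex) \<Rightarrow> complex) set" where
  "forms n d = {(\<lambda>z. \<Sum>e\<in>E. c e * (\<Prod>i\<le>n. z i ^ e i)) | (E :: (nat \<Rightarrow> nat) set) c.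
                  finite E \<and> (\<forall>e\<in>E. (\<Sum>i\<le>n. e i) = d)}"

text \<open>A point of \<open>\<P>\<^sup>n\<close> is the set of all its vectors of homogeneous coordinates.\<close>

definition proj_points :: "nat \<Rightarrow> (nat \<Rightarrow> complex) set set" where
  "proj_points n =
     {{(\<lambda>i. c * z i) | c. c \<noteq> 0} | z. (\<forall>i>n. z i = 0) \<and> (\<exists>i\<le>n. z i \<noteq> 0)}"

definition proj_space :: "nat \<Rightarrow> (nat \<Rightarrow> complex) set fun_space" where
  "proj_space n =
     \<lparr>zar = topology_generated_by {{P \<in> proj_points n. \<forall>z\<in>P. F z \<noteq> 0} | F d. F \<in> forms n d},
      reg = (\<lambda>U. {f. \<forall>P\<in>U. \<exists>d. \<exists>F\<in>forms n d. \<exists>G\<in>forms n d.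
                       (\<forall>z\<in>P. G z \<noteq> 0) \<and> (\<forall>Q\<in>U. \<forall>z\<in>Q. G z \<noteq> 0 \<longrightarrow> f Q = F z / G z)})\<rparr>"

definition projective :: "'a fun_space \<Rightarrow> bool" where
  "projective X \<longleftrightarrow>
     (\<exists>n V. closedin (zar (proj_space n)) V \<and> fs_isomorphic X (fsubspace (proj_space n) V))"

section \<open>Prevarieties, products, completeness\<close>

definition prevariety :: "'a fun_space \<Rightarrow> bool" where
  "prevariety X \<longleftrightarrow>
     (\<forall>U f g. (\<forall>p\<in>U. f p = g p) \<longrightarrow> (f \<in> reg X U \<longleftrightarrow> g \<in> reg X U)) \<and>
     (\<forall>U f. openin (zar X) U \<longrightarrow>
        (f \<in> reg X U \<longleftrightarrow> (\<forall>p\<in>U. \<exists>W. openin (zar X) W \<and> p \<in> W \<and> W \<subseteq> U \<and> f \<in> reg X W))) \<and>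
     (\<exists>\<U>. finite \<U> \<and> \<Union>\<U> = points X \<and>
        (\<forall>U\<in>\<U>. openin (zar X) U \<and>
           (\<exists>n W. closedin (zar (affine_space n)) W \<and>
                  fs_isomorphic (fsubspace X U) (fsubspace (affine_space n) W))))"

text \<open>The Zariski topology of the product of two prevarieties (not the product topology).\<close>

definition prod_zar :: "'a fun_space \<Rightarrow> 'b fun_space \<Rightarrow> ('a \<times> 'b) topology" where
  "prod_zar X Y = topology_generated_by
     {{(x, y). x \<in> U \<and> y \<in> V \<and> (\<Sum>i<k. f i x * g i y) \<noteq> 0} | U V (k::nat) f g.
        openin (zar X) U \<and> openin (zar Y) V \<and> (\<forall>i<k. f i \<in> reg X U \<and> g i \<in> reg Y V)}"

text \<open>The projection \<open>X \<times> Z \<rightarrow> Z\<close> is closed for all \<open>Z\<close>.  The type of the points of \<open>Z\<close> is no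
  restriction, since the set of points of a prevariety over \<open>\<complex>\<close> has at most the cardinality of \<open>\<complex>\<close>.\<close>

definition complete_variety :: "'a fun_space \<Rightarrow> bool" where
  "complete_variety X \<longleftrightarrow>
     (\<forall>Z :: (nat \<Rightarrow> complex) fun_space. prevariety Z \<longrightarrow> closed_map (prod_zar X Z) (zar Z) snd)"

section \<open>Dimension\<close>

definition irreducible_closed :: "'a topology \<Rightarrow> 'a set \<Rightarrow> bool" where
  "irreducible_closed T Y \<longleftrightarrow> closedin T Y \<and> Y \<noteq> {} \<and>
     (\<forall>A B. closedin T A \<and> closedin T B \<and> Y \<subseteq> A \<union> B \<longrightarrow> Y \<subseteq> A \<or> Y \<subseteq> B)"

definition irreducible_chain :: "'a topology \<Rightarrow> (nat \<Rightarrow> 'a set) \<Rightarrow> nat \<Rightarrow> bool" where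
  "irreducible_chain T Z n \<longleftrightarrow>
     (\<forall>i\<le>n. irreducible_closed T (Z i)) \<and> (\<forall>i<n. Z i \<subset> Z (Suc i))"

definition krull_dim :: "'a topology \<Rightarrow> enat" where
  "krull_dim T = (SUP n \<in> {n. \<exists>Z. irreducible_chain T Z n}. enat n)"

definition codim :: "'a topology \<Rightarrow> 'a set \<Rightarrow> enat" where
  "codim T Y = (SUP n \<in> {n. \<exists>Z. irreducible_chain T Z n \<and> Z 0 = Y}. enat n)"

section \<open>Local rings and valuations\<close>

text \<open>
  From here on \<open>X\<close> is thought of as a normal (in particular irreducible) variety.  Let \<open>Y\<close> be a
  nonempty irreducible subset of \<open>X\<close>.  Elements of the local ring of \<open>X\<close> along \<open>Y\<close> are represented
  by functions regular on some open set meeting \<open>Y\<close>, up to \<open>germ_eq X Y\<close>.  The case \<open>Y = {p}\<close> is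
  the local ring at a point, and \<open>Y = points X\<close> gives the field of rational functions.
\<close>

definition local_ring :: "'a fun_space \<Rightarrow> 'a set \<Rightarrow> ('a \<Rightarrow> complex) set" where
  "local_ring X Y = {f. \<exists>U. openin (zar X) U \<and> U \<inter> Y \<noteq> {} \<and> f \<in> reg X U}"

definition germ_eq :: "'a fun_space \<Rightarrow> 'a set \<Rightarrow> ('a \<Rightarrow> complex) \<Rightarrow> ('a \<Rightarrow> complex) \<Rightarrow> bool" where
  "germ_eq X Y f g \<longleftrightarrow> (\<exists>U. openin (zar X) U \<and> U \<inter> Y \<noteq> {} \<and> (\<forall>x\<in>U. f x = g x))"

definition local_units :: "'a fun_space \<Rightarrow> 'a set \<Rightarrow> ('a \<Rightarrow> complex) set" where
  "local_units X Y =
     {u \<in> local_ring X Y. \<exists>w\<in>local_ring X Y. germ_eq X Y (\<lambda>x. u x * w x) (\<lambda>_. 1)}"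

definition max_ideal :: "'a fun_space \<Rightarrow> 'a set \<Rightarrow> ('a \<Rightarrow> complex) set" where
  "max_ideal X Y = local_ring X Y - local_units X Y"

definition uniformizer :: "'a fun_space \<Rightarrow> 'a set \<Rightarrow> ('a \<Rightarrow> complex) \<Rightarrow> bool" where
  "uniformizer X Y \<pi> \<longleftrightarrow> \<pi> \<in> max_ideal X Y \<and>
     (\<forall>g\<in>max_ideal X Y. \<exists>h\<in>local_ring X Y. germ_eq X Y g (\<lambda>x. \<pi> x * h x))"

definition rat_units :: "'a fun_space \<Rightarrow> ('a \<Rightarrow> complex) set" where
  "rat_units X = {f \<in> local_ring X (points X). \<not> germ_eq X (points X) f (\<lambda>_. 0)}"

text \<open>The discrete valuation of the local ring along a prime divisor.\<close>

definition valuation :: "'a fun_space \<Rightarrow> 'a set \<Rightarrow> ('a \<Rightarrow> complex) \<Rightarrow> int" where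
  "valuation X Y f = (THE k. \<exists>\<pi> u. uniformizer X Y \<pi> \<and> u \<in> local_units X Y \<and>
                                germ_eq X (points X) f (\<lambda>x. u x * \<pi> x powi k))"

section \<open>Weil and Cartier divisors\<close>

definition prime_divisor :: "'a fun_space \<Rightarrow> 'a set \<Rightarrow> bool" where
  "prime_divisor X Y \<longleftrightarrow> irreducible_closed (zar X) Y \<and> codim (zar X) Y = 1"

definition weil_divisors :: "'a fun_space \<Rightarrow> ('a set \<Rightarrow> int) set" where
  "weil_divisors X = {D. finite {Y. D Y \<noteq> 0} \<and> (\<forall>Y. D Y \<noteq> 0 \<longrightarrow> prime_divisor X Y)}"

definition principal_div :: "'a fun_space \<Rightarrow> ('a \<Rightarrow> complex) \<Rightarrow> 'a set \<Rightarrow> int" where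
  "principal_div X f = (\<lambda>Y. if prime_divisor X Y then valuation X Y f else 0)"

definition principal_divisors :: "'a fun_space \<Rightarrow> ('a set \<Rightarrow> int) set" where
  "principal_divisors X = principal_div X ` rat_units X"

definition local_equation ::
    "'a fun_space \<Rightarrow> ('a set \<Rightarrow> int) \<Rightarrow> 'a \<Rightarrow> ('a \<Rightarrow> complex) \<Rightarrow> bool" where
  "local_equation X D p f \<longleftrightarrow> f \<in> rat_units X \<and>
     (\<exists>U. openin (zar X) U \<and> p \<in> U \<and>
          (\<forall>Y. prime_divisor X Y \<and> Y \<inter> U \<noteq> {} \<longrightarrow> D Y = principal_div X f Y))"

definition cartier_divisors :: "'a fun_space \<Rightarrow> ('a set \<Rightarrow> int) set" where
  "cartier_divisors X = {D \<in> weil_divisors X. \<forall>p\<in>points X. \<exists>f. local_equation X D p f}"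

definition q_factorial :: "'a fun_space \<Rightarrow> bool" where
  "q_factorial X \<longleftrightarrow>
     (\<forall>D\<in>weil_divisors X. \<exists>k::nat. k > 0 \<and> (\<lambda>Y. int k * D Y) \<in> cartier_divisors X)"

definition div_group :: "'a fun_space \<Rightarrow> ('a set \<Rightarrow> int) monoid" where
  "div_group X = \<lparr>carrier = weil_divisors X, mult = (\<lambda>D E Y. D Y + E Y), one = (\<lambda>_. 0)\<rparr>"

definition class_group :: "'a fun_space \<Rightarrow> ('a set \<Rightarrow> int) set monoid" where
  "class_group X = div_group X Mod principal_divisors X"

definition picard_group :: "'a fun_space \<Rightarrow> ('a set \<Rightarrow> int) set monoid" where
  "picard_group X = (div_group X\<lparr>carrier := cartier_divisors X\<rparr>) Mod principal_divisors X"

definition group_rank :: "('g, 'm) monoid_scheme \<Rightarrow> enat" where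
  "group_rank G = (SUP S \<in> {S. finite S \<and> S \<subseteq> carrier G \<and>
      (\<forall>c :: 'g \<Rightarrow> int. finprod G (\<lambda>s. s [^]\<^bsub>G\<^esub> c s) S = \<one>\<^bsub>G\<^esub> \<longrightarrow> (\<forall>s\<in>S. c s = 0))}. enat (card S))"

definition picard_number :: "'a fun_space \<Rightarrow> enat" where
  "picard_number X = group_rank (picard_group X)"

section \<open>Intersection with curves\<close>

definition curve :: "'a fun_space \<Rightarrow> 'a set \<Rightarrow> bool" where
  "curve X C \<longleftrightarrow> irreducible_closed (zar X) C \<and> krull_dim (subtopology (zar X) C) = 1"

text \<open>
  The length of \<open>\<O>\<^bsub>C,p\<^esub> / (a)\<close>, which is its dimension over \<open>\<complex>\<close>: there are germs \<open>e 0, \<dots>, e (k - 1)\<close>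
  whose classes form a basis.  Here \<open>\<O>\<^bsub>C,p\<^esub>\<close> is obtained from the local ring of \<open>X\<close> at \<open>p\<close> by restriction
  to \<open>C\<close>.
\<close>

definition colength :: "'a fun_space \<Rightarrow> 'a set \<Rightarrow> 'a \<Rightarrow> ('a \<Rightarrow> complex) \<Rightarrow> nat" where
  "colength X C p a = (THE k. \<exists>e :: nat \<Rightarrow> 'a \<Rightarrow> complex. (\<forall>i<k. e i \<in> local_ring X {p}) \<and>
     (\<forall>g\<in>local_ring X {p}. \<exists>!c :: nat \<Rightarrow> complex. (\<forall>i\<ge>k. c i = 0) \<and>
        (\<exists>h\<in>local_ring X {p}. \<exists>U. openin (zar X) U \<and> p \<in> U \<and>
           (\<forall>q\<in>U \<inter> C. g q = (\<Sum>i<k. c i * e i q) + a q * h q))))"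

definition vanishes_on_near :: "'a fun_space \<Rightarrow> 'a set \<Rightarrow> 'a \<Rightarrow> ('a \<Rightarrow> complex) \<Rightarrow> bool" where
  "vanishes_on_near X C p a \<longleftrightarrow> (\<exists>U. openin (zar X) U \<and> p \<in> U \<and> (\<forall>q\<in>U \<inter> C. a q = 0))"

text \<open>The order at \<open>p\<close> of the restriction to \<open>C\<close> of a local equation \<open>a / b\<close> of \<open>D\<close>, for a Cartier
  divisor \<open>D\<close> whose support does not contain \<open>C\<close> (cf. Fulton, Intersection Theory, 1.2).\<close>

definition local_int :: "'a fun_space \<Rightarrow> ('a set \<Rightarrow> int) \<Rightarrow> 'a set \<Rightarrow> 'a \<Rightarrow> int" where
  "local_int X D C p = (THE k. \<exists>f a b. local_equation X D p f \<and>
      a \<in> local_ring X {p} \<and> b \<in> local_ring X {p} \<and>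
      \<not> vanishes_on_near X C p a \<and> \<not> vanishes_on_near X C p b \<and>
      germ_eq X (points X) (\<lambda>x. f x * b x) a \<and>
      k = int (colength X C p a) - int (colength X C p b))"

text \<open>\<open>D \<cdot> C\<close>: move \<open>D\<close> in its linear equivalence class so that its support does not contain \<open>C\<close>,
  then add up the local contributions.\<close>

definition intersection_number :: "'a fun_space \<Rightarrow> ('a set \<Rightarrow> int) \<Rightarrow> 'a set \<Rightarrow> int" where
  "intersection_number X D C = (THE d. \<exists>g\<in>rat_units X.
      let D' = (\<lambda>Y. D Y + principal_div X g Y) in
        (\<forall>Y. D' Y \<noteq> 0 \<longrightarrow> \<not> C \<subseteq> Y) \<and>
        d = (\<Sum>p \<in> {p \<in> C. local_int X D' C p \<noteq> 0}. local_int X D' C p))"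

text \<open>Numerically effective divisors on a complete variety \<open>X\<close> (all closed curves of which are
  complete).\<close>

definition nef_divisors :: "'a fun_space \<Rightarrow> ('a set \<Rightarrow> int) set" where
  "nef_divisors X =
     {D \<in> cartier_divisors X. \<forall>C. curve X C \<longrightarrow> intersection_number X D C \<ge> 0}"

section \<open>The nef cone\<close>

text \<open>The real vector space \<open>G \<otimes> \<real>\<close> for an abelian group \<open>G\<close>: formal real linear combinations of
  elements of \<open>G\<close>, modulo the subspace spanned by all \<open>[g h] - [g] - [h]\<close>.\<close>

definition real_combs :: "('g, 'm) monoid_scheme \<Rightarrow> ('g \<Rightarrow> real) monoid" where
  "real_combs G = \<lparr>carrier = {a. finite {g. a g \<noteq> 0} \<and> {g. a g \<noteq> 0} \<subseteq> carrier G},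
                   mult = (\<lambda>a b g. a g + b g), one = (\<lambda>_. 0)\<rparr>"

definition tensor_relations :: "('g, 'm) monoid_scheme \<Rightarrow> ('g \<Rightarrow> real) set" where
  "tensor_relations G = generate (real_combs G)
     {(\<lambda>x. r * (of_bool (x = g \<otimes>\<^bsub>G\<^esub> h) - of_bool (x = g) - of_bool (x = h))) | r g h.
        g \<in> carrier G \<and> h \<in> carrier G}"

definition tensor_real :: "('g, 'm) monoid_scheme \<Rightarrow> ('g \<Rightarrow> real) set monoid" where
  "tensor_real G = real_combs G Mod tensor_relations G"

definition nef_classes :: "'a fun_space \<Rightarrow> ('a set \<Rightarrow> int) set set" where
  "nef_classes X = {principal_divisors X #>\<^bsub>div_group X\<^esub> D | D. D \<in> nef_divisors X}"

text \<open>The convex cone in \<open>Cl(X) \<otimes> \<real>\<close> generated by the classes of nef divisors.\<close>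

definition nef_cone :: "'a fun_space \<Rightarrow> (('a set \<Rightarrow> int) set \<Rightarrow> real) set set" where
  "nef_cone X =
     {tensor_relations (class_group X) #>\<^bsub>real_combs (class_group X)\<^esub> a | a.
        a \<in> carrier (real_combs (class_group X)) \<and>
        (\<forall>c. a c \<ge> 0) \<and> (\<forall>c. a c \<noteq> 0 \<longrightarrow> c \<in> nef_classes X)}"

section \<open>Fans\<close>

definition lat :: "int ^ 'n \<Rightarrow> real ^ 'n" where
  "lat m = (\<chi> i. real_of_int (m $ i))"

definition rational_polyhedral :: "(real ^ 'n) set \<Rightarrow> bool" where
  "rational_polyhedral \<sigma> \<longleftrightarrow> (\<exists>S. finite S \<and> \<sigma> = convex_cone hull (lat ` S))"

definition strongly_convex :: "'v::real_vector set \<Rightarrow> bool" where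
  "strongly_convex \<sigma> \<longleftrightarrow> \<sigma> \<inter> uminus ` \<sigma> = {0}"

text \<open>The library's \<open>face_of\<close> admits the empty face.\<close>

definition cone_face :: "'v::real_vector set \<Rightarrow> 'v set \<Rightarrow> bool" where
  "cone_face \<tau> \<sigma> \<longleftrightarrow> \<tau> face_of \<sigma> \<and> \<tau> \<noteq> {}"

definition rational_fan :: "(real ^ 'n) set set \<Rightarrow> bool" where
  "rational_fan \<Sigma> \<longleftrightarrow> finite \<Sigma> \<and> \<Sigma> \<noteq> {} \<and>
     (\<forall>\<sigma>\<in>\<Sigma>. rational_polyhedral \<sigma> \<and> strongly_convex \<sigma>) \<and>
     (\<forall>\<sigma>\<in>\<Sigma>. \<forall>\<tau>. cone_face \<tau> \<sigma> \<longrightarrow> \<tau> \<in> \<Sigma>) \<and>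
     (\<forall>\<sigma>\<in>\<Sigma>. \<forall>\<tau>\<in>\<Sigma>. cone_face (\<sigma> \<inter> \<tau>) \<sigma> \<and> cone_face (\<sigma> \<inter> \<tau>) \<tau>)"

definition simplicial_fan :: "(real ^ 'n) set set \<Rightarrow> bool" where
  "simplicial_fan \<Sigma> \<longleftrightarrow> (\<forall>\<sigma>\<in>\<Sigma>. \<exists>B. independent B \<and> \<sigma> = convex_cone hull B)"

definition complete_fan :: "(real ^ 'n) set set \<Rightarrow> bool" where
  "complete_fan \<Sigma> \<longleftrightarrow> \<Union>\<Sigma> = UNIV"

section \<open>The toric variety of a fan\<close>

text \<open>The semigroup \<open>S\<^sub>\<sigma> = \<sigma>\<^sup>\<or> \<inter> M\<close>, where the standard inner product identifies \<open>M\<close> with \<open>\<int>\<^sup>n\<close>.\<close>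

definition dual_semigroup :: "(real ^ 'n) set \<Rightarrow> (int ^ 'n) set" where
  "dual_semigroup \<sigma> = {m. \<forall>u\<in>\<sigma>. lat m \<bullet> u \<ge> 0}"

text \<open>The points of the affine chart \<open>U\<^sub>\<sigma> = Spec \<complex>[S\<^sub>\<sigma>]\<close>, as semigroup homomorphisms \<open>S\<^sub>\<sigma> \<rightarrow> \<complex>\<close>
  (extended by \<open>0\<close> outside \<open>S\<^sub>\<sigma>\<close>), and the coordinate ring \<open>\<complex>[S\<^sub>\<sigma>]\<close> acting on them.\<close>

definition chart :: "(real ^ 'n) set \<Rightarrow> (int ^ 'n \<Rightarrow> complex) set" where
  "chart \<sigma> = {x. x 0 = 1 \<and>
     (\<forall>m\<in>dual_semigroup \<sigma>. \<forall>m'\<in>dual_semigroup \<sigma>. x (m + m') = x m * x m') \<and>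
     (\<forall>m. m \<notin> dual_semigroup \<sigma> \<longrightarrow> x m = 0)}"

definition chart_ring :: "(real ^ 'n) set \<Rightarrow> ((int ^ 'n \<Rightarrow> complex) \<Rightarrow> complex) set" where
  "chart_ring \<sigma> = {(\<lambda>x. \<Sum>m\<in>F. c m * x m) | F c. finite F \<and> F \<subseteq> dual_semigroup \<sigma>}"

text \<open>The charts of \<open>\<sigma>\<close> and \<open>\<tau>\<close> are glued along the chart of \<open>\<sigma> \<inter> \<tau>\<close>, which maps to both of them
  by restriction of homomorphisms.\<close>

type_synonym 'n chart_point = "(real ^ 'n) set \<times> (int ^ 'n \<Rightarrow> complex)"

definition gluing :: "(real ^ 'n) set set \<Rightarrow> ('n chart_point \<times> 'n chart_point) set" where
  "gluing \<Sigma> = {((\<sigma>, x), (\<tau>, y)) | \<sigma> x \<tau> y. \<sigma> \<in> \<Sigma> \<and> \<tau> \<in> \<Sigma> \<and> x \<in> chart \<sigma> \<and> y \<in> chart \<tau> \<and>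
     (\<exists>z\<in>chart (\<sigma> \<inter> \<tau>). (\<forall>m\<in>dual_semigroup \<sigma>. z m = x m) \<and> (\<forall>m\<in>dual_semigroup \<tau>. z m = y m))}"

definition toric_point ::
    "(real ^ 'n) set set \<Rightarrow> (real ^ 'n) set \<Rightarrow> (int ^ 'n \<Rightarrow> complex) \<Rightarrow> 'n chart_point set" where
  "toric_point \<Sigma> \<sigma> x = gluing \<Sigma> `` {(\<sigma>, x)}"

definition toric_variety :: "(real ^ 'n) set set \<Rightarrow> 'n chart_point set fun_space" where
  "toric_variety \<Sigma> =
     \<lparr>zar = topology_generated_by
        {{toric_point \<Sigma> \<sigma> x | x. x \<in> chart \<sigma> \<and> f x \<noteq> 0} | \<sigma> f. \<sigma> \<in> \<Sigma> \<and> f \<in> chart_ring \<sigma>},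
      reg = (\<lambda>U. {f. \<forall>\<sigma>\<in>\<Sigma>. \<forall>x\<in>chart \<sigma>. toric_point \<Sigma> \<sigma> x \<in> U \<longrightarrow>
        (\<exists>a\<in>chart_ring \<sigma>. \<exists>b\<in>chart_ring \<sigma>. b x \<noteq> 0 \<and>
           (\<forall>y\<in>chart \<sigma>. toric_point \<Sigma> \<sigma> y \<in> U \<and> b y \<noteq> 0 \<longrightarrow>
                f (toric_point \<Sigma> \<sigma> y) = a y / b y))})\<rparr>"

section \<open>The fan of the example\<close>

definition V_mat :: "int ^ 6 ^ 3" where
  "V_mat = vector [vector [1, 0, 0,  0, -1, 1],
                   vector [0, 1, 0, -1, -1, 3],
                   vector [0, 0, 1, -1,  0, 2]]"

text \<open>In the index type \<open>6\<close> the numeral \<open>6\<close> denotes the same element as \<open>0\<close>; \<open>vector\<close> enumerates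
  the components as \<open>1, \<dots>, 6\<close>.\<close>

definition cone3 :: "6 \<Rightarrow> 6 \<Rightarrow> 6 \<Rightarrow> (real ^ 3) set" where
  "cone3 i j k = convex_cone hull (lat ` {column i V_mat, column j V_mat, column k V_mat})"

definition example_fan :: "(real ^ 3) set set" where
  "example_fan = {\<tau>. \<exists>\<sigma> \<in> {cone3 2 4 5, cone3 2 3 5, cone3 1 4 5, cone3 1 3 5,
                           cone3 2 4 6, cone3 2 3 6, cone3 1 4 6, cone3 1 3 6}. cone_face \<tau> \<sigma>}"

end

theory Submission
  imports Defs "HOL-Computational_Algebra.Computational_Algebra" "HOL-Computational_Algebra.Field_as_Ring"
begin

text \<open>
  All maximal cones except \<open>\<langle>1, 3, 6\<rangle>\<close>, which has index \<open>3\<close>, are unimodular.  Hence copies of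
  affine \<open>3\<close>-space cover \<open>X\<close> up to one point, and prime divisors and valuations are computed in the
  factorial ring of polynomials in three variables.  As divisors on the chart of \<open>\<langle>2, 3, 5\<rangle>\<close> are
  principal, every divisor is linearly equivalent to a unique \<open>D = d\<^sub>1 D\<^sub>1 + d\<^sub>4 D\<^sub>4 + d\<^sub>6 D\<^sub>6\<close>, and \<open>3 D\<close>
  is Cartier; this gives the Picard number.

  The degrees of \<open>D\<close> on the invariant curves of the walls \<open>\<langle>4, 6\<rangle>\<close>, \<open>\<langle>1, 5\<rangle>\<close>, \<open>\<langle>2, 3\<rangle>\<close>, \<open>\<langle>2, 5\<rangle>\<close> are
  nonnegative iff \<open>d\<^sub>1 \<ge> 2 d\<^sub>4 + d\<^sub>6\<close>, \<open>d\<^sub>4 \<ge> d\<^sub>1\<close>, \<open>d\<^sub>6 \<ge> 0\<close>, \<open>d\<^sub>4 \<ge> 0\<close>, which forces \<open>D = 0\<close>.  So nef divisors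
  are principal.  The hyperplane class of a projective embedding satisfies the same inequalities;
  then the ratios of the homogeneous coordinates have no poles and the embedding is constant.

  For completeness, let \<open>A\<close> be closed in \<open>X \<times> Z\<close> and disjoint from the fibre over \<open>z\<^sub>0\<close>.  On each chart
  the Nullstellensatz yields a combination of characters which vanishes on \<open>A\<close> and whose
  coefficients are regular functions on \<open>Z\<close> with value \<open>1\<close> (for the trivial character) or \<open>0\<close> at \<open>z\<^sub>0\<close>.
  Translates of these equations by a suitable finite set of characters form a square linear system
  which is the identity at \<open>z\<^sub>0\<close> and which is solved by the values of the characters at the points
  of \<open>A\<close>.  Elimination gives a regular function which does not vanish at \<open>z\<^sub>0\<close> but vanishes on the
  image of \<open>A\<close>.
\<close>

section \<open>Polynomials in three variables\<close>

text \<open>Valuations, colengths and intersection numbers are definite descriptions over all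
  uniformizers, bases, local equations and moving functions. Each computation must show independence
  of these choices; to this end relations between germs are turned into identities of polynomials on
  one chart, where multiplicities, orders and degrees can be compared. The singular fixed point is
  harmless for divisors, since it lies on \<open>D_1\<close> and so has codimension greater than 1,
  and for the degrees, since the four walls lie between smooth cones. Completeness cannot be
  inherited from projective space. The finite set of characters consists of the lattice points of a
  large polytope: if the facets that are nearly active at a point have normals in a common cone, the
  equation of the chart of that cone can be translated to the point without leaving the set. A
  polytope with the fan itself as normal fan would make \<open>X\<close> projective, so a refinement
  is used. The linear systems are set up orbit by orbit, because on the orbit of a cone only the
  characters orthogonal to it survive.\<close>

type_synonym p3 = "complex poly poly poly"
datatype c3 = Pt (px: complex) (py: complex) (pz: complex)

text \<open>The nested univariate type inherits factoriality, \<open>gcd\<close> and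
  \<open>multiplicity\<close> from univariate polynomials; \<open>z\<close> is the outermost
  variable and \<open>x\<close> the innermost one.\<close>

definition ev :: "p3 => c3 => complex" where
 "ev P v = poly (poly (poly P [:[:pz v:]:]) [:py v:]) (px v)"

definition cX :: p3 where "cX = [:[:[:0, 1:]:]:]"
definition cY :: p3 where "cY = [:[:0, 1:]:]"
definition cZ :: p3 where "cZ = [:0, 1:]"
definition cC :: "complex => p3" where "cC c = [:[:[:c:]:]:]"

lemma ev_simps [simp]:
 "ev 0 v = 0" "ev 1 v = 1" "ev (P + Q) v = ev P v + ev Q v" "ev (P * Q) v = ev P v * ev Q v"
 "ev (P - Q) v = ev P v - ev Q v" "ev (- P) v = - ev P v" "ev (P ^ n) v = ev P v ^ n"
 "ev (cC c) v = c" "ev cX v = px v" "ev cY v = py v" "ev cZ v = pz v"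
 by (cases v; simp add: ev_def cX_def cY_def cZ_def cC_def poly_power)+

lemma ev_sum [simp]: "ev (sum f A) v = (\<Sum>a\<in>A. ev (f a) v)"
 by (induct A rule: infinite_finite_induct) auto

lemma ev_prod [simp]: "ev (prod f A) v = (\<Prod>a\<in>A. ev (f a) v)"
 by (induct A rule: infinite_finite_induct) auto

lemma ev_eq_0_imp: assumes "!!v. ev P v = 0" shows "P = 0"
proof -
 have "poly (poly P [:[:z:]:]) [:y:] = 0" for y z
  using assms[of "Pt _ y z"] by (subst poly_all_0_iff_0[symmetric]) (simp add: ev_def)
 then have *: "poly P [:[:z:]:] = 0" for z
 proof -
  have "infinite (range (%y::complex. [:y:]))"
   by (simp add: finite_image_iff inj_on_def infinite_UNIV_char_0)
  moreover have "range (%y::complex. [:y:]) \<subseteq> {y. poly (poly P [:[:z:]:]) y = 0}"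
   using `!!y z. poly (poly P [:[:z:]:]) [:y:] = 0` by auto
  ultimately show ?thesis
   using poly_roots_finite infinite_super by blast
 qed
 have "infinite (range (%y::complex. [:[:y:]:]))"
  by (simp add: finite_image_iff inj_on_def infinite_UNIV_char_0)
 moreover have "range (%y::complex. [:[:y:]:]) \<subseteq> {y. poly P y = 0}"
  using * by auto
 ultimately show ?thesis
  using poly_roots_finite infinite_super by blast
qed

lemma ev_nonzero: "P ~= 0 ==> \<exists>v. ev P v ~= 0"
 using ev_eq_0_imp by blast

text \<open>\<open>C * (P - Q)\<close> vanishes everywhere. This is the way from an equation between
  germs, valid on a dense open set only, to a polynomial identity.\<close>

lemma ev_eq_genericI:
 assumes "C ~= 0" "!!v. ev C v ~= 0 ==> ev P v = ev Q v" shows "P = Q"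
proof -
 have "C * (P - Q) = 0"
  by (rule ev_eq_0_imp) (use assms(2) in auto)
 then show ?thesis using assms(1) by simp
qed

lemma ev_induct [consumes 0, case_names const X Y Z add mult]:
 assumes "!!c. R (%v. c)" "R px" "R py" "R pz"
  and "!!f g. R f ==> R g ==> R (%v. f v + g v)" "!!f g. R f ==> R g ==> R (%v. f v * g v)"
 shows "R (ev P)"
proof -
 have 1: "R (%v. poly p (px v))" for p
 proof (induct p)
  case 0 show ?case using assms(1)[of 0] by simp
 next
  case (pCons a p) show ?case using assms(5)[OF assms(1)[of a] assms(6)[OF assms(2) pCons(2)]] by simp
 qed
 have 2: "R (%v. poly (poly p [:py v:]) (px v))" for p
 proof (induct p)
  case 0 show ?case using assms(1)[of 0] by simp
 next
  case (pCons a p) show ?case using assms(5)[OF 1[of a] assms(6)[OF assms(3) pCons(2)]] by simp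
 qed
 have 3: "R (ev p)" for p
 proof (induct p)
  case 0 show ?case using assms(1)[of 0] by (simp add: ev_def fun_eq_iff)
 next
  case (pCons a p) show ?case using assms(5)[OF 2[of a] assms(6)[OF assms(4) pCons(2)]]
   by (simp add: ev_def fun_eq_iff)
 qed
 then show ?thesis .
qed

definition mon :: "nat => nat => nat => p3" where "mon i j k = cX ^ i * cY ^ j * cZ ^ k"

lemma ev_mon [simp]: "ev (mon i j k) (Pt x y z) = x ^ i * y ^ j * z ^ k"
 by (simp add: mon_def)

lemma coeff_mon: "coeff (coeff (coeff (mon i j k) c) b) a = (if a = i & b = j & c = k then 1 else 0)"
proof -
 have 1: "cX ^ i = [:[:monom 1 i:]:]"
  by (induct i) (simp_all add: cX_def monom_0 monom_Suc pCons_one)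
 have 2: "cY ^ j = [:monom 1 j:]"
  by (induct j) (simp_all add: cY_def monom_0 monom_Suc pCons_one)
 have 3: "cZ ^ k = monom 1 k" by (induct k) (simp_all add: cZ_def monom_0 monom_Suc pCons_one)
 show ?thesis unfolding mon_def 1 2 3 by (auto simp: smult_monom)
qed

lemma prime_cZ: "prime cZ"
proof -
 have "(cZ dvd P) \<longleftrightarrow> coeff P 0 = 0" for P
  unfolding cZ_def by (metis dvd_iff_poly_eq_0 minus_zero poly_0_coeff_0)
 then have "prime_elem cZ"
  by (intro prime_elemI) (auto simp: cZ_def coeff_mult_0)
 moreover have "normalize cZ = cZ" by (simp add: cZ_def normalize_poly_def pCons_one)
 ultimately show ?thesis by (simp add: prime_def)
qed

lemma prime_elem_lin: "prime_elem ([:0, 1:] :: 'a::idom poly)"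
proof -
 have "([:0, 1:] dvd P) \<longleftrightarrow> coeff P 0 = 0" for P :: "'a poly"
  by (metis dvd_iff_poly_eq_0 minus_zero poly_0_coeff_0)
 then show ?thesis by (intro prime_elemI) (auto simp: coeff_mult_0)
qed

lemma prime_cY: "prime cY"
 unfolding prime_def cY_def prime_elem_const_poly_iff
 by (simp add: prime_elem_lin normalize_const_poly) (simp add: normalize_poly_def pCons_one)

lemma prime_cX: "prime cX"
 unfolding prime_def cX_def prime_elem_const_poly_iff
 by (simp add: prime_elem_lin normalize_const_poly) (simp add: normalize_poly_def pCons_one)

lemma is_unit_p3: "is_unit (P::p3) \<longleftrightarrow> (\<exists>c. c ~= 0 & P = cC c)"
 by (simp add: is_unit_poly_iff cC_def dvd_field_iff) blast

subsection \<open>Functions vanishing on an irreducible hypersurface\<close>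

text \<open>The element \<open>d\<close> is free of the outermost variable and plays the role of a
  resultant. By pseudo-division, an element \<open>r\<close> of least degree in the ideal of
  \<open>p\<close> and \<open>q\<close> divides multiples of both by such constants; if
  \<open>r\<close> had positive degree, primality would make \<open>p\<close> divide
  \<open>r\<close> and then \<open>q\<close>.\<close>

lemma bezout_const:
 fixes p q :: "'a::idom poly"
 assumes p: "prime_elem p" "degree p > 0" and nd: "~ p dvd q"
 shows "\<exists>A B d. A * p + B * q = [:d:] & d ~= 0"
proof -
 let ?I = "%r. r ~= 0 & (\<exists>A B. r = A * p + B * q)"
 have "p = 1 * p + 0 * q" by simp
 then have "?I p" using p by (metis degree_0 less_numeral_extra(3))
 then obtain r where r: "?I r" and min: "!!s. ?I s ==> degree r <= degree s"
  using ex_has_least_nat[of ?I p degree] by blast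
 obtain A B where AB: "r = A * p + B * q" using r by blast
 have red: "\<exists>a Q. a ~= 0 & smult a s = r * Q" if s: "s = A' * p + B' * q" for s A' B'
 proof -
  obtain a Q where *: "a ~= 0" "smult a s = r * Q + pseudo_mod s r" using pseudo_mod(1)[of r s] r by blast
  have "pseudo_mod s r = smult a s - r * Q" using *(2) by simp
  also have "... = (smult a A' - Q * A) * p + (smult a B' - Q * B) * q"
   unfolding s AB by (simp add: algebra_simps smult_add_right)
  finally have "pseudo_mod s r = (smult a A' - Q * A) * p + (smult a B' - Q * B) * q" .
  then have "pseudo_mod s r = 0" using pseudo_mod(2)[of r s] r min[of "pseudo_mod s r"] by fastforce
  with * show ?thesis by auto
 qed
 show ?thesis
 proof (cases "degree r = 0")
  case True
  then show ?thesis using AB r by (metis degree_eq_zeroE pCons_0_0)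
 next
  case False
  have nc: "~ p dvd [:c:]" if "c ~= 0" for c
   using that p(2) dvd_imp_degree_le[of p "[:c:]"] by auto
  obtain a Q where a: "a ~= 0" "smult a p = r * Q" using red[of p 1 0] by auto
  have "p dvd r * Q" unfolding a(2)[symmetric] by (simp add: dvd_smult)
  then have "p dvd r"
  proof (rule disjE[OF prime_elem_dvd_multD[OF p(1)]])
   assume "p dvd Q"
   then obtain Q' where Q': "Q = p * Q'" by blast
   then have "p * [:a:] = p * (r * Q')" using a(2) by (simp add: ac_simps)
   then have "[:a:] = r * Q'" using p(1) by (metis mult_left_cancel prime_elem_def)
   then have "degree (r * Q') = 0" by (metis degree_pCons_0)
   moreover have "Q' ~= 0" using `[:a:] = r * Q'` a(1) by auto
   ultimately show ?thesis using False r by (simp add: degree_mult_eq)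
  qed simp
  obtain b Q2 where b: "b ~= 0" "smult b q = r * Q2" using red[of q 0 1] by auto
  have "p dvd [:b:] * q" using `p dvd r` b(2) by simp
  then show ?thesis using nc[OF b(1)] nd p(1) prime_elem_dvd_multD by blast
 qed
qed

lemma hypersurface_1:
 assumes "prime_elem (p :: complex poly)" and "!!x. poly p x = 0 ==> poly q x = 0"
 shows "p dvd q"
proof -
 have "p ~= 0" "~ is_unit p" using assms(1) by auto
 then have "~ constant (poly p)"
  by (simp add: constant_degree is_unit_iff_degree)
 then obtain a where a: "poly p a = 0" using fundamental_theorem_of_algebra by blast
 then obtain s where s: "p = [:-a, 1:] * s" using poly_eq_0_iff_dvd by blast
 have "~ is_unit [:-a, 1:]" by (simp add: is_unit_iff_degree)
 then have "is_unit s"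
  using irreducibleD[OF prime_elem_imp_irreducible[OF assms(1)] s] by blast
 moreover have "[:-a, 1:] dvd q" using assms(2)[OF a] poly_eq_0_iff_dvd by blast
 ultimately show ?thesis unfolding s by (simp only: mult_unit_dvd_iff)
qed

lemma poly_infinite_0: "infinite {x. poly p x = 0} ==> p = 0" for p :: "'a::idom poly"
 using poly_roots_finite by blast

lemma poly_const_0: "(!!y::complex. poly P [:y:] = 0) ==> P = 0"
proof -
 assume "!!y::complex. poly P [:y:] = 0"
 then have "range (%y::complex. [:y:]) \<subseteq> {y. poly P y = 0}" by auto
 moreover have "infinite (range (%y::complex. [:y:]))"
  by (simp add: finite_image_iff inj_on_def infinite_UNIV_char_0)
 ultimately show ?thesis using poly_roots_finite infinite_super by blast
qed

lemma poly_poly_swap: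
 "poly (poly p [:y:]) x = poly (map_poly (%c. poly c x) p) y" for p :: "complex poly poly"
proof (induct p)
 case (pCons a p)
 have "map_poly (%c. poly c x) (pCons a p) = pCons (poly a x) (map_poly (%c. poly c x) p)"
  by (intro poly_eqI) (simp add: coeff_map_poly coeff_pCons split: nat.split)
 then show ?case by (simp add: pCons(2))
qed simp

lemma poly_nonvanish2:
 assumes "c ~= (0::complex poly poly)" shows "\<exists>x y. poly (poly c [:y:]) x ~= 0"
proof (rule ccontr)
 assume *: "~ ?thesis"
 have "poly c [:y:] = 0" for y
  using * poly_all_0_iff_0[of "poly c [:y:]"] by auto
 then show False using assms poly_const_0[of c] by simp
qed

text \<open>If \<open>p\<close> is free of the outer variable, the coefficients of \<open>q\<close>
  are treated one by one. Otherwise a point where neither \<open>d\<close> nor the leading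
  coefficient of \<open>p\<close> vanishes lies below a zero of \<open>p\<close>, at which
  \<open>A * p + B * q\<close> would be both zero and nonzero. \<open>hypersurface_3\<close> repeats
  the argument one level up.\<close>

lemma hypersurface_2:
 assumes p: "prime_elem (p :: complex poly poly)"
  and q: "!!x y. poly (poly p [:y:]) x = 0 ==> poly (poly q [:y:]) x = 0"
 shows "p dvd q"
proof (cases "degree p = 0")
 case True
 then obtain p0 where p0: "p = [:p0:]" by (metis degree_eq_zeroE)
 then have "prime_elem p0" using p prime_elem_const_poly_iff by blast
 have "p0 dvd coeff q i" for i
 proof (rule hypersurface_1[OF `prime_elem p0`])
  fix x assume x: "poly p0 x = 0"
  have "poly (map_poly (%c. poly c x) q) z = 0" for z
   using q[of z x] x by (simp add: p0 poly_poly_swap[symmetric])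
  then have "map_poly (%c. poly c x) q = 0" using poly_all_0_iff_0 by blast
  then show "poly (coeff q i) x = 0" by (metis coeff_map_poly coeff_0 poly_0)
 qed
 then show ?thesis using p0 by (simp add: const_poly_dvd_iff)
next
 case False
 show ?thesis
 proof (rule ccontr)
  assume "~ p dvd q"
  then obtain A B d where AB: "A * p + B * q = [:d:]" "d ~= 0" using bezout_const[of p q] p False by auto
  have "d * lead_coeff p ~= 0" using AB False by auto
  then obtain x where x: "poly d x ~= 0" "poly (lead_coeff p) x ~= 0"
   using poly_all_0_iff_0[of "d * lead_coeff p"] by auto
  let ?p = "map_poly (%c. poly c x) p"
  have "coeff ?p (degree p) ~= 0" using x by (simp add: coeff_map_poly)
  then have "degree ?p > 0" using False by (metis gr0I le_degree le_zero_eq)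
  then obtain y where "poly ?p y = 0"
   using fundamental_theorem_of_algebra[of ?p] constant_degree[of ?p] by auto
  then have y: "poly (poly p [:y:]) x = 0" by (simp add: poly_poly_swap)
  have "poly (poly (A * p + B * q) [:y:]) x = poly d x" using AB by simp
  then show False using y q[OF y] x by simp
 qed
qed

lemma poly_poly_swap3:
 "poly (poly (poly p [:[:z:]:]) [:y:]) x = poly (map_poly (%c. poly (poly c [:y:]) x) p) z" for p :: p3
proof (induct p)
 case (pCons a p)
 have "poly (poly (poly (pCons a p) [:[:z:]:]) [:y:]) x
   = poly (poly a [:y:]) x + z * poly (poly (poly p [:[:z:]:]) [:y:]) x" by simp
 moreover have "map_poly (%c. poly (poly c [:y:]) x) (pCons a p)
   = pCons (poly (poly a [:y:]) x) (map_poly (%c. poly (poly c [:y:]) x) p)"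
  by (intro poly_eqI) (simp add: coeff_map_poly coeff_pCons split: nat.split)
 ultimately show ?case by (simp add: pCons(2))
qed simp

lemma hypersurface_3:
 assumes p: "prime_elem (p :: p3)"
  and q: "!!v. ev p v = 0 ==> ev q v = 0"
 shows "p dvd q"
proof (cases "degree p = 0")
 case True
 then obtain p0 where p0: "p = [:p0:]" by (metis degree_eq_zeroE)
 then have "prime_elem p0" using p prime_elem_const_poly_iff by blast
 have "p0 dvd coeff q i" for i
 proof (rule hypersurface_2[OF `prime_elem p0`])
  fix x y assume x: "poly (poly p0 [:y:]) x = 0"
  have "poly (map_poly (%c. poly (poly c [:y:]) x) q) z = 0" for z
   using q[of "(Pt x y z)"] x by (simp add: p0 ev_def poly_poly_swap3[symmetric])
  then have "map_poly (%c. poly (poly c [:y:]) x) q = 0" using poly_all_0_iff_0 by blast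
  then show "poly (poly (coeff q i) [:y:]) x = 0" by (metis coeff_map_poly coeff_0 poly_0)
 qed
 then show ?thesis using p0 by (simp add: const_poly_dvd_iff)
next
 case False
 show ?thesis
 proof (rule ccontr)
  assume "~ p dvd q"
  then obtain A B d where AB: "A * p + B * q = [:d:]" "d ~= 0" using bezout_const[of p q] p False by auto
  have "d * lead_coeff p ~= 0" using AB False by auto
  then obtain x y where x: "poly (poly d [:y:]) x ~= 0" "poly (poly (lead_coeff p) [:y:]) x ~= 0"
   using poly_nonvanish2[of "d * lead_coeff p"] by auto
  let ?p = "map_poly (%c. poly (poly c [:y:]) x) p"
  have "coeff ?p (degree p) ~= 0" using x by (simp add: coeff_map_poly)
  then have "degree ?p > 0" using False by (metis gr0I le_degree le_zero_eq)
  then obtain z where "poly ?p z = 0"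
   using fundamental_theorem_of_algebra[of ?p] constant_degree[of ?p] by (metis less_irrefl)
  then have y: "ev p (Pt x y z) = 0" by (simp add: ev_def poly_poly_swap3)
  have "ev (A * p + B * q) (Pt x y z) = poly (poly d [:y:]) x" using AB by (simp add: ev_def)
  moreover have "ev (A * p + B * q) (Pt x y z) = 0" unfolding ev_simps y q[OF y] by simp
  ultimately show False using x(1) by simp
 qed
qed

subsection \<open>Restriction to the line $x = y = 0$\<close>

text \<open>Restriction to \<open>x = y = 0\<close>. The invariant curves used below have this form
  in charts whose rays are ordered suitably.\<close>

definition line :: "p3 => complex poly" where
 "line P = map_poly (%c. poly (poly c 0) 0) P"

lemma poly_line: "poly (line P) z = ev P (Pt 0 0 z)"
 using poly_poly_swap3[of P z 0 0] unfolding line_def ev_def by simp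

lemma poly_extI: "(!!z. poly p z = poly q z) ==> p = q" for p :: "complex poly"
 using poly_eq_poly_eq_iff by blast

lemma line_simps [simp]: "line (P * Q) = line P * line Q" "line (P + Q) = line P + line Q"
 "line (P - Q) = line P - line Q" "line 1 = 1" "line 0 = 0" "line (P ^ n) = line P ^ n"
 by (rule poly_extI, simp add: poly_line)+

definition lift1 :: "complex poly => p3" where
 "lift1 q = map_poly (%c. [:[:c:]:]) q"

lemma ev_lift1 [simp]: "ev (lift1 q) (Pt x y z) = poly q z"
proof (induct q)
 case (pCons a q)
 have "lift1 (pCons a q) = cC a + cZ * lift1 q"
  by (intro poly_eqI) (simp add: lift1_def cC_def cZ_def coeff_map_poly coeff_pCons split: nat.split)
 then show ?case by (simp add: pCons(2))
qed (simp add: lift1_def)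

lemma line_lift1 [simp]: "line (lift1 q) = q"
 by (rule poly_extI, simp add: poly_line)

lemma line_cX [simp]: "line cX = 0" and line_cY [simp]: "line cY = 0" and line_cZ [simp]: "line cZ = [:0, 1:]"
 by (rule poly_extI, simp add: poly_line)+

section \<open>Dimension of affine space\<close>

text \<open>Elimination without division: it serves over \<int> for the Picard group as well as over
  \<complex>.\<close>

lemma nontrivial_solution:
 fixes a :: "'i => 'j => 'a :: idom"
 assumes "finite J" "finite I" "card J < card I"
 shows "\<exists>c. (\<exists>i\<in>I. c i ~= 0) & (\<forall>j\<in>J. (\<Sum>i\<in>I. c i * a i j) = 0)"
 using assms
proof (induct J arbitrary: I a rule: finite_induct)
 case empty
 then show ?case by (intro exI[of _ "%_. 1"]) (auto simp: card_gt_0_iff)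
next
 case (insert j J)
 show ?case
 proof (cases "\<forall>i\<in>I. a i j = 0")
  case True
  have "card J < card I" using insert by simp
  from insert(3)[OF insert(4) this, of a] True show ?thesis by auto
 next
  case False
  then obtain i0 where i0: "i0 \<in> I" "a i0 j ~= 0" by auto
  let ?I = "I - {i0}"
  have "card J < card ?I" using insert i0 by simp
  then obtain c where c: "\<exists>i\<in>?I. c i ~= 0"
   "!!k. k \<in> J ==> (\<Sum>i\<in>?I. c i * (a i0 j * a i k - a i j * a i0 k)) = 0"
   using insert(3)[of ?I "%i k. a i0 j * a i k - a i j * a i0 k"] insert(4) by auto
  define s where "s = (\<Sum>i\<in>?I. c i * a i j)"
  define c' where "c' = (%i. if i = i0 then - s else a i0 j * c i)"
  have "(\<Sum>i\<in>?I. c' i * a i k) = a i0 j * (\<Sum>i\<in>?I. c i * a i k)" for k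
   unfolding sum_distrib_left by (rule sum.cong) (auto simp: c'_def algebra_simps)
  then have sum: "(\<Sum>i\<in>I. c' i * a i k) = - s * a i0 k + a i0 j * (\<Sum>i\<in>?I. c i * a i k)" for k
   using i0 insert(4) by (subst sum.remove[of I i0]) (auto simp: c'_def)
  have "(\<Sum>i\<in>I. c' i * a i j) = 0" unfolding sum by (simp add: s_def)
  moreover have "(\<Sum>i\<in>I. c' i * a i k) = 0" if "k \<in> J" for k
  proof -
   have "(\<Sum>i\<in>?I. c i * (a i0 j * a i k - a i j * a i0 k)) = - s * a i0 k + a i0 j * (\<Sum>i\<in>?I. c i * a i k)"
    by (simp add: s_def algebra_simps sum_subtractf sum_distrib_left)
   then show ?thesis unfolding sum using c(2)[OF that] by simp
  qed
  moreover have "\<exists>i\<in>I. c' i ~= 0" using c(1) i0 by (auto simp: c'_def)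
  ultimately show ?thesis by (intro exI[of _ c']) auto
 qed
qed

section \<open>Four polynomials in three variables are algebraically dependent\<close>

definition box :: "nat => p3 => bool" where
 "box d P \<longleftrightarrow> degree P <= d & (\<forall>k. degree (coeff P k) <= d) & (\<forall>k j. degree (coeff (coeff P k) j) <= d)"

lemma box_mult: assumes "box d P" "box d' Q" shows "box (d + d') (P * Q)"
proof -
 have "degree (P * Q) <= d + d'"
  using assms degree_mult_le[of P Q] by (auto simp: box_def)
 moreover have "degree (coeff (P * Q) k) <= d + d'" for k
  unfolding coeff_mult using assms
  by (intro degree_sum_le) (auto simp: box_def intro!: order.trans[OF degree_mult_le] add_mono)
 moreover have "degree (coeff (coeff (P * Q) k) j) <= d + d'" for k j
  unfolding coeff_mult coeff_sum using assms
  by (intro degree_sum_le) (auto simp: box_def intro!: order.trans[OF degree_mult_le] add_mono)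
 ultimately show ?thesis by (simp add: box_def)
qed

lemma box_mono: "box d P ==> d <= d' ==> box d' P"
 unfolding box_def using order.trans by blast

lemma box_1: "box d 1"
 by (simp add: box_def one_pCons coeff_pCons split: nat.split)

lemma box_power: "box d P ==> box (n * d) (P ^ n)"
proof (induct n)
 case 0 then show ?case by (simp add: box_1)
next
 case (Suc n) then show ?case using box_mult[of d P "n * d" "P ^ n"] by simp
qed

lemma box_exists: "\<exists>d. box d P"
proof -
 define e where "e = (\<Sum>k\<le>degree P. degree (coeff P k))"
 have e: "degree (coeff P k) <= e" for k
  using member_le_sum[of k "{..degree P}" "%k. degree (coeff P k)"]
  by (cases "k <= degree P") (auto simp: e_def coeff_eq_0)
 define f where "f = (\<Sum>k\<le>degree P. \<Sum>j\<le>e. degree (coeff (coeff P k) j))"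
 have f: "degree (coeff (coeff P k) j) <= f" for k j
 proof (cases "k <= degree P & j <= e")
  case True
  have "degree (coeff (coeff P k) j) <= (\<Sum>j\<le>e. degree (coeff (coeff P k) j))"
   using True by (intro member_le_sum) auto
  also have "... <= f" unfolding f_def using True by (intro member_le_sum) auto
  finally show ?thesis .
 next
  case False
  then have "coeff (coeff P k) j = 0" using e[of k] by (auto simp: coeff_eq_0)
  then show ?thesis by simp
 qed
 have "degree (coeff P k) <= degree P + e + f" for k using e[of k] by linarith
 moreover have "degree (coeff (coeff P k) j) <= degree P + e + f" for k j using f[of k j] by linarith
 ultimately have "box (degree P + e + f) P" unfolding box_def by simp
 then show ?thesis ..
qed

fun mpow :: "p3 list => nat list => p3" where
 "mpow (f # fs) (n # ns) = f ^ n * mpow fs ns" | "mpow _ _ = 1"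

lemma box_mpow:
 assumes "\<forall>f\<in>set fs. box D f" "set e \<subseteq> {..N}" "length e = length fs"
 shows "box (length fs * (N * D)) (mpow fs e)"
 using assms
proof (induct fs e rule: mpow.induct)
 case (1 f fs n ns)
 have "box (N * D) (f ^ n)" using 1 by (intro box_mono[OF box_power[of D]]) auto
 then show ?case using 1 box_mult by fastforce
qed (auto intro: box_1)

lemma algebraically_dependent:
 assumes "length fs = 4"
 shows "\<exists>E c. finite E & (\<forall>e\<in>E. length e = 4) & (\<exists>e\<in>E. c e ~= 0) &
  (\<Sum>e\<in>E. cC (c e) * mpow fs e) = 0"
proof -
 obtain d where d: "!!f. box (d f) f" using box_exists by metis
 define D where "D = sum_list (map d fs)"
 have D: "\<forall>f\<in>set fs. box D f"
  using d member_le_sum_list[of "d _" "map d fs"] by (auto simp: D_def intro: box_mono)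
 \<comment> \<open>The monomials in \<open>fs\<close> with exponents up to \<open>N\<close> number
   \<open>(N + 1) ^ 4\<close> and lie in a space of dimension \<open>(B + 1) ^ 3\<close>, where
   \<open>B = 4 * (N * D)\<close>. With this \<open>N\<close>, the bound
   \<open>((4 * D + 1) * (N + 1)) ^ 3\<close> equals \<open>N * (N + 1) ^ 3\<close>, which is just
   below \<open>(N + 1) ^ 4\<close>.\<close>
 define N where "N = (4 * D + 1) ^ 3"
 define E where "E = {e :: nat list. set e \<subseteq> {..N} & length e = 4}"
 define B where "B = 4 * (N * D)"
 define J where "J = {..B} \<times> {..B} \<times> {..B}"
 have cE: "card E = (N + 1) ^ 4" "finite E"
  unfolding E_def by (simp_all add: card_lists_length_eq finite_lists_length_eq)
 have "B + 1 <= (4 * D + 1) * (N + 1)" by (simp add: B_def algebra_simps)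
 then have "(B + 1) ^ 3 <= ((4 * D + 1) * (N + 1)) ^ 3" by (rule power_mono) simp
 also have "... = N * (N + 1) ^ 3" by (simp only: power_mult_distrib N_def)
 also have "... < (N + 1) * (N + 1) ^ 3" by (intro mult_strict_right_mono) auto
 also have "... = card E" by (simp add: cE power_eq_if numeral_eq_Suc)
 finally have "(B + 1) ^ 3 < card E" .
 moreover have "card J = (B + 1) ^ 3" by (simp add: J_def card_cartesian_product power3_eq_cube algebra_simps)
 ultimately have "card J < card E" by simp
 then obtain c where c: "\<exists>e\<in>E. c e ~= 0"
  "\<forall>j\<in>J. (\<Sum>e\<in>E. c e * (case j of (x, y, z) => coeff (coeff (coeff (mpow fs e) z) y) x)) = 0"
  using nontrivial_solution[of J E "%e j. case j of (x, y, z) => coeff (coeff (coeff (mpow fs e) z) y) x"]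
   cE(2) by (auto simp: J_def)
 let ?P = "\<Sum>e\<in>E. cC (c e) * mpow fs e"
 have "coeff (coeff (coeff ?P z) y) x = 0" for x y z
 proof -
  have 1: "coeff (coeff (coeff ?P z) y) x = (\<Sum>e\<in>E. c e * coeff (coeff (coeff (mpow fs e) z) y) x)"
   by (simp add: coeff_sum cC_def)
  show ?thesis
  proof (cases "(x, y, z) \<in> J")
   case True then show ?thesis using c(2) 1 by auto
  next
   case False
   have "coeff (coeff (coeff (mpow fs e) z) y) x = 0" if "e \<in> E" for e
   proof -
    have "box B (mpow fs e)" unfolding B_def using box_mpow[OF D, of e N] that assms by (simp add: E_def)
    then show ?thesis using False unfolding box_def J_def
     by (metis (no_types, lifting) SigmaI atMost_iff coeff_0 coeff_eq_0 leI le_less_trans)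
   qed
   then show ?thesis using 1 by simp
  qed
 qed
 then have "?P = 0" by (intro poly_eqI) auto
 then show ?thesis using cE(2) c(1) by (intro exI[of _ E] exI[of _ c]) (auto simp: E_def)
qed

text \<open>For nonempty \<open>Z\<close> this says that the polynomials vanishing on
  \<open>Z\<close> form a prime ideal.\<close>

definition zirr :: "c3 set => bool" where
 "zirr Z \<longleftrightarrow> (\<forall>P Q. (\<forall>v\<in>Z. ev (P * Q) v = 0) --> (\<forall>v\<in>Z. ev P v = 0) | (\<forall>v\<in>Z. ev Q v = 0))"

text \<open>The list holds one witness for each strict inclusion of a chain that starts at
  \<open>Z\<close> and descends, so its length is the length of the chain.\<close>

fun desc :: "p3 list => c3 set => bool" where
 "desc [] Z = (Z ~= {})"
| "desc (f # fs) Z = (zirr Z & (\<exists>v\<in>Z. ev f v ~= 0) & (\<exists>Z'\<subseteq>Z. (\<forall>v\<in>Z'. ev f v = 0) & desc fs Z'))"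

lemma zirr_power: "zirr Z ==> \<forall>v\<in>Z. ev (P ^ m * Q) v = 0 ==> \<exists>v\<in>Z. ev P v ~= 0 ==> \<forall>v\<in>Z. ev Q v = 0"
proof (induct m)
 case (Suc m)
 then have "\<forall>v\<in>Z. ev (P * (P ^ m * Q)) v = 0" by (simp add: algebra_simps)
 then have "(\<forall>v\<in>Z. ev P v = 0) | (\<forall>v\<in>Z. ev (P ^ m * Q) v = 0)" using Suc(2) unfolding zirr_def by blast
 then show ?case using Suc by blast
qed simp

text \<open>The idea of Coquand and Lombardi's elementary characterization of Krull dimension: along a
  chain of irreducible sets, a polynomial relation is divided by the largest possible power of the
  first function, which is then set to zero.\<close>

lemma desc_independent:
 assumes "desc fs Z" "finite E" "\<forall>e\<in>E. length e = length fs" "\<exists>e\<in>E. c e ~= 0"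
 shows "\<exists>v\<in>Z. ev (\<Sum>e\<in>E. cC (c e) * mpow fs e) v ~= 0"
 using assms
proof (induct fs arbitrary: Z E c)
 case Nil
 then obtain v where "v \<in> Z" by auto
 have "E = {[]}" using Nil by auto
 then show ?case using Nil(4) `v \<in> Z` by (intro bexI[of _ v]) auto
next
 case (Cons f fs)
 obtain Z' where Z': "Z' \<subseteq> Z" "\<forall>v\<in>Z'. ev f v = 0" "desc fs Z'" using Cons(2) by auto
 define E1 where "E1 = {e\<in>E. c e ~= 0}"
 have E1: "finite E1" "E1 ~= {}" using Cons by (auto simp: E1_def)
 define m where "m = Min (hd ` E1)"
 have m: "m <= hd e" if "e \<in> E1" for e using E1 that by (auto simp: m_def)
 have "m \<in> hd ` E1" unfolding m_def using E1 by (intro Min_in) auto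
 then obtain e0 where e0: "e0 \<in> E1" "hd e0 = m" by auto
 define Q where "Q = (\<Sum>e\<in>E1. cC (c e) * (f ^ (hd e - m) * mpow fs (tl e)))"
 have fac: "(\<Sum>e\<in>E. cC (c e) * mpow (f # fs) e) = f ^ m * Q"
 proof -
  have "(\<Sum>e\<in>E. cC (c e) * mpow (f # fs) e) = (\<Sum>e\<in>E1. cC (c e) * mpow (f # fs) e)"
   unfolding E1_def using Cons(3) by (intro sum.mono_neutral_right) (auto simp: cC_def)
  also have "... = (\<Sum>e\<in>E1. f ^ m * (cC (c e) * (f ^ (hd e - m) * mpow fs (tl e))))"
  proof (rule sum.cong[OF refl])
   fix e assume e: "e \<in> E1"
   then obtain n ns where n: "e = n # ns" using Cons(4) by (cases e) (auto simp: E1_def)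
   have "f ^ n = f ^ m * f ^ (n - m)" using m[OF e] n by (simp flip: power_add)
   then show "cC (c e) * mpow (f # fs) e = f ^ m * (cC (c e) * (f ^ (hd e - m) * mpow fs (tl e)))"
    using n by (simp add: ac_simps)
  qed
  finally show ?thesis by (simp add: Q_def sum_distrib_left)
 qed
 show ?case
 proof (rule ccontr)
  assume "~ ?thesis"
  then have "\<forall>v\<in>Z. ev (f ^ m * Q) v = 0" unfolding fac by blast
  then have Q0: "\<forall>v\<in>Z. ev Q v = 0" using zirr_power[of Z f m Q] Cons(2) by auto
  define E' where "E' = tl ` {e\<in>E1. hd e = m}"
  define c' where "c' = (%e. c (m # e))"
  have inj: "inj_on tl {e\<in>E1. hd e = m}"
  proof (rule inj_onI)
   fix x y assume "x \<in> {e\<in>E1. hd e = m}" "y \<in> {e\<in>E1. hd e = m}" "tl x = tl y"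
   then show "x = y" using Cons(4) by (cases x; cases y) (auto simp: E1_def)
  qed
  have cons: "m # tl e = e" if "e \<in> E1" "hd e = m" for e
   using that Cons(4) by (cases e) (auto simp: E1_def)
  have "\<exists>v\<in>Z'. ev (\<Sum>e\<in>E'. cC (c' e) * mpow fs e) v ~= 0"
  proof (rule Cons(1)[OF Z'(3)])
   show "finite E'" using E1 by (simp add: E'_def)
   show "\<forall>e\<in>E'. length e = length fs" using Cons(4) by (auto simp: E'_def E1_def)
   show "\<exists>e\<in>E'. c' e ~= 0" using e0 cons[OF e0] by (auto simp: E'_def c'_def E1_def intro!: bexI[of _ "tl e0"])
  qed
  then obtain v where v: "v \<in> Z'" "ev (\<Sum>e\<in>E'. cC (c' e) * mpow fs e) v ~= 0" by blast
  \<comment> \<open>On \<open>Z'\<close> the function \<open>f\<close> is zero, so exactly the terms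
    with the minimal exponent \<open>m\<close> survive, as \<open>0 ^ 0 = 1\<close>.\<close>
  have "ev Q v = (\<Sum>e\<in>E1. c e * (0 ^ (hd e - m) * ev (mpow fs (tl e)) v))"
   using Z'(2) v(1) by (simp add: Q_def)
  also have "... = (\<Sum>e\<in>{e\<in>E1. hd e = m}. c e * (0 ^ (hd e - m) * ev (mpow fs (tl e)) v))"
   using E1 m by (intro sum.mono_neutral_right) (force simp: power_0_left)+
  also have "... = (\<Sum>e\<in>{e\<in>E1. hd e = m}. c' (tl e) * ev (mpow fs (tl e)) v)"
   using cons by (intro sum.cong) (auto simp: c'_def)
  also have "... = ev (\<Sum>e\<in>E'. cC (c' e) * mpow fs e) v"
   unfolding E'_def by (simp add: sum.reindex[OF inj])
  finally show False using v Q0 Z'(1) by auto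
 qed
qed

lemma no_desc_4: "length fs = 4 ==> ~ desc fs Z"
proof
 assume fs: "length fs = 4" and d: "desc fs Z"
 obtain E c where E: "finite E" "\<forall>e\<in>E. length e = length fs" "\<exists>e\<in>E. c e ~= 0"
  "(\<Sum>e\<in>E. cC (c e) * mpow fs e) = 0"
  using algebraically_dependent[OF fs] unfolding fs by blast
 show False using desc_independent[OF d E(1-3)] unfolding E(4) by simp
qed

section \<open>Chains of irreducible closed sets\<close>

lemma irreducible_chain_le: "irreducible_chain T Z n ==> m <= n ==> irreducible_chain T Z m"
 by (auto simp: irreducible_chain_def)

text \<open>Cutting a chain off at the top keeps \<open>Z 0\<close>, so the lengths that occur form
  an initial segment and the supremum is decided by the lengths 1 and 2.\<close>

lemma codim_eq_1_iff:
 "codim T Y = 1 \<longleftrightarrow> (\<exists>Z. irreducible_chain T Z 1 & Z 0 = Y) & ~ (\<exists>Z. irreducible_chain T Z 2 & Z 0 = Y)"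
  (is "_ \<longleftrightarrow> ?A & ~ ?B")
proof -
 define S where "S = {n. \<exists>Z. irreducible_chain T Z n & Z 0 = Y}"
 have down: "m \<in> S" if "n \<in> S" "m <= n" for m n
  using that irreducible_chain_le unfolding S_def by blast
 have c: "codim T Y = (SUP n\<in>S. enat n)" by (simp add: codim_def S_def)
 show ?thesis
 proof
  assume 1: "codim T Y = 1"
  have "1 \<in> S"
  proof (rule ccontr)
   assume "1 ~: S"
   then have "n = 0" if "n \<in> S" for n using down[OF that, of 1] by (cases n) auto
   then have "codim T Y <= 0" unfolding c by (intro SUP_least) (auto simp: zero_enat_def)
   then show False using 1 by simp
  qed
  moreover have "2 ~: S"
  proof
   assume "2 \<in> S"
   then have "enat 2 <= codim T Y" unfolding c by (rule SUP_upper)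
   then show False unfolding 1 by (simp add: one_enat_def)
  qed
  ultimately show "?A & ~ ?B" by (simp add: S_def)
 next
  assume AB: "?A & ~ ?B"
  have "codim T Y <= 1" unfolding c
  proof (rule SUP_least)
   fix n assume "n \<in> S"
   have "~ 2 <= n" using down[OF `n \<in> S`, of 2] AB by (auto simp: S_def)
   then show "enat n <= 1" by (simp add: one_enat_def)
  qed
  moreover have "enat 1 <= codim T Y" unfolding c by (rule SUP_upper) (use AB in \<open>auto simp: S_def\<close>)
  ultimately show "codim T Y = 1" by (simp add: one_enat_def antisym)
 qed
qed

lemma chain2:
 assumes "irreducible_closed T A" "irreducible_closed T B" "A \<subset> B"
 shows "\<exists>Z. irreducible_chain T Z 1 & Z 0 = A"
 using assms by (intro exI[of _ "%i. if i = 0 then A else B"]) (simp add: irreducible_chain_def)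

lemma chain3:
 assumes "irreducible_closed T A" "irreducible_closed T B" "irreducible_closed T C" "A \<subset> B" "B \<subset> C"
 shows "\<exists>Z. irreducible_chain T Z 2 & Z 0 = A"
 using assms by (intro exI[of _ "%i. if i = 0 then A else if i = 1 then B else C"])
  (simp add: irreducible_chain_def less_2_cases_iff)

lemma chain3D:
 assumes "irreducible_chain T Z 2"
 shows "irreducible_closed T (Z 1)" "irreducible_closed T (Z 2)" "Z 0 \<subset> Z 1" "Z 1 \<subset> Z 2"
proof -
 have i: "\<forall>i\<le>2. irreducible_closed T (Z i)" and s: "\<forall>i<2. Z i \<subset> Z (Suc i)"
  using assms by (auto simp: irreducible_chain_def)
 show "irreducible_closed T (Z 1)" "irreducible_closed T (Z 2)" "Z 0 \<subset> Z 1" "Z 1 \<subset> Z 2"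
  using i[rule_format, of 1] i[rule_format, of 2] s[rule_format, of 0] s[rule_format, of 1]
  by (simp_all add: numeral_2_eq_2)
qed

lemma irreducible_closed_meet:
 assumes "irreducible_closed T Y" "openin T A" "openin T B" "A Int Y ~= {}" "B Int Y ~= {}"
 shows "A Int B Int Y ~= {}"
proof
 assume "A Int B Int Y = {}"
 moreover have "Y \<subseteq> topspace T" using assms(1) closedin_subset by (auto simp: irreducible_closed_def)
 ultimately have "Y \<subseteq> (topspace T - A) Un (topspace T - B)" by auto
 then have "Y \<subseteq> topspace T - A | Y \<subseteq> topspace T - B"
  using assms(1-3) unfolding irreducible_closed_def by blast
 then show False using assms by auto
qed

section \<open>Charts isomorphic to affine space\<close>

definition zclosed :: "c3 set => bool" where
 "zclosed Z \<longleftrightarrow> (\<forall>v. v ~: Z --> (\<exists>P. ev P v ~= 0 & (\<forall>w\<in>Z. ev P w = 0)))"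

lemma zclosed_zeros: "zclosed {v. ev P v = 0}"
 by (auto simp: zclosed_def)

lemma zirr_UNIV: "zirr UNIV"
 unfolding zirr_def
proof (intro allI impI)
 fix P Q assume "\<forall>v\<in>UNIV. ev (P * Q) v = 0"
 then have "P * Q = 0" by (intro ev_eq_0_imp) auto
 then show "(\<forall>v\<in>UNIV. ev P v = 0) | (\<forall>v\<in>UNIV. ev Q v = 0)" by auto
qed

lemma zirr_prime: "prime p ==> zirr {v. ev p v = 0}"
 unfolding zirr_def
proof (intro allI impI)
 fix P Q assume p: "prime p" and "\<forall>v\<in>{v. ev p v = 0}. ev (P * Q) v = 0"
 then have "p dvd P * Q" using hypersurface_3[of p "P * Q"] by auto
 then have "p dvd P | p dvd Q" using p prime_dvd_multD by blast
 then show "(\<forall>v\<in>{v. ev p v = 0}. ev P v = 0) | (\<forall>v\<in>{v. ev p v = 0}. ev Q v = 0)"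
  by (auto elim!: dvdE)
qed

lemma prime_dvd_iff: "prime p ==> p dvd P \<longleftrightarrow> (\<forall>v. ev p v = 0 --> ev P v = 0)"
 using hypersurface_3[of p P] by (auto elim!: dvdE)

lemma prime_has_zero: "prime p ==> \<exists>v. ev p v = 0"
 using prime_dvd_iff[of p 1] by (auto simp: not_prime_unit)

lemma zirr_in_prime:
 "P ~= 0 ==> zirr Z ==> Z ~= {} ==> \<forall>v\<in>Z. ev P v = 0 ==> \<exists>p. prime p & p dvd P & (\<forall>v\<in>Z. ev p v = 0)"
proof (induct P rule: prime_divisors_induct)
 case (unit x)
 then show ?case by (auto simp: is_unit_p3)
next
 case (factor p x)
 then have "(\<forall>v\<in>Z. ev p v = 0) | (\<forall>v\<in>Z. ev x v = 0)" unfolding zirr_def by blast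
 then show ?case using factor by (metis dvd_mult dvd_triv_left mult_zero_right)
qed simp

text \<open>A dense open copy of affine 3-space in \<open>X\<close>, expressed through polynomials
  only: \<open>basic_open\<close> and \<open>open_nbhd\<close> compare the topologies,
  \<open>reg_local\<close> and \<open>reg_quot\<close> the regular functions. By density, rational
  functions on \<open>X\<close> can be computed in the chart.\<close>

locale chart3 =
 fixes X :: "'a fun_space" and \<phi> :: "c3 => 'a"
 assumes inj: "inj \<phi>"
  and basic_open: "openin (zar X) (\<phi> ` {v. ev P v ~= 0})"
  and open_nbhd: "openin (zar X) W ==> \<phi> v \<in> W ==> \<exists>P. ev P v ~= 0 & (\<forall>w. ev P w ~= 0 --> \<phi> w \<in> W)"
  and reg_local: "f \<in> reg X W ==> \<phi> v \<in> W ==>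
   \<exists>A B. ev B v ~= 0 & (\<forall>w. \<phi> w \<in> W & ev B w ~= 0 --> f (\<phi> w) = ev A w / ev B w)"
  and reg_quot: "(!!w. ev B w ~= 0 ==> f (\<phi> w) = ev A w / ev B w) ==> f \<in> reg X (\<phi> ` {w. ev B w ~= 0})"
  and dense: "openin (zar X) W ==> W ~= {} ==> W Int range \<phi> ~= {}"
begin

definition co :: "'a => c3" where "co = inv_into UNIV \<phi>"

lemma co_phi [simp]: "co (\<phi> v) = v" using inj by (simp add: co_def)

lemma phi_eq_iff [simp]: "\<phi> v = \<phi> w \<longleftrightarrow> v = w" using inj by (auto dest: injD)

lemma open_range: "openin (zar X) (range \<phi>)"
 using basic_open[of 1] by simp

lemma phi_points: "\<phi> v \<in> points X"
 using open_range openin_subset by blast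

subsection \<open>Closures of irreducible subsets of the chart\<close>

definition cl :: "c3 set => 'a set" where "cl Z = zar X closure_of (\<phi> ` Z)"

lemma closed_cl: "closedin (zar X) (cl Z)" by (simp add: cl_def)

lemma phi_in_cl: "v \<in> Z ==> \<phi> v \<in> cl Z"
 unfolding cl_def using closure_of_subset[of "\<phi> ` Z" "zar X"] phi_points by blast

lemma cl_iff: "zclosed Z ==> \<phi> v \<in> cl Z \<longleftrightarrow> v \<in> Z"
proof
 assume Z: "zclosed Z" and v: "\<phi> v \<in> cl Z"
 show "v \<in> Z"
 proof (rule ccontr)
  assume "v ~: Z"
  then obtain P where P: "ev P v ~= 0" "\<forall>w\<in>Z. ev P w = 0" using Z unfolding zclosed_def by blast
  have "\<phi> v \<in> \<phi> ` {v. ev P v ~= 0}" using P(1) by blast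
  then have "\<exists>y. y \<in> \<phi> ` Z & y \<in> \<phi> ` {v. ev P v ~= 0}"
   using v basic_open[of P] unfolding cl_def in_closure_of by (elim conjE allE impE) auto
  then show False using P(2) by auto
 qed
qed (rule phi_in_cl)

lemma cl_subset: "closedin (zar X) Y ==> (!!v. v \<in> Z ==> \<phi> v \<in> Y) ==> cl Z \<subseteq> Y"
 unfolding cl_def by (rule closure_of_minimal) auto

lemma irreducible_cl: assumes "zirr Z" "Z ~= {}" shows "irreducible_closed (zar X) (cl Z)"
 unfolding irreducible_closed_def
proof (intro conjI allI impI)
 show "cl Z ~= {}" using phi_in_cl assms(2) by blast
 fix A B assume AB: "closedin (zar X) A & closedin (zar X) B & cl Z \<subseteq> A Un B"
 show "cl Z \<subseteq> A | cl Z \<subseteq> B"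
 proof (rule ccontr)
  assume "~ ?thesis"
  then obtain v w where v: "v \<in> Z" "\<phi> v ~: A" and w: "w \<in> Z" "\<phi> w ~: B"
   using cl_subset[of A Z] cl_subset[of B Z] AB by blast
  have "openin (zar X) (points X - A)" "openin (zar X) (points X - B)" using AB by auto
  then obtain P Q where P: "ev P v ~= 0" "!!u. ev P u ~= 0 ==> \<phi> u \<in> points X - A"
   and Q: "ev Q w ~= 0" "!!u. ev Q u ~= 0 ==> \<phi> u \<in> points X - B"
   using open_nbhd[of "points X - A" v] open_nbhd[of "points X - B" w] v w phi_points by (metis DiffI)
  have "\<forall>u\<in>Z. ev (P * Q) u = 0" using P(2) Q(2) AB phi_in_cl by fastforce
  then show False using assms(1) P(1) Q(1) v(1) w(1) unfolding zirr_def by blast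
 qed
qed (rule closed_cl)

lemma zclosed_vimage: assumes "closedin (zar X) Y" shows "zclosed (\<phi> -` Y)"
 unfolding zclosed_def
proof (intro allI impI)
 fix v assume "v ~: \<phi> -` Y"
 moreover have "openin (zar X) (points X - Y)" using assms by auto
 ultimately obtain P where "ev P v ~= 0" "!!u. ev P u ~= 0 ==> \<phi> u \<in> points X - Y"
  using open_nbhd[of "points X - Y" v] phi_points by auto
 then show "\<exists>P. ev P v ~= 0 & (\<forall>w\<in>\<phi> -` Y. ev P w = 0)" by (intro exI[of _ P]) auto
qed

text \<open>\<open>Y\<close> is covered by the closure of its trace and the closed complement of the
  chart; irreducibility decides for the former.\<close>

lemma irreducible_eq_cl:
 assumes "irreducible_closed (zar X) Y" "Y Int range \<phi> ~= {}" shows "Y = cl (\<phi> -` Y)"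
proof
 have Y: "closedin (zar X) Y" using assms(1) by (simp add: irreducible_closed_def)
 show "cl (\<phi> -` Y) \<subseteq> Y" by (rule cl_subset[OF Y]) auto
 have "Y \<subseteq> cl (\<phi> -` Y) Un (points X - range \<phi>)"
  using closedin_subset[OF Y] phi_in_cl by fastforce
 moreover have "closedin (zar X) (points X - range \<phi>)" using open_range by blast
 ultimately show "Y \<subseteq> cl (\<phi> -` Y)"
  using assms closed_cl[of "\<phi> -` Y"] unfolding irreducible_closed_def by blast
qed

lemma zirr_vimage: assumes "irreducible_closed (zar X) Y" shows "zirr (\<phi> -` Y)"
 unfolding zirr_def
proof (intro allI impI)
 fix P Q assume PQ: "\<forall>v\<in>\<phi> -` Y. ev (P * Q) v = 0"
 have Y: "closedin (zar X) Y" using assms(1) by (simp add: irreducible_closed_def)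
 let ?D = "%P. points X - \<phi> ` {v. ev P v ~= 0}"
 have "closedin (zar X) (?D P)" for P using basic_open by blast
 moreover have "Y \<subseteq> ?D P Un ?D Q" using PQ closedin_subset[OF Y] by fastforce
 ultimately have "Y \<subseteq> ?D P | Y \<subseteq> ?D Q" using assms unfolding irreducible_closed_def by blast
 then show "(\<forall>v\<in>\<phi> -` Y. ev P v = 0) | (\<forall>v\<in>\<phi> -` Y. ev Q v = 0)" by auto
qed

lemma cl_UNIV: "cl UNIV = points X"
proof (rule ccontr)
 assume "cl UNIV ~= points X"
 then have "points X - cl UNIV ~= {}" using closedin_subset[OF closed_cl[of UNIV]] by auto
 moreover have "openin (zar X) (points X - cl UNIV)" using closed_cl by auto
 ultimately show False using dense phi_in_cl by blast
qed

lemma irreducible_points: "irreducible_closed (zar X) (points X)"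
 using irreducible_cl[OF zirr_UNIV] cl_UNIV by simp

subsection \<open>Prime divisors meeting the chart are irreducible hypersurfaces\<close>

abbreviation hyp :: "p3 => 'a set" where "hyp p \<equiv> cl {v. ev p v = 0}"

lemma hyp_iff [simp]: "\<phi> v \<in> hyp p \<longleftrightarrow> ev p v = 0"
 by (simp add: cl_iff[OF zclosed_zeros])

lemma irreducible_hyp: "prime p ==> irreducible_closed (zar X) (hyp p)"
 using irreducible_cl[OF zirr_prime] prime_has_zero by auto

lemma hyp_neq_points: "prime p ==> hyp p ~= points X"
 using ev_nonzero[of p] phi_points hyp_iff not_prime_0 by blast

lemma irreducible_in_hyp:
 assumes "irreducible_closed (zar X) Y" "Y Int range \<phi> ~= {}" "Y ~= points X"
 shows "\<exists>p. prime p & Y \<subseteq> hyp p"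
proof -
 have c: "closedin (zar X) Y" using assms(1) by (simp add: irreducible_closed_def)
 have "\<phi> -` Y ~= UNIV" using irreducible_eq_cl[OF assms(1,2)] assms(3) cl_UNIV by auto
 then obtain v where "v ~: \<phi> -` Y" by blast
 then obtain P where P: "ev P v ~= 0" "\<forall>w\<in>\<phi> -` Y. ev P w = 0"
  using zclosed_vimage[OF c] unfolding zclosed_def by blast
 then obtain p where p: "prime p" "\<forall>v\<in>\<phi> -` Y. ev p v = 0"
 proof -
  have "P ~= 0" using P(1) by auto
  moreover have "\<phi> -` Y ~= {}" using assms(2) by blast
  ultimately show ?thesis using zirr_in_prime[OF _ zirr_vimage[OF assms(1)] _ P(2)] that by blast
 qed
 have "Y = cl (\<phi> -` Y)" by (rule irreducible_eq_cl[OF assms(1,2)])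
 also have "... \<subseteq> hyp p" by (rule cl_subset[OF closed_cl]) (use p in auto)
 finally show ?thesis using p by auto
qed

text \<open>A proper irreducible closed set that contains \<open>hyp p\<close> lies in some
  \<open>hyp q\<close>; then \<open>p dvd q\<close>, so \<open>p = q\<close>, and no chain of length
  2 starts at \<open>hyp p\<close>.\<close>

lemma prime_divisor_hyp: assumes p: "prime p" shows "prime_divisor X (hyp p)"
 unfolding prime_divisor_def codim_eq_1_iff
proof (intro conjI notI)
 have "hyp p \<subset> points X" using hyp_neq_points[OF p] closedin_subset[OF closed_cl] by blast
 then show "\<exists>Z. irreducible_chain (zar X) Z 1 & Z 0 = hyp p"
  by (rule chain2[OF irreducible_hyp[OF p] irreducible_points])
 assume "\<exists>Z. irreducible_chain (zar X) Z 2 & Z 0 = hyp p"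
 then obtain Z where Z: "irreducible_chain (zar X) Z 2" "Z 0 = hyp p" by blast
 note 1 = chain3D[OF Z(1), unfolded Z(2)]
 have "Z 2 \<subseteq> points X" using 1(2) closedin_subset unfolding irreducible_closed_def by blast
 then have "Z 1 ~= points X" using 1(4) by blast
 moreover have "Z 1 Int range \<phi> ~= {}" using prime_has_zero[OF p] 1(3) hyp_iff by blast
 ultimately obtain q where q: "prime q" "Z 1 \<subseteq> hyp q" using irreducible_in_hyp[OF 1(1)] by blast
 then have "hyp p \<subseteq> hyp q" using 1(3) by blast
 then have "p dvd q" using prime_dvd_iff[OF p] hyp_iff by blast
 then have "p = q" using p q(1) primes_dvd_imp_eq by blast
 then show False using q 1(3) by blast
qed (rule irreducible_hyp[OF p])

text \<open>\<open>Y\<close> lies in some \<open>hyp p\<close>. If the inclusion were strict,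
  \<open>Y\<close>, \<open>hyp p\<close> and \<open>points X\<close> would form a chain of length
  2.\<close>

lemma prime_divisor_eq_hyp:
 assumes "prime_divisor X Y" "Y Int range \<phi> ~= {}" shows "\<exists>p. prime p & Y = hyp p"
proof -
 have Y: "irreducible_closed (zar X) Y" and c1: "\<exists>Z. irreducible_chain (zar X) Z 1 & Z 0 = Y"
  and c2: "~ (\<exists>Z. irreducible_chain (zar X) Z 2 & Z 0 = Y)"
  using assms(1) unfolding prime_divisor_def codim_eq_1_iff by auto
 from c1 obtain Z where "irreducible_chain (zar X) Z 1" "Z 0 = Y" by blast
 then have "Y \<subset> Z 1" "irreducible_closed (zar X) (Z 1)" by (auto simp: irreducible_chain_def)
 then have "Y ~= points X" using closedin_subset by (auto simp: irreducible_closed_def)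
 then obtain p where p: "prime p" "Y \<subseteq> hyp p" using irreducible_in_hyp[OF Y assms(2)] by blast
 have "hyp p \<subset> points X" using hyp_neq_points[OF p(1)] closedin_subset[OF closed_cl] by blast
 have "~ Y \<subset> hyp p"
 proof
  assume "Y \<subset> hyp p"
  from chain3[OF Y irreducible_hyp[OF p(1)] irreducible_points this `hyp p \<subset> points X`] c2
  show False by blast
 qed
 then show ?thesis using p by auto
qed

lemma hyp_eq_iff: "prime p ==> prime q ==> hyp p = hyp q \<longleftrightarrow> p = q"
 using prime_dvd_iff[of p q] primes_dvd_imp_eq[of p q] hyp_iff by blast

lemma prime_divisor_meets: "prime_divisor X Y ==> Y Int range \<phi> ~= {} ==> W Int Y ~= {} ==> openin (zar X) W ==> \<exists>v. \<phi> v \<in> W Int Y"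
 using irreducible_closed_meet[of "zar X" Y W "range \<phi>"] open_range unfolding prime_divisor_def by blast

text \<open>The point of \<open>Z 0\<close> in the chart makes every member the closure of its
  trace, so each strict inclusion yields a polynomial that vanishes on the smaller member only. Four
  of them would contradict algebraic dependence.\<close>

lemma chain_length_le_3:
 assumes "irreducible_chain (zar X) Z n" "\<phi> v \<in> Z 0" shows "n <= 3"
proof (rule ccontr)
 assume "~ n <= 3"
 then have Z: "irreducible_chain (zar X) Z 4" using irreducible_chain_le[OF assms(1), of 4] by simp
 have irr: "irreducible_closed (zar X) (Z i)" if "i <= 4" for i using Z that by (simp add: irreducible_chain_def)
 have ss: "Z i \<subset> Z (Suc i)" if "i < 4" for i using Z that by (simp add: irreducible_chain_def)
 have sub: "Z 0 \<subseteq> Z i" if "i <= 4" for i using that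
 proof (induct i)
  case (Suc i)
  then show ?case using ss[of i] by auto
 qed simp
 have "\<exists>f. (\<exists>v. \<phi> v \<in> Z (Suc i) & ev f v ~= 0) & (\<forall>v. \<phi> v \<in> Z i --> ev f v = 0)" if i: "i < 4" for i
 proof -
  have "\<phi> v \<in> Z i" "\<phi> v \<in> Z (Suc i)" using sub[of i] sub[of "Suc i"] i assms(2) by auto
  then have ne: "Z i Int range \<phi> ~= {}" "Z (Suc i) Int range \<phi> ~= {}" by blast+
  have e1: "Z i = cl (\<phi> -` Z i)" and e2: "Z (Suc i) = cl (\<phi> -` Z (Suc i))"
   by (rule irreducible_eq_cl; use irr[of i] irr[of "Suc i"] i ne in simp)+
  have "\<phi> -` Z i ~= \<phi> -` Z (Suc i)"
   using trans[OF e1 trans[OF arg_cong[of _ _ cl] e2[symmetric]]] ss[OF i] by blast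
  then obtain w where w: "\<phi> w \<in> Z (Suc i)" "w ~: \<phi> -` Z i" using ss[OF i] by auto
  moreover have "closedin (zar X) (Z i)" using irr[of i] i by (simp add: irreducible_closed_def)
  ultimately obtain P where "ev P w ~= 0" "\<forall>w\<in>\<phi> -` Z i. ev P w = 0"
   using zclosed_vimage[of "Z i"] unfolding zclosed_def by blast
  then show ?thesis using w(1) by (intro exI[of _ P]) auto
 qed
 then have "\<forall>i. \<exists>f. i < 4 --> (\<exists>v. \<phi> v \<in> Z (Suc i) & ev f v ~= 0) & (\<forall>v. \<phi> v \<in> Z i --> ev f v = 0)"
  by blast
 from choice[OF this] obtain f where f: "!!i. i < 4 ==> \<exists>v. \<phi> v \<in> Z (Suc i) & ev (f i) v ~= 0"
  "!!i v. i < 4 ==> \<phi> v \<in> Z i ==> ev (f i) v = 0" by blast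
 have step: "desc (f i # fs) (\<phi> -` Z (Suc i))" if "i < 4" "desc fs (\<phi> -` Z i)" for i fs
 proof -
  have "zirr (\<phi> -` Z (Suc i))" using irr[of "Suc i"] that(1) by (intro zirr_vimage) auto
  moreover have "\<phi> -` Z i \<subseteq> \<phi> -` Z (Suc i)" using ss[OF that(1)] by auto
  moreover have "\<exists>v\<in>\<phi> -` Z (Suc i). ev (f i) v ~= 0" "\<forall>v\<in>\<phi> -` Z i. ev (f i) v = 0"
   using f[OF that(1)] by auto
  ultimately show ?thesis using that(2) by (simp only: desc.simps) blast
 qed
 have "desc [f 3, f 2, f 1, f 0] (\<phi> -` Z 4)"
 proof -
  have 0: "desc [] (\<phi> -` Z 0)" using assms(2) by auto
  have n: "Suc 0 = 1" "Suc 1 = 2" "Suc 2 = 3" "Suc 3 = 4" by simp_all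
  have 1: "desc [f 0] (\<phi> -` Z 1)" by (rule step[of 0, unfolded n, OF _ 0]) simp
  have 2: "desc [f 1, f 0] (\<phi> -` Z 2)" by (rule step[of 1, unfolded n, OF _ 1]) simp
  have 3: "desc [f 2, f 1, f 0] (\<phi> -` Z 3)" by (rule step[of 2, unfolded n, OF _ 2]) simp
  show ?thesis by (rule step[of 3, unfolded n, OF _ 3]) simp
 qed
 then show False using no_desc_4[of "[f 3, f 2, f 1, f 0]"] by (simp del: desc.simps)
qed

end

section \<open>Valuations along prime divisors\<close>

lemma multiplicity_eq_1:
 fixes p a b :: p3
 assumes "prime p" "p dvd a" "p * b = a * c" "~ p dvd b" "a ~= 0" "c ~= 0"
 shows "multiplicity p a = 1"
proof -
 have pe: "prime_elem p" using assms(1) by auto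
 have b: "b ~= 0" using assms(4) by auto
 have "multiplicity p (p * b) = multiplicity p a + multiplicity p c"
  unfolding assms(3) by (rule prime_elem_multiplicity_mult_distrib[OF pe assms(5,6)])
 moreover have "multiplicity p (p * b) = 1"
  using prime_elem_multiplicity_mult_distrib[OF pe _ b, of p] assms(1,4)
  by (simp add: not_dvd_imp_multiplicity_0 prime_elem_not_zeroI multiplicity_self)
 moreover have "multiplicity p a > 0" using assms(2,5) pe by (simp add: prime_multiplicity_gt_zero_iff)
 ultimately show ?thesis by simp
qed

context chart3
begin

text \<open>\<open>f\<close> is the fraction \<open>A / B\<close> on the open set where
  \<open>C\<close> does not vanish. The domain is recorded apart from the denominator because a germ
  agrees with a fraction only on some open set, which shrinks under the operations.\<close>

definition rep :: "('a => complex) => p3 => p3 => p3 => bool" where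
 "rep f A B C \<longleftrightarrow> (\<forall>w. ev C w ~= 0 --> ev B w ~= 0 & f (\<phi> w) = ev A w / ev B w)"

lemma rep_mult: "rep f A B C ==> rep g A' B' C' ==> rep (%x. f x * g x) (A * A') (B * B') (C * C')"
 by (auto simp: rep_def)

lemma rep_inverse: "rep f A B C ==> rep (%x. inverse (f x)) B A (C * A)"
 by (auto simp: rep_def)

lemma rep_power: "rep f A B C ==> rep (%x. f x ^ n) (A ^ n) (B ^ n) C"
 by (auto simp: rep_def power_divide)

lemma rep_nz: "rep f A B C ==> C ~= 0 ==> B ~= 0"
 using ev_nonzero[of C] by (auto simp: rep_def)

lemma rep_unique:
 assumes "rep f A B C" "rep f A' B' C'" "C ~= 0" "C' ~= 0" shows "A * B' = A' * B"
proof (rule ev_eq_genericI[of "C * C'"])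
 fix v assume "ev (C * C') v ~= 0"
 then have "ev B v ~= 0" "ev B' v ~= 0" "ev A v / ev B v = ev A' v / ev B' v"
  using assms(1,2) unfolding rep_def by auto
 then show "ev (A * B') v = ev (A' * B) v" by (simp add: field_simps)
qed (use assms in auto)

lemma rep_ratfun: "rep (%x. ev A (co x) / ev B (co x)) A B B"
 by (simp add: rep_def)

lemma rep_polyfun: "rep (%x. ev A (co x)) A 1 1"
 by (simp add: rep_def)

lemma rep_reg: assumes "rep f A B C" shows "f \<in> reg X (\<phi> ` {w. ev C w ~= 0})"
proof -
 have e: "{w. ev C w ~= 0} = {w. ev (B * C) w ~= 0}" using assms by (auto simp: rep_def)
 show ?thesis unfolding e
  by (rule reg_quot[of _ _ "A * C"]) (use assms in \<open>auto simp: rep_def\<close>)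
qed

lemma reg_rep: assumes "openin (zar X) W" "f \<in> reg X W" "\<phi> v \<in> W"
 shows "\<exists>A B C. rep f A B C & ev C v ~= 0"
proof -
 obtain A B where AB: "ev B v ~= 0" "\<forall>w. \<phi> w \<in> W & ev B w ~= 0 --> f (\<phi> w) = ev A w / ev B w"
  using reg_local[OF assms(2,3)] by blast
 obtain P where "ev P v ~= 0" "\<forall>w. ev P w ~= 0 --> \<phi> w \<in> W" using open_nbhd[OF assms(1,3)] by blast
 then have "rep f A B (P * B) & ev (P * B) v ~= 0" using AB by (auto simp: rep_def)
 then show ?thesis by blast
qed

lemma local_ringI: "rep f A B C ==> \<phi> v \<in> Y ==> ev C v ~= 0 ==> f \<in> local_ring X Y"
 unfolding local_ring_def using rep_reg[of f A B C] basic_open[of C] by blast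

lemma local_ring_point: "f \<in> local_ring X {\<phi> v} \<longleftrightarrow> (\<exists>A B C. rep f A B C & ev C v ~= 0)"
proof
 assume "f \<in> local_ring X {\<phi> v}"
 then show "\<exists>A B C. rep f A B C & ev C v ~= 0" unfolding local_ring_def using reg_rep by blast
qed (use local_ringI in blast)

lemma nonempty_open: "openin (zar X) W ==> W ~= {} ==> \<exists>v. \<phi> v \<in> W"
 using dense by blast

lemma local_ring_points: "f \<in> local_ring X (points X) \<longleftrightarrow> (\<exists>A B C. rep f A B C & C ~= 0)"
proof
 assume "f \<in> local_ring X (points X)"
 then obtain U where "openin (zar X) U" "U ~= {}" "f \<in> reg X U" unfolding local_ring_def by blast
 then show "\<exists>A B C. rep f A B C & C ~= 0" using nonempty_open[of U] reg_rep[of U f] ev_simps(1) by metis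
next
 assume "\<exists>A B C. rep f A B C & C ~= 0"
 then show "f \<in> local_ring X (points X)" using ev_nonzero local_ringI phi_points by metis
qed

lemma germ_eqI: "(!!w. ev C w ~= 0 ==> f (\<phi> w) = g (\<phi> w)) ==> \<phi> v \<in> Y ==> ev C v ~= 0 ==> germ_eq X Y f g"
 unfolding germ_eq_def by (intro exI[of _ "\<phi> ` {w. ev C w ~= 0}"]) (use basic_open[of C] in auto)

lemma germ_eq_pointsI: "(!!w. ev C w ~= 0 ==> f (\<phi> w) = g (\<phi> w)) ==> C ~= 0 ==> germ_eq X (points X) f g"
 using ev_nonzero germ_eqI phi_points by metis

lemma germ_eq_pointsD: "germ_eq X (points X) f g ==> \<exists>C. C ~= 0 & (\<forall>w. ev C w ~= 0 --> f (\<phi> w) = g (\<phi> w))"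
proof -
 assume "germ_eq X (points X) f g"
 then obtain U where U: "openin (zar X) U" "U ~= {}" "\<forall>x\<in>U. f x = g x" unfolding germ_eq_def by blast
 then obtain v where "\<phi> v \<in> U" using nonempty_open by blast
 then obtain P where "ev P v ~= 0" "\<forall>w. ev P w ~= 0 --> \<phi> w \<in> U" using open_nbhd[OF U(1)] by blast
 then show ?thesis using U(3) by (intro exI[of _ P]) auto
qed

lemma rep_germ_eq: "germ_eq X (points X) f g ==> rep f A B C ==> C ~= 0 ==> \<exists>D. D ~= 0 & rep g A B D"
 using germ_eq_pointsD[of f g] unfolding rep_def
 by (metis (no_types, lifting) ev_simps(4) mult_eq_0_iff)

lemma rat_units_iff: "f \<in> rat_units X \<longleftrightarrow> (\<exists>A B C. rep f A B C & C ~= 0 & A ~= 0)"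
proof
 assume f: "f \<in> rat_units X"
 then obtain A B C where ABC: "rep f A B C" "C ~= 0" unfolding rat_units_def using local_ring_points by blast
 have "A ~= 0"
 proof
  assume "A = 0"
  then have "germ_eq X (points X) f (%_. 0)" using ABC by (intro germ_eq_pointsI[of C]) (auto simp: rep_def)
  then show False using f by (simp add: rat_units_def)
 qed
 then show "\<exists>A B C. rep f A B C & C ~= 0 & A ~= 0" using ABC by blast
next
 assume "\<exists>A B C. rep f A B C & C ~= 0 & A ~= 0"
 then obtain A B C where ABC: "rep f A B C" "C ~= 0" "A ~= 0" by blast
 have "~ germ_eq X (points X) f (%_. 0)"
 proof
  assume "germ_eq X (points X) f (%_. 0)"
  then obtain D where D: "D ~= 0" "rep (%_. 0) A B D" using rep_germ_eq ABC by blast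
  then have "A * D = 0" by (intro ev_eq_0_imp) (auto simp: rep_def)
  then show False using D ABC by simp
 qed
 then show "f \<in> rat_units X" using ABC local_ring_points by (auto simp: rat_units_def)
qed

lemma germ_eq_hypD:
 assumes "prime p" "germ_eq X (hyp p) f g"
 shows "\<exists>C. ~ p dvd C & (\<forall>w. ev C w ~= 0 --> f (\<phi> w) = g (\<phi> w))"
proof -
 obtain U where U: "openin (zar X) U" "U Int hyp p ~= {}" "\<forall>x\<in>U. f x = g x"
  using assms(2) unfolding germ_eq_def by blast
 have "hyp p Int range \<phi> ~= {}" using prime_has_zero[OF assms(1)] hyp_iff by blast
 then obtain v where v: "\<phi> v \<in> U" "\<phi> v \<in> hyp p"
  using prime_divisor_meets[OF prime_divisor_hyp[OF assms(1)] _ U(2,1)] by blast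
 then obtain P where P: "ev P v ~= 0" "\<forall>w. ev P w ~= 0 --> \<phi> w \<in> U" using open_nbhd[OF U(1)] by blast
 then have "~ p dvd P" using v(2) prime_dvd_iff[OF assms(1)] by auto
 then show ?thesis using P U(3) by blast
qed

lemma not_dvd_point: "prime p ==> ~ p dvd C ==> \<exists>v. \<phi> v \<in> hyp p & ev C v ~= 0"
 using prime_dvd_iff[of p C] by auto

lemma local_ring_hyp:
 assumes "prime p"
 shows "f \<in> local_ring X (hyp p) \<longleftrightarrow> (\<exists>A B C. rep f A B C & ~ p dvd C & ~ p dvd B)"
proof
 assume "f \<in> local_ring X (hyp p)"
 then obtain U where U: "openin (zar X) U" "U Int hyp p ~= {}" "f \<in> reg X U" unfolding local_ring_def by blast
 have "hyp p Int range \<phi> ~= {}" using prime_has_zero[OF assms] hyp_iff by blast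
 then obtain v where v: "\<phi> v \<in> U" "\<phi> v \<in> hyp p"
  using prime_divisor_meets[OF prime_divisor_hyp[OF assms] _ U(2,1)] by blast
 then obtain A B C where ABC: "rep f A B C" "ev C v ~= 0" using reg_rep[OF U(1,3)] by blast
 then have "ev B v ~= 0" "ev C v ~= 0" "ev p v = 0" using v(2) by (auto simp: rep_def)
 then have "~ p dvd C" "~ p dvd B" using prime_dvd_iff[OF assms] by blast+
 then show "\<exists>A B C. rep f A B C & ~ p dvd C & ~ p dvd B" using ABC by blast
next
 assume "\<exists>A B C. rep f A B C & ~ p dvd C & ~ p dvd B"
 then show "f \<in> local_ring X (hyp p)" using not_dvd_point[OF assms] local_ringI by metis
qed

lemma local_units_hyp:
 assumes p: "prime p" and f: "rep f A B C" "~ p dvd C"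
 shows "f \<in> local_units X (hyp p) \<longleftrightarrow> ~ p dvd A"
proof -
 have B: "~ p dvd B" using f prime_dvd_iff[OF p] unfolding rep_def by metis
 have fl: "f \<in> local_ring X (hyp p)" using f B local_ring_hyp[OF p] by blast
 show ?thesis
 proof
  assume "f \<in> local_units X (hyp p)"
  then obtain w where w: "w \<in> local_ring X (hyp p)" "germ_eq X (hyp p) (%x. f x * w x) (%_. 1)"
   unfolding local_units_def by blast
  obtain D where D: "~ p dvd D" "!!v. ev D v ~= 0 ==> f (\<phi> v) * w (\<phi> v) = 1"
   using germ_eq_hypD[OF p w(2)] by blast
  have "~ p dvd D * C" using D f(2) p by (simp add: prime_dvd_mult_iff)
  then obtain v where v: "\<phi> v \<in> hyp p" "ev (D * C) v ~= 0" using not_dvd_point[OF p] by blast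
  then have "f (\<phi> v) ~= 0" "f (\<phi> v) = ev A v / ev B v" using D(2)[of v] f(1) unfolding rep_def by auto
  then have "ev A v ~= 0" by auto
  then show "~ p dvd A" using v(1) prime_dvd_iff[OF p] by auto
 next
  assume A: "~ p dvd A"
  have "~ p dvd C * A" using A f(2) p by (simp add: prime_dvd_mult_iff)
  then have "(%x. inverse (f x)) \<in> local_ring X (hyp p)"
   using rep_inverse[OF f(1)] A local_ring_hyp[OF p] by blast
  moreover obtain v where v: "\<phi> v \<in> hyp p" "ev (C * A) v ~= 0"
   using not_dvd_point[OF p `~ p dvd C * A`] by blast
  have "germ_eq X (hyp p) (%x. f x * inverse (f x)) (%_. 1)"
   by (rule germ_eqI[OF _ v]) (use f in \<open>auto simp: rep_def\<close>)
  ultimately show "f \<in> local_units X (hyp p)" unfolding local_units_def using fl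
   by (intro CollectI conjI bexI[of _ "%x. inverse (f x)"])
 qed
qed

lemma uniformizer_hyp: assumes p: "prime p" shows "uniformizer X (hyp p) (%x. ev p (co x))"
 unfolding uniformizer_def
proof (intro conjI ballI)
 have 1: "rep (%x. ev p (co x)) p 1 1" by (rule rep_polyfun)
 have n1: "~ p dvd 1" using p by (simp add: not_prime_unit)
 show "(%x. ev p (co x)) \<in> max_ideal X (hyp p)"
  unfolding max_ideal_def
 proof (rule DiffI)
  show "(%x. ev p (co x)) \<in> local_ring X (hyp p)"
   unfolding local_ring_hyp[OF p] using 1 n1 by (intro exI[of _ p] exI[of _ 1]) simp
  show "(%x. ev p (co x)) ~: local_units X (hyp p)" using local_units_hyp[OF p 1 n1] by simp
 qed
 fix g assume g: "g \<in> max_ideal X (hyp p)"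
 then obtain A B C where ABC: "rep g A B C" "~ p dvd C" "~ p dvd B"
  using local_ring_hyp[OF p] unfolding max_ideal_def by blast
 then have "p dvd A" using local_units_hyp[OF p ABC(1,2)] g unfolding max_ideal_def by blast
 then obtain A1 where A1: "A = p * A1" by blast
 let ?h = "%x. ev A1 (co x) / ev B (co x)"
 have "?h \<in> local_ring X (hyp p)" using rep_ratfun ABC(3) local_ring_hyp[OF p] by blast
 moreover obtain v where v: "\<phi> v \<in> hyp p" "ev C v ~= 0" using not_dvd_point[OF p ABC(2)] by blast
 have "germ_eq X (hyp p) g (%x. ev p (co x) * ?h x)"
  by (rule germ_eqI[OF _ v]) (use ABC(1) in \<open>auto simp: rep_def A1\<close>)
 ultimately show "\<exists>h\<in>local_ring X (hyp p). germ_eq X (hyp p) g (%x. ev p (co x) * h x)"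
  by (intro bexI[of _ ?h])
qed

text \<open>\<open>valuation\<close> quantifies over all uniformizers, so an arbitrary
  \<open>t\<close> has to be controlled. As \<open>t\<close> divides \<open>p\<close> in the local
  ring, \<open>p * (B * B') = A * A'\<close> with \<open>p\<close> not dividing
  \<open>B * B'\<close>, which leaves multiplicity one for \<open>A\<close>.\<close>

lemma rep_uniformizer:
 assumes p: "prime p" and t: "uniformizer X (hyp p) t"
 shows "\<exists>A B C. rep t A B C & C ~= 0 & A ~= 0 & multiplicity p A = 1 & multiplicity p B = 0"
proof -
 have tm: "t \<in> max_ideal X (hyp p)" using t by (simp add: uniformizer_def)
 then obtain A B C where ABC: "rep t A B C" "~ p dvd C" "~ p dvd B"
  using local_ring_hyp[OF p] unfolding max_ideal_def by blast
 have "p dvd A" using local_units_hyp[OF p ABC(1,2)] tm unfolding max_ideal_def by blast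
 have "(%x. ev p (co x)) \<in> max_ideal X (hyp p)" using uniformizer_hyp[OF p] by (simp add: uniformizer_def)
 then obtain h where h: "h \<in> local_ring X (hyp p)" "germ_eq X (hyp p) (%x. ev p (co x)) (%x. t x * h x)"
  using t unfolding uniformizer_def by blast
 obtain A' B' C' where ABC': "rep h A' B' C'" "~ p dvd C'" "~ p dvd B'"
  using local_ring_hyp[OF p] h(1) by blast
 obtain D where D: "~ p dvd D" "!!v. ev D v ~= 0 ==> ev p v = t (\<phi> v) * h (\<phi> v)"
  using germ_eq_hypD[OF p h(2)] by auto
 have "p * (B * B') = A * A'"
 proof (rule ev_eq_genericI[of "C * C' * D"])
  show "C * C' * D ~= 0" using ABC(2) ABC'(2) D(1) by auto
  fix v assume "ev (C * C' * D) v ~= 0"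
  then have "ev B v ~= 0" "ev B' v ~= 0" "ev p v = ev A v / ev B v * (ev A' v / ev B' v)"
   using ABC(1) ABC'(1) D(2)[of v] unfolding rep_def by auto
  then show "ev (p * (B * B')) v = ev (A * A') v" by (simp add: field_simps)
 qed
 moreover have nd: "~ p dvd B * B'" using ABC(3) ABC'(3) p by (simp add: prime_dvd_mult_iff)
 moreover have "p * (B * B') ~= 0" using nd p by auto
 ultimately have "A ~= 0" "A' ~= 0" by auto
 then have "multiplicity p A = 1"
  using multiplicity_eq_1[OF p `p dvd A` `p * (B * B') = A * A'` nd] by blast
 then show ?thesis using ABC `A ~= 0` not_dvd_imp_multiplicity_0[OF ABC(3)] by fastforce
qed

lemma mult_mult: "prime p ==> A ~= 0 ==> B ~= 0 ==> multiplicity p (A * B) = multiplicity p A + multiplicity p B"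
 for p A B :: p3
 by (rule prime_elem_multiplicity_mult_distrib) auto

lemma mult_power: "prime p ==> A ~= 0 ==> multiplicity p (A ^ n) = n * multiplicity p A"
 for p A :: p3
 by (rule prime_elem_multiplicity_power_distrib) auto

lemma rep_powi:
 assumes "rep f A B C" "C ~= 0" "A ~= 0" "prime p"
 shows "\<exists>A' B' C'. rep (%x. f x powi k) A' B' C' & C' ~= 0 & A' ~= 0 &
  int (multiplicity p A') - int (multiplicity p B') = k * (int (multiplicity p A) - int (multiplicity p B))"
proof (cases "k >= 0")
 case True
 have "rep (%x. f x powi k) (A ^ nat k) (B ^ nat k) C"
  using rep_power[OF assms(1), of "nat k"] True by (simp add: power_int_def)
 then show ?thesis using assms rep_nz[OF assms(1,2)] True
  by (intro exI[of _ "A ^ nat k"] exI[of _ "B ^ nat k"] exI[of _ C]) (simp add: mult_power algebra_simps)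
next
 case False
 have "rep (%x. f x powi k) (B ^ nat (-k)) (A ^ nat (-k)) (C * A)"
  using rep_inverse[OF rep_power[OF assms(1), of "nat (-k)"]] False rep_nz[OF assms(1,2)]
  by (auto simp: power_int_def rep_def power_inverse[symmetric])
 then show ?thesis using assms rep_nz[OF assms(1,2)] False
  by (intro exI[of _ "B ^ nat (-k)"] exI[of _ "A ^ nat (-k)"] exI[of _ "C * A"])
    (simp add: mult_power algebra_simps)
qed

lemma valuation_hyp:
 assumes p: "prime p" and f: "rep f A B C" "C ~= 0" "A ~= 0"
 shows "valuation X (hyp p) f = int (multiplicity p A) - int (multiplicity p B)"
 unfolding valuation_def
proof (rule the_equality)
 have B: "B ~= 0" using rep_nz f by blast
 have nu: "~ is_unit p" "p ~= 0" using p by (auto simp: not_prime_unit)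
 obtain A' where A': "A = p ^ multiplicity p A * A'" "~ p dvd A'"
  using multiplicity_decompose'[OF f(3) nu(1)] by blast
 obtain B' where B': "B = p ^ multiplicity p B * B'" "~ p dvd B'"
  using multiplicity_decompose'[OF B nu(1)] by blast
 let ?u = "%x. ev A' (co x) / ev B' (co x)"
 have u: "?u \<in> local_units X (hyp p)" using local_units_hyp[OF p rep_ratfun B'(2)] A'(2) by blast
 have "germ_eq X (points X) f (%x. ?u x * ev p (co x) powi (int (multiplicity p A) - int (multiplicity p B)))"
 proof (rule germ_eq_pointsI[of "C * p"])
  fix w assume w: "ev (C * p) w ~= 0"
  then have "ev p w ~= 0" "f (\<phi> w) = ev A w / ev B w" using f(1) by (auto simp: rep_def)
  moreover have "ev A w = ev p w ^ multiplicity p A * ev A' w"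
   by (metis A'(1) ev_simps(4,7))
  moreover have "ev B w = ev p w ^ multiplicity p B * ev B' w"
   by (metis B'(1) ev_simps(4,7))
  ultimately show "f (\<phi> w) = ev A' (co (\<phi> w)) / ev B' (co (\<phi> w)) * ev p (co (\<phi> w)) powi (int (multiplicity p A) - int (multiplicity p B))"
   by (simp add: power_int_diff ac_simps)
 qed (use f nu in auto)
 then show "\<exists>\<pi> u. uniformizer X (hyp p) \<pi> & u \<in> local_units X (hyp p) &
   germ_eq X (points X) f (%x. u x * \<pi> x powi (int (multiplicity p A) - int (multiplicity p B)))"
  using u uniformizer_hyp[OF p] by blast
 fix k assume "\<exists>\<pi> u. uniformizer X (hyp p) \<pi> & u \<in> local_units X (hyp p) &
   germ_eq X (points X) f (%x. u x * \<pi> x powi k)"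
 then obtain t u where t: "uniformizer X (hyp p) t" and u: "u \<in> local_units X (hyp p)"
  and eq: "germ_eq X (points X) f (%x. u x * t x powi k)" by blast
 obtain U1 U2 U3 where U: "rep u U1 U2 U3" "~ p dvd U3" "~ p dvd U2"
  using u local_ring_hyp[OF p] unfolding local_units_def by blast
 then have U1: "~ p dvd U1" using u local_units_hyp[OF p U(1,2)] by blast
 obtain T1 T2 T3 where T: "rep t T1 T2 T3" "T3 ~= 0" "T1 ~= 0" "multiplicity p T1 = 1" "multiplicity p T2 = 0"
  using rep_uniformizer[OF p t] by blast
 obtain S1 S2 S3 where S: "rep (%x. t x powi k) S1 S2 S3" "S3 ~= 0" "S1 ~= 0"
  "int (multiplicity p S1) - int (multiplicity p S2) = k"
  using rep_powi[OF T(1-3) p, of k] T(4,5) by auto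
 obtain D where D: "D ~= 0" "rep (%x. u x * t x powi k) A B D" using rep_germ_eq[OF eq f(1,2)] by blast
 have nz: "U3 * S3 ~= 0" "U1 ~= 0" "U2 ~= 0" "S2 ~= 0" using U U1 S rep_nz[OF S(1,2)] by auto
 \<comment> \<open>This is \<open>f = u * t powi k\<close> cleared of denominators; \<open>u\<close>
   contributes no factor \<open>p\<close>, and the power of \<open>t\<close> contributes exactly
   \<open>k\<close>.\<close>
 have "A * (U2 * S2) = U1 * S1 * B"
  by (rule rep_unique[OF D(2) rep_mult[OF U(1) S(1)] D(1) nz(1)])
 then have "multiplicity p (A * (U2 * S2)) = multiplicity p (U1 * S1 * B)" by simp
 then show "k = int (multiplicity p A) - int (multiplicity p B)"
  using S(4) nz S(3) f(3) B p not_dvd_imp_multiplicity_0[OF U1] not_dvd_imp_multiplicity_0[OF U(3)]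
  by (simp add: mult_mult)
qed

lemma principal_div_hyp:
 assumes "prime p" "rep f A B C" "C ~= 0" "A ~= 0"
 shows "principal_div X f (hyp p) = int (multiplicity p A) - int (multiplicity p B)"
 using valuation_hyp[OF assms] prime_divisor_hyp[OF assms(1)] by (simp add: principal_div_def)

lemma principal_div_mult:
 assumes "Y Int range \<phi> ~= {}" "f \<in> rat_units X" "g \<in> rat_units X"
 shows "principal_div X (%x. f x * g x) Y = principal_div X f Y + principal_div X g Y"
proof (cases "prime_divisor X Y")
 case True
 then obtain p where p: "prime p" "Y = hyp p" using prime_divisor_eq_hyp assms(1) by blast
 obtain A B C where f: "rep f A B C" "C ~= 0" "A ~= 0" using assms(2) rat_units_iff by blast
 obtain A' B' C' where g: "rep g A' B' C'" "C' ~= 0" "A' ~= 0" using assms(3) rat_units_iff by blast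
 have "C * C' ~= 0" "A * A' ~= 0" using f g by auto
 from principal_div_hyp[OF p(1) rep_mult[OF f(1) g(1)] this] show ?thesis
  unfolding p(2) principal_div_hyp[OF p(1) f] principal_div_hyp[OF p(1) g]
  using p f(3) g(3) rep_nz[OF f(1,2)] rep_nz[OF g(1,2)] by (simp add: mult_mult)
qed (simp add: principal_div_def)

lemma rat_units_mult: "f \<in> rat_units X ==> g \<in> rat_units X ==> (%x. f x * g x) \<in> rat_units X"
proof -
 assume "f \<in> rat_units X" "g \<in> rat_units X"
 then obtain A B C A' B' C' where "rep f A B C" "C ~= 0" "A ~= 0" "rep g A' B' C'" "C' ~= 0" "A' ~= 0"
  unfolding rat_units_iff by blast
 then show ?thesis unfolding rat_units_iff
  by (intro exI[of _ "A * A'"] exI[of _ "B * B'"] exI[of _ "C * C'"]) (simp add: rep_mult)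
qed

lemma rat_units_inverse: "f \<in> rat_units X ==> (%x. inverse (f x)) \<in> rat_units X"
proof -
 assume "f \<in> rat_units X"
 then obtain A B C where "rep f A B C" "C ~= 0" "A ~= 0" unfolding rat_units_iff by blast
 then show ?thesis unfolding rat_units_iff using rep_nz[of f A B C]
  by (intro exI[of _ "B"] exI[of _ "A"] exI[of _ "C * A"]) (simp add: rep_inverse)
qed

lemma rat_units_1: "(%x. 1) \<in> rat_units X"
 unfolding rat_units_iff by (intro exI[of _ 1]) (simp add: rep_def)

lemma principal_div_1: assumes "Y Int range \<phi> ~= {}" shows "principal_div X (%_. 1) Y = 0"
 using principal_div_mult[OF assms rat_units_1 rat_units_1] by simp

lemma germ_eq_principal_div:
 assumes "Y Int range \<phi> ~= {}" "f \<in> rat_units X" "germ_eq X (points X) f g"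
 shows "g \<in> rat_units X" "principal_div X f Y = principal_div X g Y"
proof -
 obtain A B C where f: "rep f A B C" "C ~= 0" "A ~= 0" using assms(2) rat_units_iff by blast
 obtain D where g: "D ~= 0" "rep g A B D" using rep_germ_eq[OF assms(3) f(1,2)] by blast
 show "g \<in> rat_units X" using g f(3) rat_units_iff by blast
 show "principal_div X f Y = principal_div X g Y"
 proof (cases "prime_divisor X Y")
  case True
  then obtain p where p: "prime p" "Y = hyp p" using prime_divisor_eq_hyp assms(1) by blast
  show ?thesis unfolding p(2) using principal_div_hyp[OF p(1) f] principal_div_hyp[OF p(1) g(2,1) f(3)] by simp
 qed (simp add: principal_div_def)
qed

lemma principal_div_inverse:
 assumes "Y Int range \<phi> ~= {}" "f \<in> rat_units X"
 shows "principal_div X (%x. inverse (f x)) Y = - principal_div X f Y"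
proof -
 obtain A B C where f: "rep f A B C" "C ~= 0" "A ~= 0" using assms(2) rat_units_iff by blast
 have "germ_eq X (points X) (%x. f x * inverse (f x)) (%_. 1)"
  by (rule germ_eq_pointsI[of "C * A"]) (use f in \<open>auto simp: rep_def\<close>)
 from germ_eq_principal_div(2)[OF assms(1) rat_units_mult[OF assms(2) rat_units_inverse[OF assms(2)]] this]
 show ?thesis using principal_div_1[OF assms(1)] principal_div_mult[OF assms(1,2) rat_units_inverse[OF assms(2)]] by simp
qed

lemma finite_principal_div:
 assumes "f \<in> rat_units X" shows "finite {Y. Y Int range \<phi> ~= {} & principal_div X f Y ~= 0}"
proof -
 obtain A B C where f: "rep f A B C" "C ~= 0" "A ~= 0" using assms rat_units_iff by blast
 have "B ~= 0" using rep_nz f by blast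
 have "{Y. Y Int range \<phi> ~= {} & principal_div X f Y ~= 0} \<subseteq> hyp ` (prime_factors (A * B))"
 proof
  fix Y assume "Y \<in> {Y. Y Int range \<phi> ~= {} & principal_div X f Y ~= 0}"
  then have Y: "Y Int range \<phi> ~= {}" "principal_div X f Y ~= 0" "prime_divisor X Y"
   by (auto simp: principal_div_def split: if_splits)
  then obtain p where p: "prime p" "Y = hyp p" using prime_divisor_eq_hyp by blast
  have "p dvd A | p dvd B"
  proof (rule ccontr)
   assume "~ ?thesis"
   then have "multiplicity p A = 0" "multiplicity p B = 0" by (simp_all add: not_dvd_imp_multiplicity_0)
   then show False using Y(2) unfolding p(2) principal_div_hyp[OF p(1) f] by simp
  qed
  then show "Y \<in> hyp ` (prime_factors (A * B))"
   using p f(3) `B ~= 0` by (auto simp: in_prime_factors_iff)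
 qed
 then show ?thesis by (rule finite_subset) simp
qed

text \<open>Without poles along hypersurfaces of the chart, each prime occurs in \<open>B\<close> at
  most as often as in \<open>A\<close>; factoriality then gives \<open>B dvd A\<close>.\<close>

lemma rep_polynomial:
 assumes "f \<in> rat_units X" "!!p. prime p ==> principal_div X f (hyp p) >= 0"
 shows "\<exists>P C. P ~= 0 & C ~= 0 & rep f P 1 C"
proof -
 obtain A B C where f: "rep f A B C" "C ~= 0" "A ~= 0" using assms rat_units_iff by blast
 have "B ~= 0" using rep_nz f by blast
 then have "B dvd A"
 proof (rule multiplicity_le_imp_dvd)
  fix p :: p3 assume "prime p"
  then show "multiplicity p B <= multiplicity p A" using assms(2) principal_div_hyp[OF _ f] by fastforce
 qed
 then obtain P where P: "A = B * P" by blast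
 have "rep f P 1 C" using f(1) by (auto simp: rep_def P)
 then show ?thesis using f P by auto
qed

end

section \<open>Curves and intersection numbers\<close>

lemma ex1_eq: "\<exists>!x. P x ==> P a ==> P b ==> a = b" by blast

text \<open>The body of \<open>colength\<close> with the submodule abstracted to a predicate
  \<open>N\<close> on differences, so that uniqueness of the length becomes linear algebra.\<close>

definition basis_mod :: "('b => complex) set => (('b => complex) => bool) => nat => (nat => 'b => complex) => bool" where
 "basis_mod L N k e \<longleftrightarrow> (\<forall>i<k. e i \<in> L) &
   (\<forall>g\<in>L. \<exists>!c::nat => complex. (\<forall>i\<ge>k. c i = 0) & N (%q. g q - (\<Sum>i<k. c i * e i q)))"

text \<open>If \<open>k' > k\<close>, expanding the \<open>e'\<close> in terms of the
  \<open>e\<close> modulo \<open>N\<close> gives more vectors than coordinates. Hence a nontrivial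
  combination of the \<open>e'\<close> satisfies \<open>N\<close>, which is a second expansion of
  zero.\<close>

lemma basis_mod_le:
 fixes L :: "('b => complex) set"
 assumes add: "!!f g. N f ==> N g ==> N (%q. f q + g q)" and scale: "!!c f. N f ==> N (%q. c * f q)"
  and zero: "N (%_. 0)" "(%_. 0) \<in> L"
  and e: "basis_mod L N k e" and e': "basis_mod L N k' e'"
 shows "k' <= k"
proof (rule ccontr)
 assume "~ k' <= k"
 have ex: "\<exists>c. N (%q. e' j q - (\<Sum>i<k. c i * e i q))" if "j < k'" for j
 proof -
  have "e' j \<in> L" using e' that by (simp add: basis_mod_def)
  moreover have "\<forall>g\<in>L. \<exists>!c::nat => complex. (\<forall>i\<ge>k. c i = 0) & N (%q. g q - (\<Sum>i<k. c i * e i q))"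
   using e by (simp add: basis_mod_def)
  ultimately show ?thesis by (blast dest: bspec)
 qed
 then have "\<forall>j. \<exists>c. j < k' --> N (%q. e' j q - (\<Sum>i<k. c i * e i q))" by blast
 from choice[OF this] obtain c where c: "!!j. j < k' ==> N (%q. e' j q - (\<Sum>i<k. c j i * e i q))" by blast
 obtain d where d: "\<exists>j\<in>{..<k'}. d j ~= 0" "\<forall>i\<in>{..<k}. (\<Sum>j<k'. d j * c j i) = 0"
  using nontrivial_solution[of "{..<k}" "{..<k'}" c] `~ k' <= k` by auto
 have N_sum: "N (%q. \<Sum>j\<in>S. f j q)" if "finite S" "!!j. j \<in> S ==> N (f j)" for S and f :: "nat => 'b => complex"
  using that by (induct S rule: finite_induct) (auto intro: add zero)
 have "N (%q. \<Sum>j<k'. d j * (e' j q - (\<Sum>i<k. c j i * e i q)))"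
  by (intro N_sum scale c) auto
 moreover have "(\<Sum>j<k'. d j * (e' j q - (\<Sum>i<k. c j i * e i q))) = (\<Sum>j<k'. d j * e' j q)" for q
 proof -
  have "(\<Sum>j<k'. d j * (\<Sum>i<k. c j i * e i q)) = (\<Sum>j<k'. \<Sum>i<k. d j * c j i * e i q)"
   by (simp add: sum_distrib_left ac_simps)
  also have "... = (\<Sum>i<k. (\<Sum>j<k'. d j * c j i) * e i q)"
   by (subst sum.swap) (simp add: sum_distrib_right)
  also have "... = 0" using d(2) by simp
  finally show ?thesis by (simp add: right_diff_distrib sum_subtractf)
 qed
 ultimately have "N (%q. \<Sum>j<k'. d j * e' j q)" by simp
 from scale[OF this, of "-1"] have N': "N (%q. 0 - (\<Sum>j<k'. d j * e' j q))" by simp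
 \<comment> \<open>Cut off at \<open>k'\<close>, since expansions are unique only among sequences of
   coefficients that vanish from \<open>k'\<close> on.\<close>
 define d' where "d' = (%j. if j < k' then d j else 0)"
 have 1: "\<exists>!c::nat => complex. (\<forall>i\<ge>k'. c i = 0) & N (%q. 0 - (\<Sum>i<k'. c i * e' i q))"
  using conjunct2[OF e'[unfolded basis_mod_def]] zero(2) by (rule bspec)
 have 2: "(\<forall>i\<ge>k'. d' i = 0) & N (%q. 0 - (\<Sum>i<k'. d' i * e' i q))"
  using N' by (auto simp: d'_def)
 have 3: "(\<forall>i\<ge>k'. (%_. 0::complex) i = 0) & N (%q. 0 - (\<Sum>i<k'. (%_. 0) i * e' i q))"
  using zero(1) by simp
 have "d' = (%_. 0)" by (rule ex1_eq[OF 1]) (use 2 3 in simp_all)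
 moreover obtain j where j: "j < k'" "d j ~= 0" using d(1) by auto
 ultimately have "d' j = 0" by simp
 then show False using j by (simp add: d'_def)
qed

lemma power_dvd_combination:
 fixes q :: "complex poly"
 assumes q: "q = [:-z, 1:]" and dvd: "q ^ n dvd (\<Sum>i<n. smult (d i) (q ^ i))"
 shows "i < n ==> d i = 0"
proof (induct i rule: less_induct)
 case (less i)
 have "(\<Sum>j<n. smult (d j) (q ^ j)) = (\<Sum>j\<in>{i..<n}. smult (d j) (q ^ j))"
  using less by (intro sum.mono_neutral_right) auto
 also have "... = smult (d i) (q ^ i) + (\<Sum>j\<in>{Suc i..<n}. smult (d j) (q ^ j))"
  using less(2) by (simp add: sum.atLeast_Suc_lessThan)
 finally have *: "(\<Sum>j<n. smult (d j) (q ^ j)) = smult (d i) (q ^ i) + (\<Sum>j\<in>{Suc i..<n}. smult (d j) (q ^ j))" .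
 have "q ^ Suc i dvd (\<Sum>j\<in>{Suc i..<n}. smult (d j) (q ^ j))"
  by (intro dvd_sum dvd_smult le_imp_power_dvd) auto
 moreover have "q ^ Suc i dvd (\<Sum>j<n. smult (d j) (q ^ j))"
  using dvd less(2) by (meson Suc_leI dvd_trans le_imp_power_dvd)
 ultimately have "q ^ Suc i dvd smult (d i) (q ^ i)" unfolding * by (simp add: dvd_add_left_iff)
 then have "q ^ i * q dvd q ^ i * [:d i:]" by (simp add: mult.commute)
 moreover have "q ^ i ~= 0" by (simp add: q)
 ultimately have "q dvd [:d i:]" using dvd_times_left_cancel_iff by blast
 then have "poly [:d i:] z = 0" unfolding q by (simp only: poly_eq_0_iff_dvd)
 then show ?case by simp
qed

text \<open>Reflection loses exactly the factors \<open>[:0, 1:]\<close> of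
  \<open>p\<close>.\<close>

lemma degree_reflect_poly_order:
 fixes p :: "complex poly" assumes "p ~= 0"
 shows "degree (reflect_poly p) + Polynomial.order 0 p = degree p"
proof -
 obtain q where q: "p = [:0, 1:] ^ Polynomial.order 0 p * q" "~ [:0, 1:] dvd q"
  using order_decomp[OF assms, of 0] by auto
 then have q0: "coeff q 0 ~= 0" by (simp add: dvd_iff_poly_eq_0 poly_0_coeff_0)
 have x: "reflect_poly [:0, 1:] = (1 :: complex poly)"
  by (subst reflect_poly_pCons') (simp_all add: pCons_one)
 have "reflect_poly p = reflect_poly q"
  by (subst q(1)) (simp add: reflect_poly_mult reflect_poly_power x)
 moreover have "degree p = Polynomial.order 0 p + degree q"
 proof -
  have "q ~= 0" using q0 by auto
  then show ?thesis by (subst q(1)) (simp add: degree_mult_eq degree_power_eq)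
 qed
 ultimately show ?thesis using q0 by simp
qed

text \<open>Zeros minus poles of a rational section on the projective line. \<open>a / b\<close> and
  \<open>a' / b'\<close> express it in the coordinates \<open>z\<close> and \<open>1 / z\<close>;
  the degrees count the finite points, the orders at 0 the point at infinity. Reflection turns the
  relation into a polynomial identity, whose degrees are compared.\<close>

lemma order_degree_relation:
 fixes a b a' b' :: "complex poly"
 assumes nz: "a ~= 0" "b ~= 0" "a' ~= 0" "b' ~= 0" and S: "infinite S"
  and rel: "!!z. z \<in> S ==> z ~= 0 & poly a' (1 / z) * poly b z * z ^ m = poly a z * poly b' (1 / z) * z ^ n"
 shows "int (degree a) - int (degree b) + int (Polynomial.order 0 a') - int (Polynomial.order 0 b') = int m - int n"
proof -
 let ?l = "reflect_poly a' * b * monom 1 (m + degree b')" and ?r = "a * reflect_poly b' * monom 1 (n + degree a')"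
 have "?l = ?r"
 proof -
  have "S \<subseteq> {z. poly (?l - ?r) z = 0}"
  proof
   fix z assume "z \<in> S"
   then have z: "z ~= 0" and e: "poly a' (1 / z) * poly b z * z ^ m = poly a z * poly b' (1 / z) * z ^ n"
    using rel by auto
   have "poly ?l z = (poly a' (1 / z) * poly b z * z ^ m) * z ^ (degree a' + degree b')"
    using z by (simp add: poly_reflect_poly_nz poly_monom power_add divide_inverse)
   also have "... = poly ?r z"
    unfolding e using z by (simp add: poly_reflect_poly_nz poly_monom power_add divide_inverse)
   finally show "z \<in> {z. poly (?l - ?r) z = 0}" by simp
  qed
  then have "infinite {z. poly (?l - ?r) z = 0}" using S infinite_super by blast
  then have "?l - ?r = 0" by (rule poly_infinite_0)
  then show ?thesis by simp
 qed
 then have "degree ?l = degree ?r" by simp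
 then have "degree (reflect_poly a') + degree b + (m + degree b') = degree a + degree (reflect_poly b') + (n + degree a')"
  using nz by (simp add: degree_mult_eq degree_monom_eq)
 then show ?thesis using degree_reflect_poly_order[OF nz(3)] degree_reflect_poly_order[OF nz(4)] by linarith
qed

lemma sum_order_eq_degree:
 fixes p :: "complex poly" assumes "p ~= 0" "finite R" "{z. poly p z = 0} \<subseteq> R"
 shows "(\<Sum>z\<in>R. int (Polynomial.order z p)) = int (degree p)"
proof -
 have "(\<Sum>z\<in>R. Polynomial.order z p) = (\<Sum>z\<in>{z. poly p z = 0}. Polynomial.order z p)"
  using assms by (intro sum.mono_neutral_right) (auto simp: order_root)
 also have "... = size (proots p)"
  using assms by (simp add: size_multiset_overloaded_eq set_count_proots)
 finally show ?thesis by (simp add: size_proots_complex flip: of_nat_sum)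
qed

lemma ev_lift1' [simp]: "ev (lift1 q) v = poly q (pz v)"
 by (cases v) simp

lemma line_zero_iff: "line P = 0 \<longleftrightarrow> (\<forall>z. ev P (Pt 0 0 z) = 0)"
 by (metis poly_0 poly_all_0_iff_0 poly_line)

lemma zirr_line: "zirr {v. px v = 0 & py v = 0}"
 unfolding zirr_def
proof (intro allI impI)
 fix P Q assume "\<forall>v\<in>{v. px v = 0 & py v = 0}. ev (P * Q) v = 0"
 then have "line (P * Q) = 0" unfolding line_zero_iff by simp
 then have "line P = 0 | line Q = 0" by simp
 moreover have "ev P v = 0" if "line P = 0" "px v = 0" "py v = 0" for P v
  using that unfolding line_zero_iff by (cases v) auto
 ultimately show "(\<forall>v\<in>{v. px v = 0 & py v = 0}. ev P v = 0) | (\<forall>v\<in>{v. px v = 0 & py v = 0}. ev Q v = 0)"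
  by blast
qed

text \<open>Two local equations of one divisor near \<open>v\<close> differ by a unit at
  \<open>v\<close>: after division by the gcd, a prime factor of one quotient that vanishes at
  \<open>v\<close> would divide the other quotient as well.\<close>

lemma unit_at_point:
 fixes P Q :: p3
 assumes "P ~= 0" "Q ~= 0" "!!p. prime p ==> ev p v = 0 ==> multiplicity p P = multiplicity p Q"
 shows "\<exists>u w. ev u v ~= 0 & ev w v ~= 0 & u * P = w * Q"
proof -
 define g where "g = gcd P Q"
 have g: "g ~= 0" using assms(1) by (simp add: g_def)
 obtain P0 Q0 where PQ: "P = P0 * g" "Q = Q0 * g" "coprime P0 Q0"
  using gcd_coprime_exists[of P Q] g unfolding g_def by blast
 have nz: "P0 ~= 0" "Q0 ~= 0" using assms PQ by auto
 have z: "zirr {v}" by (auto simp: zirr_def)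
 have eq: "multiplicity p P0 = multiplicity p Q0" if p: "prime p" "ev p v = 0" for p
  using assms(3)[OF p] prime_elem_multiplicity_mult_distrib[of p P0 g]
   prime_elem_multiplicity_mult_distrib[of p Q0 g] p nz g unfolding PQ(1,2) by simp
 have nd: "~ (p dvd P0 & p dvd Q0)" if "prime p" for p
  using PQ(3) that by (meson coprime_common_divisor not_prime_unit)
 have iff: "p dvd P0 \<longleftrightarrow> p dvd Q0" if p: "prime p" "ev p v = 0" for p
  using eq[OF p] by (metis multiplicity_eq_zero_iff nz not_prime_unit p(1))
 have "ev Q0 v ~= 0"
 proof
  assume "ev Q0 v = 0"
  then obtain p where "prime p" "p dvd Q0" "ev p v = 0" using zirr_in_prime[OF nz(2) z] by auto
  then show False using nd iff by blast
 qed
 moreover have "ev P0 v ~= 0"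
 proof
  assume "ev P0 v = 0"
  then obtain p where "prime p" "p dvd P0" "ev p v = 0" using zirr_in_prime[OF nz(1) z] by auto
  then show False using nd iff by blast
 qed
 moreover have "Q0 * P = P0 * Q" unfolding PQ by (simp add: ac_simps)
 ultimately show ?thesis by blast
qed

context chart3
begin

lemma rep_add: "rep f A B C ==> rep g A' B' C' ==> rep (%x. f x + g x) (A * B' + A' * B) (B * B') (C * C')"
 by (auto simp: rep_def add_frac_eq)

lemma rep_const: "rep (%_. c) (cC c) 1 1"
 by (simp add: rep_def)

lemma local_ring_add:
 assumes "f \<in> local_ring X {\<phi> v}" "g \<in> local_ring X {\<phi> v}" shows "(%x. f x + g x) \<in> local_ring X {\<phi> v}"
proof -
 obtain A B C A' B' C' where "rep f A B C" "ev C v ~= 0" "rep g A' B' C'" "ev C' v ~= 0"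
  using assms unfolding local_ring_point by blast
 then show ?thesis unfolding local_ring_point
  by (intro exI[of _ "A * B' + A' * B"] exI[of _ "B * B'"] exI[of _ "C * C'"]) (simp add: rep_add)
qed

lemma local_ring_scale:
 assumes "f \<in> local_ring X {\<phi> v}" shows "(%x. c * f x) \<in> local_ring X {\<phi> v}"
proof -
 obtain A B C where "rep f A B C" "ev C v ~= 0" using assms unfolding local_ring_point by blast
 then show ?thesis unfolding local_ring_point using rep_mult[OF rep_const[of c], of f A B C]
  by (intro exI[of _ "cC c * A"] exI[of _ "1 * B"] exI[of _ "1 * C"]) simp
qed

lemma local_ring_poly: "(%x. ev A (co x)) \<in> local_ring X {\<phi> v}"
 unfolding local_ring_point by (intro exI[of _ A] exI[of _ 1]) (simp add: rep_polyfun)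

end

section \<open>Local intersection with a coordinate line\<close>

locale chart_line = chart3 +
 fixes C :: "'a set"
 assumes C_iff: "\<phi> v \<in> C \<longleftrightarrow> px v = 0 & py v = 0"
begin

lemma line_in_C [simp]: "\<phi> (Pt 0 0 z) \<in> C" by (simp add: C_iff)

definition pt :: "complex => 'a" where "pt z = \<phi> (Pt 0 0 z)"

lemma near_infinite: assumes "openin (zar X) U" "pt z \<in> U"
 shows "\<exists>P. ev P (Pt 0 0 z) ~= 0 & (\<forall>w. ev P (Pt 0 0 w) ~= 0 --> pt w \<in> U)"
 using open_nbhd[OF assms(1), of "Pt 0 0 z"] assms(2) unfolding pt_def by blast

lemma line_nz: "ev P (Pt 0 0 z) ~= 0 ==> line P ~= 0"
 by (auto simp: line_zero_iff)

lemma line_eq_genericI: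
 assumes "line D ~= 0" "!!z. ev D (Pt 0 0 z) ~= 0 ==> ev P (Pt 0 0 z) = ev Q (Pt 0 0 z)"
 shows "line P = line Q"
proof -
 have "line (D * (P - Q)) = 0" unfolding line_zero_iff using assms(2) by auto
 then show ?thesis using assms(1) by simp
qed

lemma vanishes_iff:
 assumes "rep a A B D" "ev D (Pt 0 0 z) ~= 0"
 shows "vanishes_on_near X C (pt z) a \<longleftrightarrow> line A = 0"
proof
 assume "vanishes_on_near X C (pt z) a"
 then obtain U where U: "openin (zar X) U" "pt z \<in> U" "\<forall>q\<in>U Int C. a q = 0" by (auto simp: vanishes_on_near_def)
 obtain P where P: "ev P (Pt 0 0 z) ~= 0" "!!w. ev P (Pt 0 0 w) ~= 0 ==> pt w \<in> U"
  using near_infinite[OF U(1,2)] by blast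
 have "line A = line 0"
 proof (rule line_eq_genericI[of "P * D"])
  show "line (P * D) ~= 0" using P(1) assms(2) by (intro line_nz[of _ z]) simp
  fix w assume w: "ev (P * D) (Pt 0 0 w) ~= 0"
  then have "a (pt w) = 0" using P(2)[of w] U(3) by (auto simp: pt_def)
  then show "ev A (Pt 0 0 w) = ev 0 (Pt 0 0 w)" using w assms(1) by (auto simp: rep_def pt_def)
 qed
 then show "line A = 0" by simp
next
 assume A: "line A = 0"
 show "vanishes_on_near X C (pt z) a" unfolding vanishes_on_near_def
 proof (intro exI conjI)
  show "openin (zar X) (\<phi> ` {w. ev D w ~= 0})" by (rule basic_open)
  show "pt z \<in> \<phi> ` {w. ev D w ~= 0}" using assms(2) by (auto simp: pt_def)
  show "\<forall>q\<in>\<phi> ` {w. ev D w ~= 0} Int C. a q = 0"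
  proof
   fix q assume "q \<in> \<phi> ` {w. ev D w ~= 0} Int C"
   then obtain w where w: "q = \<phi> w" "ev D w ~= 0" "px w = 0" "py w = 0" using C_iff by blast
   then have "w = Pt 0 0 (pz w)" by (metis c3.collapse)
   then have "ev A w = 0" using A unfolding line_zero_iff by metis
   then show "a q = 0" using w assms(1) by (auto simp: rep_def)
  qed
 qed
qed

text \<open>For \<open>f\<close> in the local ring at \<open>pt z\<close>: \<open>f\<close> becomes
  zero in the local ring of \<open>C\<close> modulo \<open>a\<close>.\<close>

definition Nmod :: "complex => ('a => complex) => ('a => complex) => bool" where
 "Nmod z a f \<longleftrightarrow> (\<exists>h\<in>local_ring X {pt z}. \<exists>U. openin (zar X) U & pt z \<in> U & (\<forall>q\<in>U Int C. f q = a q * h q))"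

lemma Nmod_add: assumes "Nmod z a f" "Nmod z a g" shows "Nmod z a (%q. f q + g q)"
proof -
 obtain h U h' U' where h: "h \<in> local_ring X {pt z}" "openin (zar X) U" "pt z \<in> U" "\<forall>q\<in>U Int C. f q = a q * h q"
  "h' \<in> local_ring X {pt z}" "openin (zar X) U'" "pt z \<in> U'" "\<forall>q\<in>U' Int C. g q = a q * h' q"
  using assms unfolding Nmod_def by blast
 show ?thesis unfolding Nmod_def
  by (rule bexI[of _ "%x. h x + h' x"], rule exI[of _ "U Int U'"])
    (use h local_ring_add in \<open>auto simp: pt_def distrib_left\<close>)
qed

lemma Nmod_scale: assumes "Nmod z a f" shows "Nmod z a (%q. c * f q)"
proof -
 obtain h U where h: "h \<in> local_ring X {pt z}" "openin (zar X) U" "pt z \<in> U" "\<forall>q\<in>U Int C. f q = a q * h q"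
  using assms unfolding Nmod_def by blast
 show ?thesis unfolding Nmod_def
  by (rule bexI[of _ "%x. c * h x"], rule exI[of _ "U"])
    (use h local_ring_scale in \<open>auto simp: pt_def\<close>)
qed

lemma zero_local_ring: "(%_. 0) \<in> local_ring X {pt z}"
 unfolding pt_def local_ring_point by (intro exI[of _ 0] exI[of _ 1]) (simp add: rep_def)

lemma Nmod_zero: "Nmod z a (%_. 0)"
 unfolding Nmod_def
 by (rule bexI[OF _ zero_local_ring], rule exI[of _ "range \<phi>"]) (auto simp: open_range pt_def)

text \<open>All denominators are units at \<open>z\<close>, so orders of vanishing on the line are
  read off from the numerators; a multiple of \<open>a\<close> vanishes at least as often as
  \<open>a\<close>.\<close>

lemma Nmod_dvd:
 assumes a: "rep a A B D" "ev D (Pt 0 0 z) ~= 0" and f: "rep f F H E" "ev E (Pt 0 0 z) ~= 0" and N: "Nmod z a f"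
  and dvd: "[:-z, 1:] ^ n dvd line A"
 shows "[:-z, 1:] ^ n dvd line F"
proof -
 obtain h U where h: "h \<in> local_ring X {pt z}" "openin (zar X) U" "pt z \<in> U" "\<forall>q\<in>U Int C. f q = a q * h q"
  using N unfolding Nmod_def by blast
 obtain G K L where G: "rep h G K L" "ev L (Pt 0 0 z) ~= 0" using h(1) unfolding pt_def local_ring_point by blast
 obtain P where P: "ev P (Pt 0 0 z) ~= 0" "!!w. ev P (Pt 0 0 w) ~= 0 ==> pt w \<in> U"
  using near_infinite[OF h(2,3)] by blast
 have eq: "line (F * (B * K)) = line (A * (G * H))"
 proof (rule line_eq_genericI[of "P * D * E * L"])
  show "line (P * D * E * L) ~= 0" by (rule line_nz[of _ z]) (use P(1) a(2) f(2) G(2) in simp)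
  fix w assume w: "ev (P * D * E * L) (Pt 0 0 w) ~= 0"
  then have "f (pt w) = a (pt w) * h (pt w)" using h(4) P(2)[of w] by (auto simp: pt_def)
  moreover have "f (pt w) = ev F (Pt 0 0 w) / ev H (Pt 0 0 w)" "ev H (Pt 0 0 w) ~= 0"
   "a (pt w) = ev A (Pt 0 0 w) / ev B (Pt 0 0 w)" "ev B (Pt 0 0 w) ~= 0"
   "h (pt w) = ev G (Pt 0 0 w) / ev K (Pt 0 0 w)" "ev K (Pt 0 0 w) ~= 0"
   using w a(1) f(1) G(1) by (auto simp: rep_def pt_def)
  ultimately show "ev (F * (B * K)) (Pt 0 0 w) = ev (A * (G * H)) (Pt 0 0 w)" by (simp add: field_simps)
 qed
 have nz: "poly (line (B * K)) z ~= 0" using a G by (auto simp: poly_line rep_def)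
 have d: "[:-z, 1:] ^ n dvd line F * line (B * K)" using eq dvd by (simp add: dvd_mult2)
 show ?thesis
 proof (cases "line F = 0")
  case False
  have BK: "line (B * K) ~= 0" using nz by auto
  then have "n <= Polynomial.order z (line F * line (B * K))"
   using d False order_divides by (metis mult_eq_0_iff)
  also have "... = Polynomial.order z (line F)"
   using order_mult[of "line F" "line (B * K)" z] False BK nz by (metis add.right_neutral mult_eq_0_iff order_0I)
  finally show ?thesis using order_divides by blast
 qed simp
qed

text \<open>The Taylor polynomial of \<open>G / H\<close> at \<open>z\<close> up to order
  \<open>n\<close>, with the denominator cleared.\<close>

lemma taylor_exists:
 assumes H: "poly H z ~= (0::complex)"
 shows "\<exists>c. (\<forall>i\<ge>n. c i = 0) & [:-z, 1:] ^ n dvd G - (\<Sum>i<n. smult (c i) ([:-z, 1:] ^ i)) * H"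
proof (induct n)
 case 0 then show ?case by (intro exI[of _ "%_. 0"]) simp
next
 case (Suc n)
 then obtain c Q where c: "\<forall>i\<ge>n. c i = 0"
  and Q: "G - (\<Sum>i<n. smult (c i) ([:-z, 1:] ^ i)) * H = [:-z, 1:] ^ n * Q" by (auto elim!: dvdE)
 define k where "k = poly Q z / poly H z"
 define c' where "c' = c(n := k)"
 have "(\<Sum>i<n. smult (c' i) ([:-z, 1:] ^ i)) = (\<Sum>i<n. smult (c i) ([:-z, 1:] ^ i))"
  by (intro sum.cong) (auto simp: c'_def)
 then have "(\<Sum>i<Suc n. smult (c' i) ([:-z, 1:] ^ i)) = (\<Sum>i<n. smult (c i) ([:-z, 1:] ^ i)) + smult k ([:-z, 1:] ^ n)"
  by (simp add: c'_def)
 then have "G - (\<Sum>i<Suc n. smult (c' i) ([:-z, 1:] ^ i)) * H = [:-z, 1:] ^ n * Q - smult k ([:-z, 1:] ^ n) * H"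
  unfolding Q[symmetric] by (simp add: algebra_simps)
 also have "... = [:-z, 1:] ^ n * (Q - smult k H)" by (simp add: algebra_simps)
 finally have e: "G - (\<Sum>i<Suc n. smult (c' i) ([:-z, 1:] ^ i)) * H = [:-z, 1:] ^ n * (Q - smult k H)" .
 have "poly (Q - smult k H) z = 0" using H by (simp add: k_def)
 then have "[:-z, 1:] dvd Q - smult k H" by (simp only: poly_eq_0_iff_dvd)
 then have "[:-z, 1:] ^ Suc n dvd G - (\<Sum>i<Suc n. smult (c' i) ([:-z, 1:] ^ i)) * H"
  unfolding e power_Suc2 by (rule mult_dvd_mono[OF dvd_refl])
 then show ?case using c by (intro exI[of _ c']) (simp add: c'_def)
qed

text \<open>With \<open>q\<close> the local parameter, the powers \<open>q ^ i\<close> for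
  \<open>i < n\<close> form a basis: Taylor expansion gives the coefficients, and independence of
  these powers modulo \<open>q ^ n\<close> makes them unique.\<close>

lemma colength_eq_order:
 assumes a: "rep a A B D" "ev D (Pt 0 0 z) ~= 0" and nz: "line A ~= 0"
 shows "colength X C (pt z) a = Polynomial.order z (line A)"
proof -
 define n where "n = Polynomial.order z (line A)"
 define q where "q = [:-z, 1:]"
 obtain A0 where A0: "line A = q ^ n * A0" "poly A0 z ~= 0"
  using order_decomp[OF nz, of z] unfolding n_def q_def poly_eq_0_iff_dvd by blast
 define e where "e = (%i x. ev (lift1 (q ^ i)) (co x))"
 let ?L = "local_ring X {pt z}"
 have e_sum: "rep (%x. \<Sum>i<n. c i * e i x) (lift1 (\<Sum>i<n. smult (c i) (q ^ i))) 1 1" for c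
  by (simp add: rep_def e_def poly_sum)
 have "basis_mod ?L (Nmod z a) n e"
  unfolding basis_mod_def
 proof (intro conjI allI impI ballI)
  show "e i \<in> ?L" for i unfolding e_def pt_def by (rule local_ring_poly)
  fix g assume "g \<in> ?L"
  then obtain G H E where G: "rep g G H E" "ev E (Pt 0 0 z) ~= 0" unfolding pt_def local_ring_point by blast
  then have Hz: "poly (line H) z ~= 0" by (auto simp: rep_def poly_line)
  show "\<exists>!c. (\<forall>i\<ge>n. c i = 0) & Nmod z a (%x. g x - (\<Sum>i<n. c i * e i x))"
  proof (rule ex_ex1I)
   obtain c Q where c: "\<forall>i\<ge>n. c i = 0" and Q: "line G - (\<Sum>i<n. smult (c i) (q ^ i)) * line H = q ^ n * Q"
    using taylor_exists[OF Hz, of n "line G"] unfolding q_def by (auto elim!: dvdE)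
   \<comment> \<open>On the line the Taylor remainder of \<open>g\<close> is
     \<open>q ^ n * Q / H\<close> and \<open>a\<close> is \<open>q ^ n * A0 / B\<close>; their
     quotient is \<open>Q * B / (A0 * H)\<close>.\<close>
   let ?h = "%x. ev (lift1 Q * B) (co x) / ev (lift1 A0 * H) (co x)"
   let ?U = "\<phi> ` {w. ev (E * D * lift1 A0) w ~= 0}"
   have "Nmod z a (%x. g x - (\<Sum>i<n. c i * e i x))"
    unfolding Nmod_def
   proof (rule bexI[of _ ?h], rule exI[of _ ?U], intro conjI ballI)
    have "ev (lift1 A0 * H) (Pt 0 0 z) ~= 0" using A0(2) Hz by (simp add: poly_line)
    then show "?h \<in> ?L" unfolding pt_def local_ring_point using rep_ratfun by blast
    show "openin (zar X) ?U" by (rule basic_open)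
    show "pt z \<in> ?U" using G(2) a(2) A0(2) by (auto simp: pt_def)
    fix x assume "x \<in> ?U Int C"
    then obtain w where w: "x = \<phi> w" "ev (E * D * lift1 A0) w ~= 0" "px w = 0" "py w = 0" using C_iff by blast
    then have wz: "w = Pt 0 0 (pz w)" by (metis c3.collapse)
    let ?w = "pz w"
    have l: "ev P w = poly (line P) ?w" for P unfolding poly_line using wz by simp
    have 1: "g x = poly (line G) ?w / poly (line H) ?w" "poly (line H) ?w ~= 0"
     "a x = poly (line A) ?w / poly (line B) ?w" "poly (line B) ?w ~= 0" "poly A0 ?w ~= 0"
     unfolding l[symmetric] using G(1) a(1) w by (auto simp: rep_def)
    have 2: "(\<Sum>i<n. c i * e i x) = poly (\<Sum>i<n. smult (c i) (q ^ i)) ?w"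
     by (simp add: e_def w(1) poly_sum)
    have 3: "poly (line G) ?w - poly (\<Sum>i<n. smult (c i) (q ^ i)) ?w * poly (line H) ?w = poly (q ^ n) ?w * poly Q ?w"
     using arg_cong[OF Q, of "%p. poly p ?w"] by simp
    have lhs: "g x - (\<Sum>i<n. c i * e i x) = poly (q ^ n) ?w * poly Q ?w / poly (line H) ?w"
     unfolding 2 1(1) 3[symmetric] using 1(2) by (simp add: field_simps)
    have ax: "a x = poly (q ^ n) ?w * poly A0 ?w / poly (line B) ?w" using 1(3) A0(1) by simp
    have hx: "?h x = poly Q ?w * poly (line B) ?w / (poly A0 ?w * poly (line H) ?w)"
     using w(1) by (simp add: l)
    show "g x - (\<Sum>i<n. c i * e i x) = a x * ?h x"
     unfolding lhs ax hx using 1(2,4,5) by (simp del: poly_power)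
   qed
   then show "\<exists>c. (\<forall>i\<ge>n. c i = 0) & Nmod z a (%x. g x - (\<Sum>i<n. c i * e i x))"
    by (intro exI[of _ c] conjI[OF c])
  next
   fix c c' assume c: "(\<forall>i\<ge>n. c i = 0) & Nmod z a (%x. g x - (\<Sum>i<n. c i * e i x))"
    and c': "(\<forall>i\<ge>n. c' i = 0) & Nmod z a (%x. g x - (\<Sum>i<n. c' i * e i x))"
   have "Nmod z a (%x. (g x - (\<Sum>i<n. c i * e i x)) + (-1) * (g x - (\<Sum>i<n. c' i * e i x)))"
    by (rule Nmod_add[OF conjunct2[OF c] Nmod_scale[OF conjunct2[OF c']]])
   moreover have "(%x. (g x - (\<Sum>i<n. c i * e i x)) + (-1) * (g x - (\<Sum>i<n. c' i * e i x)))
     = (%x. \<Sum>i<n. (c' i - c i) * e i x)"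
    by (auto simp: fun_eq_iff left_diff_distrib sum_subtractf)
   ultimately have "Nmod z a (%x. \<Sum>i<n. (c' i - c i) * e i x)" by simp
   from Nmod_dvd[OF a e_sum _ this, of n] have "q ^ n dvd (\<Sum>i<n. smult (c' i - c i) (q ^ i))"
    unfolding A0(1) q_def[symmetric] by simp
   from power_dvd_combination[OF q_def this] have "c' i = c i" if "i < n" for i using that by auto
   then show "c = c'" using c c' by (metis ext leI)
  qed
 qed
 then have bn: "basis_mod ?L (Nmod z a) n e" .
 have "colength X C (pt z) a = (THE k. \<exists>e. basis_mod ?L (Nmod z a) k e)"
  unfolding colength_def basis_mod_def Nmod_def by (simp add: diff_eq_eq add.commute)
 also have "... = n"
 proof (rule the_equality)
  show "\<exists>e. basis_mod ?L (Nmod z a) n e" using bn by blast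
  fix k assume "\<exists>e. basis_mod ?L (Nmod z a) k e"
  then obtain e' where e': "basis_mod ?L (Nmod z a) k e'" by blast
  have le: "k2 <= k1" if "basis_mod ?L (Nmod z a) k1 e1" "basis_mod ?L (Nmod z a) k2 e2" for k1 k2 e1 e2
   by (rule basis_mod_le[where N = "Nmod z a" and L = ?L, OF Nmod_add Nmod_scale Nmod_zero zero_local_ring that])
  show "k = n" using le[OF bn e'] le[OF e' bn] by simp
 qed
 finally show ?thesis by (simp add: n_def)
qed

text \<open>The description ranges over all local equations \<open>f\<close> and all fractions
  \<open>a / b\<close>. Equal multiplicities along the hypersurfaces through the point make
  \<open>f\<close> and \<open>A / B\<close> differ by a unit there, and units have order 0 on the
  line.\<close>

lemma local_int_eq:
 assumes nz: "A ~= 0" "B ~= 0" "line A ~= 0" "line B ~= 0"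
  and D: "!!p. prime p ==> D (hyp p) = int (multiplicity p A) - int (multiplicity p B)"
 shows "local_int X D C (pt z) = int (Polynomial.order z (line A)) - int (Polynomial.order z (line B))"
 unfolding local_int_def
proof (rule the_equality)
 let ?f = "%x. ev A (co x) / ev B (co x)"
 have 1: "local_equation X D (pt z) ?f"
  unfolding local_equation_def
 proof (intro conjI exI allI impI)
  show "?f \<in> rat_units X" unfolding rat_units_iff using rep_ratfun[of A B] nz by blast
  show "openin (zar X) (range \<phi>)" by (rule open_range)
  show "pt z \<in> range \<phi>" by (simp add: pt_def)
  fix Y assume "prime_divisor X Y & Y Int range \<phi> ~= {}"
  then obtain p where p: "prime p" "Y = hyp p" using prime_divisor_eq_hyp by blast
  show "D Y = principal_div X ?f Y" unfolding p(2) D[OF p(1)]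
   by (rule principal_div_hyp[OF p(1) rep_ratfun nz(2,1), symmetric])
 qed
 have n1: "ev 1 (Pt 0 0 z) ~= 0" by simp
 have 2: "(%x. ev P (co x)) \<in> local_ring X {pt z}" for P unfolding pt_def by (rule local_ring_poly)
 have 3: "germ_eq X (points X) (%x. ?f x * ev B (co x)) (%x. ev A (co x))"
  by (rule germ_eq_pointsI[OF _ nz(2)]) simp
 show "\<exists>f a b. local_equation X D (pt z) f & a \<in> local_ring X {pt z} & b \<in> local_ring X {pt z} &
   ~ vanishes_on_near X C (pt z) a & ~ vanishes_on_near X C (pt z) b &
   germ_eq X (points X) (%x. f x * b x) a &
   int (Polynomial.order z (line A)) - int (Polynomial.order z (line B)) = int (colength X C (pt z) a) - int (colength X C (pt z) b)"
  by (rule exI[of _ ?f], rule exI[of _ "%x. ev A (co x)"], rule exI[of _ "%x. ev B (co x)"])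
    (use 1 2 3 nz in \<open>simp add: vanishes_iff[OF rep_polyfun n1] colength_eq_order[OF rep_polyfun n1]\<close>)
 fix k assume "\<exists>f a b. local_equation X D (pt z) f & a \<in> local_ring X {pt z} & b \<in> local_ring X {pt z} &
   ~ vanishes_on_near X C (pt z) a & ~ vanishes_on_near X C (pt z) b &
   germ_eq X (points X) (%x. f x * b x) a & k = int (colength X C (pt z) a) - int (colength X C (pt z) b)"
 then obtain f a b where le: "local_equation X D (pt z) f" and ab: "a \<in> local_ring X {pt z}" "b \<in> local_ring X {pt z}"
  and nv: "~ vanishes_on_near X C (pt z) a" "~ vanishes_on_near X C (pt z) b"
  and g: "germ_eq X (points X) (%x. f x * b x) a"
  and k: "k = int (colength X C (pt z) a) - int (colength X C (pt z) b)" by blast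
 obtain A1 B1 C1 where a1: "rep a A1 B1 C1" "ev C1 (Pt 0 0 z) ~= 0" using ab(1) unfolding pt_def local_ring_point by blast
 obtain A2 B2 C2 where b2: "rep b A2 B2 C2" "ev C2 (Pt 0 0 z) ~= 0" using ab(2) unfolding pt_def local_ring_point by blast
 have l12: "line A1 ~= 0" "line A2 ~= 0" using nv vanishes_iff[OF a1] vanishes_iff[OF b2] by auto
 have kk: "k = int (Polynomial.order z (line A1)) - int (Polynomial.order z (line A2))"
  unfolding k colength_eq_order[OF a1 l12(1)] colength_eq_order[OF b2 l12(2)] ..
 have "f \<in> rat_units X" using le by (simp add: local_equation_def)
 then obtain A' B' C' where f: "rep f A' B' C'" "C' ~= 0" "A' ~= 0" using rat_units_iff by blast
 have B': "B' ~= 0" using rep_nz f by blast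
 obtain U where U: "openin (zar X) U" "pt z \<in> U"
  "!!Y. prime_divisor X Y ==> Y Int U ~= {} ==> D Y = principal_div X f Y"
 proof -
  have "\<exists>U. openin (zar X) U & pt z \<in> U & (\<forall>Y. prime_divisor X Y & Y Int U ~= {} --> D Y = principal_div X f Y)"
   using le by (simp add: local_equation_def)
  then show ?thesis using that by blast
 qed
 have mult: "multiplicity p (A' * B) = multiplicity p (A * B')" if p: "prime p" "ev p (Pt 0 0 z) = 0" for p
 proof -
  have "hyp p Int U ~= {}" using p(2) U(2) hyp_iff unfolding pt_def by blast
  then have "D (hyp p) = principal_div X f (hyp p)" using U(3) prime_divisor_hyp[OF p(1)] by blast
  then show ?thesis unfolding D[OF p(1)] principal_div_hyp[OF p(1) f]
   using p(1) nz B' f(3) by (simp add: mult_mult)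
 qed
 obtain u w where uw: "ev u (Pt 0 0 z) ~= 0" "ev w (Pt 0 0 z) ~= 0" "u * (A' * B) = w * (A * B')"
 proof -
  have "A' * B ~= 0" "A * B' ~= 0" using nz B' f(3) by auto
  from unit_at_point[OF this mult] show ?thesis using that by blast
 qed
 obtain E where E: "E ~= 0" "!!v. ev E v ~= 0 ==> f (\<phi> v) * b (\<phi> v) = a (\<phi> v)" using germ_eq_pointsD[OF g] by blast
 have C12: "C1 ~= 0" "C2 ~= 0" using a1 b2 by auto
 have id: "A' * A2 * B1 = B' * B2 * A1"
 proof (rule ev_eq_genericI[of "E * C1 * C2 * C'"])
  fix v assume v: "ev (E * C1 * C2 * C') v ~= 0"
  then have "ev A' v / ev B' v * (ev A2 v / ev B2 v) = ev A1 v / ev B1 v" "ev B' v ~= 0" "ev B2 v ~= 0" "ev B1 v ~= 0"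
   using E(2)[of v] f(1) a1(1) b2(1) unfolding rep_def by auto
  then show "ev (A' * A2 * B1) v = ev (B' * B2 * A1) v" by (simp add: field_simps)
 qed (use E C12 f in auto)
 \<comment> \<open>The denominator \<open>B'\<close> may vanish on the whole line, so it is
   cancelled in three variables before restricting.\<close>
 have "B' * (u * B * B2 * A1) = u * B * (B' * B2 * A1)" by (simp add: ac_simps)
 also have "... = (u * (A' * B)) * A2 * B1" unfolding id[symmetric] by (simp add: ac_simps)
 also have "... = B' * (w * A * A2 * B1)" unfolding uw(3) by (simp add: ac_simps)
 finally have "u * B * B2 * A1 = w * A * A2 * B1" using B' by simp
 then have lid: "line u * line B * line B2 * line A1 = line w * line A * line A2 * line B1"
  by (metis line_simps(1))
 have o: "Polynomial.order z (line P) = 0 & line P ~= 0" if "ev P (Pt 0 0 z) ~= 0" for P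
  using that line_nz[OF that] by (simp add: order_root order_0I poly_line)
 have B12: "ev B1 (Pt 0 0 z) ~= 0" "ev B2 (Pt 0 0 z) ~= 0" using a1 b2 by (auto simp: rep_def)
 have "Polynomial.order z (line B) + Polynomial.order z (line A1) = Polynomial.order z (line A) + Polynomial.order z (line A2)"
  using arg_cong[OF lid, of "Polynomial.order z"] o[OF uw(1)] o[OF uw(2)] o[OF B12(1)] o[OF B12(2)] nz l12
  by (simp add: order_mult)
 then show "k = int (Polynomial.order z (line A)) - int (Polynomial.order z (line B))" unfolding kk by linarith
qed

end

text \<open>\<open>C\<close> is a projective line with coordinate \<open>z\<close> in the first
  chart and \<open>1 / z\<close> in the second; the origin of the second chart is its only point
  outside the first.\<close>

locale chart_pair = c1: chart_line X \<phi> C + c2: chart_line X \<psi> C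
 for X :: "'a fun_space" and \<phi> \<psi> C +
 assumes glue: "z ~= 0 ==> \<psi> (Pt 0 0 z) = \<phi> (Pt 0 0 (1 / z))"
  and origin: "\<psi> (Pt 0 0 0) ~: range \<phi>"
  and cover: "C \<subseteq> range \<phi> Un range \<psi>"
  and closed_C: "closedin (zar X) C"
  and t1: "x \<in> points X ==> closedin (zar X) {x}"
begin

lemma glue': "z ~= 0 ==> c1.pt z = c2.pt (1 / z)"
 using glue[of "1 / z"] by (simp add: c1.pt_def c2.pt_def)

lemma C_cases: assumes "x \<in> C" obtains z where "x = c1.pt z" | "x = c2.pt 0"
proof -
 consider v where "x = \<phi> v" | v where "x = \<psi> v" using cover assms by blast
 then show ?thesis
 proof cases
  case 1
  then have "px v = 0" "py v = 0" using assms c1.C_iff by auto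
  then have "v = Pt 0 0 (pz v)" by (metis c3.collapse)
  then have "x = c1.pt (pz v)" unfolding c1.pt_def 1 by simp
  then show ?thesis using that by blast
 next
  case 2
  then have "px v = 0" "py v = 0" using assms c2.C_iff by auto
  then have "v = Pt 0 0 (pz v)" by (metis c3.collapse)
  then have x: "x = c2.pt (pz v)" unfolding c2.pt_def 2 by simp
  show ?thesis
  proof (cases "pz v = 0")
   case False
   then have "x = c1.pt (1 / pz v)" using x glue'[of "1 / pz v"] by simp
   then show ?thesis using that by blast
  qed (use x that in simp)
 qed
qed

lemma irreducible_C: "irreducible_closed (zar X) C"
 unfolding irreducible_closed_def
proof (intro conjI allI impI)
 show "C ~= {}" using c1.line_in_C by blast
 fix A B assume AB: "closedin (zar X) A & closedin (zar X) B & C \<subseteq> A Un B"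
 have sub: "C \<subseteq> S" if S: "closedin (zar X) S" "!!z. c1.pt z \<in> S" for S
 proof
  fix x assume "x \<in> C"
  then show "x \<in> S"
  proof (cases rule: C_cases)
   case 2
   have "Pt 0 0 0 \<in> \<psi> -` S"
   proof (rule ccontr)
    assume "Pt 0 0 0 ~: \<psi> -` S"
    then obtain P where P: "ev P (Pt 0 0 0) ~= 0" "\<forall>w\<in>\<psi> -` S. ev P w = 0"
     using c2.zclosed_vimage[OF S(1)] unfolding zclosed_def by blast
    have "line P = line 0"
    proof (rule c2.line_eq_genericI[of cZ])
     fix z assume "ev cZ (Pt 0 0 z) ~= 0"
     then have "c2.pt z \<in> S" using S(2)[of "1 / z"] glue'[of "1 / z"] by simp
     then show "ev P (Pt 0 0 z) = ev 0 (Pt 0 0 z)" using P(2) by (simp add: c2.pt_def)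
    qed simp
    then show False using P(1) by (simp add: line_zero_iff)
   qed
   then show ?thesis using 2 by (simp add: c2.pt_def)
  qed (use S in simp)
 qed
 show "C \<subseteq> A | C \<subseteq> B"
 proof (rule ccontr)
  assume "~ ?thesis"
  then have "~ C \<subseteq> A" "~ C \<subseteq> B" by auto
  moreover have cAB: "closedin (zar X) A" "closedin (zar X) B" using AB by auto
  ultimately obtain z w where z: "c1.pt z ~: A" and w: "c1.pt w ~: B"
   using sub[OF cAB(1)] sub[OF cAB(2)] by blast
  have "Pt 0 0 z ~: \<phi> -` A" "Pt 0 0 w ~: \<phi> -` B" using z w by (auto simp: c1.pt_def)
  have cA: "zclosed (\<phi> -` A)" and cB: "zclosed (\<phi> -` B)" using c1.zclosed_vimage cAB by auto
  obtain P where P: "ev P (Pt 0 0 z) ~= 0" "\<forall>w\<in>\<phi> -` A. ev P w = 0"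
   using cA \<open>Pt 0 0 z ~: \<phi> -` A\<close> unfolding zclosed_def by blast
  obtain Q where Q: "ev Q (Pt 0 0 w) ~= 0" "\<forall>w\<in>\<phi> -` B. ev Q w = 0"
   using cB \<open>Pt 0 0 w ~: \<phi> -` B\<close> unfolding zclosed_def by blast
  have "line (P * Q) = 0" unfolding line_zero_iff
  proof
   fix u have "\<phi> (Pt 0 0 u) \<in> A Un B" using AB c1.line_in_C by blast
   then show "ev (P * Q) (Pt 0 0 u) = 0" using P(2) Q(2) by auto
  qed
  then show False using c1.line_nz[OF P(1)] c1.line_nz[OF Q(1)] by simp
 qed
qed (rule closed_C)

lemma finite_proper_closed:
 assumes "closedin (zar X) Z" "Z \<subset> C" shows "finite Z"
proof -
 have "\<exists>z. c1.pt z ~: Z"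
 proof (rule ccontr)
  assume "~ ?thesis"
  then have a: "c1.pt z \<in> Z" for z by blast
  have "C = c1.cl (\<phi> -` C)" by (rule c1.irreducible_eq_cl[OF irreducible_C]) (use c1.line_in_C in blast)
  also have "... \<subseteq> Z"
  proof (rule c1.cl_subset[OF assms(1)])
   fix v assume "v \<in> \<phi> -` C"
   then have "px v = 0" "py v = 0" using c1.C_iff by auto
   then have "v = Pt 0 0 (pz v)" by (metis c3.collapse)
   then show "\<phi> v \<in> Z" using a[of "pz v"] unfolding c1.pt_def by simp
  qed
  finally show False using assms(2) by blast
 qed
 then obtain z where "Pt 0 0 z ~: \<phi> -` Z" by (auto simp: c1.pt_def)
 then obtain P where P: "ev P (Pt 0 0 z) ~= 0" "\<forall>w\<in>\<phi> -` Z. ev P w = 0"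
  using c1.zclosed_vimage[OF assms(1)] unfolding zclosed_def by blast
 have fin: "finite {w. poly (line P) w = 0}" using c1.line_nz[OF P(1)] by (rule poly_roots_finite)
 have "Z \<subseteq> insert (c2.pt 0) (c1.pt ` {w. poly (line P) w = 0})"
 proof
  fix x assume x: "x \<in> Z"
  then have "x \<in> C" using assms(2) by blast
  then show "x \<in> insert (c2.pt 0) (c1.pt ` {w. poly (line P) w = 0})"
  proof (cases rule: C_cases)
   case (1 w)
   then have "Pt 0 0 w \<in> \<phi> -` Z" using x by (simp add: c1.pt_def)
   then have "poly (line P) w = 0" using P(2) by (simp add: poly_line)
   then show ?thesis using 1 by blast
  qed simp
 qed
 then show ?thesis using fin finite_subset by blast
qed

text \<open>Proper closed subsets of \<open>C\<close> are finite, and a finite irreducible closed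
  set is a point; so chains have length at most 1.\<close>

lemma curve_C: "curve X C"
 unfolding curve_def
proof (intro conjI antisym)
 let ?T = "subtopology (zar X) C"
 have cl: "closedin ?T A \<longleftrightarrow> closedin (zar X) A & A \<subseteq> C" for A
  using closed_C closedin_closed_subtopology by blast
 have irr: "irreducible_closed ?T A" if "irreducible_closed (zar X) A" "A \<subseteq> C" for A
  using that by (auto simp: irreducible_closed_def cl)
 show "irreducible_closed (zar X) C" by (rule irreducible_C)
 have CX: "C \<subseteq> points X" using closedin_subset[OF closed_C] .
 have pC: "c1.pt 0 \<in> C" "c1.pt 1 \<in> C" "c1.pt 0 ~= c1.pt 1" by (auto simp: c1.pt_def)
 have "irreducible_closed (zar X) {c1.pt 0}" using t1 CX pC by (auto simp: irreducible_closed_def)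
 then have "irreducible_closed ?T {c1.pt 0}" using pC by (intro irr) auto
 moreover have "irreducible_closed ?T C" by (rule irr[OF irreducible_C]) simp
 moreover have "{c1.pt 0} \<subset> C" using pC by (auto simp: psubset_eq)
 ultimately have "\<exists>Z. irreducible_chain ?T Z 1 & Z 0 = {c1.pt 0}" by (rule chain2)
 then have "enat 1 <= krull_dim ?T" unfolding krull_dim_def by (intro SUP_upper) auto
 then show "1 <= krull_dim ?T" by (simp add: one_enat_def)
 show "krull_dim ?T <= 1" unfolding krull_dim_def
 proof (rule SUP_least)
  fix n assume "n \<in> {n. \<exists>Z. irreducible_chain ?T Z n}"
  then obtain Z where Z: "irreducible_chain ?T Z n" by blast
  show "enat n <= 1"
  proof (rule ccontr)
   assume "~ ?thesis"
   then have "2 <= n" by (simp add: one_enat_def)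
   then have Z2: "irreducible_chain ?T Z 2" by (rule irreducible_chain_le[OF Z])
   note c = chain3D[OF Z2]
   have "Z 2 \<subseteq> C" using c(2) by (simp add: irreducible_closed_def cl)
   then have Z1: "Z 1 \<subset> C" using c(4) by blast
   have "closedin (zar X) (Z 1)" using c(1) by (simp add: irreducible_closed_def cl)
   then have fin: "finite (Z 1)" using Z1 by (rule finite_proper_closed)
   have "irreducible_closed ?T (Z 0)" using Z2 by (simp add: irreducible_chain_def)
   then obtain x where x: "x \<in> Z 0" by (auto simp: irreducible_closed_def)
   obtain y where y: "y \<in> Z 1" "y ~: Z 0" using c(3) by blast
   have cs: "closedin ?T {u}" if "u \<in> Z 1" for u using t1 CX Z1 that by (auto simp: cl)
   have "closedin ?T (\<Union>u\<in>Z 1 - {x}. {u})" by (rule closedin_Union) (use fin cs in auto)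
   then have "closedin ?T (Z 1 - {x})" by simp
   moreover have "closedin ?T {x}" using cs x c(3) by blast
   moreover have "Z 1 \<subseteq> {x} Un (Z 1 - {x})" by blast
   ultimately have "Z 1 \<subseteq> {x} | Z 1 \<subseteq> Z 1 - {x}" using c(1) unfolding irreducible_closed_def by blast
   then show False using x y c(3) by blast
  qed
 qed
qed

text \<open>The relation between the local equations is known off a hypersurface that may contain
  \<open>C\<close>, so it cannot be evaluated on \<open>C\<close> directly. It is first cleared of
  denominators to a polynomial identity on the first chart, which is then restricted to the
  line.\<close>

lemma polynomial_relation:
 assumes f: "c1.rep f A B E" "E ~= 0" and f': "c2.rep f' A' B' E'" "E' ~= 0"
  and rel: "D ~= 0" "!!w. ev D w ~= 0 ==> f' (\<phi> w) * pz w ^ m = f (\<phi> w) * pz w ^ n"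
 shows "\<exists>S. infinite S & (\<forall>z\<in>S. z ~= 0 &
  poly (line A') (1 / z) * poly (line B) z * z ^ m = poly (line A) z * poly (line B') (1 / z) * z ^ n)"
proof -
 define h where "h = (%P x. ev P (c2.co x))"
 have "openin (zar X) (range \<psi>)" by (rule c2.open_range)
 have hr: "h P \<in> reg X (range \<psi>)" for P using c2.rep_reg[OF c2.rep_polyfun[of P]] by (simp add: h_def)
 \<comment> \<open>The point \<open>z = 1\<close> lies in both charts. Near it, functions of the
   second chart become fractions whose denominators do not vanish identically on the line.\<close>
 have v1: "\<phi> (Pt 0 0 1) \<in> range \<psi>" using glue[of 1] by (metis div_by_1 one_neq_zero rangeI)
 obtain A1 A2 A3 where A: "c1.rep (h A') A1 A2 A3" "ev A3 (Pt 0 0 1) ~= 0"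
  using c1.reg_rep[OF c2.open_range hr v1] by blast
 obtain B1 B2 B3 where B: "c1.rep (h B') B1 B2 B3" "ev B3 (Pt 0 0 1) ~= 0"
  using c1.reg_rep[OF c2.open_range hr v1] by blast
 have "germ_eq X (points X) (%x. f' x * h B' x) (h A')"
  by (rule c2.germ_eq_pointsI[OF _ f'(2)]) (use f'(1) in \<open>auto simp: c2.rep_def h_def\<close>)
 then obtain G where G: "G ~= 0" "!!w. ev G w ~= 0 ==> f' (\<phi> w) * h B' (\<phi> w) = h A' (\<phi> w)"
  using c1.germ_eq_pointsD by blast
 have nz: "A3 ~= 0" "B3 ~= 0" using A B by auto
 have id: "A1 * B2 * B * cZ ^ m = A * A2 * B1 * cZ ^ n"
 proof (rule ev_eq_genericI[of "A3 * B3 * G * D * E"])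
  fix v assume v: "ev (A3 * B3 * G * D * E) v ~= 0"
  have 1: "f' (\<phi> v) * (ev B1 v / ev B2 v) = ev A1 v / ev A2 v" "ev A2 v ~= 0" "ev B2 v ~= 0"
   using G(2)[of v] A(1) B(1) v by (auto simp: c1.rep_def)
  have 2: "f' (\<phi> v) * pz v ^ m = ev A v / ev B v * pz v ^ n" "ev B v ~= 0"
   using rel(2)[of v] f(1) v by (auto simp: c1.rep_def)
  have "ev A1 v * pz v ^ m = ev A2 v * (f' (\<phi> v) * pz v ^ m) * (ev B1 v / ev B2 v)"
   using 1 by (simp add: field_simps)
  then have "ev A1 v * pz v ^ m = ev A2 v * (ev A v / ev B v * pz v ^ n) * (ev B1 v / ev B2 v)"
   unfolding 2(1) .
  then show "ev (A1 * B2 * B * cZ ^ m) v = ev (A * A2 * B1 * cZ ^ n) v"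
   using 1 2 by (simp add: field_simps)
 qed (use nz G rel f in auto)
 define q where "q = line (A3 * B3 * cZ)"
 have "q ~= 0" unfolding q_def by (rule c1.line_nz[of _ 1]) (use A B in simp)
 then have "finite {z. poly q z = 0}" by (rule poly_roots_finite)
 then have "infinite (UNIV - {z. poly q z = 0})" by (rule Diff_infinite_finite) (rule infinite_UNIV_char_0)
 moreover have "UNIV - {z. poly q z = 0} = {z. poly q z ~= 0}" by auto
 ultimately have inf: "infinite {z. poly q z ~= 0}" by simp
 show ?thesis
 proof (rule exI[of _ "{z. poly q z ~= 0}"], intro conjI ballI inf)
  fix z assume "z \<in> {z. poly q z ~= 0}"
  then have z: "ev A3 (Pt 0 0 z) ~= 0" "ev B3 (Pt 0 0 z) ~= 0" "z ~= 0" by (auto simp: q_def poly_line)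
  show "z ~= 0" by fact
  have co: "c2.co (\<phi> (Pt 0 0 z)) = Pt 0 0 (1 / z)" using glue[of "1 / z"] z(3) c2.co_phi by (metis divide_divide_eq_right div_by_1 divide_eq_0_iff mult_1 one_neq_zero)
  have 1: "poly (line A') (1 / z) = ev A1 (Pt 0 0 z) / ev A2 (Pt 0 0 z)" "ev A2 (Pt 0 0 z) ~= 0"
   using A(1) z(1) co by (auto simp: c1.rep_def h_def poly_line)
  have 2: "poly (line B') (1 / z) = ev B1 (Pt 0 0 z) / ev B2 (Pt 0 0 z)" "ev B2 (Pt 0 0 z) ~= 0"
   using B(1) z(2) co by (auto simp: c1.rep_def h_def poly_line)
  have "ev (A1 * B2 * B * cZ ^ m) (Pt 0 0 z) = ev (A * A2 * B1 * cZ ^ n) (Pt 0 0 z)" by (simp only: id)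
  then show "poly (line A') (1 / z) * poly (line B) z * z ^ m = poly (line A) z * poly (line B') (1 / z) * z ^ n"
   unfolding 1(1) 2(1) unfolding poly_line using 1(2) 2(2) by (simp add: field_simps)
 qed
qed

text \<open>Without poles on either chart, \<open>m - n\<close> is a degree plus an order of
  vanishing.\<close>

lemma polynomial_degree_nonneg:
 assumes "c1.rep f A 1 E" "E ~= 0" "c2.rep f' A' 1 E'" "E' ~= 0" "line A ~= 0"
  and "D ~= 0" "!!w. ev D w ~= 0 ==> f' (\<phi> w) * pz w ^ m = f (\<phi> w) * pz w ^ n"
 shows "m >= n"
proof -
 obtain S where S: "infinite S" "!!z. z \<in> S ==> z ~= 0 &
   poly (line A') (1 / z) * poly (line 1) z * z ^ m = poly (line A) z * poly (line 1) (1 / z) * z ^ n"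
  using polynomial_relation[OF assms(1-4,6,7)] by blast
 have "line A' ~= 0"
 proof
  assume "line A' = 0"
  then have "poly (line A) z = 0" if "z \<in> S" for z using S(2)[OF that] by auto
  then have "S \<subseteq> {z. poly (line A) z = 0}" by blast
  then show False using S(1) poly_roots_finite[OF assms(5)] infinite_super by blast
 qed
 have n1: "line 1 ~= 0" by simp
 have o1: "Polynomial.order 0 (line 1) = 0" by (rule order_0I) simp
 from order_degree_relation[OF assms(5) n1 `line A' ~= 0` n1 S(1,2)] o1
 have "int (degree (line A)) + int (Polynomial.order 0 (line A')) = int m - int n" by simp
 then show ?thesis by linarith
qed

lemma coprime_rep:
 assumes "f \<in> rat_units X"
 shows "\<exists>A B E. c1.rep f A B E & E ~= 0 & A ~= 0 & B ~= 0 & coprime A B"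
proof -
 obtain A B E where f: "c1.rep f A B E" "E ~= 0" "A ~= 0" using assms c1.rat_units_iff by blast
 have B: "B ~= 0" using c1.rep_nz f by blast
 then obtain A0 B0 where AB: "A = A0 * gcd A B" "B = B0 * gcd A B" "coprime A0 B0"
  using gcd_coprime_exists[of A B] by auto
 have "c1.rep f A0 B0 E"
  unfolding c1.rep_def
 proof (intro allI impI)
  fix w assume "ev E w ~= 0"
  then have "ev B w ~= 0" "f (\<phi> w) = ev A w / ev B w" using f(1) by (auto simp: c1.rep_def)
  moreover have "ev A w = ev A0 w * ev (gcd A B) w" "ev B w = ev B0 w * ev (gcd A B) w"
   using arg_cong[OF AB(1), of "%P. ev P w"] arg_cong[OF AB(2), of "%P. ev P w"] by auto
  ultimately show "ev B0 w ~= 0 & f (\<phi> w) = ev A0 w / ev B0 w" by auto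
 qed
 moreover have "A0 ~= 0" "B0 ~= 0" using AB f B by auto
 ultimately show ?thesis using f(2) AB(3) by blast
qed

text \<open>A prime factor of \<open>A\<close> that vanishes on the line does not divide
  \<open>B\<close>, by coprimality, so its hypersurface lies in the support of \<open>D\<close> and
  contains \<open>C\<close>; likewise for \<open>B\<close>.\<close>

lemma line_nonzero:
 assumes AB: "A ~= 0" "B ~= 0" "coprime A B"
  and D: "!!p. prime p ==> D (c1.hyp p) = int (multiplicity p A) - int (multiplicity p B)"
  and C: "!!Y. D Y ~= 0 ==> ~ C \<subseteq> Y"
 shows "line A ~= 0 & line B ~= 0"
proof -
 have sub: "C \<subseteq> c1.hyp p" if "\<forall>v\<in>{v. px v = 0 & py v = 0}. ev p v = 0" for p
 proof -
  have "C = c1.cl (\<phi> -` C)" by (rule c1.irreducible_eq_cl[OF irreducible_C]) (use c1.line_in_C in blast)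
  also have "... \<subseteq> c1.hyp p" by (rule c1.cl_subset[OF c1.closed_cl]) (use that c1.C_iff in auto)
  finally show ?thesis .
 qed
 have ne: "{v. px v = 0 & py v = 0} ~= {}" by (metis (mono_tags, lifting) c3.sel(1,2) empty_iff mem_Collect_eq)
 have all0: "\<forall>v\<in>{v. px v = 0 & py v = 0}. ev P v = 0" if "line P = 0" for P
 proof
  fix v assume "v \<in> {v. px v = 0 & py v = 0}"
  then have "v = Pt 0 0 (pz v)" by (cases v) simp
  then show "ev P v = 0" using that unfolding line_zero_iff by metis
 qed
 have nd: "~ (p dvd A & p dvd B)" if "prime p" for p
  using AB(3) that by (meson coprime_common_divisor not_prime_unit)
 have "line A ~= 0"
 proof
  assume "line A = 0"
  then obtain p where p: "prime p" "p dvd A" "\<forall>v\<in>{v. px v = 0 & py v = 0}. ev p v = 0"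
   using zirr_in_prime[OF AB(1) zirr_line ne all0] by blast
  have "multiplicity p B = 0" "multiplicity p A > 0"
   using nd[OF p(1)] p AB(1) by (auto simp: not_dvd_imp_multiplicity_0 prime_multiplicity_gt_zero_iff)
  then have "D (c1.hyp p) ~= 0" unfolding D[OF p(1)] by simp
  then show False using C sub[OF p(3)] by blast
 qed
 moreover have "line B ~= 0"
 proof
  assume "line B = 0"
  then obtain p where p: "prime p" "p dvd B" "\<forall>v\<in>{v. px v = 0 & py v = 0}. ev p v = 0"
   using zirr_in_prime[OF AB(2) zirr_line ne all0] by blast
  have "multiplicity p A = 0" "multiplicity p B > 0"
   using nd[OF p(1)] p AB(2) by (auto simp: not_dvd_imp_multiplicity_0 prime_multiplicity_gt_zero_iff)
  then have "D (c1.hyp p) ~= 0" unfolding D[OF p(1)] by simp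
  then show False using C sub[OF p(3)] by blast
 qed
 ultimately show ?thesis by blast
qed

end

lemma chart_pair_swap: "chart_pair X \<phi> \<psi> C ==> \<phi> (Pt 0 0 0) ~: range \<psi> ==> chart_pair X \<psi> \<phi> C"
proof -
 assume a: "chart_pair X \<phi> \<psi> C" and o: "\<phi> (Pt 0 0 0) ~: range \<psi>"
 interpret chart_pair X \<phi> \<psi> C by fact
 show ?thesis
 proof
  fix z :: complex assume "z ~= 0"
  then show "\<phi> (Pt 0 0 z) = \<psi> (Pt 0 0 (1 / z))" using glue[of "1 / z"] by simp
 qed (use o cover closed_C t1 in auto)
qed

locale chart_pair2 = chart_pair + assumes origin2: "\<phi> (Pt 0 0 0) ~: range \<psi>"
begin

sublocale swap: chart_pair X \<psi> \<phi> C
 using chart_pair_swap[OF chart_pair_axioms origin2] .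

text \<open>The finite points contribute orders of \<open>A\<close> and \<open>B\<close>, which add
  up to degrees by the fundamental theorem of algebra; the point at infinity contributes the orders
  of \<open>A'\<close> and \<open>B'\<close> at 0.\<close>

lemma sum_local_int:
 assumes F: "F \<in> rat_units X" "!!Y. prime_divisor X Y ==> Y Int range \<phi> ~= {} ==> D Y = principal_div X F Y"
  and F': "F' \<in> rat_units X" "!!Y. prime_divisor X Y ==> Y Int range \<psi> ~= {} ==> D Y = principal_div X F' Y"
  and rel: "E0 ~= 0" "!!w. ev E0 w ~= 0 ==> F' (\<phi> w) * pz w ^ m = F (\<phi> w) * pz w ^ n"
  and C: "!!Y. D Y ~= 0 ==> ~ C \<subseteq> Y"
 shows "(\<Sum>p \<in> {p \<in> C. local_int X D C p ~= 0}. local_int X D C p) = int m - int n"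
proof -
 obtain A B E where f: "c1.rep F A B E" "E ~= 0" "A ~= 0" "B ~= 0" "coprime A B" using coprime_rep[OF F(1)] by blast
 obtain A' B' E' where f': "c2.rep F' A' B' E'" "E' ~= 0" "A' ~= 0" "B' ~= 0" "coprime A' B'"
  using swap.coprime_rep[OF F'(1)] by blast
 have D1: "D (c1.hyp p) = int (multiplicity p A) - int (multiplicity p B)" if p: "prime p" for p
 proof -
  have "c1.hyp p Int range \<phi> ~= {}" using prime_has_zero[OF p] c1.hyp_iff by blast
  then show ?thesis using F(2)[OF c1.prime_divisor_hyp[OF p]] c1.principal_div_hyp[OF p f(1-3)] by simp
 qed
 have D2: "D (c2.hyp p) = int (multiplicity p A') - int (multiplicity p B')" if p: "prime p" for p
 proof -
  have "c2.hyp p Int range \<psi> ~= {}" using prime_has_zero[OF p] c2.hyp_iff by blast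
  then show ?thesis using F'(2)[OF c2.prime_divisor_hyp[OF p]] c2.principal_div_hyp[OF p f'(1-3)] by simp
 qed
 have nz: "line A ~= 0" "line B ~= 0" using line_nonzero[OF f(3-5) D1 C] by auto
 have nz': "line A' ~= 0" "line B' ~= 0" using swap.line_nonzero[OF f'(3-5) D2 C] by auto
 let ?l = "local_int X D C"
 have l1: "?l (c1.pt z) = int (Polynomial.order z (line A)) - int (Polynomial.order z (line B))" for z
  by (rule c1.local_int_eq[OF f(3,4) nz D1])
 have l2: "?l (c2.pt 0) = int (Polynomial.order 0 (line A')) - int (Polynomial.order 0 (line B'))"
  by (rule c2.local_int_eq[OF f'(3,4) nz' D2])
 define R where "R = {z. poly (line A) z = 0} Un {z. poly (line B) z = 0}"
 have R: "finite R" unfolding R_def using nz poly_roots_finite by blast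
 have notin: "c2.pt 0 ~: c1.pt ` R" using origin unfolding c1.pt_def c2.pt_def by blast
 have inj: "inj_on c1.pt R" by (auto simp: inj_on_def c1.pt_def)
 have in_C: "c1.pt z \<in> C" "c2.pt z \<in> C" for z by (simp_all add: c1.pt_def c2.pt_def)
 have sub: "{p \<in> C. ?l p ~= 0} \<subseteq> insert (c2.pt 0) (c1.pt ` R)"
 proof
  fix x assume x: "x \<in> {p \<in> C. ?l p ~= 0}"
  then have "x \<in> C" by blast
  then show "x \<in> insert (c2.pt 0) (c1.pt ` R)"
  proof (cases rule: C_cases)
   case (1 z)
   then have "Polynomial.order z (line A) ~= 0 | Polynomial.order z (line B) ~= 0" using x l1[of z] by auto
   then have "z \<in> R" using nz by (auto simp: R_def order_root)
   then show ?thesis using 1 by blast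
  qed simp
 qed
 have "(\<Sum>p \<in> {p \<in> C. ?l p ~= 0}. ?l p) = (\<Sum>p \<in> insert (c2.pt 0) (c1.pt ` R). ?l p)"
  by (rule sum.mono_neutral_left) (use R sub in_C in auto)
 also have "... = ?l (c2.pt 0) + (\<Sum>z\<in>R. ?l (c1.pt z))"
  using R notin by (simp add: sum.reindex[OF inj])
 also have "(\<Sum>z\<in>R. ?l (c1.pt z)) = int (degree (line A)) - int (degree (line B))"
  unfolding l1 sum_subtractf using nz R by (simp add: sum_order_eq_degree R_def)
 finally have *: "(\<Sum>p \<in> {p \<in> C. ?l p ~= 0}. ?l p) = int (Polynomial.order 0 (line A')) - int (Polynomial.order 0 (line B'))
   + (int (degree (line A)) - int (degree (line B)))" unfolding l2 .
 obtain S where S: "infinite S" "!!z. z \<in> S ==> z ~= 0 &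
   poly (line A') (1 / z) * poly (line B) z * z ^ m = poly (line A) z * poly (line B') (1 / z) * z ^ n"
  using polynomial_relation[OF f(1,2) f'(1,2) rel] by blast
 show ?thesis unfolding * using order_degree_relation[OF nz nz' S] by linarith
qed

text \<open>Moving \<open>D\<close> by \<open>g\<close> multiplies both local equations by
  \<open>g\<close> and leaves their relation intact, so every admissible \<open>g\<close> gives the
  same sum.\<close>

lemma intersection_number_eq:
 assumes F: "F \<in> rat_units X" "!!Y. prime_divisor X Y ==> Y Int range \<phi> ~= {} ==> D Y = principal_div X F Y"
  and F': "F' \<in> rat_units X" "!!Y. prime_divisor X Y ==> Y Int range \<psi> ~= {} ==> D Y = principal_div X F' Y"
  and rel: "E0 ~= 0" "!!w. ev E0 w ~= 0 ==> F' (\<phi> w) * pz w ^ m = F (\<phi> w) * pz w ^ n"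
  and D: "!!Y. D Y ~= 0 ==> prime_divisor X Y"
 shows "intersection_number X D C = int m - int n"
 unfolding intersection_number_def Let_def
proof (rule the_equality)
 let ?D = "%g Y. D Y + principal_div X g Y"
 have key: "(\<Sum>p \<in> {p \<in> C. local_int X (?D g) C p ~= 0}. local_int X (?D g) C p) = int m - int n"
  if g: "g \<in> rat_units X" and gC: "\<forall>Y. ?D g Y ~= 0 --> ~ C \<subseteq> Y" for g
 proof (rule sum_local_int[of "%x. F x * g x" _ "%x. F' x * g x"])
  show "(%x. F x * g x) \<in> rat_units X" by (rule c1.rat_units_mult[OF F(1) g])
  show "(%x. F' x * g x) \<in> rat_units X" by (rule c1.rat_units_mult[OF F'(1) g])
  show "?D g Y = principal_div X (%x. F x * g x) Y" if "prime_divisor X Y" "Y Int range \<phi> ~= {}" for Y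
   unfolding c1.principal_div_mult[OF that(2) F(1) g] F(2)[OF that] ..
  show "?D g Y = principal_div X (%x. F' x * g x) Y" if "prime_divisor X Y" "Y Int range \<psi> ~= {}" for Y
   unfolding c2.principal_div_mult[OF that(2) F'(1) g] F'(2)[OF that] ..
  show "E0 ~= 0" by (rule rel(1))
  show "F' (\<phi> w) * g (\<phi> w) * pz w ^ m = F (\<phi> w) * g (\<phi> w) * pz w ^ n" if "ev E0 w ~= 0" for w
   using rel(2)[OF that] by (simp add: ac_simps)
  show "~ C \<subseteq> Y" if "?D g Y ~= 0" for Y using gC that by blast
 qed
 \<comment> \<open>Dividing by the local equation on the first chart clears this chart of the
   divisor, and every prime divisor that contains \<open>C\<close> meets the chart.\<close>
 let ?g = "%x. inverse (F x)"
 have g: "?g \<in> rat_units X" by (rule c1.rat_units_inverse[OF F(1)])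
 have gC: "\<forall>Y. ?D ?g Y ~= 0 --> ~ C \<subseteq> Y"
 proof (intro allI impI notI)
  fix Y assume Y: "?D ?g Y ~= 0" "C \<subseteq> Y"
  have r: "Y Int range \<phi> ~= {}" using Y(2) c1.line_in_C by blast
  have p: "prime_divisor X Y"
  proof (rule ccontr)
   assume n: "~ ?thesis"
   then have "D Y = 0" using D by blast
   then show False using Y(1) n by (simp add: principal_div_def)
  qed
  show False using Y(1) unfolding c1.principal_div_inverse[OF r F(1)] F(2)[OF p r] by simp
 qed
 show "\<exists>g\<in>rat_units X. (\<forall>Y. ?D g Y ~= 0 --> ~ C \<subseteq> Y) &
   int m - int n = (\<Sum>p \<in> {p \<in> C. local_int X (?D g) C p ~= 0}. local_int X (?D g) C p)"
  by (rule bexI[OF _ g]) (use gC key[OF g gC] in simp)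
 show "d = int m - int n" if "\<exists>g\<in>rat_units X. (\<forall>Y. ?D g Y ~= 0 --> ~ C \<subseteq> Y) &
   d = (\<Sum>p \<in> {p \<in> C. local_int X (?D g) C p ~= 0}. local_int X (?D g) C p)" for d
  using that
 proof (elim bexE conjE)
  fix g assume g: "g \<in> rat_units X" "\<forall>Y. ?D g Y ~= 0 --> ~ C \<subseteq> Y"
   and d: "d = (\<Sum>p \<in> {p \<in> C. local_int X (?D g) C p ~= 0}. local_int X (?D g) C p)"
  show "d = int m - int n" unfolding d by (rule key[OF g])
 qed
qed

end

section \<open>The fan\<close>

type_synonym mvec = "int ^ 3"

text \<open>The pairing of the character \<open>m\<close> with the generator of the
  \<open>i\<close>-th ray; every index other than 1 to 5 is read as 6.\<close>

definition pr :: "mvec => nat => int" where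
 "pr m i = (if i = 1 then m $ 1 else if i = 2 then m $ 2 else if i = 3 then m $ 3
   else if i = 4 then - m $ 2 - m $ 3 else if i = 5 then - m $ 1 - m $ 2
   else m $ 1 + 3 * m $ 2 + 2 * m $ 3)"

definition vv :: "nat => mvec" where
 "vv i = (if i = 1 then vector [1, 0, 0] else if i = 2 then vector [0, 1, 0] else if i = 3 then vector [0, 0, 1]
   else if i = 4 then vector [0, -1, -1] else if i = 5 then vector [-1, -1, 0]
   else vector [1, 3, 2])"

definition Mx :: "nat set set" where
 "Mx = {{2, 4, 5}, {2, 3, 5}, {1, 4, 5}, {1, 3, 5}, {2, 4, 6}, {2, 3, 6}, {1, 4, 6}, {1, 3, 6}}"

definition K :: "nat set set" where "K = {I. \<exists>J\<in>Mx. I \<subseteq> J}"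

definition cn :: "nat set => (real ^ 3) set" where "cn I = convex_cone hull (lat ` vv ` I)"

lemma pr_add [simp]: "pr (m + m') i = pr m i + pr m' i"
 and pr_0 [simp]: "pr 0 i = 0" and pr_minus [simp]: "pr (- m) i = - pr m i"
 and pr_diff [simp]: "pr (m - m') i = pr m i - pr m' i"
 and pr_scale [simp]: "pr (k *s m) i = k * pr m i"
 by (simp_all add: pr_def algebra_simps)

lemma lat_inner: "lat m \<bullet> lat (vv i) = real_of_int (pr m i)"
 by (simp add: lat_def inner_vec_def sum_3 pr_def vv_def vector_3)

lemma MxK: "I \<in> Mx ==> I \<in> K" by (auto simp: K_def)

lemma K_subset: "I \<in> K ==> I' \<subseteq> I ==> I' \<in> K" by (auto simp: K_def)

lemma finite_Mx: "I \<in> Mx ==> finite I" by (auto simp: Mx_def)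

lemma finite_K: "I \<in> K ==> finite I" unfolding K_def using finite_Mx finite_subset by blast

lemma K_Int: "I \<in> K ==> I Int J \<in> K" using K_subset by blast

subsection \<open>Integral linear algebra\<close>

lemma pr_unique: assumes "I \<in> Mx" "\<forall>i\<in>I. pr m i = pr m' i" shows "m = m'"
 using assms unfolding Mx_def
 by (elim insertE emptyE) (simp_all add: pr_def vec_eq_iff forall_3)

text \<open>Each witness is the integral inverse of a unimodular matrix applied to
  \<open>d\<close>.\<close>

lemma pr_solve:
 assumes "I \<in> Mx" "I ~= {1, 3, 6}" shows "\<exists>m. \<forall>i\<in>I. pr m i = d i"
proof -
 consider "I = {2, 4, 5}" | "I = {2, 3, 5}" | "I = {1, 4, 5}" | "I = {1, 3, 5}"
  | "I = {2, 4, 6}" | "I = {2, 3, 6}" | "I = {1, 4, 6}" using assms unfolding Mx_def by fast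
 then show ?thesis
 proof cases
  case 1 show ?thesis unfolding 1 by (rule exI[of _ "vector [- d 2 - d 5, d 2, - d 2 - d 4]"]) (simp add: pr_def)
 next
  case 2 show ?thesis unfolding 2 by (rule exI[of _ "vector [- d 2 - d 5, d 2, d 3]"]) (simp add: pr_def)
 next
  case 3 show ?thesis unfolding 3 by (rule exI[of _ "vector [d 1, - d 1 - d 5, d 1 + d 5 - d 4]"]) (simp add: pr_def)
 next
  case 4 show ?thesis unfolding 4 by (rule exI[of _ "vector [d 1, - d 1 - d 5, d 3]"]) (simp add: pr_def)
 next
  case 5 show ?thesis unfolding 5 by (rule exI[of _ "vector [d 6 - d 2 + 2 * d 4, d 2, - d 2 - d 4]"]) (simp add: pr_def)
 next
  case 6 show ?thesis unfolding 6 by (rule exI[of _ "vector [d 6 - 3 * d 2 - 2 * d 3, d 2, d 3]"]) (simp add: pr_def)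
 next
  case 7 show ?thesis unfolding 7 by (rule exI[of _ "vector [d 1, d 6 - d 1 + 2 * d 4, d 1 - d 6 - 3 * d 4]"]) (simp add: pr_def)
 qed
qed

text \<open>The index 3 of the singular cone serves for all cones. This yields Cartier multiples,
  and also integral functionals with prescribed signs on the rays of any cone.\<close>

lemma pr_solve3:
 assumes "I \<in> Mx" shows "\<exists>m. \<forall>i\<in>I. pr m i = 3 * d i"
proof (cases "I = {1, 3, 6}")
 case True
 show ?thesis unfolding True
  by (rule exI[of _ "vector [3 * d 1, d 6 - d 1 - 2 * d 3, 3 * d 3]"]) (simp add: pr_def)
next
 case False
 show ?thesis using pr_solve[OF assms False, of "%i. 3 * d i"] by simp
qed

text \<open>A character that separates two cones and vanishes, among their rays, precisely on the
  common ones. It proves the intersection axiom of a fan, and inverting it on one chart gives the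
  overlap with the other.\<close>

definition sep :: "mvec => nat set => nat set => bool" where
 "sep m I J \<longleftrightarrow> (\<forall>i\<in>I. if i \<in> J then pr m i = 0 else pr m i > 0) & (\<forall>j\<in>J. j ~: I --> pr m j < 0)"

text \<open>One certificate for each of the 28 pairs of maximal cones; the reversed pairs follow by
  negation.\<close>

lemma sep_table:
 "sep (vector [0, 0, -1]) {2, 4, 5} {2, 3, 5}"
 "sep (vector [-1, 1, -1]) {2, 4, 5} {1, 4, 5}"
 "sep (vector [-1, 1, -2]) {2, 4, 5} {1, 3, 5}"
 "sep (vector [-1, 0, 0]) {2, 4, 5} {2, 4, 6}"
 "sep (vector [-1, 0, -1]) {2, 4, 5} {2, 3, 6}"
 "sep (vector [-2, 1, -1]) {2, 4, 5} {1, 4, 6}"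
 "sep (vector [-2, 1, -2]) {2, 4, 5} {1, 3, 6}"
 "sep (vector [-1, 1, 1]) {2, 3, 5} {1, 4, 5}"
 "sep (vector [-1, 1, 0]) {2, 3, 5} {1, 3, 5}"
 "sep (vector [-3, 0, 1]) {2, 3, 5} {2, 4, 6}"
 "sep (vector [-1, 0, 0]) {2, 3, 5} {2, 3, 6}"
 "sep (vector [-6, 1, 1]) {2, 3, 5} {1, 4, 6}"
 "sep (vector [-4, 1, 0]) {2, 3, 5} {1, 3, 6}"
 "sep (vector [0, 0, -1]) {1, 4, 5} {1, 3, 5}"
 "sep (vector [1, -2, 2]) {1, 4, 5} {2, 4, 6}"
 "sep (vector [1, -2, -1]) {1, 4, 5} {2, 3, 6}"
 "sep (vector [0, -1, 1]) {1, 4, 5} {1, 4, 6}"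
 "sep (vector [0, -1, -1]) {1, 4, 5} {1, 3, 6}"
 "sep (vector [1, -4, 5]) {1, 3, 5} {2, 4, 6}"
 "sep (vector [1, -2, 0]) {1, 3, 5} {2, 3, 6}"
 "sep (vector [0, -3, 4]) {1, 3, 5} {1, 4, 6}"
 "sep (vector [0, -1, 0]) {1, 3, 5} {1, 3, 6}"
 "sep (vector [2, 0, -1]) {2, 4, 6} {2, 3, 6}"
 "sep (vector [-1, 1, -1]) {2, 4, 6} {1, 4, 6}"
 "sep (vector [-1, 3, -4]) {2, 4, 6} {1, 3, 6}"
 "sep (vector [-5, 1, 1]) {2, 3, 6} {1, 4, 6}"
 "sep (vector [-3, 1, 0]) {2, 3, 6} {1, 3, 6}"
 "sep (vector [0, 2, -3]) {1, 4, 6} {1, 3, 6}"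
 by (simp_all add: sep_def pr_def)

lemma sepD:
 assumes "sep m I J"
 shows "i \<in> I ==> i \<in> J ==> pr m i = 0" "i \<in> I ==> i ~: J ==> pr m i > 0" "i \<in> J ==> i ~: I ==> pr m i < 0"
  "i \<in> I ==> pr m i >= 0" "i \<in> J ==> pr m i <= 0"
proof -
 have 1: "\<forall>i\<in>I. if i \<in> J then pr m i = 0 else pr m i > 0" and 2: "\<forall>j\<in>J. j ~: I --> pr m j < 0"
  using assms by (simp_all add: sep_def)
 show a: "i \<in> I ==> i \<in> J ==> pr m i = 0" and b: "i \<in> I ==> i ~: J ==> pr m i > 0"
  using bspec[OF 1, of i] by simp_all
 show c: "i \<in> J ==> i ~: I ==> pr m i < 0" using bspec[OF 2, of i] by simp
 show "i \<in> I ==> pr m i >= 0" using a b by (cases "i \<in> J") auto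
 show "i \<in> J ==> pr m i <= 0" using a c by (cases "i \<in> I") auto
qed

lemma sep_sym: "sep m I J ==> sep (- m) J I"
 by (auto simp: sep_def split: if_splits)

lemma sep_refl: "sep 0 I I" by (simp add: sep_def)

lemma sep_exists_Mx: "I \<in> Mx ==> J \<in> Mx ==> \<exists>m. sep m I J"
 unfolding Mx_def
 by (elim insertE emptyE; simp only:;
   (rule exI, rule sep_table | rule exI, rule sep_refl | rule exI, rule sep_sym, rule sep_table))

text \<open>A separator of the maximal cones vanishes on all their common rays; \<open>n\<close>
  corrects the signs at those rays that belong to one of the two faces only. Off \<open>I'\<close>
  the values of \<open>n\<close> are uncontrolled, and the multiple \<open>N\<close> of
  \<open>m\<close> outweighs them.\<close>

lemma sep_exists:
 assumes "I \<in> K" "J \<in> K" shows "\<exists>m. sep m I J"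
proof -
 obtain I' J' where IJ: "I \<subseteq> I'" "J \<subseteq> J'" "I' \<in> Mx" "J' \<in> Mx" using assms by (auto simp: K_def)
 obtain m where m: "sep m I' J'" using sep_exists_Mx IJ by blast
 obtain n where n: "\<forall>i\<in>I'. pr n i = 3 * (if i \<in> I & i ~: J then 1 else if i \<in> J & i ~: I then -1 else 0)"
  using pr_solve3[OF IJ(3), of "%i. (if i \<in> I & i ~: J then 1 else if i \<in> J & i ~: I then -1 else 0)"] by blast
 define N where "N = 1 + (\<Sum>j\<in>J'. \<bar>pr n j\<bar>)"
 have N: "\<bar>pr n j\<bar> < N" "0 < N" if "j \<in> J'" for j
  using member_le_sum[OF that, of "%j. \<bar>pr n j\<bar>"] finite_Mx[OF IJ(4)]
  by (auto simp: N_def add_strict_increasing sum_nonneg)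
 have N0: "0 < N" by (simp add: N_def add_pos_nonneg sum_nonneg)
 note m = sepD[OF m]
 have "sep (N *s m + n) I J"
  unfolding sep_def
 proof (intro conjI ballI impI)
  fix i assume i: "i \<in> I"
  then have i': "i \<in> I'" using IJ by blast
  then have ni: "pr n i = 3 * (if i \<in> I & i ~: J then 1 else if i \<in> J & i ~: I then -1 else 0)" using n by blast
  show "if i \<in> J then pr (N *s m + n) i = 0 else pr (N *s m + n) i > 0"
  proof (cases "i \<in> J")
   case True
   then have "i \<in> J'" using IJ by blast
   then have "pr m i = 0" using m(1) i' by blast
   then show ?thesis using True i ni by simp
  next
   case False
   have "N * pr m i >= 0" using m(4)[OF i'] N0 by simp
   then show ?thesis using False i ni by simp
  qed
 next
  fix j assume j: "j \<in> J" "j ~: I"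
  then have j': "j \<in> J'" using IJ by blast
  show "pr (N *s m + n) j < 0"
  proof (cases "j \<in> I'")
   case True
   then have "pr n j = 3 * (if j \<in> I & j ~: J then 1 else if j \<in> J & j ~: I then -1 else 0)" using n by blast
   then show ?thesis using m(1)[OF True j'] j by simp
  next
   case False
   have "N * pr m j <= N * (-1)" using m(3)[OF j' False] N0 by (intro mult_left_mono) auto
   then show ?thesis using N(1)[OF j'] by simp
  qed
 qed
 then show ?thesis ..
qed

subsection \<open>The cones\<close>

lemma cn_iff: assumes "finite I"
 shows "x \<in> cn I \<longleftrightarrow> (\<exists>c. (\<forall>i\<in>I. c i >= 0) & x = (\<Sum>i\<in>I. c i *\<^sub>R lat (vv i)))"
proof -
 let ?S = "{\<Sum>i\<in>I. c i *\<^sub>R lat (vv i) | c. \<forall>i\<in>I. c i >= (0::real)}"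
 have "cn I = ?S" unfolding cn_def
 proof (rule hull_unique)
  show "lat ` vv ` I \<subseteq> ?S"
  proof clarify
   fix i assume "i \<in> I"
   have "(\<Sum>j\<in>I. (if j = i then 1 else 0) *\<^sub>R lat (vv j)) = (\<Sum>j\<in>I. if j = i then lat (vv j) else 0)"
    by (intro sum.cong) auto
   also have "... = lat (vv i)" using `i \<in> I` assms by simp
   finally show "\<exists>c. lat (vv i) = (\<Sum>i\<in>I. c i *\<^sub>R lat (vv i)) & (\<forall>i\<in>I. c i >= (0::real))"
    by (intro exI[of _ "%j. if j = i then 1 else 0"]) simp
  qed
  show "convex_cone ?S"
   unfolding convex_cone_iff
  proof (intro conjI ballI allI impI)
   show "0 \<in> ?S" by (rule CollectI, rule exI[of _ "%_. 0"]) simp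
  next
   fix x y assume "x \<in> ?S" "y \<in> ?S"
   then obtain c d where "x = (\<Sum>i\<in>I. c i *\<^sub>R lat (vv i))" "\<forall>i\<in>I. c i >= (0::real)"
    "y = (\<Sum>i\<in>I. d i *\<^sub>R lat (vv i))" "\<forall>i\<in>I. d i >= (0::real)" by blast
   then show "x + y \<in> ?S"
    by (intro CollectI exI[of _ "%i. c i + d i"]) (simp add: scaleR_add_left sum.distrib)
  next
   fix x and k :: real assume "x \<in> ?S" and k: "0 <= k"
   then obtain c where "x = (\<Sum>i\<in>I. c i *\<^sub>R lat (vv i))" "\<forall>i\<in>I. c i >= (0::real)" by blast
   then show "k *\<^sub>R x \<in> ?S" using k
    by (intro CollectI exI[of _ "%i. k * c i"]) (simp add: scaleR_sum_right)
  qed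
  fix T assume T: "lat ` vv ` I \<subseteq> T" "convex_cone T"
  show "?S \<subseteq> T"
  proof clarify
   fix c assume c: "\<forall>i\<in>I. c i >= (0::real)"
   have "J \<subseteq> I ==> (\<Sum>i\<in>J. c i *\<^sub>R lat (vv i)) \<in> T" if "finite J" for J using that
   proof (induct J rule: finite_induct)
    case empty then show ?case using convex_cone_contains_0[OF T(2)] by simp
   next
    case (insert i J)
    then have "c i *\<^sub>R lat (vv i) \<in> T" using T(1) c insert.prems convex_cone_scaleR[OF T(2)] by blast
    then show ?case using insert convex_cone_add[OF T(2)] by simp
   qed
   then show "(\<Sum>i\<in>I. c i *\<^sub>R lat (vv i)) \<in> T" using assms by blast
  qed
 qed
 then show ?thesis by blast
qed

lemma inner_comb: "lat m \<bullet> (\<Sum>i\<in>I. c i *\<^sub>R lat (vv i)) = (\<Sum>i\<in>I. c i * real_of_int (pr m i))"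
 by (simp add: inner_sum_right lat_inner)

lemma vv_in_cn: "i \<in> I ==> lat (vv i) \<in> cn I"
 unfolding cn_def by (rule hull_inc) blast

lemma dual_semigroup_cn: assumes "finite I" shows "dual_semigroup (cn I) = {m. \<forall>i\<in>I. pr m i >= 0}"
proof -
 have "(\<forall>u\<in>cn I. lat m \<bullet> u >= 0) \<longleftrightarrow> (\<forall>i\<in>I. pr m i >= 0)" for m
 proof
  assume "\<forall>u\<in>cn I. lat m \<bullet> u >= 0"
  then have "lat m \<bullet> lat (vv i) >= 0" if "i \<in> I" for i using vv_in_cn[OF that] by blast
  then show "\<forall>i\<in>I. pr m i >= 0" by (simp add: lat_inner)
 next
  assume m: "\<forall>i\<in>I. pr m i >= 0"
  show "\<forall>u\<in>cn I. lat m \<bullet> u >= 0"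
  proof
   fix u assume "u \<in> cn I"
   then obtain c where c: "\<forall>i\<in>I. c i >= 0" "u = (\<Sum>i\<in>I. c i *\<^sub>R lat (vv i))" using cn_iff[OF assms] by blast
   show "lat m \<bullet> u >= 0" unfolding c(2) inner_comb using m c(1) by (intro sum_nonneg mult_nonneg_nonneg) auto
  qed
 qed
 then show ?thesis unfolding dual_semigroup_def by (rule Collect_cong)
qed

lemma coeff_unique:
 assumes "I \<in> Mx" "(\<Sum>i\<in>I. c i *\<^sub>R lat (vv i)) = (\<Sum>i\<in>I. d i *\<^sub>R lat (vv i))" "i \<in> I" shows "c i = d i"
proof -
 obtain m where m: "\<forall>j\<in>I. pr m j = 3 * (if j = i then 1 else 0)" using pr_solve3[OF assms(1), of "%j. (if j = i then 1 else 0)"] by blast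
 have s: "(\<Sum>j\<in>I. c j * real_of_int (pr m j)) = 3 * c i" for c
 proof -
  have "(\<Sum>j\<in>I. c j * real_of_int (pr m j)) = (\<Sum>j\<in>I. if j = i then 3 * c i else 0)"
   using m by (intro sum.cong) auto
  also have "... = 3 * c i" using assms(3) finite_Mx[OF assms(1)] by simp
  finally show ?thesis .
 qed
 have "(\<Sum>j\<in>I. c j * real_of_int (pr m j)) = (\<Sum>j\<in>I. d j * real_of_int (pr m j))"
  using arg_cong[OF assms(2), of "%u. lat m \<bullet> u"] by (simp only: inner_comb)
 then show ?thesis by (simp add: s)
qed

lemma cn_mono: "I \<subseteq> J ==> cn I \<subseteq> cn J" unfolding cn_def by (intro hull_mono image_mono)

lemma cn_restrict:
 assumes "finite I" "J \<subseteq> I" "\<forall>i\<in>I. c i >= 0" "!!i. i \<in> I ==> i ~: J ==> c i = 0"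
 shows "(\<Sum>i\<in>I. c i *\<^sub>R lat (vv i)) \<in> cn J"
proof -
 have "(\<Sum>i\<in>I. c i *\<^sub>R lat (vv i)) = (\<Sum>i\<in>J. c i *\<^sub>R lat (vv i))"
  using assms by (intro sum.mono_neutral_right) auto
 then show ?thesis using cn_iff[of J] assms finite_subset by blast
qed

lemma zero_terms:
 fixes f :: "nat => real"
 assumes "finite I" "!!i. i \<in> I ==> f i >= 0" "sum f I <= 0" "i \<in> I" shows "f i = 0"
proof -
 have "sum f I = 0" using sum_nonneg[of I f] assms(2,3) by (intro antisym) auto
 then show ?thesis using sum_nonneg_eq_0_iff[of I f] assms(1,2,4) by blast
qed

text \<open>Pairing a common point with the separator gives a sum of nonnegative terms that is at
  most 0, so the coefficients off the common rays vanish.\<close>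

lemma cn_Int: assumes "I \<in> K" "J \<in> K" shows "cn I Int cn J = cn (I Int J)"
proof
 show "cn (I Int J) \<subseteq> cn I Int cn J" using cn_mono by blast
 obtain m where m: "sep m I J" using sep_exists[OF assms] by blast
 note fin = finite_K[OF assms(1)] finite_K[OF assms(2)]
 show "cn I Int cn J \<subseteq> cn (I Int J)"
 proof
  fix x assume "x \<in> cn I Int cn J"
  then have x: "x \<in> cn I" "x \<in> cn J" by auto
  obtain c where c: "\<forall>i\<in>I. c i >= 0" "x = (\<Sum>i\<in>I. c i *\<^sub>R lat (vv i))" using x(1) cn_iff[OF fin(1)] by blast
  obtain d where d: "\<forall>i\<in>J. d i >= 0" "x = (\<Sum>i\<in>J. d i *\<^sub>R lat (vv i))" using x(2) cn_iff[OF fin(2)] by blast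
  note pi = sepD(4)[OF m] and pj = sepD(5)[OF m]
  have eq: "(\<Sum>i\<in>I. c i * real_of_int (pr m i)) = (\<Sum>i\<in>J. d i * real_of_int (pr m i))"
   unfolding inner_comb[symmetric] c(2)[symmetric] d(2)[symmetric] ..
  have "(\<Sum>i\<in>J. d i * real_of_int (pr m i)) <= 0"
   using d(1) pj by (intro sum_nonpos mult_nonneg_nonpos) auto
  then have le: "(\<Sum>i\<in>I. c i * real_of_int (pr m i)) <= 0" using eq by simp
  have z: "c i * real_of_int (pr m i) = 0" if "i \<in> I" for i
   by (rule zero_terms[OF fin(1) _ le that]) (use c(1) pi in auto)
  have "c i = 0" if "i \<in> I" "i ~: I Int J" for i
  proof -
   have "pr m i > 0" using sepD(2)[OF m] that by blast
   then show ?thesis using z[OF that(1)] by simp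
  qed
  then show "x \<in> cn (I Int J)" unfolding c(2) by (intro cn_restrict[OF fin(1) _ c(1)]) auto
 qed
qed

lemma cn_face: assumes "J \<in> Mx" "I \<subseteq> J" shows "cone_face (cn I) (cn J)"
 unfolding cone_face_def
proof
 show "cn I ~= {}" unfolding cn_def by (rule convex_cone_hull_nonempty)
 obtain m where m: "\<forall>i\<in>J. pr m i = 3 * (if i \<in> I then 0 else 1)" using pr_solve3[OF assms(1), of "%i. (if i \<in> I then 0 else 1)"] by blast
 have fin: "finite J" using finite_Mx assms by blast
 have "cn I = cn J Int {x. lat m \<bullet> x = 0}"
 proof
  show "cn I \<subseteq> cn J Int {x. lat m \<bullet> x = 0}"
  proof
   fix x assume x: "x \<in> cn I"
   then obtain c where c: "x = (\<Sum>i\<in>I. c i *\<^sub>R lat (vv i))" using cn_iff[of I] fin assms(2) finite_subset by blast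
   have "lat m \<bullet> x = 0" unfolding c inner_comb using m assms(2) by (intro sum.neutral) auto
   then show "x \<in> cn J Int {x. lat m \<bullet> x = 0}" using x cn_mono[OF assms(2)] by blast
  qed
  show "cn J Int {x. lat m \<bullet> x = 0} \<subseteq> cn I"
  proof
   fix x assume x: "x \<in> cn J Int {x. lat m \<bullet> x = 0}"
   then obtain c where c: "\<forall>i\<in>J. c i >= 0" "x = (\<Sum>i\<in>J. c i *\<^sub>R lat (vv i))" using cn_iff[OF fin] by blast
   have le: "(\<Sum>i\<in>J. c i * real_of_int (pr m i)) <= 0" using x unfolding c(2) by (simp add: inner_comb)
   have z: "c i * real_of_int (pr m i) = 0" if "i \<in> J" for i
    by (rule zero_terms[OF fin _ le that]) (use c(1) m in auto)
   have "c i = 0" if "i \<in> J" "i ~: I" for i using z[OF that(1)] m that by auto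
   then show "x \<in> cn I" unfolding c(2) by (intro cn_restrict[OF fin assms(2) c(1)]) auto
  qed
 qed
 also have "... face_of cn J"
 proof (rule face_of_Int_supporting_hyperplane_ge)
  show "convex (cn J)" unfolding cn_def by (rule convex_convex_cone_hull)
  fix x assume "x \<in> cn J"
  then obtain c where c: "\<forall>i\<in>J. c i >= 0" "x = (\<Sum>i\<in>J. c i *\<^sub>R lat (vv i))" using cn_iff[OF fin] by blast
  show "lat m \<bullet> x >= 0" unfolding c(2) inner_comb using c(1) m by (intro sum_nonneg) auto
 qed
 finally show "cn I face_of cn J" .
qed

lemma face_cn: assumes "J \<in> Mx" "cone_face \<tau> (cn J)" shows "\<exists>I\<subseteq>J. \<tau> = cn I"
proof -
 have f: "\<tau> face_of cn J" "\<tau> ~= {}" using assms(2) by (auto simp: cone_face_def)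
 have fin: "finite J" using finite_Mx assms by blast
 have con: "conic \<tau>" by (rule face_of_conic[OF _ f(1)]) (simp add: cn_def conic_convex_cone_hull)
 have "convex_cone \<tau>" using con face_of_imp_convex[OF f(1)] f(2) by (simp add: convex_cone_def)
 define I where "I = {i\<in>J. lat (vv i) \<in> \<tau>}"
 have "cn I \<subseteq> \<tau>" unfolding cn_def by (rule hull_minimal) (use `convex_cone \<tau>` in \<open>auto simp: I_def\<close>)
 moreover have "\<tau> \<subseteq> cn I"
 proof
  fix x assume x: "x \<in> \<tau>"
  then have "x \<in> cn J" using face_of_imp_subset[OF f(1)] by blast
  then obtain c where c: "\<forall>i\<in>J. c i >= 0" "x = (\<Sum>i\<in>J. c i *\<^sub>R lat (vv i))" using cn_iff[OF fin] by blast
  have "c i = 0" if i: "i \<in> J" "i ~: I" for i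
  proof (rule ccontr)
   assume "c i ~= 0"
   then have ci: "c i > 0" using c(1) i by force
   \<comment> \<open>\<open>x\<close> is the midpoint of \<open>a\<close>, its doubled
     \<open>i\<close>-th component, and \<open>b\<close>, the doubled rest; the face property puts
     \<open>a\<close>, and hence the ray, into the face.\<close>
   define a where "a = (2 * c i) *\<^sub>R lat (vv i)"
   define b where "b = 2 *\<^sub>R (\<Sum>j\<in>J - {i}. c j *\<^sub>R lat (vv j))"
   have aJ: "a \<in> cn J" unfolding a_def cn_def using ci vv_in_cn[OF i(1)] by (intro convex_cone_hull_mul) (auto simp: cn_def)
   have "(\<Sum>j\<in>J - {i}. c j *\<^sub>R lat (vv j)) \<in> cn (J - {i})" using cn_iff[of "J - {i}"] c(1) fin by auto
   then have "(\<Sum>j\<in>J - {i}. c j *\<^sub>R lat (vv j)) \<in> cn J" using cn_mono[of "J - {i}" J] by blast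
   then have bJ: "b \<in> cn J" unfolding b_def cn_def by (intro convex_cone_hull_mul) auto
   have xab: "x = (1/2) *\<^sub>R a + (1/2) *\<^sub>R b"
    unfolding c(2) a_def b_def using sum.remove[OF fin i(1), of "%i. c i *\<^sub>R lat (vv i)"] by simp
   have "a \<in> \<tau>"
   proof (cases "a = b")
    case True
    then have "x = a" using xab by (simp flip: scaleR_add_left)
    then show ?thesis using x by simp
   next
    case False
    have "x \<in> open_segment a b" using False xab
     by (auto simp: in_segment intro!: exI[of _ "1/2"])
    then show ?thesis using f(1) aJ bJ x unfolding face_of_def by blast
   qed
   then have "(1 / (2 * c i)) *\<^sub>R a \<in> \<tau>" using con ci by (intro conicD) auto
   then have "lat (vv i) \<in> \<tau>" using ci by (simp add: a_def)
   then show False using i by (simp add: I_def)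
  qed
  then show "x \<in> cn I" unfolding c(2) by (intro cn_restrict[OF fin _ c(1)]) (auto simp: I_def)
 qed
 ultimately show ?thesis by (intro exI[of _ I]) (auto simp: I_def)
qed

lemma column_V_mat:
 "column 1 V_mat = vv 1" "column 2 V_mat = vv 2" "column 3 V_mat = vv 3"
 "column 4 V_mat = vv 4" "column 5 V_mat = vv 5" "column 6 V_mat = vv 6"
 by (simp_all add: column_def V_mat_def vv_def vec_eq_iff forall_3 vector_3) (simp_all add: vector_def)

lemma example_fan_eq: "example_fan = cn ` K"
proof -
 have m: "{cone3 2 4 5, cone3 2 3 5, cone3 1 4 5, cone3 1 3 5, cone3 2 4 6, cone3 2 3 6, cone3 1 4 6, cone3 1 3 6} = cn ` Mx"
  by (simp add: Mx_def cone3_def cn_def column_V_mat)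
 show ?thesis unfolding example_fan_def m
 proof (intro equalityI subsetI)
  fix \<tau> assume "\<tau> \<in> {\<tau>. \<exists>\<sigma>\<in>cn ` Mx. cone_face \<tau> \<sigma>}"
  then obtain J where "J \<in> Mx" "cone_face \<tau> (cn J)" by blast
  then obtain I where "I \<subseteq> J" "\<tau> = cn I" using face_cn by blast
  then show "\<tau> \<in> cn ` K" using `J \<in> Mx` by (auto simp: K_def)
 next
  fix \<tau> assume "\<tau> \<in> cn ` K"
  then obtain I J where "\<tau> = cn I" "I \<subseteq> J" "J \<in> Mx" by (auto simp: K_def)
  then show "\<tau> \<in> {\<tau>. \<exists>\<sigma>\<in>cn ` Mx. cone_face \<tau> \<sigma>}" using cn_face by blast
 qed
qed

lemma cn_inj: assumes "I \<in> K" "J \<in> K" "cn I = cn J" shows "I = J"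
proof -
 have "I \<subseteq> J" if IJ: "I \<in> K" "J \<in> K" "cn I \<subseteq> cn J" for I J
 proof
  fix i assume i: "i \<in> I"
  obtain m where m: "sep m I J" using sep_exists[OF IJ(1,2)] by blast
  have "lat (vv i) \<in> cn J" using vv_in_cn[OF i] IJ(3) by blast
  then obtain c where c: "\<forall>i\<in>J. c i >= 0" "lat (vv i) = (\<Sum>i\<in>J. c i *\<^sub>R lat (vv i))"
   using cn_iff[OF finite_K[OF IJ(2)]] by blast
  note pj = sepD(5)[OF m]
  have "real_of_int (pr m i) = lat m \<bullet> (\<Sum>i\<in>J. c i *\<^sub>R lat (vv i))" unfolding c(2)[symmetric] by (simp add: lat_inner)
  also have "... <= 0" unfolding inner_comb using c(1) pj by (intro sum_nonpos mult_nonneg_nonpos) auto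
  finally have "~ pr m i > 0" by simp
  then show "i \<in> J" using sepD(2)[OF m i] by blast
 qed
 from this[OF assms(1,2)] this[OF assms(2,1)] assms(3) show ?thesis by blast
qed

lemma cn_face_K: assumes "J \<in> K" "I \<subseteq> J" shows "cone_face (cn I) (cn J)"
proof -
 obtain J' where J: "J \<subseteq> J'" "J' \<in> Mx" using assms by (auto simp: K_def)
 have "cn I face_of cn J'" using cn_face[of J' I] J assms by (auto simp: cone_face_def)
 then have "cn I face_of cn J" using cn_mono assms J by (meson face_of_subset)
 then show ?thesis by (simp add: cone_face_def cn_def convex_cone_hull_nonempty)
qed

lemma rational_example_fan: "rational_fan example_fan"
 unfolding rational_fan_def
proof (intro conjI ballI allI impI)
 have "K \<subseteq> Pow {1..6}" by (auto simp: K_def Mx_def)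
 then show "finite example_fan" unfolding example_fan_eq using finite_subset by fastforce
 have "{} \<in> K" by (auto simp: K_def Mx_def)
 then show "example_fan ~= {}" unfolding example_fan_eq by blast
next
 fix \<sigma> assume "\<sigma> \<in> example_fan"
 then obtain I where I: "\<sigma> = cn I" "I \<in> K" unfolding example_fan_eq by blast
 show "rational_polyhedral \<sigma>" unfolding rational_polyhedral_def I cn_def
  by (intro exI[of _ "vv ` I"]) (simp add: finite_K[OF I(2)])
 show "strongly_convex \<sigma>"
 proof -
  obtain J where J: "I \<subseteq> J" "J \<in> Mx" using I by (auto simp: K_def)
  obtain m where m: "\<forall>i\<in>J. pr m i = 3 * 1" using pr_solve3[OF J(2), of "%_. 1"] by blast
  have fin: "finite I" using I finite_K by blast
  have "x = 0" if x: "x \<in> cn I" "- x \<in> cn I" for x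
  proof -
   obtain c where c: "\<forall>i\<in>I. c i >= 0" "x = (\<Sum>i\<in>I. c i *\<^sub>R lat (vv i))" using x(1) cn_iff[OF fin] by blast
   obtain d where d: "\<forall>i\<in>I. d i >= 0" "- x = (\<Sum>i\<in>I. d i *\<^sub>R lat (vv i))" using x(2) cn_iff[OF fin] by blast
   have "lat m \<bullet> (- x) >= 0" unfolding d(2) inner_comb using d(1) m J by (intro sum_nonneg) auto
   then have le: "(\<Sum>i\<in>I. c i * real_of_int (pr m i)) <= 0" unfolding inner_comb[symmetric] c(2)[symmetric] by simp
   have z: "c i * real_of_int (pr m i) = 0" if "i \<in> I" for i
    by (rule zero_terms[OF fin _ le that]) (use c(1) m J in auto)
   have "c i = 0" if "i \<in> I" for i using z[OF that] m J that by auto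
   then show ?thesis unfolding c(2) by simp
  qed
  moreover have "0 \<in> cn I" by (simp add: cn_def convex_cone_hull_contains_0)
  ultimately show ?thesis unfolding strongly_convex_def I(1) by force
 qed
next
 fix \<sigma> \<tau> assume "\<sigma> \<in> example_fan" and t: "cone_face \<tau> \<sigma>"
 then obtain I where I: "\<sigma> = cn I" "I \<in> K" unfolding example_fan_eq by blast
 then obtain J where J: "I \<subseteq> J" "J \<in> Mx" by (auto simp: K_def)
 have "cone_face \<tau> (cn J)" using t cn_face[OF J(2,1)] face_of_trans unfolding I cone_face_def by blast
 then show "\<tau> \<in> example_fan" using face_cn[OF J(2)] J(2) unfolding example_fan_eq K_def by blast
next
 fix \<sigma> \<tau> assume "\<sigma> \<in> example_fan" "\<tau> \<in> example_fan"
 then obtain I J where IJ: "\<sigma> = cn I" "I \<in> K" "\<tau> = cn J" "J \<in> K" unfolding example_fan_eq by blast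
 show "cone_face (\<sigma> Int \<tau>) \<sigma>" "cone_face (\<sigma> Int \<tau>) \<tau>"
  unfolding IJ cn_Int[OF IJ(2,4)] using cn_face_K IJ by auto
qed

lemma simplicial_example_fan: "simplicial_fan example_fan"
 unfolding simplicial_fan_def
proof
 fix \<sigma> assume "\<sigma> \<in> example_fan"
 then obtain I where I: "\<sigma> = cn I" "I \<in> K" unfolding example_fan_eq by blast
 then obtain J where J: "I \<subseteq> J" "J \<in> Mx" by (auto simp: K_def)
 have inj: "inj_on (%i. lat (vv i)) J"
 proof (rule inj_onI)
  fix i j assume ij: "i \<in> J" "j \<in> J" "lat (vv i) = lat (vv j)"
  obtain m where m: "\<forall>k\<in>J. pr m k = 3 * (if k = i then 1 else 0)" using pr_solve3[OF J(2), of "%k. (if k = i then 1 else 0)"] by blast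
  have "real_of_int (pr m i) = real_of_int (pr m j)" unfolding lat_inner[symmetric] ij(3) ..
  then show "i = j" using m ij by (auto split: if_splits)
 qed
 have "independent (lat ` vv ` J)"
 proof (rule independent_if_scalars_zero)
  show "finite (lat ` vv ` J)" using finite_Mx[OF J(2)] by simp
  fix f x assume s: "(\<Sum>x\<in>lat ` vv ` J. f x *\<^sub>R x) = 0" and x: "x \<in> lat ` vv ` J"
  then obtain i where i: "i \<in> J" "x = lat (vv i)" by blast
  have "(\<Sum>x\<in>lat ` vv ` J. f x *\<^sub>R x) = (\<Sum>i\<in>J. f (lat (vv i)) *\<^sub>R lat (vv i))"
   unfolding image_image by (rule sum.reindex_cong[OF inj refl]) simp
  then have "(\<Sum>i\<in>J. f (lat (vv i)) *\<^sub>R lat (vv i)) = (\<Sum>i\<in>J. 0 *\<^sub>R lat (vv i))" using s by simp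
  from coeff_unique[OF J(2) this i(1)] show "f x = 0" by (simp add: i(2))
 qed
 then have "independent (lat ` vv ` I)" by (rule independent_mono) (use J in blast)
 then show "\<exists>B. independent B & \<sigma> = convex_cone hull B" unfolding I cn_def by blast
qed

text \<open>For the point \<open>(a, b, c)\<close> each disjunct says that the coefficients with
  respect to one maximal cone are nonnegative, the cones being taken in the order of
  \<open>Mx\<close>.\<close>

lemma cone_cover:
 fixes a b c :: real
 shows "(a <= 0 & c <= 0 & b >= a + c) | (a <= 0 & c >= 0 & b >= a) | (c <= 0 & b <= c & a + c >= b) |
  (c >= 0 & b <= 0 & a >= b) | (a >= 0 & 2 * a >= c & b >= a + c) | (a >= 0 & c >= 2 * a & b >= 3 * a) |
  (b >= c & 2 * b >= 3 * c & a + c >= b) | (b >= 0 & 3 * c >= 2 * b & 3 * a >= b)"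
 by argo

lemma complete_example_fan: "complete_fan example_fan"
 unfolding complete_fan_def
proof (intro equalityI subset_UNIV subsetI)
 fix x :: "real ^ 3"
 define a b c where "a = x $ 1" and "b = x $ 2" and "c = x $ 3"
 have mem: "x \<in> \<Union> example_fan" if "J \<in> Mx" "!!i. i \<in> J ==> f i >= 0" "x = (\<Sum>i\<in>J. f i *\<^sub>R lat (vv i))" for J f
 proof -
  have "x \<in> cn J" using that cn_iff[OF finite_Mx[OF that(1)]] by blast
  then show ?thesis using MxK[OF that(1)] unfolding example_fan_eq by blast
 qed
 have abc: "x $ 1 = a" "x $ 2 = b" "x $ 3 = c" by (simp_all add: a_def b_def c_def)
 note s = vec_eq_iff forall_3 abc lat_def vv_def vector_3
 from cone_cover[of a c b] show "x \<in> \<Union> example_fan"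
 proof (elim disjE conjE)
  assume c: "a <= 0" "c <= 0" "b >= a + c"
  show ?thesis
   by (rule mem[of "{2, 4, 5}" "%i. if i = 2 then b - a - c else if i = 4 then - c else - a"])
    (use c in \<open>auto simp: Mx_def s\<close>)
 next
  assume c: "a <= 0" "c >= 0" "b >= a"
  show ?thesis
   by (rule mem[of "{2, 3, 5}" "%i. if i = 2 then b - a else if i = 3 then c else - a"])
    (use c in \<open>auto simp: Mx_def s\<close>)
 next
  assume c: "c <= 0" "b <= c" "a + c >= b"
  show ?thesis
   by (rule mem[of "{1, 4, 5}" "%i. if i = 1 then a + c - b else if i = 4 then - c else c - b"])
    (use c in \<open>auto simp: Mx_def s\<close>)
 next
  assume c: "c >= 0" "b <= 0" "a >= b"
  show ?thesis
   by (rule mem[of "{1, 3, 5}" "%i. if i = 1 then a - b else if i = 3 then c else - b"])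
    (use c in \<open>auto simp: Mx_def s\<close>)
 next
  assume c: "a >= 0" "2 * a >= c" "b >= a + c"
  show ?thesis
   by (rule mem[of "{2, 4, 6}" "%i. if i = 2 then b - a - c else if i = 4 then 2 * a - c else a"])
    (use c in \<open>auto simp: Mx_def s\<close>)
 next
  assume c: "a >= 0" "c >= 2 * a" "b >= 3 * a"
  show ?thesis
   by (rule mem[of "{2, 3, 6}" "%i. if i = 2 then b - 3 * a else if i = 3 then c - 2 * a else a"])
    (use c in \<open>auto simp: Mx_def s\<close>)
 next
  assume c: "b >= c" "2 * b >= 3 * c" "a + c >= b"
  show ?thesis
   by (rule mem[of "{1, 4, 6}" "%i. if i = 1 then a + c - b else if i = 4 then 2 * b - 3 * c else b - c"])
    (use c in \<open>auto simp: Mx_def s\<close>)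
 next
  assume c: "b >= 0" "3 * c >= 2 * b" "3 * a >= b"
  show ?thesis
   by (rule mem[of "{1, 3, 6}" "%i. if i = 1 then a - b / 3 else if i = 3 then c - 2 * b / 3 else b / 3"])
    (use c in \<open>auto simp: Mx_def s\<close>)
 qed
qed

section \<open>The toric variety\<close>

abbreviation XX :: "3 chart_point set fun_space" where "XX \<equiv> toric_variety example_fan"

definition SG :: "nat set => mvec set" where "SG I = {m. \<forall>i\<in>I. pr m i >= 0}"

abbreviation ch :: "nat set => (mvec => complex) set" where "ch I \<equiv> chart (cn I)"

abbreviation tp :: "nat set => (mvec => complex) => 3 chart_point set" where
 "tp I x \<equiv> toric_point example_fan (cn I) x"

lemma dual_SG: "I \<in> K ==> dual_semigroup (cn I) = SG I"
 by (simp add: dual_semigroup_cn finite_K SG_def)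

lemma SG_0 [simp]: "0 \<in> SG I" and SG_add: "m \<in> SG I ==> m' \<in> SG I ==> m + m' \<in> SG I"
 by (auto simp: SG_def)

lemma SG_mono: "I \<subseteq> J ==> SG J \<subseteq> SG I" by (auto simp: SG_def)

lemma SG_scale: "m \<in> SG I ==> of_nat k *s m \<in> SG I" by (auto simp: SG_def)

lemma ch_iff: "I \<in> K ==> x \<in> ch I \<longleftrightarrow> x 0 = 1 & (\<forall>m\<in>SG I. \<forall>m'\<in>SG I. x (m + m') = x m * x m') & (\<forall>m. m ~: SG I --> x m = 0)"
 by (simp add: chart_def dual_SG)

lemma ch_simps: assumes "I \<in> K" "x \<in> ch I"
 shows "x 0 = 1" "m \<in> SG I ==> m' \<in> SG I ==> x (m + m') = x m * x m'" "m ~: SG I ==> x m = 0"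
 using assms(2) unfolding ch_iff[OF assms(1)] by blast+

lemma scale_Suc: "of_nat (Suc k) *s m = m + of_nat k *s (m :: mvec)"
 by (simp add: vec_eq_iff algebra_simps)

lemma ch_scale: assumes "I \<in> K" "x \<in> ch I" "m \<in> SG I" shows "x (of_nat k *s m) = x m ^ k"
proof (induct k)
 case 0 then show ?case using ch_simps(1)[OF assms(1,2)] by simp
next
 case (Suc k)
 show ?case unfolding scale_Suc using Suc ch_simps(2)[OF assms(1,2,3) SG_scale[OF assms(3)]] by simp
qed

text \<open>A point of the chart of \<open>I\<close> is a homomorphism on \<open>SG I\<close>.  It extends uniquely to a
  multiplicative function on the localization of \<open>SG I\<close> at the elements with nonzero value, and two
  points of charts are glued iff these maximal extensions agree.\<close>

definition Edom :: "nat set => (mvec => complex) => mvec => mvec => bool" where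
 "Edom I x m m0 \<longleftrightarrow> m0 \<in> SG I & x m0 ~= 0 & m + m0 \<in> SG I"

definition Ext :: "nat set => (mvec => complex) => mvec => complex option" where
 "Ext I x m = (if \<exists>m0. Edom I x m m0 then Some (x (m + (SOME m0. Edom I x m m0)) / x (SOME m0. Edom I x m m0)) else None)"

text \<open>Any admissible denominator \<open>m0\<close> gives the same value, so the choice made in
  \<open>Ext\<close> is immaterial.\<close>

lemma Ext_eq: assumes I: "I \<in> K" "x \<in> ch I" and m0: "m0 \<in> SG I" "x m0 ~= 0" "m + m0 \<in> SG I"
 shows "Ext I x m = Some (x (m + m0) / x m0)"
proof -
 define m1 where "m1 = (SOME m0. Edom I x m m0)"
 have ex: "\<exists>m0. Edom I x m m0" using m0 unfolding Edom_def by blast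
 have "Edom I x m m1" unfolding m1_def by (rule someI_ex[OF ex])
 then have m1: "m1 \<in> SG I" "x m1 ~= 0" "m + m1 \<in> SG I" unfolding Edom_def by auto
 have "x (m + m1) * x m0 = x (m + m1 + m0)" by (rule ch_simps(2)[OF I m1(3) m0(1), symmetric])
 also have "... = x (m + m0 + m1)" by (simp add: ac_simps)
 also have "... = x (m + m0) * x m1" by (rule ch_simps(2)[OF I m0(3) m1(1)])
 finally have "x (m + m1) / x m1 = x (m + m0) / x m0" using m0 m1 by (simp add: field_simps)
 then show ?thesis using ex unfolding Ext_def m1_def[symmetric] by simp
qed

lemma Ext_SomeD: "Ext I x m = Some a ==> \<exists>m0. m0 \<in> SG I & x m0 ~= 0 & m + m0 \<in> SG I & a = x (m + m0) / x m0"
proof -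
 assume a: "Ext I x m = Some a"
 then have ex: "\<exists>m0. Edom I x m m0" unfolding Ext_def by (meson option.distinct(1))
 define m1 where "m1 = (SOME m0. Edom I x m m0)"
 have "Edom I x m m1" unfolding m1_def by (rule someI_ex[OF ex])
 moreover have "a = x (m + m1) / x m1" using a ex unfolding Ext_def m1_def[symmetric] by simp
 ultimately show ?thesis unfolding Edom_def by blast
qed

lemma Ext_SG: "I \<in> K ==> x \<in> ch I ==> m \<in> SG I ==> Ext I x m = Some (x m)"
 using Ext_eq[of I x 0 m] ch_simps(1)[of I x] by simp

lemma Ext_add: assumes I: "I \<in> K" "x \<in> ch I" and "Ext I x m = Some a" "Ext I x m' = Some b"
 shows "Ext I x (m + m') = Some (a * b)"
proof -
 obtain m0 where m0: "m0 \<in> SG I" "x m0 ~= 0" "m + m0 \<in> SG I" "a = x (m + m0) / x m0" using Ext_SomeD[OF assms(3)] by blast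
 obtain m1 where m1: "m1 \<in> SG I" "x m1 ~= 0" "m' + m1 \<in> SG I" "b = x (m' + m1) / x m1" using Ext_SomeD[OF assms(4)] by blast
 have e: "m + m' + (m0 + m1) = (m + m0) + (m' + m1)" by (simp add: ac_simps)
 have 1: "x (m0 + m1) = x m0 * x m1" by (rule ch_simps(2)[OF I m0(1) m1(1)])
 have 2: "x (m + m' + (m0 + m1)) = x (m + m0) * x (m' + m1)" unfolding e by (rule ch_simps(2)[OF I m0(3) m1(3)])
 have 3: "m + m' + (m0 + m1) \<in> SG I" unfolding e by (rule SG_add[OF m0(3) m1(3)])
 have 4: "x (m0 + m1) ~= 0" using 1 m0(2) m1(2) by simp
 have "Ext I x (m + m') = Some (x (m + m' + (m0 + m1)) / x (m0 + m1))"
  by (rule Ext_eq[OF I SG_add[OF m0(1) m1(1)] 4 3])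
 then show ?thesis unfolding 1 2 m0(4) m1(4) by simp
qed

lemma Ext_0: "I \<in> K ==> x \<in> ch I ==> Ext I x 0 = Some 1"
 using Ext_SG[of I x 0] ch_simps(1)[of I x] by simp

lemma sep_SG: assumes "sep m0 I J" shows "m0 \<in> SG I" "- m0 \<in> SG J" "m0 \<in> SG (I Int J)" "- m0 \<in> SG (I Int J)"
 using sepD[OF assms] by (auto simp: SG_def)

text \<open>The semigroup of the common face is the localization of \<open>SG I\<close> at
  \<open>m0\<close>. The exponent \<open>k\<close> is only bounded below, so that several
  \<open>m\<close> can be shifted at once.\<close>

lemma sep_shift:
 assumes "sep m0 I J" "m \<in> SG (I Int J)" "finite I" "(\<Sum>i\<in>I. nat \<bar>pr m i\<bar>) <= k"
 shows "m + of_nat k *s m0 \<in> SG I"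
 unfolding SG_def
proof (intro CollectI ballI)
 fix i assume i: "i \<in> I"
 show "pr (m + of_nat k *s m0) i >= 0"
 proof (cases "i \<in> J")
  case True
  then show ?thesis using assms(2) i sepD(1)[OF assms(1) i] by (simp add: SG_def)
 next
  case False
  have "nat \<bar>pr m i\<bar> <= k" using member_le_sum[OF i, of "%i. nat \<bar>pr m i\<bar>"] assms(3,4) by simp
  then have "- pr m i <= int k * 1" by linarith
  also have "... <= int k * pr m0 i" using sepD(2)[OF assms(1) i False] by (intro mult_left_mono) auto
  finally show ?thesis by simp
 qed
qed

text \<open>\<open>SG L\<close> arises from \<open>SG I\<close> by inverting a character
  \<open>m0\<close>, and \<open>z m0\<close> is nonzero because \<open>- m0\<close> lies in
  \<open>SG L\<close> too. Numerators and denominators from \<open>SG L\<close> are moved into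
  \<open>SG I\<close> by adding a multiple of \<open>m0\<close>.\<close>

lemma Ext_face:
 assumes I: "I \<in> K" "x \<in> ch I" and L: "L \<subseteq> I" "z \<in> ch L" and eq: "\<forall>m\<in>SG I. z m = x m"
 shows "Ext I x = Ext L z"
proof
 fix m
 have LK: "L \<in> K" using K_subset[OF I(1) L(1)] .
 obtain m0 where m0: "sep m0 I L" using sep_exists[OF I(1) LK] by blast
 have IL: "I Int L = L" using L by blast
 note s = sep_SG[OF m0, unfolded IL]
 have "z m0 * z (- m0) = z (m0 + - m0)" by (rule ch_simps(2)[OF LK L(2) s(3,4), symmetric])
 then have z0: "z m0 ~= 0" using ch_simps(1)[OF LK L(2)] by auto
 have sub: "SG I \<subseteq> SG L" by (rule SG_mono[OF L(1)])
 have up: "Ext L z m = Some a" if e: "Ext I x m = Some a" for a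
 proof -
  obtain m1 where m1: "m1 \<in> SG I" "x m1 ~= 0" "m + m1 \<in> SG I" "a = x (m + m1) / x m1" using Ext_SomeD[OF e] by blast
  then have "Ext L z m = Some (z (m + m1) / z m1)" by (intro Ext_eq[OF LK L(2)]) (use sub eq in auto)
  then show ?thesis using m1 eq by simp
 qed
 have down: "\<exists>a. Ext I x m = Some a" if e: "Ext L z m = Some a" for a
 proof -
  obtain m1 where m1: "m1 \<in> SG L" "z m1 ~= 0" "m + m1 \<in> SG L" using Ext_SomeD[OF e] by blast
  define k where "k = (\<Sum>i\<in>I. nat \<bar>pr m1 i\<bar>) + (\<Sum>i\<in>I. nat \<bar>pr (m + m1) i\<bar>)"
  have a: "m1 + of_nat k *s m0 \<in> SG I"
   by (rule sep_shift[OF m0]) (use m1 IL finite_K[OF I(1)] in \<open>auto simp: k_def\<close>)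
  have b: "m + m1 + of_nat k *s m0 \<in> SG I"
   by (rule sep_shift[OF m0]) (use m1 IL finite_K[OF I(1)] in \<open>auto simp: k_def\<close>)
  have "z (m1 + of_nat k *s m0) = z m1 * z m0 ^ k"
   using ch_simps(2)[OF LK L(2) m1(1) SG_scale[OF s(3)]] ch_scale[OF LK L(2) s(3)] by simp
  then have "x (m1 + of_nat k *s m0) ~= 0" using eq a m1(2) z0 by simp
  then show ?thesis using Ext_eq[OF I a] b by (simp add: add.assoc)
 qed
 show "Ext I x m = Ext L z m"
 proof (cases "Ext L z m")
  case None then show ?thesis using up by (cases "Ext I x m") auto
 next
  case (Some a)
  then obtain b where b: "Ext I x m = Some b" using down by blast
  then show ?thesis using up[OF b] by simp
 qed
qed

lemma Ext_restrict:
 assumes I: "I \<in> K" "x \<in> ch I" and def: "\<forall>m\<in>SG L. Ext I x m ~= None" and L: "L \<in> K"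
 shows "(%m. if m \<in> SG L then the (Ext I x m) else 0) \<in> ch L"
 unfolding ch_iff[OF L]
proof (intro conjI ballI allI impI)
 show "(if 0 \<in> SG L then the (Ext I x 0) else 0) = 1" using Ext_0[OF I] by simp
 fix m m' assume m: "m \<in> SG L" "m' \<in> SG L"
 have "Ext I x m ~= None" "Ext I x m' ~= None" using def m by blast+
 then obtain a b where "Ext I x m = Some a" "Ext I x m' = Some b" by blast
 then show "(if m + m' \<in> SG L then the (Ext I x (m + m')) else 0) =
  (if m \<in> SG L then the (Ext I x m) else 0) * (if m' \<in> SG L then the (Ext I x m') else 0)"
  using m Ext_add[OF I] SG_add by simp
qed simp

text \<open>An element of \<open>SG (I Int J)\<close> is the sum of an element of
  \<open>SG I\<close> and a multiple of \<open>- m0\<close>, which lies in \<open>SG J\<close>.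
  Hence the extension is defined on it and glues the two points along the common face.\<close>

lemma Ext_chart:
 assumes I: "I \<in> K" "x \<in> ch I" and J: "J \<in> K" and def: "\<forall>m\<in>SG J. Ext I x m ~= None"
 defines "y \<equiv> %m. if m \<in> SG J then the (Ext I x m) else 0"
  and "z \<equiv> %m. if m \<in> SG (I Int J) then the (Ext I x m) else 0"
 shows "y \<in> ch J" "Ext J y = Ext I x" "z \<in> ch (I Int J)" "\<forall>m\<in>SG I. z m = x m" "\<forall>m\<in>SG J. z m = y m"
proof -
 obtain m0 where m0: "sep m0 I J" using sep_exists[OF I(1) J] by blast
 note s = sep_SG[OF m0]
 have IJ: "I Int J \<in> K" by (rule K_Int[OF I(1)])
 have def': "\<forall>m\<in>SG (I Int J). Ext I x m ~= None"
 proof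
  fix m assume m: "m \<in> SG (I Int J)"
  define k where "k = (\<Sum>i\<in>I. nat \<bar>pr m i\<bar>)"
  have "m + of_nat k *s m0 \<in> SG I" by (rule sep_shift[OF m0 m]) (simp_all add: finite_K[OF I(1)] k_def)
  then obtain a where a: "Ext I x (m + of_nat k *s m0) = Some a" using Ext_SG[OF I] by blast
  have "of_nat k *s (- m0) \<in> SG J" by (rule SG_scale[OF s(2)])
  then obtain b where b: "Ext I x (of_nat k *s (- m0)) = Some b" using def by blast
  have "m + of_nat k *s m0 + of_nat k *s (- m0) = m" by (simp add: vec_eq_iff)
  then show "Ext I x m ~= None" using Ext_add[OF I a b] by simp
 qed
 show y: "y \<in> ch J" unfolding y_def by (rule Ext_restrict[OF I def J])
 show z: "z \<in> ch (I Int J)" unfolding z_def by (rule Ext_restrict[OF I def' IJ])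
 show zx: "\<forall>m\<in>SG I. z m = x m" using SG_mono[of "I Int J" I] Ext_SG[OF I] by (auto simp: z_def)
 show zy: "\<forall>m\<in>SG J. z m = y m" using SG_mono[of "I Int J" J] by (auto simp: z_def y_def)
 have "Ext I x = Ext (I Int J) z" by (rule Ext_face[OF I _ z zx]) simp
 moreover have "Ext J y = Ext (I Int J) z" by (rule Ext_face[OF J y _ z zy]) simp
 ultimately show "Ext J y = Ext I x" by simp
qed

text \<open>Consequently gluing is an equivalence relation, and a point of the variety amounts to a
  maximal partial character.\<close>

lemma gluing_iff:
 assumes I: "I \<in> K" "x \<in> ch I" and J: "J \<in> K" "y \<in> ch J"
 shows "((cn I, x), (cn J, y)) \<in> gluing example_fan \<longleftrightarrow> Ext I x = Ext J y"
proof -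
 have c: "chart (cn I Int cn J) = ch (I Int J)" by (simp add: cn_Int[OF I(1) J(1)])
 have IJ: "I Int J \<in> K" by (rule K_Int[OF I(1)])
 have m: "cn I \<in> example_fan" "cn J \<in> example_fan" using I J by (auto simp: example_fan_eq)
 have "((cn I, x), (cn J, y)) \<in> gluing example_fan \<longleftrightarrow> (\<exists>z\<in>chart (cn I Int cn J).
   (\<forall>m\<in>dual_semigroup (cn I). z m = x m) & (\<forall>m\<in>dual_semigroup (cn J). z m = y m))"
  unfolding gluing_def using I J m by auto
 also have "... \<longleftrightarrow> (\<exists>z\<in>ch (I Int J). (\<forall>m\<in>SG I. z m = x m) & (\<forall>m\<in>SG J. z m = y m))"
  unfolding c dual_SG[OF I(1)] dual_SG[OF J(1)] ..
 also have "... \<longleftrightarrow> Ext I x = Ext J y"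
 proof
  assume "\<exists>z\<in>ch (I Int J). (\<forall>m\<in>SG I. z m = x m) & (\<forall>m\<in>SG J. z m = y m)"
  then obtain z where z: "z \<in> ch (I Int J)" "\<forall>m\<in>SG I. z m = x m" "\<forall>m\<in>SG J. z m = y m" by blast
  show "Ext I x = Ext J y" using Ext_face[OF I _ z(1,2)] Ext_face[OF J _ z(1,3)] by simp
 next
  assume e: "Ext I x = Ext J y"
  have def: "\<forall>m\<in>SG J. Ext I x m ~= None" using Ext_SG[OF J] e by simp
  have yy: "(%m. if m \<in> SG J then the (Ext I x m) else 0) = y"
   using Ext_SG[OF J] ch_simps(3)[OF J] by (auto simp: e)
  note c = Ext_chart(3,4,5)[OF I J(1) def, unfolded yy]
  show "\<exists>z\<in>ch (I Int J). (\<forall>m\<in>SG I. z m = x m) & (\<forall>m\<in>SG J. z m = y m)"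
  proof (rule bexI[OF _ c(1)], rule conjI[OF c(2)])
   show "\<forall>m\<in>SG J. (if m \<in> SG (I Int J) then the (Ext I x m) else 0) = y m"
    using c(3) Ext_SG[OF J] SG_mono[of "I Int J" J] by (auto simp: e)
  qed
 qed
 finally show ?thesis .
qed

lemma tp_eq_set: assumes "I \<in> K" "x \<in> ch I"
 shows "tp I x = {(cn J, y) | J y. J \<in> K & y \<in> ch J & Ext J y = Ext I x}"
proof -
 have "p \<in> tp I x \<longleftrightarrow> p \<in> {(cn J, y) | J y. J \<in> K & y \<in> ch J & Ext J y = Ext I x}" for p
 proof
  assume "p \<in> tp I x"
  then have g: "((cn I, x), p) \<in> gluing example_fan" by (simp add: toric_point_def)
  then obtain \<tau> y where p: "p = (\<tau>, y)" "\<tau> \<in> example_fan" "y \<in> chart \<tau>" unfolding gluing_def by blast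
  then obtain J where J: "\<tau> = cn J" "J \<in> K" unfolding example_fan_eq by blast
  then have "Ext I x = Ext J y" using g gluing_iff[OF assms J(2)] p by simp
  then show "p \<in> {(cn J, y) | J y. J \<in> K & y \<in> ch J & Ext J y = Ext I x}" using p J by auto
 next
  assume "p \<in> {(cn J, y) | J y. J \<in> K & y \<in> ch J & Ext J y = Ext I x}"
  then obtain J y where "p = (cn J, y)" "J \<in> K" "y \<in> ch J" "Ext J y = Ext I x" by blast
  then show "p \<in> tp I x" unfolding toric_point_def using gluing_iff[OF assms] by simp
 qed
 then show ?thesis by blast
qed

lemma tp_eq_iff: assumes "I \<in> K" "x \<in> ch I" "J \<in> K" "y \<in> ch J"
 shows "tp I x = tp J y \<longleftrightarrow> Ext I x = Ext J y"
proof
 assume "tp I x = tp J y"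
 moreover have "(cn I, x) \<in> tp I x" unfolding tp_eq_set[OF assms(1,2)] using assms by blast
 ultimately have "(cn I, x) \<in> tp J y" by simp
 then obtain I' where "cn I = cn I'" "I' \<in> K" "Ext I' x = Ext J y" unfolding tp_eq_set[OF assms(3,4)] by blast
 then show "Ext I x = Ext J y" using cn_inj[OF assms(1)] by metis
next
 assume "Ext I x = Ext J y"
 then show "tp I x = tp J y" unfolding tp_eq_set[OF assms(1,2)] tp_eq_set[OF assms(3,4)] by simp
qed

section \<open>Points as partial characters of the lattice\<close>

definition UU :: "nat set => 3 chart_point set set" where "UU I = {tp I x | x. x \<in> ch I}"

definition evp :: "3 chart_point set => mvec => complex option" where
 "evp p = (THE e. \<exists>I\<in>K. \<exists>x\<in>ch I. p = tp I x & e = Ext I x)"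

text \<open>Meaningful only where \<open>evp p m\<close> is defined, for instance for
  \<open>m\<close> in \<open>SG I\<close> and \<open>p\<close> in \<open>UU I\<close>.\<close>

definition vl :: "3 chart_point set => mvec => complex" where "vl p m = the (evp p m)"

lemma evp_tp: assumes "I \<in> K" "x \<in> ch I" shows "evp (tp I x) = Ext I x"
 unfolding evp_def
proof (rule the_equality)
 show "\<exists>J\<in>K. \<exists>y\<in>ch J. tp I x = tp J y & Ext I x = Ext J y" using assms by blast
 fix e assume "\<exists>J\<in>K. \<exists>y\<in>ch J. tp I x = tp J y & e = Ext J y"
 then obtain J y where J: "J \<in> K" "y \<in> ch J" "tp I x = tp J y" "e = Ext J y" by blast
 then show "e = Ext I x" using tp_eq_iff[OF assms J(1,2)] by simp
qed

definition PP :: "3 chart_point set set" where "PP = (\<Union>I\<in>K. UU I)"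

lemma PP_cases: assumes "p \<in> PP" obtains I x where "I \<in> K" "x \<in> ch I" "p = tp I x" "evp p = Ext I x"
 using assms evp_tp unfolding PP_def UU_def by blast

lemma UU_PP: "I \<in> K ==> UU I \<subseteq> PP" by (auto simp: PP_def)

lemma evp_add: assumes "p \<in> PP" "evp p m = Some a" "evp p m' = Some b" shows "evp p (m + m') = Some (a * b)"
proof -
 obtain I x where p: "I \<in> K" "x \<in> ch I" "evp p = Ext I x" using PP_cases[OF assms(1)] by metis
 show ?thesis using assms Ext_add[OF p(1,2)] unfolding p(3) by blast
qed

lemma evp_0: assumes "p \<in> PP" shows "evp p 0 = Some 1"
proof -
 obtain I x where p: "I \<in> K" "x \<in> ch I" "evp p = Ext I x" using PP_cases[OF assms(1)] by metis
 show ?thesis unfolding p(3) by (rule Ext_0[OF p(1,2)])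
qed

lemma UU_iff: assumes "p \<in> PP" "J \<in> K" shows "p \<in> UU J \<longleftrightarrow> (\<forall>m\<in>SG J. evp p m ~= None)"
proof
 assume "p \<in> UU J"
 then obtain y where y: "y \<in> ch J" "p = tp J y" by (auto simp: UU_def)
 then show "\<forall>m\<in>SG J. evp p m ~= None" using evp_tp[OF assms(2) y(1)] Ext_SG[OF assms(2) y(1)] by simp
next
 assume def: "\<forall>m\<in>SG J. evp p m ~= None"
 obtain I x where p: "I \<in> K" "x \<in> ch I" "p = tp I x" "evp p = Ext I x" using PP_cases[OF assms(1)] .
 note c = Ext_chart(1,2)[OF p(1,2) assms(2) def[unfolded p(4)]]
 have "p = tp J (%m. if m \<in> SG J then the (Ext I x m) else 0)"
  unfolding p(3) tp_eq_iff[OF p(1,2) assms(2) c(1)] using c(2) by simp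
 then show "p \<in> UU J" using c(1) by (auto simp: UU_def)
qed

lemma evp_UU: "J \<in> K ==> p \<in> UU J ==> m \<in> SG J ==> evp p m = Some (vl p m)"
 using UU_iff[of p J] UU_PP[of J] unfolding vl_def by fastforce

lemma vl_0: "p \<in> PP ==> vl p 0 = 1" by (simp add: vl_def evp_0)

lemma vl_add: "J \<in> K ==> p \<in> UU J ==> m \<in> SG J ==> m' \<in> SG J ==> vl p (m + m') = vl p m * vl p m'"
 using evp_add[OF _ evp_UU evp_UU] UU_PP unfolding vl_def[of p "m + m'"] by fastforce

lemma vl_scale: assumes "J \<in> K" "p \<in> UU J" "m \<in> SG J" shows "vl p (of_nat k *s m) = vl p m ^ k"
proof (induct k)
 case 0 then show ?case using vl_0 UU_PP assms by auto
next
 case (Suc k)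
 show ?case unfolding scale_Suc using Suc vl_add[OF assms SG_scale[OF assms(3)]] by simp
qed

lemma vl_tp: "I \<in> K ==> x \<in> ch I ==> m \<in> SG I ==> vl (tp I x) m = x m"
 by (simp add: vl_def evp_tp Ext_SG)

lemma UU_ch: assumes "J \<in> K" "p \<in> UU J"
 shows "(%m. if m \<in> SG J then vl p m else 0) \<in> ch J" "p = tp J (%m. if m \<in> SG J then vl p m else 0)"
proof -
 obtain y where y: "y \<in> ch J" "p = tp J y" using assms by (auto simp: UU_def)
 have "(%m. if m \<in> SG J then vl p m else 0) = y"
  using vl_tp[OF assms(1) y(1)] ch_simps(3)[OF assms(1) y(1)] unfolding y(2) by auto
 then show "(%m. if m \<in> SG J then vl p m else 0) \<in> ch J" "p = tp J (%m. if m \<in> SG J then vl p m else 0)"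
  using y by simp_all
qed

lemma UU_eqI: assumes "J \<in> K" "p \<in> UU J" "q \<in> UU J" "!!m. m \<in> SG J ==> vl p m = vl q m" shows "p = q"
proof -
 have "(%m. if m \<in> SG J then vl p m else 0) = (%m. if m \<in> SG J then vl q m else 0)" using assms(4) by auto
 then show ?thesis using UU_ch(2)[OF assms(1,2)] UU_ch(2)[OF assms(1,3)] by simp
qed

text \<open>The overlap with chart \<open>J\<close> is the principal open subset of chart
  \<open>I\<close> given by the separator; most questions of chart membership reduce to
  this.\<close>

lemma UU_sep: assumes "I \<in> K" "J \<in> K" "sep m0 I J" "p \<in> UU I"
 shows "p \<in> UU J \<longleftrightarrow> vl p m0 ~= 0"
proof -
 note s = sep_SG[OF assms(3)]
 have P: "p \<in> PP" using assms UU_PP by blast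
 show ?thesis
 proof
  assume "p \<in> UU J"
  then have "evp p (- m0) = Some (vl p (- m0))" using evp_UU[OF assms(2)] s(2) by blast
  from evp_add[OF P evp_UU[OF assms(1,4) s(1)] this] show "vl p m0 ~= 0" using evp_0[OF P] by auto
 next
  assume nz: "vl p m0 ~= 0"
  have "evp p m ~= None" if m: "m \<in> SG J" for m
  proof -
   have mIJ: "m \<in> SG (I Int J)" using m SG_mono[of "I Int J" J] by blast
   define k where "k = (\<Sum>i\<in>I. nat \<bar>pr m i\<bar>)"
   have a: "m + of_nat k *s m0 \<in> SG I" by (rule sep_shift[OF assms(3) mIJ]) (simp_all add: finite_K[OF assms(1)] k_def)
   let ?x = "%m. if m \<in> SG I then vl p m else 0"
   note x = UU_ch[OF assms(1,4)]
   have sk: "of_nat k *s m0 \<in> SG I" by (rule SG_scale[OF s(1)])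
   have "?x (of_nat k *s m0) ~= 0" using sk vl_scale[OF assms(1,4) s(1)] nz by simp
   from Ext_eq[OF assms(1) x(1) sk this a] have "Ext I ?x m ~= None" by blast
   then show ?thesis using evp_tp[OF assms(1) x(1)] x(2) by simp
  qed
  then show "p \<in> UU J" using UU_iff[OF P assms(2)] by blast
 qed
qed

lemma vl_shift: assumes "I \<in> K" "J \<in> K" "sep m0 I J" "p \<in> UU I" "p \<in> UU J" "m \<in> SG J"
 "m + of_nat k *s m0 \<in> SG I"
 shows "vl p (m + of_nat k *s m0) = vl p m * vl p m0 ^ k"
proof -
 note s = sep_SG[OF assms(3)]
 have P: "p \<in> PP" using assms UU_PP by blast
 have "evp p (of_nat k *s m0) = Some (vl p m0 ^ k)"
  using evp_UU[OF assms(1,4) SG_scale[OF s(1)]] vl_scale[OF assms(1,4) s(1)] by simp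
 from evp_add[OF P evp_UU[OF assms(2,5,6)] this] show ?thesis by (simp add: vl_def)
qed

subsection \<open>Regular functions on charts\<close>

definition RR :: "nat set => (3 chart_point set => complex) set" where
 "RR I = {f. \<exists>F c. finite F & F \<subseteq> SG I & (\<forall>p\<in>UU I. f p = (\<Sum>m\<in>F. c m * vl p m))}"

text \<open>A ring of coefficient functions. Functions on a single point give the coordinate rings
  of the toric charts; for completeness, the coordinate ring of an affine chart of the second factor
  is taken.\<close>

locale function_ring =
 fixes R :: "('z => complex) set"
 assumes const: "(%_. c) \<in> R" and add: "f \<in> R ==> g \<in> R ==> (%z. f z + g z) \<in> R"
  and mult: "f \<in> R ==> g \<in> R ==> (%z. f z * g z) \<in> R"
begin

lemma diff: assumes "f \<in> R" "g \<in> R" shows "(%z. f z - g z) \<in> R"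
 using add[OF assms(1) mult[OF const[of "-1"] assms(2)]] by simp

lemma sum: assumes "finite A" "!!a. a \<in> A ==> f a \<in> R" shows "(%z. \<Sum>a\<in>A. f a z) \<in> R"
 using assms by (induct A rule: finite_induct) (auto intro: add const)

lemma prod: assumes "finite A" "!!a. a \<in> A ==> f a \<in> R" shows "(%z. \<Prod>a\<in>A. f a z) \<in> R"
 using assms by (induct A rule: finite_induct) (auto intro: mult const)

text \<open>The tensor product of the coordinate ring of chart \<open>J\<close> with
  \<open>R\<close>, as functions on the product.\<close>

definition QQ :: "nat set => (3 chart_point set => 'z => complex) set" where
 "QQ J = {q. \<exists>F \<rho>. finite F & F \<subseteq> SG J & (\<forall>m\<in>F. \<rho> m \<in> R) & (\<forall>x\<in>UU J. \<forall>z. q x z = (\<Sum>m\<in>F. \<rho> m z * vl x m))}"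

lemma QQ_I:
 assumes "finite A" "g ` A \<subseteq> SG J" "!!a. a \<in> A ==> \<rho> a \<in> R" "!!x z. x \<in> UU J ==> q x z = (\<Sum>a\<in>A. \<rho> a z * vl x (g a))"
 shows "q \<in> QQ J"
 unfolding QQ_def
proof (intro CollectI exI conjI ballI allI)
 show "finite (g ` A)" "g ` A \<subseteq> SG J" using assms by auto
 show "(%z. \<Sum>a\<in>{a\<in>A. g a = y}. \<rho> a z) \<in> R" for y by (rule sum) (use assms(1,3) in auto)
 fix x z assume "x \<in> UU J"
 have "(\<Sum>a\<in>A. \<rho> a z * vl x (g a)) = (\<Sum>y\<in>g ` A. \<Sum>a\<in>{a\<in>A. g a = y}. \<rho> a z * vl x (g a))"
  by (rule sum.image_gen[OF assms(1)])
 also have "... = (\<Sum>y\<in>g ` A. (\<Sum>a\<in>{a\<in>A. g a = y}. \<rho> a z) * vl x y)"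
  by (intro sum.cong) (auto simp: sum_distrib_right)
 finally show "q x z = (\<Sum>y\<in>g ` A. (\<Sum>a\<in>{a\<in>A. g a = y}. \<rho> a z) * vl x y)" using assms(4)[OF `x \<in> UU J`] by simp
qed

lemma QQ_ex: "q \<in> QQ J ==> \<exists>F \<rho>. finite F & F \<subseteq> SG J & (\<forall>m\<in>F. \<rho> m \<in> R) & (\<forall>x\<in>UU J. \<forall>z. q x z = (\<Sum>m\<in>F. \<rho> m z * vl x m))"
 unfolding QQ_def by (elim CollectE)

lemma QQ_RR: assumes "a \<in> RR J" shows "(%x z. a x) \<in> QQ J"
proof -
 obtain F c where F: "finite F" "F \<subseteq> SG J" "!!p. p \<in> UU J ==> a p = (\<Sum>m\<in>F. c m * vl p m)" using assms unfolding RR_def by blast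
 show ?thesis by (rule QQ_I[of F "%m. m" J "%m _. c m"]) (use F const in auto)
qed

lemma QQ_R: assumes "J \<in> K" "r \<in> R" shows "(%x. r) \<in> QQ J"
 by (rule QQ_I[of "{0}" "%m. m" J "%m. r"]) (use assms vl_0 UU_PP[OF assms(1)] in auto)

lemma QQ_add: assumes "q \<in> QQ J" "q' \<in> QQ J" shows "(%x z. q x z + q' x z) \<in> QQ J"
proof -
 obtain F c where F': "finite F" "F \<subseteq> SG J" "\<forall>m\<in>F. c m \<in> R" "\<forall>x\<in>UU J. \<forall>z. q x z = (\<Sum>m\<in>F. c m z * vl x m)" using QQ_ex[OF assms(1)] by (elim exE conjE)
 note F = F'(1,2) F'(3)[rule_format] F'(4)[rule_format]
 obtain G d where G': "finite G" "G \<subseteq> SG J" "\<forall>m\<in>G. d m \<in> R" "\<forall>x\<in>UU J. \<forall>z. q' x z = (\<Sum>m\<in>G. d m z * vl x m)" using QQ_ex[OF assms(2)] by (elim exE conjE)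
 note G = G'(1,2) G'(3)[rule_format] G'(4)[rule_format]
 show ?thesis
  by (rule QQ_I[of "F <+> G" "case_sum (%m. m) (%m. m)" J "case_sum c d"])
    (use F G in \<open>auto simp: sum.Plus\<close>)
qed

lemma QQ_mult: assumes "J \<in> K" "q \<in> QQ J" "q' \<in> QQ J" shows "(%x z. q x z * q' x z) \<in> QQ J"
proof -
 obtain F c where F': "finite F" "F \<subseteq> SG J" "\<forall>m\<in>F. c m \<in> R" "\<forall>x\<in>UU J. \<forall>z. q x z = (\<Sum>m\<in>F. c m z * vl x m)" using QQ_ex[OF assms(2)] by (elim exE conjE)
 note F = F'(1,2) F'(3)[rule_format] F'(4)[rule_format]
 obtain G d where G': "finite G" "G \<subseteq> SG J" "\<forall>m\<in>G. d m \<in> R" "\<forall>x\<in>UU J. \<forall>z. q' x z = (\<Sum>m\<in>G. d m z * vl x m)" using QQ_ex[OF assms(3)] by (elim exE conjE)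
 note G = G'(1,2) G'(3)[rule_format] G'(4)[rule_format]
 show ?thesis
 proof (rule QQ_I[of "F \<times> G" "%(m, m'). m + m'" J "%(m, m') z. c m z * d m' z"])
  fix x z assume x: "x \<in> UU J"
  have "q x z * q' x z = (\<Sum>m\<in>F. \<Sum>m'\<in>G. c m z * vl x m * (d m' z * vl x m'))" using F(4)[OF x] G(4)[OF x] by (simp add: sum_product)
  also have "... = (\<Sum>m\<in>F. \<Sum>m'\<in>G. c m z * d m' z * vl x (m + m'))"
  proof (intro sum.cong refl)
   fix m m' assume "m \<in> F" "m' \<in> G"
   then have "vl x (m + m') = vl x m * vl x m'" using vl_add[OF assms(1) x] F(2) G(2) by blast
   then show "c m z * vl x m * (d m' z * vl x m') = c m z * d m' z * vl x (m + m')" by simp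
  qed
  finally show "q x z * q' x z = (\<Sum>a\<in>F \<times> G. (case a of (m, m') => %z. c m z * d m' z) z * vl x (case a of (m, m') => m + m'))"
   by (simp add: sum.cartesian_product case_prod_beta)
 next
  have "m + m' \<in> SG J" if "m \<in> F" "m' \<in> G" for m m' using F(2) G(2) SG_add that by blast
  then show "(%(m, m'). m + m') ` (F \<times> G) \<subseteq> SG J" by auto
  show "(case a of (m, m') => %z. c m z * d m' z) \<in> R" if "a \<in> F \<times> G" for a
   using that mult F(3) G(3) by (auto simp: case_prod_beta)
 qed (use F G in auto)
qed

end

interpretation U: function_ring "UNIV :: (unit => complex) set" by unfold_locales auto

lemma RR_iff: "f \<in> RR I \<longleftrightarrow> (%x _. f x) \<in> U.QQ I"
proof
 assume "f \<in> RR I"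
 then show "(%x _. f x) \<in> U.QQ I" by (rule U.QQ_RR)
next
 assume "(%x _. f x) \<in> U.QQ I"
 from U.QQ_ex[OF this] obtain F \<rho> where F: "finite F" "F \<subseteq> SG I" "\<forall>m\<in>F. \<rho> m \<in> UNIV"
  "\<forall>x\<in>UU I. \<forall>z::unit. f x = (\<Sum>m\<in>F. \<rho> m z * vl x m)" by (elim exE conjE)
 show "f \<in> RR I" unfolding RR_def
  by (intro CollectI exI[of _ F] exI[of _ "%m. \<rho> m ()"] conjI F(1,2)) (use F(4) in simp)
qed

lemma RR_I: assumes "finite A" "g ` A \<subseteq> SG I" "!!p. p \<in> UU I ==> f p = (\<Sum>a\<in>A. d a * vl p (g a))" shows "f \<in> RR I"
 unfolding RR_iff by (rule U.QQ_I[of A g I "%a _. d a"]) (use assms in auto)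

lemma RR_const: "I \<in> K ==> (%_. c) \<in> RR I"
 by (rule RR_I[of "{0}" "%m. m" I _ "%_. c"]) (use vl_0 UU_PP in auto)

lemma RR_vl: "m \<in> SG I ==> (%p. vl p m) \<in> RR I"
 by (rule RR_I[of "{m}" "%m. m" I _ "%_. 1"]) auto

lemma RR_add: "f \<in> RR I ==> g \<in> RR I ==> (%p. f p + g p) \<in> RR I"
 unfolding RR_iff by (rule U.QQ_add)

lemma RR_mult: "I \<in> K ==> f \<in> RR I ==> g \<in> RR I ==> (%p. f p * g p) \<in> RR I"
 unfolding RR_iff by (rule U.QQ_mult)

lemma chart_ring_RR: "I \<in> K ==> a \<in> chart_ring (cn I) ==> \<exists>f\<in>RR I. \<forall>x\<in>ch I. f (tp I x) = a x"
proof -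
 assume I: "I \<in> K" and "a \<in> chart_ring (cn I)"
 then obtain F c where F: "finite F" "F \<subseteq> SG I" "a = (%x. \<Sum>m\<in>F. c m * x m)"
  unfolding chart_ring_def dual_SG[OF I] by blast
 show ?thesis
 proof (rule bexI[of _ "%p. \<Sum>m\<in>F. c m * vl p m"])
  show "\<forall>x\<in>ch I. (\<Sum>m\<in>F. c m * vl (tp I x) m) = a x"
  proof
   fix x assume "x \<in> ch I"
   then show "(\<Sum>m\<in>F. c m * vl (tp I x) m) = a x" unfolding F(3) using F(2) vl_tp[OF I] by (intro sum.cong) auto
  qed
  show "(%p. \<Sum>m\<in>F. c m * vl p m) \<in> RR I" unfolding RR_def using F by blast
 qed
qed

lemma RR_chart_ring: "I \<in> K ==> f \<in> RR I ==> \<exists>a\<in>chart_ring (cn I). \<forall>x\<in>ch I. f (tp I x) = a x"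
proof -
 assume I: "I \<in> K" and "f \<in> RR I"
 then obtain F c where F: "finite F" "F \<subseteq> SG I" "!!p. p \<in> UU I ==> f p = (\<Sum>m\<in>F. c m * vl p m)" unfolding RR_def by blast
 show ?thesis
 proof (rule bexI[of _ "%x. \<Sum>m\<in>F. c m * x m"])
  show "\<forall>x\<in>ch I. f (tp I x) = (\<Sum>m\<in>F. c m * x m)"
  proof
   fix x assume x: "x \<in> ch I"
   then have "tp I x \<in> UU I" by (auto simp: UU_def)
   then have "f (tp I x) = (\<Sum>m\<in>F. c m * vl (tp I x) m)" by (rule F(3))
   also have "... = (\<Sum>m\<in>F. c m * x m)" using F(2) vl_tp[OF I x] by (intro sum.cong) auto
   finally show "f (tp I x) = (\<Sum>m\<in>F. c m * x m)" .
  qed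
  show "(%x. \<Sum>m\<in>F. c m * x m) \<in> chart_ring (cn I)" unfolding chart_ring_def dual_SG[OF I] using F by blast
 qed
qed

definition gens :: "3 chart_point set set set" where
 "gens = {{p \<in> UU I. f p ~= 0} | I f. I \<in> K & f \<in> RR I}"

lemma zar_XX: "zar XX = topology_generated_by gens"
proof -
 have "{{tp I x | x. x \<in> ch I & a x ~= 0} | I a. I \<in> K & a \<in> chart_ring (cn I)} = gens" (is "?L = _")
 proof (intro equalityI subsetI)
  fix G assume "G \<in> ?L"
  then obtain I a where I: "I \<in> K" "a \<in> chart_ring (cn I)" "G = {tp I x | x. x \<in> ch I & a x ~= 0}" by blast
  obtain f where f: "f \<in> RR I" "\<forall>x\<in>ch I. f (tp I x) = a x" using chart_ring_RR[OF I(1,2)] by blast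
  have "G = {p \<in> UU I. f p ~= 0}" unfolding I(3) UU_def using f(2) by auto
  then show "G \<in> gens" unfolding gens_def using I f by blast
 next
  fix G assume "G \<in> gens"
  then obtain I f where I: "I \<in> K" "f \<in> RR I" "G = {p \<in> UU I. f p ~= 0}" unfolding gens_def by blast
  obtain a where a: "a \<in> chart_ring (cn I)" "\<forall>x\<in>ch I. f (tp I x) = a x" using RR_chart_ring[OF I(1,2)] by blast
  have "G = {tp I x | x. x \<in> ch I & a x ~= 0}" unfolding I(3) UU_def using a(2) by auto
  then show "G \<in> ?L" using I a by blast
 qed
 moreover have "{{tp I x | x. x \<in> ch I & a x ~= 0} | I a. I \<in> K & a \<in> chart_ring (cn I)}
  = {{toric_point example_fan \<sigma> x | x. x \<in> chart \<sigma> & f x ~= 0} | \<sigma> f. \<sigma> \<in> example_fan & f \<in> chart_ring \<sigma>}"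
  unfolding example_fan_eq by blast
 ultimately show ?thesis by (simp add: toric_variety_def)
qed

lemma open_RR: "I \<in> K ==> f \<in> RR I ==> openin (zar XX) {p \<in> UU I. f p ~= 0}"
 unfolding zar_XX by (rule topology_generated_by_Basis) (auto simp: gens_def)

lemma open_UU: "I \<in> K ==> openin (zar XX) (UU I)"
 using open_RR[of I "%_. 1"] RR_const by simp

lemma points_XX: "points XX = PP"
proof
 show "points XX \<subseteq> PP" unfolding zar_XX topology_generated_by_topspace gens_def PP_def by blast
 show "PP \<subseteq> points XX" unfolding PP_def using open_UU openin_subset by blast
qed

text \<open>One power of the separating character moves the finitely many exponents of
  \<open>f\<close> into \<open>SG I\<close>, which clears the denominators of \<open>f\<close> on
  the other chart.\<close>

lemma RR_transfer:
 assumes "I \<in> K" "J \<in> K" "sep m0 I J" "f \<in> RR J"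
 shows "\<exists>g\<in>RR I. \<exists>k. \<forall>q\<in>UU I Int UU J. g q = f q * vl q m0 ^ k"
proof -
 obtain F c where F: "finite F" "F \<subseteq> SG J" "!!p. p \<in> UU J ==> f p = (\<Sum>m\<in>F. c m * vl p m)"
  using assms(4) unfolding RR_def by blast
 define k where "k = (\<Sum>m\<in>F. \<Sum>i\<in>I. nat \<bar>pr m i\<bar>)"
 have sh: "m + of_nat k *s m0 \<in> SG I" if "m \<in> F" for m
 proof (rule sep_shift[OF assms(3) _ finite_K[OF assms(1)]])
  show "m \<in> SG (I Int J)" using that F(2) SG_mono[of "I Int J" J] by blast
  show "(\<Sum>i\<in>I. nat \<bar>pr m i\<bar>) <= k" unfolding k_def
   using that F(1) by (intro member_le_sum[where f = "%m. \<Sum>i\<in>I. nat \<bar>pr m i\<bar>"]) auto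
 qed
 define g where "g = (%q. \<Sum>m\<in>F. c m * vl q (m + of_nat k *s m0))"
 have "g \<in> RR I" unfolding g_def
  by (rule RR_I[of F "%m. m + of_nat k *s m0" I _ c]) (use F sh in auto)
 moreover have "\<forall>q\<in>UU I Int UU J. g q = f q * vl q m0 ^ k"
 proof
  fix q assume "q \<in> UU I Int UU J"
  then have q: "q \<in> UU I" "q \<in> UU J" by auto
  have "g q = (\<Sum>m\<in>F. c m * vl q m * vl q m0 ^ k)" unfolding g_def
  proof (rule sum.cong[OF refl])
   fix m assume "m \<in> F"
   then show "c m * vl q (m + of_nat k *s m0) = c m * vl q m * vl q m0 ^ k"
    using vl_shift[OF assms(1-3) q _ sh] F(2) by auto
  qed
  also have "... = f q * vl q m0 ^ k" using F(3)[OF q(2)] by (simp add: sum_distrib_right)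
  finally show "g q = f q * vl q m0 ^ k" .
 qed
 ultimately show ?thesis by blast
qed

lemma open_local:
 assumes "openin (zar XX) W" "p \<in> W" "p \<in> UU I" "I \<in> K"
 shows "\<exists>f\<in>RR I. f p ~= 0 & {q \<in> UU I. f q ~= 0} \<subseteq> W"
proof -
 have "generate_topology_on gens W" using assms(1) unfolding zar_XX by (simp add: openin_topology_generated_by_iff)
 then show ?thesis using assms(2)
 proof (induct W rule: generate_topology_on.induct)
  case (Int A B)
  then have pAB: "p \<in> A" "p \<in> B" by auto
  obtain f where f: "f \<in> RR I" "f p ~= 0" "{q \<in> UU I. f q ~= 0} \<subseteq> A" using Int(2)[OF pAB(1)] by blast
  obtain g where g: "g \<in> RR I" "g p ~= 0" "{q \<in> UU I. g q ~= 0} \<subseteq> B" using Int(4)[OF pAB(2)] by blast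
  show ?case by (rule bexI[OF _ RR_mult[OF assms(4) f(1) g(1)]]) (use f g in auto)
 next
  case (UN \<K>)
  then obtain A where A: "A \<in> \<K>" "p \<in> A" by blast
  obtain f where f: "f \<in> RR I" "f p ~= 0" "{q \<in> UU I. f q ~= 0} \<subseteq> A" using UN(2)[OF A] by blast
  show ?case by (rule bexI[OF _ f(1)]) (use f A in auto)
 next
  case (Basis W)
  have "W \<in> gens" by (rule Basis(1))
  then obtain J f where J: "J \<in> K" "f \<in> RR J" "W = {p \<in> UU J. f p ~= 0}" unfolding gens_def by blast
  have "p \<in> W" by (rule Basis(2))
  then have p: "p \<in> UU J" "f p ~= 0" unfolding J(3) by auto
  obtain m0 where m0: "sep m0 I J" using sep_exists[OF assms(4) J(1)] by blast
  note s = sep_SG[OF m0]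
  obtain g k where g: "g \<in> RR I" "\<forall>q\<in>UU I Int UU J. g q = f q * vl q m0 ^ k"
   using RR_transfer[OF assms(4) J(1) m0 J(2)] by blast
  \<comment> \<open>The extra factor \<open>vl q m0\<close> makes nonvanishing imply membership in
    \<open>UU J\<close>.\<close>
  have gR: "(%q. vl q m0 * g q) \<in> RR I" by (rule RR_mult[OF assms(4) RR_vl[OF s(1)] g(1)])
  have "vl p m0 ~= 0" using UU_sep[OF assms(4) J(1) m0 assms(3)] p(1) by blast
  then have "vl p m0 * g p ~= 0" using g(2) assms(3) p by simp
  moreover have "{q \<in> UU I. vl q m0 * g q ~= 0} \<subseteq> W"
  proof
   fix q assume "q \<in> {q \<in> UU I. vl q m0 * g q ~= 0}"
   then have q: "q \<in> UU I" "vl q m0 ~= 0" "g q ~= 0" by auto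
   then have qJ: "q \<in> UU J" using UU_sep[OF assms(4) J(1) m0 q(1)] by blast
   then show "q \<in> W" using q g(2) J(3) by auto
  qed
  ultimately show ?case using gR by (intro bexI[of _ "%q. vl q m0 * g q"]) auto
 qed simp
qed

lemma ball_UU: "(\<forall>p\<in>UU I Int W. Q p) \<longleftrightarrow> (\<forall>x\<in>ch I. tp I x \<in> W --> Q (tp I x))"
 unfolding UU_def by auto

lemma reg_XX: "f \<in> reg XX W \<longleftrightarrow> (\<forall>I\<in>K. \<forall>p\<in>UU I Int W. \<exists>a\<in>RR I. \<exists>b\<in>RR I. b p ~= 0 &
  (\<forall>q\<in>UU I Int W. b q ~= 0 --> f q = a q / b q))"
proof -
 have "f \<in> reg XX W \<longleftrightarrow> (\<forall>I\<in>K. \<forall>x\<in>ch I. tp I x \<in> W --> (\<exists>a\<in>chart_ring (cn I). \<exists>b\<in>chart_ring (cn I). b x ~= 0 &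
   (\<forall>y\<in>ch I. tp I y \<in> W & b y ~= 0 --> f (tp I y) = a y / b y)))"
  by (simp add: toric_variety_def example_fan_eq)
 also have "... \<longleftrightarrow> (\<forall>I\<in>K. \<forall>p\<in>UU I Int W. \<exists>a\<in>RR I. \<exists>b\<in>RR I. b p ~= 0 &
  (\<forall>q\<in>UU I Int W. b q ~= 0 --> f q = a q / b q))"
 proof (intro ball_cong refl)
  fix I assume I: "I \<in> K"
  have "(\<exists>a\<in>chart_ring (cn I). \<exists>b\<in>chart_ring (cn I). b x ~= 0 &
    (\<forall>y\<in>ch I. tp I y \<in> W & b y ~= 0 --> f (tp I y) = a y / b y)) \<longleftrightarrow>
   (\<exists>a\<in>RR I. \<exists>b\<in>RR I. b (tp I x) ~= 0 & (\<forall>q\<in>UU I Int W. b q ~= 0 --> f q = a q / b q))" (is "?A \<longleftrightarrow> ?B") if x: "x \<in> ch I" for x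
  proof
   assume ?A
   then obtain a b where ab: "a \<in> chart_ring (cn I)" "b \<in> chart_ring (cn I)" "b x ~= 0"
    "\<forall>y\<in>ch I. tp I y \<in> W & b y ~= 0 --> f (tp I y) = a y / b y" by blast
   obtain a' where a': "a' \<in> RR I" "\<forall>x\<in>ch I. a' (tp I x) = a x" using chart_ring_RR[OF I ab(1)] by blast
   obtain b' where b': "b' \<in> RR I" "\<forall>x\<in>ch I. b' (tp I x) = b x" using chart_ring_RR[OF I ab(2)] by blast
   have "\<forall>q\<in>UU I Int W. b' q ~= 0 --> f q = a' q / b' q" using ab(4) a'(2) b'(2) unfolding UU_def by auto
   moreover have "b' (tp I x) ~= 0" using ab(3) b'(2) x by simp
   ultimately show ?B using a'(1) b'(1) by blast
  next
   assume ?B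
   then obtain a b where ab: "a \<in> RR I" "b \<in> RR I" "b (tp I x) ~= 0" "\<forall>q\<in>UU I Int W. b q ~= 0 --> f q = a q / b q" by blast
   obtain a' where a': "a' \<in> chart_ring (cn I)" "\<forall>x\<in>ch I. a (tp I x) = a' x" using RR_chart_ring[OF I ab(1)] by blast
   obtain b' where b': "b' \<in> chart_ring (cn I)" "\<forall>x\<in>ch I. b (tp I x) = b' x" using RR_chart_ring[OF I ab(2)] by blast
   have "\<forall>y\<in>ch I. tp I y \<in> W & b' y ~= 0 --> f (tp I y) = a' y / b' y"
   proof (intro ballI impI)
    fix y assume y: "y \<in> ch I" "tp I y \<in> W & b' y ~= 0"
    then have "tp I y \<in> UU I Int W" by (auto simp: UU_def)
    then show "f (tp I y) = a' y / b' y" using ab(4) a'(2) b'(2) y by auto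
   qed
   moreover have "b' x ~= 0" using ab(3) b'(2) x by simp
   ultimately show ?A using a'(1) b'(1) by blast
  qed
  then show "(\<forall>x\<in>ch I. tp I x \<in> W --> (\<exists>a\<in>chart_ring (cn I). \<exists>b\<in>chart_ring (cn I). b x ~= 0 &
   (\<forall>y\<in>ch I. tp I y \<in> W & b y ~= 0 --> f (tp I y) = a y / b y))) \<longleftrightarrow>
   (\<forall>p\<in>UU I Int W. \<exists>a\<in>RR I. \<exists>b\<in>RR I. b p ~= 0 & (\<forall>q\<in>UU I Int W. b q ~= 0 --> f q = a q / b q))"
   unfolding ball_UU[of I W "%p. \<exists>a\<in>RR I. \<exists>b\<in>RR I. b p ~= 0 & (\<forall>q\<in>UU I Int W. b q ~= 0 --> f q = a q / b q)"]
   by (intro ball_cong refl) simp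
 qed
 finally show ?thesis .
qed

lemma reg_quotient:
 assumes I: "I \<in> K" and ab: "a \<in> RR I" "b \<in> RR I" and f: "!!p. p \<in> UU I ==> b p ~= 0 ==> f p = a p / b p"
 shows "f \<in> reg XX {p \<in> UU I. b p ~= 0}"
 unfolding reg_XX
proof (intro ballI)
 fix J p assume J: "J \<in> K" and p: "p \<in> UU J Int {p \<in> UU I. b p ~= 0}"
 obtain m0 where m0: "sep m0 J I" using sep_exists[OF J I] by blast
 obtain a' k where a': "a' \<in> RR J" "\<forall>q\<in>UU J Int UU I. a' q = a q * vl q m0 ^ k"
  using RR_transfer[OF J I m0 ab(1)] by blast
 obtain b' l where b': "b' \<in> RR J" "\<forall>q\<in>UU J Int UU I. b' q = b q * vl q m0 ^ l"
  using RR_transfer[OF J I m0 ab(2)] by blast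
 have m0J: "(%q. vl q m0 ^ n) \<in> RR J" for n
 proof (induct n)
  case (Suc n) then show ?case using RR_mult[OF J RR_vl[OF sep_SG(1)[OF m0]] Suc] by simp
 qed (simp add: RR_const[OF J])
 have nz: "vl q m0 ~= 0" if "q \<in> UU J" "q \<in> UU I" for q using UU_sep[OF J I m0 that(1)] that(2) by blast
 show "\<exists>a\<in>RR J. \<exists>b'\<in>RR J. b' p ~= 0 & (\<forall>q\<in>UU J Int {p \<in> UU I. b p ~= 0}. b' q ~= 0 --> f q = a q / b' q)"
 proof (rule bexI[OF _ RR_mult[OF J a'(1) m0J[of l]]], rule bexI[OF _ RR_mult[OF J b'(1) m0J[of k]]], intro conjI ballI impI)
  show "b' p * vl p m0 ^ k ~= 0" using p b'(2) nz by auto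
  fix q assume "q \<in> UU J Int {p \<in> UU I. b p ~= 0}"
  then have q: "q \<in> UU J" "q \<in> UU I" "b q ~= 0" by auto
  have "a' q = a q * vl q m0 ^ k" "b' q = b q * vl q m0 ^ l" using a'(2) b'(2) q by auto
  then show "f q = a' q * vl q m0 ^ l / (b' q * vl q m0 ^ k)" using f[OF q(2,3)] nz[OF q(1,2)] by simp
 qed
qed

subsection \<open>The torus is dense\<close>

definition tor :: "c3 => mvec => complex" where
 "tor t m = px t powi (vec_nth m 1) * py t powi (vec_nth m 2) * pz t powi (vec_nth m 3)"

abbreviation tunit :: "c3 => bool" where "tunit t \<equiv> px t ~= 0 & py t ~= 0 & pz t ~= 0"

lemma empty_K: "{} \<in> K" by (auto simp: K_def Mx_def)

lemma SG_empty [simp]: "SG {} = UNIV" by (simp add: SG_def)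

lemma tor_ch: "tunit t ==> tor t \<in> ch {}"
 unfolding ch_iff[OF empty_K] by (simp add: tor_def power_int_add)

lemma tor_evp: "tunit t ==> evp (tp {} (tor t)) m = Some (tor t m)"
 by (simp add: evp_tp[OF empty_K tor_ch] Ext_SG[OF empty_K tor_ch])

lemma tor_vl: "tunit t ==> vl (tp {} (tor t)) m = tor t m"
 by (simp add: vl_def tor_evp)

lemma tor_UU: "tunit t ==> I \<in> K ==> tp {} (tor t) \<in> UU I"
proof -
 assume t: "tunit t" and I: "I \<in> K"
 have "tp {} (tor t) \<in> PP" using UU_PP[OF empty_K] tor_ch[OF t] by (auto simp: UU_def)
 then show ?thesis using UU_iff[OF _ I] tor_evp[OF t] by simp
qed

lemma laurent_nonzero:
 assumes "finite F" "m0 \<in> F" "c m0 ~= 0"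
 shows "\<exists>t. tunit t & (\<Sum>m\<in>F. c m * tor t m) ~= 0"
proof -
 define h where "h = (%m :: mvec. nat \<bar>vec_nth m 1\<bar> + nat \<bar>vec_nth m 2\<bar> + nat \<bar>vec_nth m 3\<bar>)"
 define N where "N = sum h F"
 have N: "h m <= N" if "m \<in> F" for m
  unfolding N_def using assms(1) that by (intro member_le_sum) auto
 define e where "e = (%(m :: mvec) i. nat (vec_nth m i + int N))"
 have e: "int (e m 1) = vec_nth m 1 + int N" "int (e m 2) = vec_nth m 2 + int N" "int (e m 3) = vec_nth m 3 + int N" if "m \<in> F" for m
  using N[OF that] unfolding e_def h_def by simp_all
 define P where "P = (\<Sum>m\<in>F. cC (c m) * mon (e m 1) (e m 2) (e m 3))"
 have iff: "(e m0 1 = e m 1 & e m0 2 = e m 2 & e m0 3 = e m 3) \<longleftrightarrow> m = m0" if "m \<in> F" for m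
  using e[OF that] e[OF assms(2)] by (auto simp: vec_eq_iff forall_3)
 have "coeff (coeff (coeff P (e m0 3)) (e m0 2)) (e m0 1) =
   (\<Sum>m\<in>F. if e m0 1 = e m 1 & e m0 2 = e m 2 & e m0 3 = e m 3 then c m else 0)"
  by (simp add: P_def coeff_sum cC_def coeff_mon if_distrib cong: if_cong)
 also have "... = (\<Sum>m\<in>F. if m = m0 then c m else 0)" by (intro sum.cong refl if_cong iff)
 also have "... = c m0" using assms(1,2) by simp
 finally have "P ~= 0" using assms(3) by auto
 \<comment> \<open>The extra factor forces the point that is found into the torus.\<close>
 then have "P * (cX * cY * cZ) ~= 0" by (simp add: cX_def cY_def cZ_def)
 from ev_nonzero[OF this] obtain t where t: "ev (P * (cX * cY * cZ)) t ~= 0" by (elim exE)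
 then have tu: "tunit t" and P: "ev P t ~= 0" by auto
 have "ev P t = (\<Sum>m\<in>F. c m * tor t m * (px t * py t * pz t) ^ N)"
  unfolding P_def ev_sum
 proof (rule sum.cong[OF refl])
  fix m assume m: "m \<in> F"
  have "px t ^ e m 1 = px t powi (vec_nth m 1) * px t ^ N" "py t ^ e m 2 = py t powi (vec_nth m 2) * py t ^ N"
   "pz t ^ e m 3 = pz t powi (vec_nth m 3) * pz t ^ N"
   using e[OF m] tu by (simp_all add: power_int_add flip: power_int_of_nat)
  then show "ev (cC (c m) * mon (e m 1) (e m 2) (e m 3)) t = c m * tor t m * (px t * py t * pz t) ^ N"
   by (simp add: mon_def tor_def power_mult_distrib)
 qed
 then have "ev P t = (\<Sum>m\<in>F. c m * tor t m) * (px t * py t * pz t) ^ N" by (simp add: sum_distrib_right)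
 then show ?thesis using tu P by auto
qed

lemma torus_dense:
 assumes "openin (zar XX) W" "W ~= {}" shows "\<exists>t. tunit t & tp {} (tor t) \<in> W"
proof -
 obtain p where p: "p \<in> W" using assms(2) by blast
 then have "p \<in> PP" using assms(1) openin_subset points_XX by blast
 then obtain I where I: "I \<in> K" "p \<in> UU I" by (auto simp: PP_def)
 obtain f where f: "f \<in> RR I" "f p ~= 0" "{q \<in> UU I. f q ~= 0} \<subseteq> W" using open_local[OF assms(1) p I(2,1)] by blast
 obtain F c where F: "finite F" "F \<subseteq> SG I" "!!p. p \<in> UU I ==> f p = (\<Sum>m\<in>F. c m * vl p m)" using f(1) unfolding RR_def by blast
 have "\<exists>m\<in>F. c m ~= 0"
 proof (rule ccontr)
  assume "~ ?thesis"
  then have "f p = 0" using F(3)[OF I(2)] by simp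
  then show False using f(2) by simp
 qed
 then obtain t where t: "tunit t" "(\<Sum>m\<in>F. c m * tor t m) ~= 0" using laurent_nonzero[OF F(1)] by blast
 have u: "tp {} (tor t) \<in> UU I" by (rule tor_UU[OF t(1) I(1)])
 have "f (tp {} (tor t)) ~= 0" using F(3)[OF u] t(2) tor_vl[OF t(1)] by simp
 then show ?thesis using u f(3) t(1) by blast
qed

lemma closed_point: assumes "p \<in> points XX" shows "closedin (zar XX) {p}"
proof -
 have "openin (zar XX) (points XX - {p})"
 proof (subst openin_subopen, intro ballI)
  fix q assume q: "q \<in> points XX - {p}"
  then obtain I where I: "I \<in> K" "q \<in> UU I" unfolding points_XX PP_def by auto
  show "\<exists>T. openin (zar XX) T & q \<in> T & T \<subseteq> points XX - {p}"
  proof (cases "p \<in> UU I")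
   case False
   then show ?thesis using open_UU[OF I(1)] I openin_subset by blast
  next
   case True
   then obtain m where m: "m \<in> SG I" "vl q m ~= vl p m" using UU_eqI[OF I(1,2) True] q by blast
   have "(%r. vl r m + (- vl p m)) \<in> RR I" by (rule RR_add[OF RR_vl[OF m(1)] RR_const[OF I(1)]])
   from open_RR[OF I(1) this] have o: "openin (zar XX) {r \<in> UU I. vl r m + (- vl p m) ~= 0}" .
   then show ?thesis using I(2) m(2) openin_subset[OF o] by (intro exI[of _ "{r \<in> UU I. vl r m + (- vl p m) ~= 0}"]) auto
  qed
 qed
 then show ?thesis using assms by (simp add: closedin_def)
qed

subsection \<open>The smooth charts\<close>

text \<open>The order of the rays is the order of the coordinates: for the wall of the first two
  rays the invariant curve becomes \<open>x = y = 0\<close>.\<close>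

definition smooth :: "nat => nat => nat => bool" where
 "smooth i j k \<longleftrightarrow> {i, j, k} \<in> Mx & {i, j, k} ~= {1, 3, 6} & i ~= j & j ~= k & i ~= k"

definition mo :: "nat => nat => nat => c3 => mvec => complex" where
 "mo i j k v m = (if m \<in> SG {i, j, k} then px v ^ nat (pr m i) * py v ^ nat (pr m j) * pz v ^ nat (pr m k) else 0)"

definition ph :: "nat => nat => nat => c3 => 3 chart_point set" where
 "ph i j k v = tp {i, j, k} (mo i j k v)"

context
 fixes i j k :: nat
 assumes sm: "smooth i j k"
begin

lemma smI: "{i, j, k} \<in> Mx" "{i, j, k} \<in> K" "i ~= j" "j ~= k" "i ~= k" "{i, j, k} ~= {1, 3, 6}"
 using sm MxK by (auto simp: smooth_def)

lemma mo_ch: "mo i j k v \<in> ch {i, j, k}"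
 unfolding ch_iff[OF smI(2)]
 by (auto simp: mo_def SG_def nat_add_distrib power_add)

lemma ph_UU: "ph i j k v \<in> UU {i, j, k}" using mo_ch by (auto simp: ph_def UU_def)

lemma vl_ph: "m \<in> SG {i, j, k} ==> vl (ph i j k v) m = px v ^ nat (pr m i) * py v ^ nat (pr m j) * pz v ^ nat (pr m k)"
 unfolding ph_def by (simp add: vl_tp[OF smI(2) mo_ch] mo_def)

lemma dual_basis:
 obtains a b c where "pr a i = 1" "pr a j = 0" "pr a k = 0" "pr b i = 0" "pr b j = 1" "pr b k = 0"
  "pr c i = 0" "pr c j = 0" "pr c k = 1" "a \<in> SG {i, j, k}" "b \<in> SG {i, j, k}" "c \<in> SG {i, j, k}"
proof -
 have "\<exists>m. \<forall>l\<in>{i, j, k}. pr m l = (if l = l' then 1 else 0)" for l' by (rule pr_solve[OF smI(1,6)])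
 then have *: "\<exists>m. \<forall>l. l \<in> {i, j, k} --> pr m l = (if l = l' then 1 else 0)" for l' by blast
 obtain a where a: "\<forall>l. l \<in> {i, j, k} --> pr a l = (if l = i then 1 else 0)" using *[of i] by (elim exE)
 obtain b where b: "\<forall>l. l \<in> {i, j, k} --> pr b l = (if l = j then 1 else 0)" using *[of j] by (elim exE)
 obtain c where c: "\<forall>l. l \<in> {i, j, k} --> pr c l = (if l = k then 1 else 0)" using *[of k] by (elim exE)
 show thesis
  by (rule that[of a b c]) (use smI(3-5) in \<open>simp_all add: SG_def a[THEN spec, THEN mp] b[THEN spec, THEN mp] c[THEN spec, THEN mp]\<close>)
qed

lemma range_ph: "range (ph i j k) = UU {i, j, k}"
proof
 show "range (ph i j k) \<subseteq> UU {i, j, k}" using ph_UU by blast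
 show "UU {i, j, k} \<subseteq> range (ph i j k)"
 proof
  fix p assume p: "p \<in> UU {i, j, k}"
  obtain a b c where abc: "pr a i = 1" "pr a j = 0" "pr a k = 0" "pr b i = 0" "pr b j = 1" "pr b k = 0" "pr c i = 0" "pr c j = 0" "pr c k = 1"
   and S: "a \<in> SG {i, j, k}" "b \<in> SG {i, j, k}" "c \<in> SG {i, j, k}"
   by (rule dual_basis) simp
  have "p = ph i j k (Pt (vl p a) (vl p b) (vl p c))"
  proof (rule UU_eqI[OF smI(2) p ph_UU])
   fix m assume m: "m \<in> SG {i, j, k}"
   have e: "m = of_nat (nat (pr m i)) *s a + (of_nat (nat (pr m j)) *s b + of_nat (nat (pr m k)) *s c)"
    by (rule pr_unique[OF smI(1)]) (use m abc in \<open>auto simp: SG_def\<close>)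
   have "vl p (of_nat x *s a + (of_nat y *s b + of_nat z *s c)) = vl p a ^ x * (vl p b ^ y * vl p c ^ z)" for x y z
    by (simp add: vl_add[OF smI(2) p] vl_scale[OF smI(2) p] S SG_scale SG_add)
   then have "vl p m = vl p a ^ nat (pr m i) * (vl p b ^ nat (pr m j) * vl p c ^ nat (pr m k))"
    by (subst e)
   then show "vl p m = vl (ph i j k (Pt (vl p a) (vl p b) (vl p c))) m" by (simp add: vl_ph[OF m])
  qed
  then show "p \<in> range (ph i j k)" by blast
 qed
qed

lemma inj_ph: "inj (ph i j k)"
proof (rule injI)
 fix v w assume e: "ph i j k v = ph i j k w"
 obtain a b c where abc: "pr a i = 1" "pr a j = 0" "pr a k = 0" "pr b i = 0" "pr b j = 1" "pr b k = 0" "pr c i = 0" "pr c j = 0" "pr c k = 1"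
   and S: "a \<in> SG {i, j, k}" "b \<in> SG {i, j, k}" "c \<in> SG {i, j, k}"
   by (rule dual_basis) simp
 have "px v = px w" using vl_ph[OF S(1), of v] vl_ph[OF S(1), of w] abc e by simp
 moreover have "py v = py w" using vl_ph[OF S(2), of v] vl_ph[OF S(2), of w] abc e by simp
 moreover have "pz v = pz w" using vl_ph[OF S(3), of v] vl_ph[OF S(3), of w] abc e by simp
 ultimately show "v = w" by (rule c3.expand[OF conjI[OF _ conjI]])
qed

lemma RR_poly: assumes "f \<in> RR {i, j, k}" shows "\<exists>P. \<forall>v. f (ph i j k v) = ev P v"
proof -
 obtain F c where F: "finite F" "F \<subseteq> SG {i, j, k}" "!!p. p \<in> UU {i, j, k} ==> f p = (\<Sum>m\<in>F. c m * vl p m)"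
  using assms unfolding RR_def by blast
 show ?thesis
 proof (intro exI allI)
  fix v
  have "f (ph i j k v) = (\<Sum>m\<in>F. c m * vl (ph i j k v) m)" by (rule F(3)[OF ph_UU])
  also have "... = (\<Sum>m\<in>F. c m * ev (mon (nat (pr m i)) (nat (pr m j)) (nat (pr m k))) v)"
   using F(2) vl_ph by (intro sum.cong) (auto simp: mon_def)
  finally show "f (ph i j k v) = ev (\<Sum>m\<in>F. cC (c m) * mon (nat (pr m i)) (nat (pr m j)) (nat (pr m k))) v" by simp
 qed
qed

lemma poly_RR: "\<exists>f\<in>RR {i, j, k}. \<forall>v. f (ph i j k v) = ev P v"
proof -
 obtain a b c where abc: "pr a i = 1" "pr a j = 0" "pr a k = 0" "pr b i = 0" "pr b j = 1" "pr b k = 0" "pr c i = 0" "pr c j = 0" "pr c k = 1"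
   and S: "a \<in> SG {i, j, k}" "b \<in> SG {i, j, k}" "c \<in> SG {i, j, k}"
   by (rule dual_basis) simp
 show ?thesis
 proof (rule ev_induct[where R = "%g. \<exists>f\<in>RR {i, j, k}. \<forall>v. f (ph i j k v) = g v"])
  show "\<exists>f\<in>RR {i, j, k}. \<forall>v. f (ph i j k v) = c" for c by (rule bexI[OF _ RR_const[OF smI(2)]]) simp
  show "\<exists>f\<in>RR {i, j, k}. \<forall>v. f (ph i j k v) = px v" by (rule bexI[OF _ RR_vl[OF S(1)]]) (simp add: vl_ph[OF S(1)] abc)
  show "\<exists>f\<in>RR {i, j, k}. \<forall>v. f (ph i j k v) = py v" by (rule bexI[OF _ RR_vl[OF S(2)]]) (simp add: vl_ph[OF S(2)] abc)
  show "\<exists>f\<in>RR {i, j, k}. \<forall>v. f (ph i j k v) = pz v" by (rule bexI[OF _ RR_vl[OF S(3)]]) (simp add: vl_ph[OF S(3)] abc)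
 next
  fix g h assume "\<exists>f\<in>RR {i, j, k}. \<forall>v. f (ph i j k v) = g v" "\<exists>f\<in>RR {i, j, k}. \<forall>v. f (ph i j k v) = h v"
  then obtain f f' where f: "f \<in> RR {i, j, k}" "\<forall>v. f (ph i j k v) = g v" "f' \<in> RR {i, j, k}" "\<forall>v. f' (ph i j k v) = h v" by blast
  show "\<exists>f\<in>RR {i, j, k}. \<forall>v. f (ph i j k v) = g v + h v" by (rule bexI[OF _ RR_add[OF f(1,3)]]) (use f in simp)
  show "\<exists>f\<in>RR {i, j, k}. \<forall>v. f (ph i j k v) = g v * h v" by (rule bexI[OF _ RR_mult[OF smI(2) f(1,3)]]) (use f in simp)
 qed
qed

lemma chart3_ph: "chart3 XX (ph i j k)"
proof
 have im: "ph i j k ` {v. f (ph i j k v) ~= 0} = {p \<in> UU {i, j, k}. f p ~= 0}" for f :: "3 chart_point set => complex"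
  unfolding range_ph[symmetric] by blast
 show "inj (ph i j k)" by (rule inj_ph)
 show "openin (zar XX) (ph i j k ` {v. ev P v ~= 0})" for P
 proof -
  obtain f where f: "f \<in> RR {i, j, k}" "\<forall>v. f (ph i j k v) = ev P v" using poly_RR by blast
  show ?thesis using open_RR[OF smI(2) f(1)] im[of f] f(2) by simp
 qed
 show "\<exists>P. ev P v ~= 0 & (\<forall>w. ev P w ~= 0 --> ph i j k w \<in> W)" if W: "openin (zar XX) W" "ph i j k v \<in> W" for W v
 proof -
  obtain f where f: "f \<in> RR {i, j, k}" "f (ph i j k v) ~= 0" "{q \<in> UU {i, j, k}. f q ~= 0} \<subseteq> W"
   using open_local[OF W ph_UU smI(2)] by (elim bexE conjE)
  obtain P where P: "\<forall>v. f (ph i j k v) = ev P v" using RR_poly[OF f(1)] by blast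
  show ?thesis by (rule exI[of _ P]) (use f P ph_UU in auto)
 qed
 show "\<exists>A B. ev B v ~= 0 & (\<forall>w. ph i j k w \<in> W & ev B w ~= 0 --> f (ph i j k w) = ev A w / ev B w)"
  if f: "f \<in> reg XX W" "ph i j k v \<in> W" for f W v
 proof -
  have "ph i j k v \<in> UU {i, j, k} Int W" using f(2) ph_UU by blast
  then obtain a b where ab: "a \<in> RR {i, j, k}" "b \<in> RR {i, j, k}" "b (ph i j k v) ~= 0"
   "\<forall>q\<in>UU {i, j, k} Int W. b q ~= 0 --> f q = a q / b q"
   using f(1) smI(2) unfolding reg_XX by blast
  obtain A where A: "\<forall>v. a (ph i j k v) = ev A v" using RR_poly[OF ab(1)] by blast
  obtain B where B: "\<forall>v. b (ph i j k v) = ev B v" using RR_poly[OF ab(2)] by blast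
  show ?thesis by (rule exI[of _ A], rule exI[of _ B]) (use ab A B ph_UU in auto)
 qed
 show "f \<in> reg XX (ph i j k ` {w. ev B w ~= 0})" if f: "!!w. ev B w ~= 0 ==> f (ph i j k w) = ev A w / ev B w" for B f A
 proof -
  obtain a where a: "a \<in> RR {i, j, k}" "\<forall>v. a (ph i j k v) = ev A v" using poly_RR by blast
  obtain b where b: "b \<in> RR {i, j, k}" "\<forall>v. b (ph i j k v) = ev B v" using poly_RR by blast
  have "f \<in> reg XX {p \<in> UU {i, j, k}. b p ~= 0}"
  proof (rule reg_quotient[OF smI(2) a(1) b(1)])
   fix p assume p: "p \<in> UU {i, j, k}" "b p ~= 0"
   then obtain w where "p = ph i j k w" using range_ph by blast
   then show "f p = a p / b p" using f[of w] a(2) b(2) p(2) by simp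
  qed
  then show ?thesis using im[of b] b(2) by simp
 qed
 show "W Int range (ph i j k) ~= {}" if W: "openin (zar XX) W" "W ~= {}" for W
  using torus_dense[OF W] tor_UU[OF _ smI(2)] range_ph by blast
qed

end

subsection \<open>The torus invariant prime divisors\<close>

text \<open>The union of the orbits whose cones contain the ray \<open>l\<close>.\<close>

definition DD :: "nat => 3 chart_point set set" where "DD l = PP - (\<Union>J\<in>{J \<in> K. l ~: J}. UU J)"

definition crd :: "nat => nat => nat => p3" where "crd i j l = (if l = i then cX else if l = j then cY else cZ)"

text \<open>Chosen without reference to a chart; \<open>YY_eq\<close> identifies it with a
  coordinate hyperplane in every smooth chart whose cone contains \<open>l\<close>.\<close>

definition YY :: "nat => 3 chart_point set set" where "YY l = (SOME Y. prime_divisor XX Y & Y \<subseteq> DD l)"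

lemma prime_crd: "prime (crd i j l)" using prime_cX prime_cY prime_cZ by (simp add: crd_def)

lemma closed_DD: "closedin (zar XX) (DD l)"
 unfolding DD_def points_XX[symmetric] using open_UU by (intro closedin_diff closedin_topspace openin_Union) auto

lemma DD_disjoint: "J \<in> K ==> l ~: J ==> DD l Int UU J = {}" by (auto simp: DD_def)

lemma UU_mono: assumes "J \<in> K" "I \<subseteq> J" shows "UU I \<subseteq> UU J"
proof
 fix p assume p: "p \<in> UU I"
 have I: "I \<in> K" using assms K_subset by blast
 then have P: "p \<in> PP" using p UU_PP by blast
 have "\<forall>m\<in>SG I. evp p m ~= None" using p UU_iff[OF P I] by blast
 then show "p \<in> UU J" using UU_iff[OF P assms(1)] SG_mono[OF assms(2)] by blast
qed

lemma sep_remove: "l \<in> I ==> pr a l > 0 ==> (!!l'. l' \<in> I ==> l' ~= l ==> pr a l' = 0) ==> sep a I (I - {l})"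
 by (auto simp: sep_def)

definition chi :: "mvec => 3 chart_point set => complex" where "chi m p = vl p m"

context
 fixes i j k :: nat
 assumes sm: "smooth i j k"
begin

interpretation C: chart3 XX "ph i j k" by (rule chart3_ph[OF sm])

lemma crd_dual: assumes "l \<in> {i, j, k}"
 obtains a where "a \<in> SG {i, j, k}" "pr a l = 1" "!!l'. l' \<in> {i, j, k} ==> l' ~= l ==> pr a l' = 0"
  "!!v. vl (ph i j k v) a = ev (crd i j l) v"
proof -
 note d = smI[OF sm]
 obtain a where a: "\<forall>l'\<in>{i, j, k}. pr a l' = (if l' = l then 1 else 0)" using pr_solve[OF d(1,6), of "%l'. if l' = l then 1 else 0"] by (elim exE)
 have S: "a \<in> SG {i, j, k}" unfolding SG_def using a by simp
 show thesis
  by (rule that[OF S]) (use a assms d(3-5) in \<open>auto simp: vl_ph[OF sm S] crd_def\<close>)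
qed

lemma vl_crd_0: "l \<in> {i, j, k} ==> m \<in> SG {i, j, k} ==> pr m l > 0 ==> ev (crd i j l) v = 0 ==> vl (ph i j k v) m = 0"
 using smI[OF sm] by (auto simp: vl_ph[OF sm] crd_def zero_power split: if_splits)

lemma ph_DD_iff: assumes l: "l \<in> {i, j, k}" shows "ph i j k v \<in> DD l \<longleftrightarrow> ev (crd i j l) v = 0"
proof
 note d = smI[OF sm]
 assume D: "ph i j k v \<in> DD l"
 obtain a where a: "a \<in> SG {i, j, k}" "pr a l = 1" "!!l'. l' \<in> {i, j, k} ==> l' ~= l ==> pr a l' = 0"
  "!!v. vl (ph i j k v) a = ev (crd i j l) v" by (rule crd_dual[OF l]) simp
 have J: "{i, j, k} - {l} \<in> K" by (rule K_subset[OF d(2) Diff_subset])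
 have "sep a {i, j, k} ({i, j, k} - {l})" by (rule sep_remove[OF l]) (simp add: a(2), rule a(3))
 moreover have "ph i j k v ~: UU ({i, j, k} - {l})" using D DD_disjoint[OF J, of l] by blast
 ultimately show "ev (crd i j l) v = 0" using UU_sep[OF d(2) J _ ph_UU[OF sm]] a(4) by simp
next
 note d = smI[OF sm]
 assume z: "ev (crd i j l) v = 0"
 have "ph i j k v ~: UU J" if J: "J \<in> K" "l ~: J" for J
 proof -
  obtain m where m: "sep m {i, j, k} J" using sep_exists[OF d(2) J(1)] by (elim exE)
  have "vl (ph i j k v) m = 0" by (rule vl_crd_0[OF l sep_SG(1)[OF m] _ z]) (use sepD[OF m] l J in blast)
  then show ?thesis using UU_sep[OF d(2) J(1) m ph_UU[OF sm]] by simp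
 qed
 then show "ph i j k v \<in> DD l" using ph_UU[OF sm] UU_PP[OF d(2)] by (auto simp: DD_def)
qed

lemma hyp_in_DD: "l \<in> {i, j, k} ==> C.hyp (crd i j l) \<subseteq> DD l"
 by (rule C.cl_subset[OF closed_DD]) (simp add: ph_DD_iff)

lemma prime_in_DD:
 assumes "l \<in> {i, j, k}" "prime_divisor XX Y" "Y Int UU {i, j, k} ~= {}" "Y \<subseteq> DD l"
 shows "Y = C.hyp (crd i j l)"
proof -
 obtain p where p: "prime p" "Y = C.hyp p" using C.prime_divisor_eq_hyp[OF assms(2)] assms(3) range_ph[OF sm] by auto
 have "ev (crd i j l) v = 0" if "ev p v = 0" for v
  using that assms(4) p(2) C.hyp_iff[of v p] ph_DD_iff[OF assms(1)] by blast
 then have "p dvd crd i j l" using prime_dvd_iff[OF p(1)] by blast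
 then show ?thesis using primes_dvd_imp_eq[OF p(1) prime_crd] p(2) by blast
qed

text \<open>The point with coordinate 0 at \<open>l\<close> and 1 elsewhere lies in the orbit of
  \<open>l\<close>. It is visible in the chart \<open>UU {l}\<close>, which is part of the chart of
  every cone through \<open>l\<close>.\<close>

lemma orbit_point: assumes "l \<in> {i, j, k}" shows "C.hyp (crd i j l) Int UU {l} ~= {}"
proof -
 note d = smI[OF sm]
 have J: "{l} \<in> K" by (rule K_subset[OF d(2)]) (use assms in simp)
 define v where "v = Pt (if l = i then 0 else 1) (if l = j then 0 else 1) (if l = k then 0 else 1)"
 have v: "ev (crd i j l) v = 0" using assms d(3-5) by (auto simp: v_def crd_def)
 obtain m where m: "sep m {i, j, k} {l}" using sep_exists[OF d(2) J] by (elim exE)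
 have "pr m l = 0" using sepD(1)[OF m] assms by simp
 then have "vl (ph i j k v) m ~= 0" unfolding vl_ph[OF sm sep_SG(1)[OF m]] by (auto simp: v_def)
 then have "ph i j k v \<in> UU {l}" using UU_sep[OF d(2) J m ph_UU[OF sm]] by simp
 then show ?thesis using v C.hyp_iff[of v "crd i j l"] by blast
qed

lemma torus_vl:
 assumes "px v ~= 0" "py v ~= 0" "pz v ~= 0"
 shows "vl (ph i j k v) m = px v powi pr m i * py v powi pr m j * pz v powi pr m k" "ph i j k v \<in> UU {}"
proof -
 note d = smI[OF sm]
 let ?I = "{i, j, k}"
 obtain m0 where m0: "\<forall>l\<in>?I. pr m0 l = \<bar>pr m l\<bar>" using pr_solve[OF d(1,6), of "%l. \<bar>pr m l\<bar>"] by (elim exE)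
 have S: "m0 \<in> SG ?I" "m + m0 \<in> SG ?I" using m0 by (auto simp: SG_def)
 have nz: "mo i j k v m' ~= 0" if "m' \<in> SG ?I" for m' using assms that by (simp add: mo_def)
 have "evp (ph i j k v) m = Some (mo i j k v (m + m0) / mo i j k v m0)"
  unfolding ph_def evp_tp[OF d(2) mo_ch[OF sm]] by (rule Ext_eq[OF d(2) mo_ch[OF sm] S(1) nz[OF S(1)] S(2)])
 then have "vl (ph i j k v) m = mo i j k v (m + m0) / mo i j k v m0" by (simp add: vl_def)
 moreover have "x ^ nat (b + \<bar>b\<bar>) = x powi b * x ^ nat \<bar>b\<bar>" if "x ~= 0" for x :: complex and b
  using that by (simp add: power_int_add flip: power_int_of_nat)
 ultimately show "vl (ph i j k v) m = px v powi pr m i * py v powi pr m j * pz v powi pr m k"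
  using assms m0 S nz[OF S(1)] by (simp add: mo_def field_simps)
 obtain s where s: "sep s ?I {}" using sep_exists[OF d(2) empty_K] by (elim exE)
 show "ph i j k v \<in> UU {}"
  using UU_sep[OF d(2) empty_K s ph_UU[OF sm]] assms unfolding vl_ph[OF sm sep_SG(1)[OF s]] by simp
qed

lemma rep_chi:
 "C.rep (chi m) (cX ^ nat (pr m i) * cY ^ nat (pr m j) * cZ ^ nat (pr m k))
   (cX ^ nat (- pr m i) * cY ^ nat (- pr m j) * cZ ^ nat (- pr m k)) (cX * cY * cZ)"
 unfolding C.rep_def
proof (intro allI impI)
 fix v assume "ev (cX * cY * cZ) v ~= 0"
 then have v: "px v ~= 0" "py v ~= 0" "pz v ~= 0" by auto
 have "x powi b = x ^ nat b / x ^ nat (- b)" if "x ~= 0" for x :: complex and b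
  using that by (simp add: power_int_def divide_inverse power_inverse)
 then show "ev (cX ^ nat (- pr m i) * cY ^ nat (- pr m j) * cZ ^ nat (- pr m k)) v ~= 0 &
  chi m (ph i j k v) = ev (cX ^ nat (pr m i) * cY ^ nat (pr m j) * cZ ^ nat (pr m k)) v /
   ev (cX ^ nat (- pr m i) * cY ^ nat (- pr m j) * cZ ^ nat (- pr m k)) v"
  using v by (simp add: chi_def torus_vl[OF v])
qed

lemma chi_rat_unit: "chi m \<in> rat_units XX"
 unfolding C.rat_units_iff
 by (intro exI conjI) (rule rep_chi, simp_all add: cX_def cY_def cZ_def)

lemma principal_chi:
 assumes "prime p"
 shows "principal_div XX (chi m) (C.hyp p) = (\<Sum>l\<in>{i, j, k}. if C.hyp p = C.hyp (crd i j l) then pr m l else 0)"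
proof -
 note d = smI[OF sm]
 have m: "multiplicity p (q ^ n) = (if p = q then n else 0)" if "prime q" for q :: p3 and n
 proof (cases "p = q")
  case True
  moreover have "p ~= 0" "~ is_unit p" using assms by (auto simp: not_prime_unit)
  ultimately show ?thesis using multiplicity_same_power[of p n] by simp
 next
  case False
  then have "~ p dvd q ^ n" using prime_dvd_power[OF assms, of q n] primes_dvd_imp_eq[OF assms that] by blast
  then show ?thesis using False by (simp add: not_dvd_imp_multiplicity_0)
 qed
 have nz: "cX ~= 0" "cY ~= 0" "cZ ~= 0" by (auto simp: cX_def cY_def cZ_def)
 then have "multiplicity p (cX ^ a * cY ^ b * cZ ^ c) = multiplicity p (cX ^ a) + multiplicity p (cY ^ b) + multiplicity p (cZ ^ c)" for a b c
  by (simp add: C.mult_mult[OF assms])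
 then have mm: "int (multiplicity p (cX ^ a * cY ^ b * cZ ^ c)) =
   (if p = cX then int a else 0) + (if p = cY then int b else 0) + (if p = cZ then int c else 0)" for a b c
  unfolding m[OF prime_cX] m[OF prime_cY] m[OF prime_cZ] by simp
 have q: "(if P then int (nat x) else 0) - (if P then int (nat (- x)) else 0) = (if P then x else 0)" for P x by simp
 have "principal_div XX (chi m) (C.hyp p) =
  (if p = cX then pr m i else 0) + (if p = cY then pr m j else 0) + (if p = cZ then pr m k else 0)"
  unfolding C.principal_div_hyp[OF assms rep_chi no_zero_divisors[OF no_zero_divisors[OF nz(1,2)] nz(3)]
   no_zero_divisors[OF no_zero_divisors[OF nz(1,2)[THEN power_not_zero]] nz(3)[THEN power_not_zero]]] mm
  using q[of "p = cX" "pr m i"] q[of "p = cY" "pr m j"] q[of "p = cZ" "pr m k"] by linarith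
 also have "(if p = cX then pr m i else 0) + (if p = cY then pr m j else 0) + (if p = cZ then pr m k else 0)
  = (\<Sum>l\<in>{i, j, k}. if p = crd i j l then pr m l else 0)"
 proof -
  have "j ~= i" "k ~= i" "k ~= j" using d(3-5) by simp_all
  then show ?thesis by (simp add: crd_def)
 qed
 finally show ?thesis unfolding C.hyp_eq_iff[OF assms prime_crd] .
qed

end

lemma ne_136: "2 \<in> J | 4 \<in> J | 5 \<in> J ==> J ~= {1, 3, 6 :: nat}" by auto

lemma smoothI: "{i, j, k} \<in> Mx ==> 2 \<in> {i, j, k} | 4 \<in> {i, j, k} | 5 \<in> {i, j, k} ==> distinct [i, j, k] ==> smooth i j k"
 unfolding smooth_def using ne_136[of "{i, j, k}"] by simp

lemma smooth_instances:
 "smooth 2 3 5" "smooth 1 3 5" "smooth 1 4 5" "smooth 2 3 6" "smooth 1 4 6" "smooth 4 6 2" "smooth 4 6 1"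
 "smooth 1 5 4" "smooth 1 5 3" "smooth 2 5 4" "smooth 2 5 3"
 by (rule smoothI; simp add: Mx_def insert_commute)+

lemma smooth_ex: assumes "J \<in> Mx" "J ~= {1, 3, 6}" shows "\<exists>i j k. J = {i, j, k} & smooth i j k"
proof -
 have "smooth 2 4 5" "smooth 2 4 6" by (rule smoothI; simp add: Mx_def insert_commute)+
 then show ?thesis using smooth_instances(1-5) assms by (fastforce simp: Mx_def)
qed

section \<open>The singular fixed point\<close>

lemma I0: "{1, 3, 6} \<in> Mx" "{1, 3, 6} \<in> K" by (auto simp: Mx_def K_def)

lemma sub_I0: assumes "J \<subset> {1, 3, 6}" shows "\<exists>J'\<in>Mx. J' ~= {1, 3, 6} & J \<subseteq> J'"
proof -
 obtain a where "a \<in> {1, 3, 6}" "J \<subseteq> {1, 3, 6} - {a}" using assms by auto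
 then consider "J \<subseteq> {3, 6}" | "J \<subseteq> {1, 6}" | "J \<subseteq> {1, 3}" by fastforce
 then show ?thesis
 proof cases
  case 1 then show ?thesis by (intro bexI[of _ "{2, 3, 6}"] conjI ne_136) (auto simp: Mx_def)
 next
  case 2 then show ?thesis by (intro bexI[of _ "{1, 4, 6}"] conjI ne_136) (auto simp: Mx_def)
 next
  case 3 then show ?thesis by (intro bexI[of _ "{1, 3, 5}"] conjI ne_136) (auto simp: Mx_def)
 qed
qed

text \<open>For \<open>m\<close> nonzero, the rays on which \<open>m\<close> vanishes span a proper
  face, which lies in a smooth cone; if \<open>vl p m\<close> were nonzero, \<open>p\<close> would
  be in the chart of that face.\<close>

lemma UU_I0: assumes p: "p \<in> UU {1, 3, 6}" and n: "!!i j k. smooth i j k ==> p ~: UU {i, j, k}" and m: "m \<in> SG {1, 3, 6}"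
 shows "vl p m = (if m = 0 then 1 else 0)"
proof (cases "m = 0")
 case True
 then show ?thesis using vl_0 UU_PP[OF I0(2)] p by auto
next
 case False
 define J where "J = {l \<in> {1, 3, 6}. pr m l = 0}"
 have "J ~= {1, 3, 6}"
 proof
  assume "J = {1, 3, 6}"
  then have "\<forall>l\<in>{1, 3, 6}. pr m l = pr 0 l" by (auto simp: J_def)
  then show False using pr_unique[OF I0(1)] False by blast
 qed
 moreover have "J \<subseteq> {1, 3, 6}" unfolding J_def by blast
 ultimately have "J \<subset> {1, 3, 6}" by blast
 then obtain J' where J': "J' \<in> Mx" "J' ~= {1, 3, 6}" "J \<subseteq> J'" using sub_I0 by blast
 have s: "sep m {1, 3, 6} J" using m by (auto simp: sep_def J_def SG_def)
 have "p ~: UU J'" using smooth_ex[OF J'(1,2)] n by blast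
 then have "p ~: UU J" using UU_mono[OF MxK[OF J'(1)] J'(3)] by blast
 then show ?thesis using UU_sep[OF I0(2) K_subset[OF MxK[OF J'(1)] J'(3)] s p] False by simp
qed

text \<open>A curve in the orbit of the first ray which tends to the fixed point of the singular cone.\<close>

definition gam :: "complex => mvec => complex" where
 "gam s m = (if m \<in> SG {1, 3, 6} & pr m 1 = 0 then s ^ nat (pr m 3 + pr m 6) else 0)"

lemma gam_ch: "gam s \<in> ch {1, 3, 6}"
 unfolding ch_iff[OF I0(2)]
proof (intro conjI ballI allI impI)
 fix m m' assume "m \<in> SG {1, 3, 6}" "m' \<in> SG {1, 3, 6}"
 then have "pr m 1 >= 0" "pr m 3 + pr m 6 >= 0" "pr m' 1 >= 0" "pr m' 3 + pr m' 6 >= 0" "m \<in> SG {1, 3, 6}" "m' \<in> SG {1, 3, 6}"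
  "m + m' \<in> SG {1, 3, 6}" by (auto simp: SG_def)
 moreover from this have "nat (pr m 3 + pr m' 3 + (pr m 6 + pr m' 6)) = nat (pr m 3 + pr m 6) + nat (pr m' 3 + pr m' 6)" by linarith
 ultimately show "gam s (m + m') = gam s m * gam s m'" by (simp add: gam_def power_add add_nonneg_eq_0_iff)
qed (simp_all add: gam_def)

lemma gam_UU: "tp {1, 3, 6} (gam s) \<in> UU {1, 3, 6}" using gam_ch by (auto simp: UU_def)

lemma vl_gam: "m \<in> SG {1, 3, 6} ==> vl (tp {1, 3, 6} (gam s)) m = (if pr m 1 = 0 then s ^ nat (pr m 3 + pr m 6) else 0)"
 unfolding vl_tp[OF I0(2) gam_ch] by (simp add: gam_def)

lemma gam_DD: "tp {1, 3, 6} (gam s) \<in> DD 1"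
proof -
 have "tp {1, 3, 6} (gam s) ~: UU J" if J: "J \<in> K" "1 ~: J" for J
 proof -
  obtain m where m: "sep m {1, 3, 6} J" using sep_exists[OF I0(2) J(1)] by (elim exE)
  have "pr m 1 > 0" by (rule sepD(2)[OF m]) (use J in auto)
  then show ?thesis using UU_sep[OF I0(2) J(1) m gam_UU] vl_gam[OF sep_SG(1)[OF m]] by simp
 qed
 then show ?thesis using gam_UU UU_PP[OF I0(2)] by (auto simp: DD_def)
qed

lemma gam_135: assumes "s ~= 0" shows "tp {1, 3, 6} (gam s) \<in> UU {1, 3, 5}"
proof -
 have J: "{1, 3, 5} \<in> K" using MxK smI(1)[OF smooth_instances(2)] by blast
 obtain m where m: "sep m {1, 3, 6} {1, 3, 5}" using sep_exists[OF I0(2) J] by (elim exE)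
 have "pr m 1 = 0" by (rule sepD(1)[OF m]) auto
 then show ?thesis using UU_sep[OF I0(2) J m gam_UU] vl_gam[OF sep_SG(1)[OF m]] assms by simp
qed

lemma nonsmooth_point:
 assumes p: "p \<in> points XX" "!!i j k. smooth i j k ==> p ~: UU {i, j, k}"
 shows "p \<in> UU {1, 3, 6}" "m \<in> SG {1, 3, 6} ==> vl p m = (if m = 0 then 1 else 0)"
proof -
 obtain I where I: "I \<in> K" "p \<in> UU I" using p(1) unfolding points_XX by (auto simp: PP_def)
 then obtain J where J: "J \<in> Mx" "I \<subseteq> J" by (auto simp: K_def)
 have "p \<in> UU J" using UU_mono[OF MxK[OF J(1)] J(2)] I(2) by blast
 moreover have "J = {1, 3, 6}"
 proof (rule ccontr)
  assume "J ~= {1, 3, 6}"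
  from smooth_ex[OF J(1) this] obtain i j k where "J = {i, j, k}" "smooth i j k" by (elim exE conjE)
  then show False using p(2)[of i j k] `p \<in> UU J` by blast
 qed
 ultimately show 1: "p \<in> UU {1, 3, 6}" by simp
 show "vl p m = (if m = 0 then 1 else 0)" if "m \<in> SG {1, 3, 6}" by (rule UU_I0[OF 1 p(2) that])
qed

lemma nonsmooth_unique:
 assumes p: "p \<in> points XX" "!!i j k. smooth i j k ==> p ~: UU {i, j, k}"
  and q: "q \<in> points XX" "!!i j k. smooth i j k ==> q ~: UU {i, j, k}"
 shows "p = q"
proof (rule UU_eqI[OF I0(2) nonsmooth_point(1)[OF p] nonsmooth_point(1)[OF q]])
 fix m assume m: "m \<in> SG {1, 3, 6}"
 show "vl p m = vl q m" by (rule trans[OF nonsmooth_point(2)[OF p m] nonsmooth_point(2)[OF q m, symmetric]])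
qed

text \<open>Otherwise \<open>Y\<close> would be the singular fixed point alone. The curve
  \<open>gam\<close> runs in the divisor of the first ray and tends to this point, which is thus
  strictly contained in a prime divisor and has codimension at least 2.\<close>

lemma prime_divisor_meets_smooth:
 assumes Y: "prime_divisor XX Y" shows "\<exists>i j k. smooth i j k & Y Int UU {i, j, k} ~= {}"
proof (rule ccontr)
 assume "~ ?thesis"
 then have n: "!!i j k. smooth i j k ==> Y Int UU {i, j, k} = {}" by blast
 have irr: "irreducible_closed (zar XX) Y" and cod: "codim (zar XX) Y = 1" using Y by (auto simp: prime_divisor_def)
 have Yc: "closedin (zar XX) Y" "Y ~= {}" using irr by (auto simp: irreducible_closed_def)
 have ns: "q \<in> points XX" "smooth i j k ==> q ~: UU {i, j, k}" if "q \<in> Y" for q i j k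
  using that closedin_subset[OF Yc(1)] n by blast+
 have YI: "q \<in> UU {1, 3, 6}" if q: "q \<in> Y" for q by (rule nonsmooth_point(1)[OF ns(1)[OF q] ns(2)[OF q]])
 have val: "vl q m = (if m = 0 then 1 else 0)" if q: "q \<in> Y" and m: "m \<in> SG {1, 3, 6}" for q m
  by (rule nonsmooth_point(2)[OF ns(1)[OF q] ns(2)[OF q] m])
 obtain p where p: "p \<in> Y" using Yc(2) by blast
 have Yp: "Y = {p}" using nonsmooth_unique[OF ns ns] p by blast
 interpret C: chart3 XX "ph 1 3 5" by (rule chart3_ph[OF smooth_instances(2)])
 define H where "H = C.hyp (crd 1 3 1)"
 have gH: "tp {1, 3, 6} (gam s) \<in> H" if s: "s ~= 0" for s
 proof -
  obtain v where v: "tp {1, 3, 6} (gam s) = ph 1 3 5 v" using gam_135[OF s] range_ph[OF smooth_instances(2)] by (metis imageE)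
  then have "ev (crd 1 3 1) v = 0" using ph_DD_iff[OF smooth_instances(2), of 1 v] gam_DD[of s] by simp
  then show ?thesis unfolding H_def v C.hyp_iff .
 qed
 have pH: "p \<in> H"
 proof (rule ccontr)
  assume "p ~: H"
  then have "p \<in> points XX - H" using p closedin_subset[OF Yc(1)] by blast
  moreover have "openin (zar XX) (points XX - H)" unfolding H_def using C.closed_cl by blast
  ultimately have "\<exists>f\<in>RR {1, 3, 6}. f p ~= 0 & {q \<in> UU {1, 3, 6}. f q ~= 0} \<subseteq> points XX - H"
   by (intro open_local[OF _ _ YI[OF p] I0(2)])
  then obtain f where f: "f \<in> RR {1, 3, 6}" "f p ~= 0" "{q \<in> UU {1, 3, 6}. f q ~= 0} \<subseteq> points XX - H"
   by (elim bexE conjE)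
  obtain F c where F: "finite F" "F \<subseteq> SG {1, 3, 6}" "!!q. q \<in> UU {1, 3, 6} ==> f q = (\<Sum>m\<in>F. c m * vl q m)"
   using f(1) unfolding RR_def by blast
  \<comment> \<open>\<open>Q\<close> is \<open>f\<close> along the curve and its value at 0 is
    \<open>f p\<close>; so \<open>Q\<close> is a nonzero polynomial, and \<open>f\<close> is nonzero
    at some point of the curve with \<open>s\<close> other than 0.\<close>
  define Q where "Q = (\<Sum>m\<in>F. if pr m 1 = 0 then monom (c m) (nat (pr m 3 + pr m 6)) else 0)"
  have Q: "poly Q s = f (tp {1, 3, 6} (gam s))" for s
   unfolding F(3)[OF gam_UU] Q_def poly_sum
  proof (rule sum.cong[OF refl])
   fix m assume "m \<in> F"
   then have "m \<in> SG {1, 3, 6}" using F(2) by blast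
   from vl_gam[OF this, of s]
   show "poly (if pr m 1 = 0 then monom (c m) (nat (pr m 3 + pr m 6)) else 0) s = c m * vl (tp {1, 3, 6} (gam s)) m"
    by (simp only:) (simp add: poly_monom)
  qed
  have "poly Q 0 = f p"
   unfolding F(3)[OF YI[OF p]] Q_def poly_sum
  proof (rule sum.cong[OF refl])
   fix m assume "m \<in> F"
   then have m: "m \<in> SG {1, 3, 6}" using F(2) by blast
   then have "pr m 1 = 0 & nat (pr m 3 + pr m 6) = 0 \<longleftrightarrow> (\<forall>l\<in>{1, 3, 6}. pr m l = pr 0 l)" by (auto simp: SG_def)
   also have "... \<longleftrightarrow> m = 0" using pr_unique[OF I0(1)] by auto
   finally show "poly (if pr m 1 = 0 then monom (c m) (nat (pr m 3 + pr m 6)) else 0) 0 = c m * vl p m"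
    unfolding val[OF p m] by (auto simp: poly_monom)
  qed
  then have "Q * [:0, 1:] ~= 0" using f(2) by auto
  then obtain s where s: "poly (Q * [:0, 1:]) s ~= 0" using poly_all_0_iff_0 by metis
  then have "f (tp {1, 3, 6} (gam s)) ~= 0" "s ~= 0" using Q[of s] by auto
  then show False using f(3) gam_UU[of s] gH by blast
 qed
 have "H ~= {p}" using gH[of 1] gam_135[of 1] n[OF smooth_instances(2)] p one_neq_zero by blast
 then have 1: "Y \<subset> H" using pH Yp by blast
 have 2: "H \<subset> points XX" unfolding H_def using C.hyp_neq_points[OF prime_crd] closedin_subset[OF C.closed_cl] by blast
 have "\<exists>Z. irreducible_chain (zar XX) Z 2 & Z 0 = Y"
  by (rule chain3[OF irr _ C.irreducible_points 1 2]) (unfold H_def, rule C.irreducible_hyp[OF prime_crd])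
 then show False using cod codim_eq_1_iff[of "zar XX" Y] by blast
qed

subsection \<open>Weil divisors and principal divisors\<close>

abbreviation hh :: "nat => nat => nat => p3 => 3 chart_point set set" where
 "hh i j k p \<equiv> chart3.cl XX (ph i j k) {v. ev p v = 0}"

abbreviation L6 :: "nat set" where "L6 \<equiv> {1, 2, 3, 4, 5, 6}"

lemma smooth_L6: assumes "smooth i j k" shows "{i, j, k} \<subseteq> L6"
 using smI(1)[OF assms] unfolding Mx_def by fast

lemma smooth_cover: assumes "l \<in> L6" shows "\<exists>i j k. smooth i j k & l \<in> {i, j, k}"
proof -
 have "l \<in> {2, 3, 5} | l \<in> {1, 4, 6}" using assms by auto
 then show ?thesis using smooth_instances(1,5) by blast
qed

lemma YY_prime: assumes "l \<in> L6" shows "prime_divisor XX (YY l)" "YY l \<subseteq> DD l"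
proof -
 obtain i j k where s: "smooth i j k" "l \<in> {i, j, k}" using smooth_cover[OF assms] by (elim exE conjE)
 have "\<exists>Y. prime_divisor XX Y & Y \<subseteq> DD l"
  by (intro exI[of _ "hh i j k (crd i j l)"] conjI chart3.prime_divisor_hyp[OF chart3_ph[OF s(1)]] prime_crd hyp_in_DD[OF s])
 then have "prime_divisor XX (YY l) & YY l \<subseteq> DD l" unfolding YY_def by (rule someI_ex)
 then show "prime_divisor XX (YY l)" "YY l \<subseteq> DD l" by auto
qed

text \<open>The components found in different charts are compared through \<open>UU {l}\<close>,
  which is contained in all of these charts.\<close>

lemma YY_eq: assumes s: "smooth i j k" and l: "l \<in> {i, j, k}" shows "YY l = hh i j k (crd i j l)"
proof -
 have l6: "l \<in> L6" using smooth_L6[OF s] l by blast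
 obtain i' j' k' where s': "smooth i' j' k'" "YY l Int UU {i', j', k'} ~= {}"
  using prime_divisor_meets_smooth[OF YY_prime(1)[OF l6]] by (elim exE conjE)
 have l': "l \<in> {i', j', k'}"
 proof (rule ccontr)
  assume "l ~: {i', j', k'}"
  then have "DD l Int UU {i', j', k'} = {}" by (rule DD_disjoint[OF smI(2)[OF s'(1)]])
  then show False using s'(2) YY_prime(2)[OF l6] by blast
 qed
 have "YY l = hh i' j' k' (crd i' j' l)" by (rule prime_in_DD[OF s'(1) l' YY_prime(1)[OF l6] s'(2) YY_prime(2)[OF l6]])
 then have "YY l Int UU {l} ~= {}" using orbit_point[OF s'(1) l'] by simp
 moreover have "UU {l} \<subseteq> UU {i, j, k}" by (rule UU_mono[OF smI(2)[OF s]]) (use l in simp)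
 ultimately have "YY l Int UU {i, j, k} ~= {}" by blast
 then show ?thesis by (rule prime_in_DD[OF s l YY_prime(1)[OF l6] _ YY_prime(2)[OF l6]])
qed

lemma YY_disjoint: "l \<in> L6 ==> I \<in> K ==> l ~: I ==> YY l Int UU I = {}"
 using YY_prime(2)[of l] DD_disjoint[of I l] by blast

lemma YY_orbit: assumes "l \<in> L6" shows "YY l Int UU {l} ~= {}" "{l} \<in> K"
proof -
 obtain i j k where s: "smooth i j k" "l \<in> {i, j, k}" using smooth_cover[OF assms] by (elim exE conjE)
 show "YY l Int UU {l} ~= {}" unfolding YY_eq[OF s] by (rule orbit_point[OF s])
 show "{l} \<in> K" by (rule K_subset[OF smI(2)[OF s(1)]]) (use s(2) in simp)
qed

lemma YY_eq_iff: assumes "l \<in> L6" "l' \<in> L6" shows "YY l = YY l' \<longleftrightarrow> l = l'"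
proof
 assume "YY l = YY l'"
 then have "YY l Int UU {l'} ~= {}" using YY_orbit(1)[OF assms(2)] by simp
 then show "l = l'" using YY_disjoint[OF assms(1) YY_orbit(2)[OF assms(2)]] by blast
qed simp

definition TT :: "(nat => int) => 3 chart_point set set => int" where
 "TT d Y = (\<Sum>l\<in>L6. if Y = YY l then d l else 0)"

lemma TT_YY: assumes "l \<in> L6" shows "TT d (YY l) = d l"
proof -
 have "TT d (YY l) = (\<Sum>l'\<in>L6. if l = l' then d l' else 0)"
  unfolding TT_def by (rule sum.cong[OF refl]) (use YY_eq_iff[OF assms] in auto)
 also have "... = d l" using sum.delta'[of L6 l d] assms by simp
 finally show ?thesis .
qed

lemma TT_cong: "(!!l. l \<in> L6 ==> Y = YY l ==> d l = d' l) ==> TT d Y = TT d' Y"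
 unfolding TT_def by (rule sum.cong) auto

lemma TT_linear: "TT (%l. a * d l + b * e l) Y = a * TT d Y + b * TT e Y"
 unfolding TT_def sum_distrib_left by (auto simp: sum.distrib[symmetric] intro!: sum.cong)

lemma prime_divisor_chart:
 assumes "prime_divisor XX Y"
 obtains i j k p where "smooth i j k" "prime p" "Y = hh i j k p" "Y Int range (ph i j k) ~= {}"
proof -
 obtain i j k where s: "smooth i j k" "Y Int UU {i, j, k} ~= {}" using prime_divisor_meets_smooth[OF assms] by (elim exE conjE)
 then have "Y Int range (ph i j k) ~= {}" using range_ph by simp
 moreover from chart3.prime_divisor_eq_hyp[OF chart3_ph[OF s(1)] assms this] obtain p where "prime p" "Y = hh i j k p" by (elim exE conjE)
 ultimately show thesis using that s(1) by blast
qed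

lemma principal_div_chi: assumes Y: "prime_divisor XX Y" shows "principal_div XX (chi m) Y = TT (pr m) Y"
proof -
 obtain i j k p where s: "smooth i j k" and p: "prime p" "Y = hh i j k p" "Y Int range (ph i j k) ~= {}" by (rule prime_divisor_chart[OF Y])
 have "principal_div XX (chi m) Y = (\<Sum>l\<in>{i, j, k}. if Y = hh i j k (crd i j l) then pr m l else 0)"
  unfolding p(2) by (rule principal_chi[OF s p(1)])
 also have "... = (\<Sum>l\<in>{i, j, k}. if Y = YY l then pr m l else 0)"
  by (rule sum.cong[OF refl]) (simp only: YY_eq[OF s])
 also have "... = TT (pr m) Y" unfolding TT_def
 proof (rule sum.mono_neutral_left)
  show "\<forall>l\<in>L6 - {i, j, k}. (if Y = YY l then pr m l else 0) = 0"
  proof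
   fix l assume l: "l \<in> L6 - {i, j, k}"
   then have "YY l Int UU {i, j, k} = {}" by (intro YY_disjoint smI(2)[OF s]) auto
   then show "(if Y = YY l then pr m l else 0) = 0" using p(3) range_ph[OF s] by auto
  qed
 qed (use smooth_L6[OF s] in auto)
 finally show ?thesis .
qed

lemma rat_mult: "f \<in> rat_units XX ==> g \<in> rat_units XX ==> (%x. f x * g x) \<in> rat_units XX"
 and rat_inverse: "f \<in> rat_units XX ==> (%x. inverse (f x)) \<in> rat_units XX"
 and rat_1: "(%x. 1) \<in> rat_units XX"
 by (rule chart3.rat_units_mult[OF chart3_ph[OF smooth_instances(1)]] chart3.rat_units_inverse[OF chart3_ph[OF smooth_instances(1)]]
   chart3.rat_units_1[OF chart3_ph[OF smooth_instances(1)]]; assumption?)+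

lemma pd_mult: assumes "f \<in> rat_units XX" "g \<in> rat_units XX"
 shows "principal_div XX (%x. f x * g x) Y = principal_div XX f Y + principal_div XX g Y"
proof (cases "prime_divisor XX Y")
 case True
 obtain i j k p where s: "smooth i j k" and p: "Y Int range (ph i j k) ~= {}" by (rule prime_divisor_chart[OF True])
 show ?thesis by (rule chart3.principal_div_mult[OF chart3_ph[OF s] p assms])
qed (simp add: principal_div_def)

lemma pd_inverse: assumes "f \<in> rat_units XX"
 shows "principal_div XX (%x. inverse (f x)) Y = - principal_div XX f Y"
proof (cases "prime_divisor XX Y")
 case True
 obtain i j k p where s: "smooth i j k" and p: "Y Int range (ph i j k) ~= {}" by (rule prime_divisor_chart[OF True])
 show ?thesis by (rule chart3.principal_div_inverse[OF chart3_ph[OF s] p assms])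
qed (simp add: principal_div_def)

lemma pd_1: "principal_div XX (%_. 1) Y = 0"
proof (cases "prime_divisor XX Y")
 case True
 obtain i j k p where s: "smooth i j k" and p: "Y Int range (ph i j k) ~= {}" by (rule prime_divisor_chart[OF True])
 show ?thesis by (rule chart3.principal_div_1[OF chart3_ph[OF s] p])
qed (simp add: principal_div_def)

lemma pd_germ_eq: assumes "f \<in> rat_units XX" "germ_eq XX (points XX) f g"
 shows "principal_div XX f Y = principal_div XX g Y"
proof (cases "prime_divisor XX Y")
 case True
 obtain i j k p where s: "smooth i j k" and p: "Y Int range (ph i j k) ~= {}" by (rule prime_divisor_chart[OF True])
 show ?thesis by (rule chart3.germ_eq_principal_div(2)[OF chart3_ph[OF s] p assms])
qed (simp add: principal_div_def)

lemma pd_power: assumes "f \<in> rat_units XX"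
 shows "(%x. f x ^ n) \<in> rat_units XX & principal_div XX (%x. f x ^ n) Y = int n * principal_div XX f Y"
proof (induct n)
 case 0 then show ?case using rat_1 pd_1 by simp
next
 case (Suc n)
 then show ?case using rat_mult[OF assms, of "%x. f x ^ n"] pd_mult[OF assms, of "%x. f x ^ n" Y] by (simp add: algebra_simps)
qed

lemma pd_const: assumes "c ~= 0" shows "(%_. c) \<in> rat_units XX" "principal_div XX (%_. c) Y = 0"
proof -
 have r: "chart3.rep (ph i j k) (%_. c) (cC c) 1 1" if "smooth i j k" for i j k
  unfolding chart3.rep_def[OF chart3_ph[OF that]] by simp
 have nz: "cC c ~= 0" using assms by (simp add: cC_def)
 show "(%_. c) \<in> rat_units XX"
  unfolding chart3.rat_units_iff[OF chart3_ph[OF smooth_instances(1)]] using r[OF smooth_instances(1)] nz one_neq_zero by blast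
 show "principal_div XX (%_. c) Y = 0"
 proof (cases "prime_divisor XX Y")
  case True
  obtain i j k p where s: "smooth i j k" and p: "prime p" "Y = hh i j k p" by (rule prime_divisor_chart[OF True])
  have "is_unit (cC c)" using assms is_unit_p3 by blast
  then have "multiplicity p (cC c) = 0" by (simp add: multiplicity_unit_right)
  then show ?thesis unfolding p(2) chart3.principal_div_hyp[OF chart3_ph[OF s] p(1) r[OF s] one_neq_zero nz] by simp
 qed (simp add: principal_div_def)
qed

lemma pd_weil: assumes "f \<in> rat_units XX" shows "principal_div XX f \<in> weil_divisors XX"
proof -
 let ?S = "{(i, j, k). smooth i j k}"
 have "t \<in> L6 \<times> L6 \<times> L6" if t: "t \<in> ?S" for t
 proof -
  obtain i j k where ijk: "t = (i, j, k)" by (rule prod_cases3)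
  have "smooth i j k" using t ijk by simp
  show ?thesis using smooth_L6[OF `smooth i j k`] unfolding ijk insert_subset mem_Sigma_iff by (elim conjE, intro conjI)
 qed
 then have "?S \<subseteq> L6 \<times> L6 \<times> L6" by (rule subsetI)
 then have fS: "finite ?S" by (rule finite_subset) auto
 have "{Y. principal_div XX f Y ~= 0} \<subseteq> (\<Union>(i, j, k)\<in>?S. {Y. Y Int range (ph i j k) ~= {} & principal_div XX f Y ~= 0})"
 proof
  fix Y assume Y: "Y \<in> {Y. principal_div XX f Y ~= 0}"
  then have "prime_divisor XX Y" by (auto simp: principal_div_def split: if_splits)
  from prime_divisor_chart[OF this] obtain i j k where "smooth i j k" "Y Int range (ph i j k) ~= {}" by metis
  then have "(i, j, k) \<in> ?S & Y \<in> {Y. Y Int range (ph i j k) ~= {} & principal_div XX f Y ~= 0}" using Y by simp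
  then show "Y \<in> (\<Union>(i, j, k)\<in>?S. {Y. Y Int range (ph i j k) ~= {} & principal_div XX f Y ~= 0})" by blast
 qed
 moreover have "finite (\<Union>(i, j, k)\<in>?S. {Y. Y Int range (ph i j k) ~= {} & principal_div XX f Y ~= 0})"
  by (rule finite_UN_I[OF fS]) (auto intro!: chart3.finite_principal_div[OF chart3_ph assms])
 ultimately have "finite {Y. principal_div XX f Y ~= 0}" by (rule finite_subset)
 then show ?thesis unfolding weil_divisors_def by (auto simp: principal_div_def split: if_splits)
qed

text \<open>Either \<open>Y\<close> meets the torus, or it is an invariant divisor, and those of the
  rays 2, 3, 5 meet the base chart.\<close>

lemma base_meets: assumes Y: "prime_divisor XX Y" and n: "Y ~= YY 1" "Y ~= YY 4" "Y ~= YY 6"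
 shows "\<exists>p. prime p & Y = hh 2 3 5 p"
proof -
 obtain i j k p where s: "smooth i j k" and p: "prime p" "Y = hh i j k p" "Y Int range (ph i j k) ~= {}" by (rule prime_divisor_chart[OF Y])
 have "Y Int UU {2, 3, 5} ~= {}"
 proof (cases "p dvd cX * cY * cZ")
  case True
  then have "p = cX | p = cY | p = cZ" using p(1) prime_dvd_multD[OF p(1)] primes_dvd_imp_eq[OF p(1)] prime_cX prime_cY prime_cZ by blast
  then obtain l where l: "l \<in> {i, j, k}" "p = crd i j l" using smI(3-5)[OF s] unfolding crd_def by (metis insertCI)
  then have "Y = YY l" using YY_eq[OF s l(1)] p(2) by simp
  then have "l \<in> {2, 3, 5}" using n smooth_L6[OF s] l(1) by auto
  then have "Y = hh 2 3 5 (crd 2 3 l)" "hh 2 3 5 (crd 2 3 l) Int UU {l} ~= {}" "UU {l} \<subseteq> UU {2, 3, 5}"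
   using YY_eq[OF smooth_instances(1)] orbit_point[OF smooth_instances(1)] UU_mono[OF smI(2)[OF smooth_instances(1)]] `Y = YY l` by auto
  then show ?thesis by blast
 next
  case False
  then obtain v where v: "ev p v = 0" "ev (cX * cY * cZ) v ~= 0" using prime_dvd_iff[OF p(1)] by blast
  then have "px v ~= 0" "py v ~= 0" "pz v ~= 0" by auto
  then have "ph i j k v \<in> UU {}" by (rule torus_vl(2)[OF s])
  moreover have "UU {} \<subseteq> UU {2, 3, 5}" by (rule UU_mono[OF smI(2)[OF smooth_instances(1)]]) simp
  moreover have "ph i j k v \<in> Y" unfolding p(2) chart3.hyp_iff[OF chart3_ph[OF s]] by (rule v(1))
  ultimately show ?thesis by blast
 qed
 then have "Y Int range (ph 2 3 5) ~= {}" unfolding range_ph[OF smooth_instances(1)] .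
 then show ?thesis by (rule chart3.prime_divisor_eq_hyp[OF chart3_ph[OF smooth_instances(1)] Y])
qed

lemma not_base: assumes "prime p" "l \<in> {1, 4, 6}" shows "hh 2 3 5 p ~= YY l"
proof -
 obtain v where "ev p v = 0" using prime_has_zero[OF assms(1)] by blast
 then have "ph 2 3 5 v \<in> hh 2 3 5 p" using chart3.hyp_iff[OF chart3_ph[OF smooth_instances(1)], of v p] by simp
 moreover have "ph 2 3 5 v \<in> UU {2, 3, 5}" by (rule ph_UU[OF smooth_instances(1)])
 moreover have "YY l Int UU {2, 3, 5} = {}" by (rule YY_disjoint[OF _ smI(2)[OF smooth_instances(1)]]) (use assms(2) in auto)
 ultimately show ?thesis by blast
qed

text \<open>Linear equivalence to a combination of the three invariant divisors outside the base chart.\<close>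

definition rel :: "(3 chart_point set set => int) => (3 chart_point set => complex) => (nat => int) => bool" where
 "rel D g d \<longleftrightarrow> g \<in> rat_units XX & d 2 = 0 & d 3 = 0 & d 5 = 0 &
   (\<forall>Y. prime_divisor XX Y --> D Y = principal_div XX g Y + TT d Y)"

lemma rel_exists: assumes D: "D \<in> weil_divisors XX" shows "\<exists>g d. rel D g d"
proof -
 interpret C: chart3 XX "ph 2 3 5" by (rule chart3_ph[OF smooth_instances(1)])
 let ?h = "%p. C.hyp p"
 let ?P = "{p. prime p & D (?h p) ~= 0}"
 have fD: "finite {Y. D Y ~= 0}" using D by (simp add: weil_divisors_def)
 have fP: "finite ?P"
 proof (rule finite_imageD)
  show "finite (?h ` ?P)" by (rule finite_subset[OF _ fD]) auto
  show "inj_on ?h ?P" by (rule inj_onI) (simp add: C.hyp_eq_iff)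
 qed
 \<comment> \<open>\<open>nat\<close> cuts off negative exponents: \<open>A 1\<close> collects the
   zeros and \<open>A (-1)\<close> the poles prescribed by \<open>D\<close>.\<close>
 define A where "A = (%e :: int. \<Prod>p\<in>?P. p ^ nat (e * D (?h p)))"
 have m: "multiplicity p (A e) = nat (e * D (?h p))" if "prime p" for p e
  using multiplicity_prod_prime_powers[OF fP _ that, of "%p. nat (e * D (?h p))"] that by (auto simp: A_def)
 have A0: "A e ~= 0" for e using fP by (auto simp: A_def)
 define g where "g = (%x. ev (A 1) (C.co x) / ev (A (-1)) (C.co x))"
 have g: "C.rep g (A 1) (A (-1)) (A (-1))" unfolding g_def by (rule C.rep_ratfun)
 have gu: "g \<in> rat_units XX" unfolding C.rat_units_iff using g A0 by blast
 have pg: "principal_div XX g (?h p) = D (?h p)" if "prime p" for p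
  unfolding C.principal_div_hyp[OF that g A0 A0] m[OF that] by simp
 define d where "d = (%l :: nat. if l \<in> {1, 4, 6} then D (YY l) - principal_div XX g (YY l) else 0)"
 have "D Y = principal_div XX g Y + TT d Y" if Y: "prime_divisor XX Y" for Y
 proof (cases "\<exists>l\<in>{1, 4, 6}. Y = YY l")
  case True
  then obtain l where l: "l \<in> {1, 4, 6}" "Y = YY l" by (elim bexE)
  have "TT d Y = d l" unfolding l(2) by (rule TT_YY) (use l(1) in auto)
  then show ?thesis unfolding d_def using l by simp
 next
  case False
  then have "Y ~= YY 1" "Y ~= YY 4" "Y ~= YY 6" by simp_all
  from base_meets[OF Y this] obtain p where p: "prime p" "Y = ?h p" by (elim exE conjE)
  have "TT d Y = TT (%_. 0) Y" by (rule TT_cong) (use False in \<open>auto simp: d_def\<close>)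
  then show ?thesis unfolding p(2) pg[OF p(1)] by (simp add: TT_def)
 qed
 then have "rel D g d" unfolding rel_def using gu by (simp add: d_def)
 then show ?thesis by blast
qed

lemma constant_function:
 assumes f: "f \<in> rat_units XX" and z: "!!p. prime p ==> principal_div XX f (hh 2 3 5 p) = 0"
 shows "\<exists>c. c ~= 0 & germ_eq XX (points XX) f (%_. c)"
proof -
 interpret C: chart3 XX "ph 2 3 5" by (rule chart3_ph[OF smooth_instances(1)])
 obtain P E where P: "P ~= 0" "E ~= 0" "C.rep f P 1 E" using C.rep_polynomial[OF f] z by (metis order_refl)
 have "is_unit P"
 proof (rule ccontr)
  assume "~ is_unit P"
  then obtain p where p: "prime p" "p dvd P" using prime_divisor_exists[of P] P(1) by blast
  have "multiplicity p P = 0" using C.principal_div_hyp[OF p(1) P(3,2,1)] z[OF p(1)] by simp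
  then show False using p P(1) multiplicity_eq_zero_iff[of P p] not_prime_unit by auto
 qed
 then obtain c where c: "c ~= 0" "P = cC c" using is_unit_p3 by blast
 have "germ_eq XX (points XX) f (%_. c)"
  by (rule C.germ_eq_pointsI[OF _ P(2)]) (use P(3) c(2) in \<open>auto simp: C.rep_def\<close>)
 then show ?thesis using c(1) by blast
qed

text \<open>\<open>f\<close> has neither zeros nor poles on the base chart, so it is a unit of the
  polynomial ring, that is a constant, and its divisor is zero.\<close>

lemma TT_principal_0:
 assumes f: "f \<in> rat_units XX" and d: "d 2 = 0" "d 3 = 0" "d 5 = 0"
  and p: "!!Y. prime_divisor XX Y ==> principal_div XX f Y = TT d Y" and l: "l \<in> L6"
 shows "d l = 0"
proof -
 have "principal_div XX f (hh 2 3 5 q) = 0" if q: "prime q" for q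
 proof -
  have "TT d (hh 2 3 5 q) = TT (%_. 0) (hh 2 3 5 q)" by (rule TT_cong) (use not_base[OF q] d in auto)
  then show ?thesis using p[OF chart3.prime_divisor_hyp[OF chart3_ph[OF smooth_instances(1)] q]] by (simp add: TT_def)
 qed
 from constant_function[OF f this] obtain c where c: "c ~= 0" "germ_eq XX (points XX) f (%_. c)" by blast
 have "d l = principal_div XX f (YY l)" using p[OF YY_prime(1)[OF l]] TT_YY[OF l] by simp
 also have "... = 0" using pd_germ_eq[OF f c(2)] pd_const(2)[OF c(1)] by simp
 finally show ?thesis .
qed

lemma rel_principal_iff: assumes r: "rel D g d" and D: "D \<in> weil_divisors XX"
 shows "D \<in> principal_divisors XX \<longleftrightarrow> (\<forall>l\<in>L6. d l = 0)"
proof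
 have g: "g \<in> rat_units XX" and d: "d 2 = 0" "d 3 = 0" "d 5 = 0"
  and e: "!!Y. prime_divisor XX Y ==> D Y = principal_div XX g Y + TT d Y" using r by (auto simp: rel_def)
 {
  assume "D \<in> principal_divisors XX"
  then obtain f where f: "f \<in> rat_units XX" "D = principal_div XX f" by (auto simp: principal_divisors_def)
  show "\<forall>l\<in>L6. d l = 0"
  proof
   fix l assume l: "l \<in> L6"
   have "principal_div XX (%x. f x * inverse (g x)) Y = TT d Y" if "prime_divisor XX Y" for Y
    using e[OF that] f(2) unfolding pd_mult[OF f(1) rat_inverse[OF g]] pd_inverse[OF g] by simp
   from TT_principal_0[OF rat_mult[OF f(1) rat_inverse[OF g]] d this l] show "d l = 0" .
  qed
 }
 assume z: "\<forall>l\<in>L6. d l = 0"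
 have "D = principal_div XX g"
 proof
  fix Y
  have "TT d Y = TT (%_. 0) Y" by (rule TT_cong) (use z in blast)
  then show "D Y = principal_div XX g Y" using e[of Y] D by (cases "prime_divisor XX Y") (auto simp: TT_def weil_divisors_def principal_div_def)
 qed
 then show "D \<in> principal_divisors XX" using g by (auto simp: principal_divisors_def)
qed

text \<open>Invariant divisors of rays outside \<open>J\<close> miss \<open>UU J\<close>, so on this
  chart the invariant part is the divisor of any character with the values \<open>d\<close> on
  \<open>J\<close>.\<close>

lemma local_equation_chi:
 assumes r: "rel D g d" and J: "J \<in> Mx" and m: "!!l. l \<in> J ==> pr m l = d l"
  and Y: "prime_divisor XX Y" "Y Int UU J ~= {}"
 shows "D Y = principal_div XX (%x. g x * chi m x) Y"
proof -
 have g: "g \<in> rat_units XX" and e: "D Y = principal_div XX g Y + TT d Y" using r Y(1) by (auto simp: rel_def)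
 have "TT d Y = TT (pr m) Y"
 proof (rule TT_cong)
  fix l assume l: "l \<in> L6" "Y = YY l"
  then have "l \<in> J" using YY_disjoint[OF l(1) MxK[OF J]] Y(2) by blast
  then show "d l = pr m l" using m by simp
 qed
 then show ?thesis unfolding pd_mult[OF g chi_rat_unit[OF smooth_instances(1)]] principal_div_chi[OF Y(1)] e by simp
qed

lemma cartierI:
 assumes D: "D \<in> weil_divisors XX" and r: "rel D g d" and m: "!!J. J \<in> Mx ==> \<exists>m. \<forall>l\<in>J. pr m l = d l"
 shows "D \<in> cartier_divisors XX"
proof -
 have g: "g \<in> rat_units XX" using r by (simp add: rel_def)
 have "\<exists>f. local_equation XX D p f" if p: "p \<in> points XX" for p
 proof -
  obtain I where I: "I \<in> K" "p \<in> UU I" using p unfolding points_XX PP_def by blast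
  then obtain J where J: "J \<in> Mx" "I \<subseteq> J" by (auto simp: K_def)
  obtain m where m: "\<forall>l\<in>J. pr m l = d l" using m[OF J(1)] by (elim exE)
  have pU: "p \<in> UU J" using UU_mono[OF MxK[OF J(1)] J(2)] I(2) by blast
  have "local_equation XX D p (%x. g x * chi m x)"
   unfolding local_equation_def
  proof (intro conjI exI[of _ "UU J"] allI impI)
   show "(%x. g x * chi m x) \<in> rat_units XX" by (rule rat_mult[OF g chi_rat_unit[OF smooth_instances(1)]])
   show "openin (zar XX) (UU J)" by (rule open_UU[OF MxK[OF J(1)]])
   show "p \<in> UU J" by fact
   fix Y assume "prime_divisor XX Y & Y Int UU J ~= {}"
   then show "D Y = principal_div XX (%x. g x * chi m x) Y"
    using local_equation_chi[OF r J(1), of m Y] m by blast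
  qed
  then show ?thesis by blast
 qed
 then show ?thesis using D by (simp add: cartier_divisors_def)
qed

lemma q_factorial_XX: "q_factorial XX"
 unfolding q_factorial_def
proof (intro ballI exI[of _ 3] conjI)
 fix D assume D: "D \<in> weil_divisors XX"
 obtain g d where r: "rel D g d" using rel_exists[OF D] by (elim exE)
 have g: "g \<in> rat_units XX" using r by (simp add: rel_def)
 show "(%Y. int 3 * D Y) \<in> cartier_divisors XX"
 proof (rule cartierI)
  show "(%Y. int 3 * D Y) \<in> weil_divisors XX" using D by (simp add: weil_divisors_def)
  show "rel (%Y. int 3 * D Y) (%x. g x ^ 3) (%l. 3 * d l)"
   using r pd_power[OF g, of 3] TT_linear[of 3 d 0 d] unfolding rel_def by simp
  show "\<exists>m. \<forall>l\<in>J. pr m l = 3 * d l" if "J \<in> Mx" for J by (rule pr_solve3[OF that])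
 qed
qed simp

subsection \<open>The Picard number\<close>

lemma Mod_finprod:
 fixes G (structure)
 assumes "comm_group G" "subgroup H G" "finite S" "!!s. s \<in> S ==> r s \<in> carrier G & s = H #> r s"
 shows "finprod (G Mod H) (%s. s [^]\<^bsub>G Mod H\<^esub> (c s :: int)) S = H #> finprod G (%s. r s [^] c s) S"
proof -
 interpret comm_group G by fact
 interpret N: normal H G by (rule subgroup_imp_normal[OF assms(2)])
 interpret Q: comm_group "G Mod H" by (rule abelian_FactGroup[OF assms(2)])
 have "(%s. r s [^] c s) \<in> S \<rightarrow> carrier G" using assms(4) by auto
 have pow: "s [^]\<^bsub>G Mod H\<^esub> c s = H #> (r s [^] c s)" "H #> (r s [^] c s) \<in> carrier (G Mod H)" if "s \<in> S" for s
  using N.FactGroup_int_pow[of "r s" "c s"] assms(4)[OF that] by (auto simp: carrier_FactGroup)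
 show ?thesis using assms(3,4) pow
 proof (induct S rule: finite_induct)
  case empty
  then show ?case using coset_join2[OF one_closed assms(2) N.one_closed] by simp
 next
  case (insert s S)
  have 1: "finprod (G Mod H) (%s. s [^]\<^bsub>G Mod H\<^esub> c s) S = H #> finprod G (%s. r s [^] c s) S"
   by (rule insert(3)[OF insert(4)[OF insertI2] insert(5)[OF insertI2] insert(6)[OF insertI2]])
  have 2: "r s [^] c s \<in> carrier G" "(%s. r s [^] c s) \<in> S \<rightarrow> carrier G" using insert(4) by auto
  have "(%s. s [^]\<^bsub>G Mod H\<^esub> c s) \<in> S \<rightarrow> carrier (G Mod H)" "s [^]\<^bsub>G Mod H\<^esub> c s \<in> carrier (G Mod H)" using insert(5,6) by auto
  then have "finprod (G Mod H) (%s. s [^]\<^bsub>G Mod H\<^esub> c s) (insert s S) = (H #> (r s [^] c s)) <#> (H #> finprod G (%s. r s [^] c s) S)"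
   using insert(1,2) 1 insert(5)[of s] by simp
  also have "... = H #> (r s [^] c s \<otimes> finprod G (%s. r s [^] c s) S)" by (rule N.rcos_sum) (use 2 in auto)
  finally show ?case using insert(1,2) 2 by simp
 qed
qed

abbreviation "DG \<equiv> div_group XX"
abbreviation "PR \<equiv> principal_divisors XX"

lemma div_group_simps [simp]:
 "carrier DG = weil_divisors XX" "mult DG = (%D E Y. D Y + E Y)" "one DG = (%_. 0)"
 by (simp_all add: div_group_def)

lemma weil_add: "D \<in> weil_divisors XX ==> E \<in> weil_divisors XX ==> (%Y. D Y + E Y) \<in> weil_divisors XX"
proof -
 assume a: "D \<in> weil_divisors XX" "E \<in> weil_divisors XX"
 then have f: "finite ({Y. D Y ~= 0} Un {Y. E Y ~= 0})" by (simp add: weil_divisors_def)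
 have "finite {Y. D Y + E Y ~= 0}" by (rule finite_subset[OF _ f]) auto
 moreover have "prime_divisor XX Y" if "D Y + E Y ~= 0" for Y
  using that a by (cases "D Y = 0") (auto simp: weil_divisors_def)
 ultimately show ?thesis by (simp add: weil_divisors_def)
qed

lemma weil_minus: "D \<in> weil_divisors XX ==> (%Y. - D Y) \<in> weil_divisors XX"
 and weil_0: "(%_. 0) \<in> weil_divisors XX" by (simp_all add: weil_divisors_def)

lemma cartier_add: assumes "D \<in> cartier_divisors XX" "E \<in> cartier_divisors XX"
 shows "(%Y. D Y + E Y) \<in> cartier_divisors XX"
 unfolding cartier_divisors_def
proof (intro CollectI conjI ballI)
 show "(%Y. D Y + E Y) \<in> weil_divisors XX" using assms weil_add by (simp add: cartier_divisors_def)
 fix p assume "p \<in> points XX"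
 then obtain f f' where f: "local_equation XX D p f" "local_equation XX E p f'" using assms unfolding cartier_divisors_def by blast
 then obtain U U' where U: "openin (zar XX) U" "p \<in> U" "\<forall>Y. prime_divisor XX Y & Y Int U ~= {} --> D Y = principal_div XX f Y"
  and U': "openin (zar XX) U'" "p \<in> U'" "\<forall>Y. prime_divisor XX Y & Y Int U' ~= {} --> E Y = principal_div XX f' Y"
  unfolding local_equation_def by (elim conjE exE)
 have r: "f \<in> rat_units XX" "f' \<in> rat_units XX" using f by (auto simp: local_equation_def)
 have "local_equation XX (%Y. D Y + E Y) p (%x. f x * f' x)"
  unfolding local_equation_def
 proof (intro conjI exI[of _ "U Int U'"] allI impI)
  fix Y assume "prime_divisor XX Y & Y Int (U Int U') ~= {}"
  then have "D Y = principal_div XX f Y" "E Y = principal_div XX f' Y" using U(3) U'(3) by blast+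
  then show "D Y + E Y = principal_div XX (%x. f x * f' x) Y" using pd_mult[OF r] by simp
 qed (use U U' rat_mult[OF r] in auto)
 then show "\<exists>f. local_equation XX (%Y. D Y + E Y) p f" by blast
qed

lemma cartier_minus: assumes "D \<in> cartier_divisors XX" shows "(%Y. - D Y) \<in> cartier_divisors XX"
 unfolding cartier_divisors_def
proof (intro CollectI conjI ballI)
 show "(%Y. - D Y) \<in> weil_divisors XX" using assms weil_minus by (simp add: cartier_divisors_def)
 fix p assume "p \<in> points XX"
 then obtain f where f: "local_equation XX D p f" using assms unfolding cartier_divisors_def by blast
 then have "local_equation XX (%Y. - D Y) p (%x. inverse (f x))"
  unfolding local_equation_def using rat_inverse pd_inverse by simp
 then show "\<exists>f. local_equation XX (%Y. - D Y) p f" by blast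
qed

lemma principal_cartier: "PR \<subseteq> cartier_divisors XX"
proof
 fix D assume "D \<in> PR"
 then obtain f where f: "f \<in> rat_units XX" "D = principal_div XX f" by (auto simp: principal_divisors_def)
 then have "local_equation XX D p f" if "p \<in> points XX" for p using that
  unfolding local_equation_def by (intro conjI exI[of _ "points XX"]) auto
 then show "D \<in> cartier_divisors XX" using pd_weil[OF f(1)] f(2) by (auto simp: cartier_divisors_def)
qed

lemma principal_0: "(%_. 0) \<in> PR"
 and principal_add: "D \<in> PR ==> E \<in> PR ==> (%Y. D Y + E Y) \<in> PR"
 and principal_minus: "D \<in> PR ==> (%Y. - D Y) \<in> PR"
proof -
 have "principal_div XX (%_. 1) = (%_. 0)" using pd_1 by auto
 then show "(%_. 0) \<in> PR" using rat_1 unfolding principal_divisors_def by (metis image_eqI)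
next
 assume "D \<in> PR" "E \<in> PR"
 then obtain f f' where f: "f \<in> rat_units XX" "D = principal_div XX f" "f' \<in> rat_units XX" "E = principal_div XX f'" by (auto simp: principal_divisors_def)
 then have "(%Y. D Y + E Y) = principal_div XX (%x. f x * f' x)" using pd_mult by auto
 then show "(%Y. D Y + E Y) \<in> PR" using rat_mult[OF f(1,3)] by (simp add: principal_divisors_def)
next
 assume "D \<in> PR"
 then obtain f where f: "f \<in> rat_units XX" "D = principal_div XX f" by (auto simp: principal_divisors_def)
 then have "(%Y. - D Y) = principal_div XX (%x. inverse (f x))" using pd_inverse by auto
 then show "(%Y. - D Y) \<in> PR" using rat_inverse[OF f(1)] by (simp add: principal_divisors_def)
qed

lemma divisor_group:
 assumes "S \<subseteq> weil_divisors XX" "PR \<subseteq> S" "!!D E. D \<in> S ==> E \<in> S ==> (%Y. D Y + E Y) \<in> S" "!!D. D \<in> S ==> (%Y. - D Y) \<in> S"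
 shows "comm_group (DG\<lparr>carrier := S\<rparr>)" "subgroup PR (DG\<lparr>carrier := S\<rparr>)"
  "!!D c. D \<in> S ==> D [^]\<^bsub>DG\<lparr>carrier := S\<rparr>\<^esub> (c :: int) = (%Y. c * D Y)"
proof -
 let ?G = "DG\<lparr>carrier := S\<rparr>"
 have 0: "(%_. 0) \<in> S" using assms(2) principal_0 by blast
 have cg: "comm_group ?G"
 proof (rule comm_groupI)
  fix D assume "D \<in> carrier ?G"
  then show "\<exists>y\<in>carrier ?G. y \<otimes>\<^bsub>?G\<^esub> D = \<one>\<^bsub>?G\<^esub>" by (intro bexI[of _ "%Y. - D Y"]) (auto intro: assms(4))
 qed (use 0 assms(3) in \<open>auto simp: algebra_simps\<close>)
 then show "comm_group ?G" .
 interpret comm_group ?G by (rule cg)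
 have i: "inv\<^bsub>?G\<^esub> D = (%Y. - D Y)" if "D \<in> S" for D
  by (rule inv_equality) (use that assms(4) in auto)
 show "subgroup PR ?G"
  by (rule subgroupI) (use assms(2) principal_0 principal_add principal_minus i in auto)
 fix D and c :: int assume D: "D \<in> S"
 have n: "D [^]\<^bsub>?G\<^esub> (n :: nat) = (%Y. int n * D Y)" for n by (induct n) (auto simp: algebra_simps)
 have nS: "(%Y. int n * D Y) \<in> S" for n using nat_pow_closed[of D n] D n by simp
 show "D [^]\<^bsub>?G\<^esub> c = (%Y. c * D Y)" unfolding int_pow_def2 n using i[OF nS[of "nat (- c)"]] by auto
qed

lemma cartier_weil: "cartier_divisors XX \<subseteq> weil_divisors XX" by (auto simp: cartier_divisors_def)

abbreviation "CG \<equiv> DG\<lparr>carrier := cartier_divisors XX\<rparr>"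

lemma cartier_group: "comm_group CG" "subgroup PR CG"
  "!!D c. D \<in> cartier_divisors XX ==> D [^]\<^bsub>CG\<^esub> (c :: int) = (%Y. c * D Y)"
 by (rule divisor_group[OF cartier_weil principal_cartier], erule (1) cartier_add, erule cartier_minus, assumption?)+

lemma rel_0: "rel (%_. 0) (%_. 1) (%_. 0)" unfolding rel_def using rat_1 pd_1 by (simp add: TT_def)

lemma rel_combine: assumes "rel D g d" "rel E h e" shows "\<exists>g'. rel (%Y. c * D Y + E Y) g' (%l. c * d l + e l)"
proof -
 have g: "g \<in> rat_units XX" "h \<in> rat_units XX" using assms by (auto simp: rel_def)
 have "\<exists>g'\<in>rat_units XX. \<forall>Y. principal_div XX g' Y = c * principal_div XX g Y"
 proof (cases "c >= 0")
  case True
  then show ?thesis using pd_power[OF g(1), of "nat c"] by (intro bexI[of _ "%x. g x ^ nat c"]) auto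
 next
  case False
  then show ?thesis using pd_power[OF rat_inverse[OF g(1)], of "nat (- c)"] pd_inverse[OF g(1)]
   by (intro bexI[of _ "%x. inverse (g x) ^ nat (- c)"]) auto
 qed
 then obtain g' where g': "g' \<in> rat_units XX" "!!Y. principal_div XX g' Y = c * principal_div XX g Y" by blast
 have "rel (%Y. c * D Y + E Y) (%x. g' x * h x) (%l. c * d l + e l)"
  using assms TT_linear[of c d 1 e] pd_mult[OF g'(1) g(2)] g'(2) rat_mult[OF g'(1) g(2)]
  unfolding rel_def by (simp add: algebra_simps)
 then show ?thesis by blast
qed

lemma rel_sum: assumes "finite S" "!!s. s \<in> S ==> rel (r s) (g s) (d s)"
 shows "\<exists>g'. rel (%Y. \<Sum>s\<in>S. c s * r s Y) g' (%l. \<Sum>s\<in>S. c s * d s l)"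
 using assms
proof (induct S rule: finite_induct)
 case empty then show ?case using rel_0 by (intro exI[of _ "%_. 1"]) simp
next
 case (insert s S)
 then obtain g' where "rel (%Y. \<Sum>s\<in>S. c s * r s Y) g' (%l. \<Sum>s\<in>S. c s * d s l)" by blast
 from rel_combine[OF insert(4)[of s] this, of "c s"] show ?case using insert(1,2) by simp
qed

lemma cartier_sum: "finite S ==> (!!s. s \<in> S ==> r s \<in> cartier_divisors XX) ==>
  finprod CG (%s. r s [^]\<^bsub>CG\<^esub> (c s :: int)) S = (%Y. \<Sum>s\<in>S. c s * r s Y) & (%Y. \<Sum>s\<in>S. c s * r s Y) \<in> cartier_divisors XX"
proof (induct S rule: finite_induct)
 case empty
 interpret comm_group CG by (rule cartier_group(1))
 show ?case using one_closed by simp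
next
 case (insert s S)
 interpret comm_group CG by (rule cartier_group(1))
 have pc: "r x [^]\<^bsub>CG\<^esub> c x \<in> carrier CG" if "x \<in> insert s S" for x
  by (rule int_pow_closed) (simp add: insert(4)[OF that])
 have IH: "finprod CG (%s. r s [^]\<^bsub>CG\<^esub> c s) S = (%Y. \<Sum>s\<in>S. c s * r s Y)"
  using insert(3)[OF insert(4)[OF insertI2]] by blast
 have "finprod CG (%s. r s [^]\<^bsub>CG\<^esub> c s) (insert s S) = r s [^]\<^bsub>CG\<^esub> c s \<otimes>\<^bsub>CG\<^esub> finprod CG (%s. r s [^]\<^bsub>CG\<^esub> c s) S"
  by (rule finprod_insert[OF insert(1,2)]) (use pc in blast)+
 also have "... = (%Y. \<Sum>s\<in>insert s S. c s * r s Y)"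
  unfolding IH cartier_group(3)[OF insert(4)[OF insertI1]] using insert(1,2) by simp
 finally have "finprod CG (%s. r s [^]\<^bsub>CG\<^esub> c s) (insert s S) = (%Y. \<Sum>s\<in>insert s S. c s * r s Y)" .
 moreover have "finprod CG (%s. r s [^]\<^bsub>CG\<^esub> c s) (insert s S) \<in> carrier CG"
  by (rule finprod_closed) (use pc in blast)
 ultimately show ?case by simp
qed

text \<open>Representatives are reduced to their invariant parts, so a relation between classes
  becomes three integral linear equations.\<close>

lemma pic_relation:
 assumes "finite S" "!!s. s \<in> S ==> r s \<in> cartier_divisors XX & s = PR #>\<^bsub>CG\<^esub> r s" "!!s. s \<in> S ==> rel (r s) (g s) (d s)"
 shows "finprod (picard_group XX) (%s. s [^]\<^bsub>picard_group XX\<^esub> (c s :: int)) S = \<one>\<^bsub>picard_group XX\<^esub> \<longleftrightarrow> (\<forall>l\<in>{1, 4, 6}. (\<Sum>s\<in>S. c s * d s l) = 0)"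
proof -
 interpret comm_group CG by (rule cartier_group(1))
 have s: "subgroup PR CG" by (rule cartier_group(2))
 let ?D = "%Y. \<Sum>s\<in>S. c s * r s Y"
 have D: "?D \<in> cartier_divisors XX" and p: "finprod CG (%s. r s [^]\<^bsub>CG\<^esub> c s) S = ?D"
  using cartier_sum[OF assms(1), of r c] assms(2) by auto
 have "finprod (picard_group XX) (%s. s [^]\<^bsub>picard_group XX\<^esub> c s) S = PR #>\<^bsub>CG\<^esub> ?D"
  unfolding picard_group_def p[symmetric] by (rule Mod_finprod[OF cartier_group(1) s assms(1)]) (use assms(2) in simp)
 then have "finprod (picard_group XX) (%s. s [^]\<^bsub>picard_group XX\<^esub> c s) S = \<one>\<^bsub>picard_group XX\<^esub> \<longleftrightarrow> PR #>\<^bsub>CG\<^esub> ?D = PR"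
  by (simp add: picard_group_def)
 also have "... \<longleftrightarrow> ?D \<in> PR" using coset_join1[OF _ _ s, of ?D] coset_join2[OF _ s, of ?D] D by auto
 also have "?D \<in> PR \<longleftrightarrow> (\<forall>l\<in>L6. (\<Sum>s\<in>S. c s * d s l) = 0)"
 proof -
  have "\<exists>g'. rel ?D g' (%l. \<Sum>s\<in>S. c s * d s l)" by (rule rel_sum[OF assms(1)]) (rule assms(3))
  then obtain g' where g': "rel ?D g' (%l. \<Sum>s\<in>S. c s * d s l)" by (elim exE)
  show ?thesis by (rule rel_principal_iff[OF g']) (use D cartier_weil in blast)
 qed
 also have "... \<longleftrightarrow> (\<forall>l\<in>{1, 4, 6}. (\<Sum>s\<in>S. c s * d s l) = 0)"
 proof -
  have "(\<Sum>s\<in>S. c s * d s l) = 0" if "l \<in> {2, 3, 5}" for l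
   by (rule sum.neutral) (use assms(3) that in \<open>auto simp: rel_def\<close>)
  then show ?thesis by auto
 qed
 finally show ?thesis .
qed

text \<open>The multiple 3 makes the divisor Cartier on the singular chart as well.\<close>

definition EE :: "nat => 3 chart_point set set => int" where "EE i = TT (%l. if l = i then 3 else 0)"

lemma EE_rel: "i \<in> {1, 4, 6} ==> rel (EE i) (%_. 1) (%l. if l = i then 3 else 0)"
 unfolding rel_def EE_def using rat_1 pd_1 by auto

lemma EE_cartier: assumes i: "i \<in> {1, 4, 6}" shows "EE i \<in> cartier_divisors XX"
proof (rule cartierI[OF _ EE_rel[OF i]])
 have "{Y. EE i Y ~= 0} \<subseteq> {YY i}"
 proof
  fix Y assume Y: "Y \<in> {Y. EE i Y ~= 0}"
  show "Y \<in> {YY i}"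
  proof (rule ccontr)
   assume "Y ~: {YY i}"
   then have "EE i Y = TT (%_. 0) Y" unfolding EE_def by (intro TT_cong) auto
   then show False using Y by (simp add: TT_def)
  qed
 qed
 then show "EE i \<in> weil_divisors XX" unfolding weil_divisors_def
  using YY_prime(1)[of i] i finite_subset[of _ "{YY i}"] by auto
 show "\<exists>m. \<forall>l\<in>J. pr m l = (if l = i then 3 else 0)" if "J \<in> Mx" for J
  using pr_solve3[OF that, of "%l. if l = i then 1 else 0"] by (simp add: if_distrib cong: if_cong)
qed

lemma picard_number_XX: "picard_number XX = 3"
proof -
 let ?P = "picard_group XX"
 define good where "good = {S. finite S & S \<subseteq> carrier ?P & (\<forall>c :: _ => int. finprod ?P (%s. s [^]\<^bsub>?P\<^esub> c s) S = \<one>\<^bsub>?P\<^esub> --> (\<forall>s\<in>S. c s = 0))}"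
 have up: "card S <= 3" if S: "S \<in> good" for S
 proof (rule ccontr)
  assume c: "~ card S <= 3"
  have fS: "finite S" and cS: "S \<subseteq> carrier ?P" using S by (auto simp: good_def)
  have "\<forall>s\<in>S. \<exists>r. r \<in> cartier_divisors XX & s = PR #>\<^bsub>CG\<^esub> r" using cS unfolding picard_group_def carrier_FactGroup by auto
  then obtain r where r: "!!s. s \<in> S ==> r s \<in> cartier_divisors XX & s = PR #>\<^bsub>CG\<^esub> r s" by (elim bchoice[THEN exE]) blast
  define gd where "gd s = (SOME gd. rel (r s) (fst gd) (snd gd))" for s
  have gd: "rel (r s) (fst (gd s)) (snd (gd s))" if "s \<in> S" for s
  proof -
   have "r s \<in> weil_divisors XX" using r[OF that] cartier_weil by blast
   from rel_exists[OF this] obtain g d where "rel (r s) g d" by (elim exE)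
   then have "\<exists>gd. rel (r s) (fst gd) (snd gd)" by (intro exI[of _ "(g, d)"]) simp
   then show ?thesis unfolding gd_def by (rule someI_ex)
  qed
  obtain c :: "_ => int" where c: "\<exists>s\<in>S. c s ~= 0" "\<forall>l\<in>{1, 4, 6}. (\<Sum>s\<in>S. c s * snd (gd s) l) = 0"
   using nontrivial_solution[of "{1, 4, 6}" S "%s. snd (gd s)"] fS c by auto
  have "finprod ?P (%s. s [^]\<^bsub>?P\<^esub> c s) S = \<one>\<^bsub>?P\<^esub>" using pic_relation[OF fS r gd, of c] c(2) by blast
  then show False using S c(1) unfolding good_def by blast
 qed
 let ?e = "%i. PR #>\<^bsub>CG\<^esub> EE i"
 interpret comm_group CG by (rule cartier_group(1))
 have sg: "subgroup PR CG" by (rule cartier_group(2))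
 have inj: "inj_on ?e {1, 4, 6}"
 proof (rule inj_onI)
  fix i j :: nat assume ij: "i \<in> {1, 4, 6}" "j \<in> {1, 4, 6}" and e: "?e i = ?e j"
  have "EE i \<in> ?e j" using rcos_self[OF _ sg, of "EE i"] EE_cartier[OF ij(1)] e by simp
  then obtain D where D: "D \<in> PR" "EE i = (%Y. D Y + EE j Y)" unfolding r_coset_def by auto
  obtain g' where "rel (%Y. -1 * EE j Y + EE i Y) g' (%l. -1 * (if l = j then 3 else 0) + (if l = i then 3 else 0))"
   using rel_combine[OF EE_rel[OF ij(2)] EE_rel[OF ij(1)], of "-1"] by (elim exE)
  moreover have "(%Y. -1 * EE j Y + EE i Y) = D" using D(2) by auto
  ultimately have rD: "rel D g' (%l. -1 * (if l = j then 3 else 0) + (if l = i then 3 else 0))" by simp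
  have "D \<in> weil_divisors XX" using D(1) principal_cartier cartier_weil by blast
  then have "\<forall>l\<in>L6. -1 * (if l = j then 3 else 0) + (if l = i then 3 else 0) = (0 :: int)"
   using rel_principal_iff[OF rD] D(1) by blast
  then show "i = j" using ij by (auto split: if_splits)
 qed
 define S where "S = ?e ` {1, 4, 6}"
 have "card S = 3" unfolding S_def card_image[OF inj] by simp
 define r where "r = (%s. EE (inv_into {1, 4, 6} ?e s))"
 have inv: "inv_into {1, 4, 6} ?e (?e i) = i" if "i \<in> {1, 4, 6}" for i by (rule inv_into_f_f[OF inj that])
 have "S \<in> good" unfolding good_def
 proof (intro CollectI conjI allI impI)
  show "finite S" by (simp add: S_def)
  show "S \<subseteq> carrier ?P" unfolding S_def picard_group_def carrier_FactGroup using EE_cartier by auto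
  fix c :: "_ => int" assume a: "finprod ?P (%s. s [^]\<^bsub>?P\<^esub> c s) S = \<one>\<^bsub>?P\<^esub>"
  have 1: "r s \<in> cartier_divisors XX & s = PR #>\<^bsub>CG\<^esub> r s" if "s \<in> S" for s
   using that inv EE_cartier unfolding S_def r_def by (elim imageE) simp
  have 2: "rel (r s) (%_. 1) (%l. if l = inv_into {1, 4, 6} ?e s then 3 else 0)" if "s \<in> S" for s
   using that inv EE_rel unfolding S_def r_def by (elim imageE) simp
  have z: "(\<Sum>s\<in>S. c s * (if l = inv_into {1, 4, 6} ?e s then 3 else 0)) = 0" if "l \<in> {1, 4, 6}" for l
   using pic_relation[OF `finite S` 1 2, of c] a that by blast
  show "\<forall>s\<in>S. c s = 0"
  proof
   fix s assume "s \<in> S"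
   then obtain i where i: "i \<in> {1, 4, 6}" "s = ?e i" by (auto simp: S_def)
   have "0 = (\<Sum>j\<in>{1, 4, 6}. c (?e j) * (if i = inv_into {1, 4, 6} ?e (?e j) then 3 else 0))"
    using z[OF i(1)] unfolding S_def sum.reindex[OF inj] o_def by simp
   also have "... = (\<Sum>j\<in>{1, 4, 6}. if i = j then c (?e j) * 3 else 0)"
    by (rule sum.cong[OF refl]) (simp only: inv, simp)
   also have "... = c (?e i) * 3" using i(1) sum.delta'[of "{1, 4, 6}" i "%j. c (?e j) * 3"] by simp
   finally show "c s = 0" using i(2) by simp
  qed
 qed
 have "picard_number XX = (SUP S\<in>good. enat (card S))" by (simp add: picard_number_def group_rank_def good_def)
 also have "... = enat 3"
 proof (rule antisym)
  show "(SUP S\<in>good. enat (card S)) <= enat 3" by (rule SUP_least) (simp add: up)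
  have "enat (card S) <= (SUP S\<in>good. enat (card S))" by (rule SUP_upper[OF `S \<in> good`])
  then show "enat 3 <= (SUP S\<in>good. enat (card S))" using `card S = 3` by simp
 qed
 finally show ?thesis by (simp add: numeral_eq_enat)
qed

subsection \<open>The invariant curves\<close>

lemma chart_line_ph: assumes "smooth i j k" shows "chart_line XX (ph i j k) (DD i Int DD j)"
proof -
 interpret chart3 XX "ph i j k" by (rule chart3_ph[OF assms])
 note d = smI(3-5)[OF assms]
 have "ph i j k v \<in> DD i Int DD j \<longleftrightarrow> px v = 0 & py v = 0" for v
 proof -
  have "ph i j k v \<in> DD i \<longleftrightarrow> ev (crd i j i) v = 0" by (rule ph_DD_iff[OF assms]) simp
  moreover have "ph i j k v \<in> DD j \<longleftrightarrow> ev (crd i j j) v = 0" by (rule ph_DD_iff[OF assms]) simp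
  ultimately show ?thesis using d by (simp add: crd_def)
 qed
 then show ?thesis by unfold_locales
qed

text \<open>\<open>k\<close> and \<open>k'\<close> are the rays opposite to the wall of
  \<open>i\<close> and \<open>j\<close>; as both adjacent cones are unimodular, they enter the wall
  relation with coefficient 1.\<close>

context
 fixes i j k k' :: nat and b b' :: int
 assumes s: "smooth i j k" and s': "smooth i j k'" and kk: "k ~= k'"
  and relation: "!!m. pr m k + pr m k' = b * pr m i + b' * pr m j"
  and wall: "!!J. J \<in> Mx ==> {i, j} \<subseteq> J ==> J = {i, j, k} | J = {i, j, k'}"
begin

text \<open>The primitive character orthogonal to the wall; it is the coordinate of the curve in one
  chart, and its inverse is the coordinate in the other.\<close>

lemma wall_vector: obtains c where "pr c i = 0" "pr c j = 0" "pr c k = 1" "pr c k' = -1"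
proof -
 note d = smI[OF s]
 obtain c where c: "\<forall>l\<in>{i, j, k}. pr c l = (if l = k then 1 else 0)"
  using pr_solve[OF d(1,6), of "%l. if l = k then 1 else 0"] by (elim exE)
 then have "pr c i = 0" "pr c j = 0" "pr c k = 1" using d(3-5) by auto
 moreover from this have "pr c k' = -1" using relation[of c] by simp
 ultimately show thesis by (rule that)
qed

lemma wall_pair: "chart_pair2 XX (ph i j k) (ph i j k') (DD i Int DD j)"
proof -
 note d = smI[OF s] and d' = smI[OF s']
 obtain c where c: "pr c i = 0" "pr c j = 0" "pr c k = 1" "pr c k' = -1" by (rule wall_vector)
 interpret L: chart_line XX "ph i j k" "DD i Int DD j" by (rule chart_line_ph[OF s])
 interpret L': chart_line XX "ph i j k'" "DD i Int DD j" by (rule chart_line_ph[OF s'])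
 have k'I: "k' ~: {i, j, k}" "k ~: {i, j, k'}" using d(3-5) d'(3-5) kk by auto
 have sep': "sep (- c) {i, j, k'} {i, j, k}" and sep: "sep c {i, j, k} {i, j, k'}"
  unfolding sep_def using c k'I d(3-5) d'(3-5) by auto
 have cS: "c \<in> SG {i, j, k}" "- c \<in> SG {i, j, k'}" "c \<in> SG {i, j}" "- c \<in> SG {i, j}" using c by (auto simp: SG_def)
 have ij: "{i, j} \<in> K" by (rule K_subset[OF d(2)]) auto
 have v: "vl (ph i j k v) c = pz v" and v': "vl (ph i j k' v) (- c) = pz v" for v
  unfolding vl_ph[OF s cS(1)] vl_ph[OF s' cS(2)] using c by simp_all
 have o: "ph i j k (Pt 0 0 0) ~: UU {i, j, k'}" "ph i j k' (Pt 0 0 0) ~: UU {i, j, k}"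
  using UU_sep[OF d(2) d'(2) sep ph_UU[OF s]] UU_sep[OF d'(2) d(2) sep' ph_UU[OF s']] v v' by simp_all
 have "ph i j k' (Pt 0 0 z) = ph i j k (Pt 0 0 (1 / z))" if z: "z ~= 0" for z
 proof -
  let ?q = "ph i j k' (Pt 0 0 z)"
  have "?q \<in> UU {i, j, k}" using UU_sep[OF d'(2) d(2) sep' ph_UU[OF s'], of "Pt 0 0 z"] v' z by simp
  then obtain w where w: "?q = ph i j k w" using range_ph[OF s] by (metis imageE)
  have C: "?q \<in> DD i Int DD j" using L'.C_iff by simp
  then have "ph i j k w \<in> DD i Int DD j" unfolding w .
  then have xy: "px w = 0" "py w = 0" unfolding L.C_iff by blast+
  have q: "?q \<in> UU {i, j}"
  proof -
   have "sep (- c) {i, j, k'} {i, j}" unfolding sep_def using c k'I d'(3-5) by auto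
   then show ?thesis using UU_sep[OF d'(2) ij _ ph_UU[OF s']] v' z by simp
  qed
  have "vl ?q (c + - c) = vl ?q c * vl ?q (- c)" by (rule vl_add[OF ij q cS(3,4)])
  then have "1 = vl ?q c * vl ?q (- c)" using vl_0[of ?q] q UU_PP[OF ij] by auto
  moreover have "vl ?q c = pz w" unfolding w by (rule v)
  moreover have "vl ?q (- c) = z" using v'[of "Pt 0 0 z"] by simp
  ultimately have "pz w * z = 1" by simp
  then have "w = Pt 0 0 (1 / z)" using xy z by (cases w) (auto simp: field_simps)
  then show ?thesis using w by simp
 qed
 moreover have "DD i Int DD j \<subseteq> range (ph i j k) Un range (ph i j k')"
 proof
  fix p assume p: "p \<in> DD i Int DD j"
  then have "p \<in> PP" by (simp add: DD_def)
  then obtain I where I: "I \<in> K" "p \<in> UU I" by (auto simp: PP_def)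
  then obtain J where J: "J \<in> Mx" "I \<subseteq> J" by (auto simp: K_def)
  have pJ: "p \<in> UU J" using UU_mono[OF MxK[OF J(1)] J(2)] I(2) by blast
  have "l \<in> J" if "p \<in> DD l" for l using pJ DD_disjoint[OF MxK[OF J(1)], of l] that by blast
  then have "{i, j} \<subseteq> J" using p by blast
  then show "p \<in> range (ph i j k) Un range (ph i j k')" using wall[OF J(1)] pJ unfolding range_ph[OF s] range_ph[OF s'] by auto
 qed
 moreover have "closedin (zar XX) (DD i Int DD j)" using closed_DD by blast
 ultimately show ?thesis
  by unfold_locales (use o closed_point in \<open>simp_all add: range_ph[OF s] range_ph[OF s']\<close>)
qed

lemma wall_relation:
 assumes m: "pr m i = pr m' i" "pr m j = pr m' j"
  and e: "int M - int N = pr m k + pr m' k' - b * pr m i - b' * pr m j"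
  and w: "ev (cX * cY * cZ) w ~= 0"
 shows "chi m' (ph i j k w) * pz w ^ M = chi m (ph i j k w) * pz w ^ N"
proof -
 have z: "px w ~= 0" "py w ~= 0" "pz w ~= 0" using w by auto
 have "int M - int N = pr m k - pr m' k" using e relation[of m'] m by simp
 then have "pr m' k + int M = pr m k + int N" by simp
 then have "pz w powi pr m' k * pz w ^ M = pz w powi pr m k * pz w ^ N"
  using z(3) by (metis power_int_add power_int_of_nat)
 then show ?thesis unfolding chi_def torus_vl(1)[OF s z] using m by simp
qed

text \<open>The local equations \<open>g * chi m\<close> and \<open>g * chi m'\<close> are related
  by a power of the coordinate of the curve, whose exponent is the wall relation evaluated at
  \<open>d\<close>.\<close>

lemma wall_intersection:
 assumes D: "D \<in> weil_divisors XX" and r: "rel D g d"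
 shows "intersection_number XX D (DD i Int DD j) = d k + d k' - b * d i - b' * d j"
proof -
 interpret P: chart_pair2 XX "ph i j k" "ph i j k'" "DD i Int DD j" by (rule wall_pair)
 note sd = smI[OF s] and sd' = smI[OF s']
 obtain m where m: "\<forall>l\<in>{i, j, k}. pr m l = d l" using pr_solve[OF sd(1,6), of d] by (elim exE)
 obtain m' where m': "\<forall>l\<in>{i, j, k'}. pr m' l = d l" using pr_solve[OF sd'(1,6), of d] by (elim exE)
 define t where "t = d k + d k' - b * d i - b' * d j"
 have g: "g \<in> rat_units XX" using r by (simp add: rel_def)
 \<comment> \<open>Positive and negative part of \<open>t\<close> serve as the two natural
   exponents, so that negative degrees are covered.\<close>
 have "intersection_number XX D (DD i Int DD j) = int (nat t) - int (nat (- t))"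
 proof (rule P.intersection_number_eq)
  show "(%x. g x * chi m x) \<in> rat_units XX" "(%x. g x * chi m' x) \<in> rat_units XX"
   using rat_mult[OF g chi_rat_unit[OF s]] by auto
  show "D Y = principal_div XX (%x. g x * chi m x) Y" if "prime_divisor XX Y" "Y Int range (ph i j k) ~= {}" for Y
   by (rule local_equation_chi[OF r sd(1) _ that(1)]) (use m that(2) range_ph[OF s] in auto)
  show "D Y = principal_div XX (%x. g x * chi m' x) Y" if "prime_divisor XX Y" "Y Int range (ph i j k') ~= {}" for Y
   by (rule local_equation_chi[OF r sd'(1) _ that(1)]) (use m' that(2) range_ph[OF s'] in auto)
  show "cX * cY * cZ ~= 0" by (simp add: cX_def cY_def cZ_def)
  show "g (ph i j k w) * chi m' (ph i j k w) * pz w ^ nat t = g (ph i j k w) * chi m (ph i j k w) * pz w ^ nat (- t)"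
   if "ev (cX * cY * cZ) w ~= 0" for w
   using wall_relation[OF _ _ _ that, of m m' "nat t" "nat (- t)"] m m' t_def by simp
  show "prime_divisor XX Y" if "D Y ~= 0" for Y using D that by (auto simp: weil_divisors_def)
 qed
 then show ?thesis by (simp add: t_def)
qed

lemma wall_curve: "curve XX (DD i Int DD j)"
proof -
 interpret P: chart_pair2 XX "ph i j k" "ph i j k'" "DD i Int DD j" by (rule wall_pair)
 show ?thesis by (rule P.curve_C)
qed

end

text \<open>All four walls separate smooth cones. Coefficients 1 and 0 are written out to match the
  parameters \<open>b\<close> and \<open>b'\<close> of the wall relation.\<close>

lemma wall_data:
 "pr m 2 + pr m 1 = 2 * pr m 4 + 1 * pr m 6" "pr m 4 + pr m 3 = 1 * pr m 1 + 1 * pr m 5"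
 "pr m 5 + pr m 6 = 2 * pr m 2 + 2 * pr m 3" "pr m 4 + pr m 3 = (-1) * pr m 2 + 0 * pr m 5"
 by (simp_all add: pr_def)

lemma wall_cases: assumes "J \<in> Mx"
 shows "{4, 6} \<subseteq> J ==> J = {4, 6, 2} | J = {4, 6, 1}" "{1, 5} \<subseteq> J ==> J = {1, 5, 4} | J = {1, 5, 3}"
  "{2, 3} \<subseteq> J ==> J = {2, 3, 5} | J = {2, 3, 6}" "{2, 5} \<subseteq> J ==> J = {2, 5, 4} | J = {2, 5, 3}"
proof -
 have "J = {2, 4, 5} | J = {2, 3, 5} | J = {1, 4, 5} | J = {1, 3, 5} | J = {2, 4, 6} | J = {2, 3, 6} | J = {1, 4, 6} | J = {1, 3, 6}"
  using assms by (simp add: Mx_def)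
 then show "{4, 6} \<subseteq> J ==> J = {4, 6, 2} | J = {4, 6, 1}" "{1, 5} \<subseteq> J ==> J = {1, 5, 4} | J = {1, 5, 3}"
  "{2, 3} \<subseteq> J ==> J = {2, 3, 5} | J = {2, 3, 6}" "{2, 5} \<subseteq> J ==> J = {2, 5, 4} | J = {2, 5, 3}"
  by (elim disjE; simp add: insert_commute)+
qed

subsection \<open>The nef cone\<close>

text \<open>The four inequalities force \<open>d\<^sub>4 \<ge> d\<^sub>1 \<ge> 2 d\<^sub>4 + d\<^sub>6\<close> with \<open>d\<^sub>4, d\<^sub>6 \<ge> 0\<close>.\<close>

lemma walls_nonneg:
 fixes d :: "nat => int"
 assumes "d 2 = 0" "d 3 = 0" "d 5 = 0" "d 2 + d 1 - 2 * d 4 - 1 * d 6 >= 0" "d 4 + d 3 - 1 * d 1 - 1 * d 5 >= 0"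
  "d 5 + d 6 - 2 * d 2 - 2 * d 3 >= 0" "d 4 + d 3 - (-1) * d 2 - 0 * d 5 >= 0"
 shows "\<forall>l\<in>L6. d l = 0"
proof -
 have "d 1 = 0" "d 4 = 0" "d 6 = 0" using assms by linarith+
 then show ?thesis using assms(1-3) by simp
qed

lemma nef_principal: assumes D: "D \<in> nef_divisors XX" shows "D \<in> PR"
proof -
 have w: "D \<in> weil_divisors XX" using D cartier_weil by (auto simp: nef_divisors_def)
 have n: "intersection_number XX D C >= 0" if "curve XX C" for C using D that by (auto simp: nef_divisors_def)
 obtain g d where r: "rel D g d" using rel_exists[OF w] by (elim exE)
 note S = smooth_instances
 have "d 2 + d 1 - 2 * d 4 - 1 * d 6 >= 0"
  using n[OF wall_curve[OF S(6,7) _ wall_data(1) wall_cases(1)]] wall_intersection[OF S(6,7) _ wall_data(1) wall_cases(1) w r] by simp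
 moreover have "d 4 + d 3 - 1 * d 1 - 1 * d 5 >= 0"
  using n[OF wall_curve[OF S(8,9) _ wall_data(2) wall_cases(2)]] wall_intersection[OF S(8,9) _ wall_data(2) wall_cases(2) w r] by simp
 moreover have "d 5 + d 6 - 2 * d 2 - 2 * d 3 >= 0"
  using n[OF wall_curve[OF S(1,4) _ wall_data(3) wall_cases(3)]] wall_intersection[OF S(1,4) _ wall_data(3) wall_cases(3) w r] by simp
 moreover have "d 4 + d 3 - (-1) * d 2 - 0 * d 5 >= 0"
  using n[OF wall_curve[OF S(10,11) _ wall_data(4) wall_cases(4)]] wall_intersection[OF S(10,11) _ wall_data(4) wall_cases(4) w r] by simp
 ultimately have "\<forall>l\<in>L6. d l = 0" by (intro walls_nonneg) (use r in \<open>auto simp: rel_def\<close>)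
 then show ?thesis using rel_principal_iff[OF r w] by blast
qed

text \<open>Nef classes are trivial, and the formal generator of the trivial class is up to sign a
  tensor relation, namely the one with \<open>g\<close> and \<open>h\<close> trivial. So every
  admissible combination is a relation.\<close>

lemma nef_cone_XX: "nef_cone XX = {\<one>\<^bsub>tensor_real (class_group XX)\<^esub>}"
proof -
 let ?C = "class_group XX" and ?R = "real_combs (class_group XX)"
 have DG': "DG\<lparr>carrier := weil_divisors XX\<rparr> = DG" by (simp add: div_group_def)
 have grp: "comm_group (DG\<lparr>carrier := weil_divisors XX\<rparr>)" "subgroup PR (DG\<lparr>carrier := weil_divisors XX\<rparr>)"
  by (rule divisor_group[OF order_refl order_trans[OF principal_cartier cartier_weil]], erule (1) weil_add, erule weil_minus)+
 interpret comm_group DG by (rule grp(1)[unfolded DG'])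
 have sg: "subgroup PR DG" by (rule grp(2)[unfolded DG'])
 interpret Q: comm_group ?C unfolding class_group_def by (rule abelian_FactGroup[OF sg])
 have one: "\<one>\<^bsub>?C\<^esub> = PR" by (simp add: class_group_def)
 have g: "comm_group ?R"
 proof (rule comm_groupI)
  fix a assume a: "a \<in> carrier ?R"
  then have "(%x. - a x) \<in> carrier ?R" by (simp add: real_combs_def)
  then show "\<exists>y\<in>carrier ?R. y \<otimes>\<^bsub>?R\<^esub> a = \<one>\<^bsub>?R\<^esub>" by (intro bexI[of _ "%x. - a x"]) (auto simp: real_combs_def)
 next
  fix a a' assume a: "a \<in> carrier ?R" "a' \<in> carrier ?R"
  have s: "{g. a g + a' g ~= 0} \<subseteq> {g. a g ~= 0} Un {g. a' g ~= 0}" by auto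
  have "finite ({g. a g ~= 0} Un {g. a' g ~= 0})" "{g. a g ~= 0} Un {g. a' g ~= 0} \<subseteq> carrier ?C" using a by (auto simp: real_combs_def)
  then have "finite {g. a g + a' g ~= 0}" "{g. a g + a' g ~= 0} \<subseteq> carrier ?C" using finite_subset[OF s] order_trans[OF s] by blast+
  then show "a \<otimes>\<^bsub>?R\<^esub> a' \<in> carrier ?R" by (simp add: real_combs_def)
 qed (auto simp: real_combs_def algebra_simps)
 interpret R: comm_group ?R by (rule g)
 let ?gen = "{(%x. r * (of_bool (x = g \<otimes>\<^bsub>?C\<^esub> h) - of_bool (x = g) - of_bool (x = h))) | r g h. g \<in> carrier ?C & h \<in> carrier ?C}"
 have "f \<in> carrier ?R" if f: "f \<in> ?gen" for f
 proof -
  obtain r g h where f: "f = (%x. r * (of_bool (x = g \<otimes>\<^bsub>?C\<^esub> h) - of_bool (x = g) - of_bool (x = h)))" "g \<in> carrier ?C" "h \<in> carrier ?C"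
   using f by (elim CollectE exE conjE)
  have s: "{x. f x ~= 0} \<subseteq> {g \<otimes>\<^bsub>?C\<^esub> h, g, h}" unfolding f(1) by auto
  have "{g \<otimes>\<^bsub>?C\<^esub> h, g, h} \<subseteq> carrier ?C" using f by auto
  from order_trans[OF s this] finite_subset[OF s] show ?thesis by (simp add: real_combs_def)
 qed
 then have sub: "?gen \<subseteq> carrier ?R" by blast
 let ?T = "tensor_relations ?C"
 have T: "subgroup ?T ?R" unfolding tensor_relations_def by (rule R.generate_is_subgroup[OF sub])
 have nc: "c = PR" if c: "c \<in> nef_classes XX" for c
 proof -
  obtain D where D: "D \<in> nef_divisors XX" "c = PR #>\<^bsub>DG\<^esub> D" using c by (auto simp: nef_classes_def)
  have "D \<in> PR" by (rule nef_principal[OF D(1)])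
  moreover from this have "D \<in> carrier DG" using principal_cartier cartier_weil by auto
  ultimately show ?thesis unfolding D(2) by (intro coset_join2[OF _ sg])
 qed
 have in_T: "a \<in> ?T" if a: "!!c. a c ~= 0 ==> c = PR" for a
 proof -
  have "PR \<otimes>\<^bsub>?C\<^esub> PR = PR" using Q.l_one[OF Q.one_closed] unfolding one .
  moreover have "PR \<in> carrier ?C" using Q.one_closed unfolding one .
  moreover have "a = (%x. - a PR * (of_bool (x = PR) - of_bool (x = PR) - of_bool (x = PR)))"

  proof
   fix x show "a x = - a PR * (of_bool (x = PR) - of_bool (x = PR) - of_bool (x = PR))" using a[of x] by (cases "x = PR") auto
  qed
  ultimately have "a \<in> ?gen" by (intro CollectI exI[of _ "- a PR"] exI[of _ PR]) simp
  then show ?thesis unfolding tensor_relations_def by (rule generate.incl)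
 qed
 have "nef_cone XX = {?T}"
 proof (intro antisym subsetI)
  fix x assume "x \<in> nef_cone XX"
  then obtain a where a: "x = ?T #>\<^bsub>?R\<^esub> a" "a \<in> carrier ?R" "\<forall>c. a c ~= 0 --> c \<in> nef_classes XX" by (auto simp: nef_cone_def)
  have "a \<in> ?T" by (rule in_T) (use a(3) nc in blast)
  then show "x \<in> {?T}" using R.coset_join2[OF a(2) T] a(1) by simp
 next
  fix x assume x: "x \<in> {?T}"
  have "(%_. 0) \<in> carrier ?R" by (simp add: real_combs_def)
  from R.coset_join2[OF this T in_T] have "x = ?T #>\<^bsub>?R\<^esub> (%_. 0)" using x by simp
  then show "x \<in> nef_cone XX" using `(%_. 0) \<in> carrier ?R` by (auto simp: nef_cone_def)
 qed
 then show ?thesis by (simp add: tensor_real_def)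
qed

subsection \<open>The dimension\<close>

lemma irreducible_point: "p \<in> points XX ==> irreducible_closed (zar XX) {p}"
 unfolding irreducible_closed_def using closed_point by auto

lemma krull_dim_XX: "krull_dim (zar XX) = 3"
proof -
 have up: "n <= 3" if Z: "irreducible_chain (zar XX) Z n" for n Z
 proof (cases "n = 0")
  case False
  have irr: "irreducible_closed (zar XX) (Z i)" if "i <= n" for i using Z that by (simp add: irreducible_chain_def)
  have ss: "Z i \<subset> Z (Suc i)" if "i < n" for i using Z that by (simp add: irreducible_chain_def)
  have pt: "Z i \<subseteq> points XX" if "i <= n" for i using irr[OF that] closedin_subset by (auto simp: irreducible_closed_def)
  \<comment> \<open>\<open>Z 0\<close> may be the singular point, where no smooth chart is
    available. \<open>Z 1\<close> has at least two points, so one of them lies in a smooth chart; it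
    replaces \<open>Z 0\<close>.\<close>
  have "\<exists>q\<in>Z 1. \<exists>i j k. smooth i j k & q \<in> UU {i, j, k} & {q} ~= Z 1"
  proof -
   have 1: "Z 0 \<subset> Z 1" using ss[of 0] False by simp
   have "Z 0 ~= {}" using irr[of 0] by (simp add: irreducible_closed_def)
   then obtain p q where pq: "p \<in> Z 1" "q \<in> Z 1" "p ~= q" using 1 by blast
   then have "p \<in> points XX" "q \<in> points XX" using pt[of 1] False by auto
   then have "(\<exists>i j k. smooth i j k & p \<in> UU {i, j, k}) | (\<exists>i j k. smooth i j k & q \<in> UU {i, j, k})"
    using nonsmooth_unique[of p q] pq(3) by metis
   moreover have "{p} ~= Z 1" "{q} ~= Z 1" using pq by auto
   ultimately show ?thesis using pq(1,2) by metis
  qed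
  then obtain q i j k where q: "q \<in> Z 1" "smooth i j k" "q \<in> UU {i, j, k}" "{q} ~= Z 1" by (elim bexE exE conjE)
  obtain v where v: "q = ph i j k v" using q(3) range_ph[OF q(2)] by (metis imageE)
  have "irreducible_chain (zar XX) (Z(0 := {q})) n"
   unfolding irreducible_chain_def
  proof (intro conjI allI impI)
   fix a assume "a <= n"
   then show "irreducible_closed (zar XX) ((Z(0 := {q})) a)" using irr[of a] irreducible_point[of q] pt[of 1] q(1) False by auto
  next
   fix a assume "a < n"
   then show "(Z(0 := {q})) a \<subset> (Z(0 := {q})) (Suc a)" using ss[of a] q(1,4) by auto
  qed
  then show ?thesis by (rule chart3.chain_length_le_3[OF chart3_ph[OF q(2)]]) (simp add: v)
 qed simp
 interpret C: chart3 XX "ph 2 3 5" by (rule chart3_ph[OF smooth_instances(1)])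
 define A where "A = (%i :: nat. if i = 0 then {v. px v = 0 & py v = 0 & pz v = 0} else if i = 1 then {v. px v = 0 & py v = 0}
  else if i = 2 then {v. ev cX v = 0} else UNIV)"
 have A0: "A 0 = {Pt 0 0 0}" unfolding A_def by (auto simp: c3.expand)
 have zi: "zirr (A i)" "A i ~= {}" for i
 proof -
  have "zirr (A 0)" unfolding A0 by (auto simp: zirr_def)
  moreover have "zirr (A 1)" unfolding A_def using zirr_line by simp
  moreover have "zirr (A 2)" unfolding A_def using zirr_prime[OF prime_cX] by simp
  moreover have "zirr (A i)" if "i ~= 0" "i ~= 1" "i ~= 2" using that zirr_UNIV by (simp add: A_def)
  ultimately show "zirr (A i)" by metis
  have "Pt 0 0 0 \<in> A i" by (simp add: A_def)
  then show "A i ~= {}" by blast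
 qed
 have zc: "zclosed (A i)" for i
 proof -
  have "zclosed {v. px v = 0 & py v = 0}" unfolding zclosed_def
  proof (intro allI impI)
   fix v assume "v ~: {v. px v = 0 & py v = 0}"
   then have "px v ~= 0 | py v ~= 0" by blast
   then show "\<exists>P. ev P v ~= 0 & (\<forall>w\<in>{v. px v = 0 & py v = 0}. ev P w = 0)"
    by (elim disjE) (rule exI[of _ cX], simp, rule exI[of _ cY], simp)
  qed
  moreover have "zclosed {v. px v = 0 & py v = 0 & pz v = 0}" unfolding zclosed_def
  proof (intro allI impI)
   fix v assume "v ~: {v. px v = 0 & py v = 0 & pz v = 0}"
   then have "px v ~= 0 | py v ~= 0 | pz v ~= 0" by blast
   then show "\<exists>P. ev P v ~= 0 & (\<forall>w\<in>{v. px v = 0 & py v = 0 & pz v = 0}. ev P w = 0)"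
    by (elim disjE) (rule exI[of _ cX], simp, rule exI[of _ cY], simp, rule exI[of _ cZ], simp)
  qed
  moreover have "zclosed UNIV" by (simp add: zclosed_def)
  ultimately show ?thesis unfolding A_def using zclosed_zeros[of cX] by simp
 qed
 have "irreducible_chain (zar XX) (%i. C.cl (A i)) 3"
  unfolding irreducible_chain_def
 proof (intro conjI allI impI)
  show "irreducible_closed (zar XX) (C.cl (A i))" for i by (rule C.irreducible_cl[OF zi])
  fix i :: nat assume "i < 3"
  then have i: "i = 0 | i = 1 | i = 2" by auto
  have sub: "A i \<subseteq> A (Suc i)" using i by (auto simp: A_def)
  define w where "w = Pt (if i = 2 then 1 else 0) (if i = 1 then 1 else 0) (if i = 0 then 1 else 0)"
  have w: "w \<in> A (Suc i)" "w ~: A i" using i by (auto simp: A_def w_def)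
  have "C.cl (A i) \<subseteq> C.cl (A (Suc i))" by (rule C.cl_subset[OF C.closed_cl]) (use sub C.phi_in_cl in blast)
  then show "C.cl (A i) \<subset> C.cl (A (Suc i))" using w C.cl_iff[OF zc, of w] by blast
 qed
 then have "enat 3 <= krull_dim (zar XX)" unfolding krull_dim_def by (intro SUP_upper) blast
 moreover have "krull_dim (zar XX) <= enat 3" unfolding krull_dim_def using up by (intro SUP_least) auto
 ultimately show ?thesis by (simp add: numeral_eq_enat antisym)
qed

subsection \<open>Regular functions on the torus\<close>

lemma smooth_open_points: "smooth i j k ==> range (ph i j k) \<subseteq> points XX"
 using chart3.phi_points[OF chart3_ph] by blast

lemma opens_meet: assumes "openin (zar XX) A" "A ~= {}" "openin (zar XX) B" "B ~= {}" shows "A Int B ~= {}"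
proof -
 have "A Int points XX ~= {}" "B Int points XX ~= {}" using assms openin_subset by blast+
 from irreducible_closed_meet[OF chart3.irreducible_points[OF chart3_ph[OF smooth_instances(1)]] assms(1,3) this]
 show ?thesis by blast
qed

text \<open>Characters are linearly independent on every nonempty open set, because such a set meets
  the nonempty open locus in the torus where a given nonzero Laurent polynomial does not
  vanish.\<close>

lemma laurent_support:
 assumes F: "finite F" "finite F'" and W: "openin (zar XX) W" "W ~= {}"
  and eq: "!!p. p \<in> W ==> p \<in> UU {} ==> (\<Sum>m\<in>F. c m * vl p m) = (\<Sum>m\<in>F'. c' m * vl p m)"
  and m: "m \<in> F" "c m ~= 0"
 shows "m \<in> F'"
proof (rule ccontr)
 assume n: "m ~: F'"
 define e where "e = (%m. (if m \<in> F then c m else 0) - (if m \<in> F' then c' m else 0))"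
 have e: "(\<Sum>m\<in>F Un F'. e m * f m) = (\<Sum>m\<in>F. c m * f m) - (\<Sum>m\<in>F'. c' m * f m)" for f
 proof -
  have "(\<Sum>m\<in>F. c m * f m) = (\<Sum>m\<in>F Un F'. (if m \<in> F then c m else 0) * f m)"
   "(\<Sum>m\<in>F'. c' m * f m) = (\<Sum>m\<in>F Un F'. (if m \<in> F' then c' m else 0) * f m)"
   by (rule sum.mono_neutral_cong_left; use F in auto)+
  then show ?thesis unfolding e_def by (simp add: left_diff_distrib sum_subtractf)
 qed
 have fF: "finite (F Un F')" and mF: "m \<in> F Un F'" and em: "e m ~= 0" using F m n by (auto simp: e_def)
 obtain t where t: "tunit t" "(\<Sum>m\<in>F Un F'. e m * tor t m) ~= 0" using laurent_nonzero[of "F Un F'" m e, OF fF mF em] by (elim exE conjE) simp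
 let ?q = "%p. \<Sum>m\<in>F Un F'. e m * vl p m"
 have "?q \<in> RR {}" by (rule RR_I[where A = "F Un F'" and g = "%m. m" and d = e]) (use F in auto)
 from open_RR[OF empty_K this] have o: "openin (zar XX) {p \<in> UU {}. ?q p ~= 0}" .
 have "tp {} (tor t) \<in> {p \<in> UU {}. ?q p ~= 0}" using tor_UU[OF t(1) empty_K] t(2) tor_vl[OF t(1)] by simp
 then have "{p \<in> UU {}. ?q p ~= 0} Int W ~= {}" by (intro opens_meet[OF o _ W]) blast
 then obtain p where "p \<in> UU {}" "?q p ~= 0" "p \<in> W" by blast
 then show False using eq[of p] e[of "vl p"] by simp
qed

text \<open>On each smooth chart the function is a polynomial in the coordinates; by independence of
  characters, its exponents pair nonnegatively with the rays of all these charts.\<close>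

lemma global_function_constant:
 assumes f: "f \<in> rat_units XX" and n: "!!Y. principal_div XX f Y >= 0"
 shows "\<exists>c. germ_eq XX (points XX) f (%_. c)"
proof -
 have L: "\<exists>F c W. finite F & F \<subseteq> SG {i, j, k} & openin (zar XX) W & W ~= {} & (\<forall>p\<in>W. p \<in> UU {i, j, k} & f p = (\<Sum>m\<in>F. c m * vl p m))"
  if s: "smooth i j k" for i j k
 proof -
  interpret C: chart3 XX "ph i j k" by (rule chart3_ph[OF s])
  have "\<exists>P E. P ~= 0 & E ~= 0 & C.rep f P 1 E" by (rule C.rep_polynomial[OF f n])
  then obtain P E where P: "E ~= 0" "C.rep f P 1 E" by (elim exE conjE)
  obtain h where h: "h \<in> RR {i, j, k}" "\<forall>v. h (ph i j k v) = ev P v" using poly_RR[OF s, of P] by (elim bexE)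
  obtain F c where F: "finite F" "F \<subseteq> SG {i, j, k}" "!!p. p \<in> UU {i, j, k} ==> h p = (\<Sum>m\<in>F. c m * vl p m)"
   using h(1) unfolding RR_def by blast
  define W where "W = ph i j k ` {v. ev E v ~= 0}"
  have "p \<in> UU {i, j, k} & f p = (\<Sum>m\<in>F. c m * vl p m)" if p: "p \<in> W" for p
  proof -
   obtain v where v: "p = ph i j k v" "ev E v ~= 0" using p by (auto simp: W_def)
   have "f p = ev P v" using P(2) v unfolding C.rep_def by simp
   then show ?thesis using F(3)[OF ph_UU[OF s], of v] h(2) v(1) ph_UU[OF s] by simp
  qed
  moreover have "openin (zar XX) W" unfolding W_def by (rule C.basic_open)
  moreover have "W ~= {}" using ev_nonzero[OF P(1)] by (auto simp: W_def)
  ultimately show ?thesis using F(1,2) by blast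
 qed
 obtain F c W where F: "finite F" "F \<subseteq> SG {2, 3, 5}" and W: "openin (zar XX) W" "W ~= {}"
  "\<forall>p\<in>W. p \<in> UU {2, 3, 5} & f p = (\<Sum>m\<in>F. c m * vl p m)" using L[OF smooth_instances(1)] by (elim exE conjE)
 have sup: "m \<in> SG {i, j, k}" if m: "m \<in> F" "c m ~= 0" and s: "smooth i j k" for m i j k
 proof -
  obtain F' c' W' where F': "finite F'" "F' \<subseteq> SG {i, j, k}" and W': "openin (zar XX) W'" "W' ~= {}"
   "\<forall>p\<in>W'. p \<in> UU {i, j, k} & f p = (\<Sum>m\<in>F'. c' m * vl p m)" using L[OF s] by (elim exE conjE)
  have "m \<in> F'"
  proof (rule laurent_support[where c = c and c' = c' and W = "W Int W'", OF F(1) F'(1) _ _ _ m])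
   show "openin (zar XX) (W Int W')" using W(1) W'(1) by blast
   show "W Int W' ~= {}" by (rule opens_meet[OF W(1,2) W'(1,2)])
   show "(\<Sum>m\<in>F. c m * vl p m) = (\<Sum>m\<in>F'. c' m * vl p m)" if "p \<in> W Int W'" for p
   proof -
    have "f p = (\<Sum>m\<in>F. c m * vl p m)" using W(3) that by blast
    moreover have "f p = (\<Sum>m\<in>F'. c' m * vl p m)" using W'(3) that by blast
    ultimately show ?thesis by simp
   qed
  qed
  then show ?thesis using F'(2) by blast
 qed
 have z: "m = 0" if m: "m \<in> F" "c m ~= 0" for m
 proof -
  have "pr m 2 >= 0" "pr m 3 >= 0" "pr m 5 >= 0" "pr m 1 >= 0" "pr m 4 >= 0"
   using sup[OF m smooth_instances(1)] sup[OF m smooth_instances(3)] by (auto simp: SG_def)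
  \<comment> \<open>The relations \<open>v2 + v3 + v4 = 0\<close> and
    \<open>v1 + v2 + v5 = 0\<close> among the rays: nonnegative numbers with sum 0 vanish.\<close>
  moreover have "pr m 2 + pr m 3 + pr m 4 = 0" "pr m 1 + pr m 2 + pr m 5 = 0" by (simp_all add: pr_def)
  ultimately have "pr m 2 = 0" "pr m 3 = 0" "pr m 5 = 0" by linarith+
  then have "\<forall>l\<in>{2, 3, 5}. pr m l = pr 0 l" by simp
  then show "m = 0" by (rule pr_unique[OF smI(1)[OF smooth_instances(1)]])
 qed
 have "f p = (\<Sum>m\<in>F. if m = 0 then c m else 0)" if p: "p \<in> W" for p
 proof -
  have "vl p 0 = 1" by (rule vl_0) (use p W(1) openin_subset points_XX in blast)
  then have "(\<Sum>m\<in>F. c m * vl p m) = (\<Sum>m\<in>F. if m = 0 then c m else 0)"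
   by (intro sum.cong refl) (use z in auto)
  then show ?thesis using W(3) p by simp
 qed
 then have "germ_eq XX (points XX) f (%_. \<Sum>m\<in>F. if m = 0 then c m else 0)"
  unfolding germ_eq_def using W(1,2) openin_subset[OF W(1)] by (intro exI[of _ W]) auto
 then show ?thesis by blast
qed

subsection \<open>There is no embedding into projective space\<close>

text \<open>What an embedding provides: \<open>U j\<close> is the locus where the
  \<open>j\<close>-th homogeneous coordinate is nonzero, and \<open>S i j\<close> is the quotient of
  the \<open>i\<close>-th by the \<open>j\<close>-th coordinate.\<close>

locale proj_data =
 fixes n :: nat and U :: "nat => 3 chart_point set set" and S :: "nat => nat => 3 chart_point set => complex"
 assumes op: "j <= n ==> openin (zar XX) (U j)"
  and cover: "x \<in> points XX ==> \<exists>j\<le>n. x \<in> U j"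
  and reg: "i <= n ==> j <= n ==> S i j \<in> reg XX (U j)"
  and cocycle: "i <= n ==> j <= n ==> k <= n ==> x \<in> U j ==> x \<in> U k ==> S i k x = S i j x * S j k x"
  and diag: "j <= n ==> x \<in> U j ==> S j j x = 1"
  and separates: "j <= n ==> x \<in> U j ==> y \<in> U j ==> (!!i. i <= n ==> S i j x = S i j y) ==> x = y"
begin

definition j0 where "j0 = (SOME j. j <= n & U j ~= {})"

lemma j0: "j0 <= n" "U j0 ~= {}"
proof -
 have "ph 2 3 5 v \<in> points XX" for v using smooth_open_points[OF smooth_instances(1)] by blast
 then have "\<exists>j. j <= n & U j ~= {}" using cover by blast
 from someI_ex[OF this] show "j0 <= n" "U j0 ~= {}" unfolding j0_def by auto
qed

abbreviation r where "r i \<equiv> S i j0"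

text \<open>The indices of the coordinates that do not vanish identically on the variety.\<close>

definition Is where "Is = {i. i <= n & r i \<in> rat_units XX}"

lemma Is: "finite Is" "i \<in> Is ==> i <= n" "i \<in> Is ==> r i \<in> rat_units XX" by (auto simp: Is_def)

lemma r_local: "i <= n ==> r i \<in> local_ring XX (points XX)"
 unfolding local_ring_def using op[OF j0(1)] openin_subset[OF op[OF j0(1)]] j0 reg[OF _ j0(1)] by blast

lemma in_Is: assumes j: "j <= n" "U j ~= {}" shows "j \<in> Is"
proof -
 have "~ germ_eq XX (points XX) (r j) (%_. 0)"
 proof
  assume "germ_eq XX (points XX) (r j) (%_. 0)"
  then obtain W where W: "openin (zar XX) W" "W ~= {}" "\<forall>x\<in>W. r j x = 0" unfolding germ_eq_def by blast
  have "U j Int U j0 ~= {}" by (rule opens_meet[OF op[OF j(1)] j(2) op[OF j0(1)] j0(2)])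
  moreover have "openin (zar XX) (U j Int U j0)" using op[OF j(1)] op[OF j0(1)] by blast
  ultimately have "(U j Int U j0) Int W ~= {}" using opens_meet W by blast
  then obtain x where x: "x \<in> U j" "x \<in> U j0" "x \<in> W" by blast
  have "1 = S j0 j x * r j x" using cocycle[OF j0(1) j(1) j0(1) x(1,2)] diag[OF j0(1) x(2)] by simp
  then show False using W(3) x(3) by simp
 qed
 then show ?thesis using r_local j(1) by (simp add: Is_def rat_units_def)
qed

text \<open>The least divisor that makes all \<open>r i\<close> with \<open>i\<close> in
  \<open>Is\<close> sections without poles; it represents the hyperplane class.\<close>

definition D where "D Y = - Min ((%i. principal_div XX (r i) Y) ` Is)"

lemma D_ge: "i \<in> Is ==> principal_div XX (r i) Y + D Y >= 0"
 unfolding D_def using Is(1) Min_le[of "(%i. principal_div XX (r i) Y) ` Is" "principal_div XX (r i) Y"] by simp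

lemma D_eq: "\<exists>i\<in>Is. principal_div XX (r i) Y + D Y = 0"
proof -
 have "Min ((%i. principal_div XX (r i) Y) ` Is) \<in> (%i. principal_div XX (r i) Y) ` Is"
  by (rule Min_in) (use Is(1) in_Is[OF j0] in auto)
 then show ?thesis unfolding D_def by auto
qed

lemma D_weil: "D \<in> weil_divisors XX"
proof -
 have D0: "\<exists>i\<in>Is. principal_div XX (r i) Y ~= 0" if DY: "D Y ~= 0" for Y
 proof -
  obtain i where "i \<in> Is" "principal_div XX (r i) Y + D Y = 0" using D_eq[of Y] by (elim bexE)
  then show ?thesis using DY by (intro bexI[of _ i]) auto
 qed
 have "finite (\<Union>i\<in>Is. {Y. principal_div XX (r i) Y ~= 0})"
  by (rule finite_UN_I[OF Is(1)]) (use pd_weil[OF Is(3)] in \<open>auto simp: weil_divisors_def\<close>)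
 then have "finite {Y. D Y ~= 0}" by (rule rev_finite_subset) (use D0 in auto)
 moreover have "prime_divisor XX Y" if DY: "D Y ~= 0" for Y using D0[OF DY] by (auto simp: principal_div_def split: if_splits)
 ultimately show ?thesis by (simp add: weil_divisors_def)
qed

context
 fixes g d i j k m
 assumes rel: "rel D g d" and s: "smooth i j k" and m: "!!l. l \<in> {i, j, k} ==> pr m l = d l"
begin

interpretation C: chart3 XX "ph i j k" by (rule chart3_ph[OF s])

lemma section_unit: assumes "a \<in> Is" shows "(%x. r a x * (g x * chi m x)) \<in> rat_units XX"
 using rat_mult[OF Is(3)[OF assms] rat_mult[OF _ chi_rat_unit[OF s]]] rel by (simp add: rel_def)

lemma section_div: assumes a: "a \<in> Is" and p: "prime p"
 shows "principal_div XX (%x. r a x * (g x * chi m x)) (C.hyp p) = principal_div XX (r a) (C.hyp p) + D (C.hyp p)"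
proof -
 have g: "(%x. g x * chi m x) \<in> rat_units XX" using rat_mult[OF _ chi_rat_unit[OF s]] rel by (simp add: rel_def)
 obtain v where "ev p v = 0" using prime_has_zero[OF p] by blast
 then have "C.hyp p Int UU {i, j, k} ~= {}" using C.hyp_iff[of v p] ph_UU[OF s, of v] by blast
 from local_equation_chi[OF rel smI(1)[OF s] m C.prime_divisor_hyp[OF p] this]
 have "D (C.hyp p) = principal_div XX (%x. g x * chi m x) (C.hyp p)" by blast
 then show ?thesis unfolding pd_mult[OF Is(3)[OF a] g] by simp
qed

lemma section_rep: assumes a: "a \<in> Is" shows "\<exists>P E. P ~= 0 & E ~= 0 & C.rep (%x. r a x * (g x * chi m x)) P 1 E"
 by (rule C.rep_polynomial[OF section_unit[OF a]]) (use section_div[OF a] D_ge[OF a] in simp)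

text \<open>The sections have no common zero, since the coordinates on projective space have none.\<close>

lemma section_nonzero:
 "\<exists>a\<in>Is. \<exists>P E. E ~= 0 & C.rep (%x. r a x * (g x * chi m x)) P 1 E & ev P v ~= 0"
proof -
 let ?f = "%a x. r a x * (g x * chi m x)"
 obtain b where b: "b <= n" "ph i j k v \<in> U b" using cover[OF C.phi_points] by blast
 then have bI: "b \<in> Is" using in_Is by blast
 obtain B E where B: "B ~= 0" "E ~= 0" "C.rep (?f b) B 1 E" using section_rep[OF bI] by (elim exE conjE)
 have "ev B v ~= 0"
 proof
  assume 0: "ev B v = 0"
  have "zirr {v}" by (auto simp: zirr_def)
  then obtain p where p: "prime p" "p dvd B" "ev p v = 0" using zirr_in_prime[OF B(1), of "{v}"] 0 by auto
  \<comment> \<open>Some section \<open>a\<close> does not vanish along the hypersurface of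
    \<open>p\<close>. Its quotient by the section \<open>b\<close> is regular at \<open>v\<close>,
    so its numerator times a polynomial that is nonzero at \<open>v\<close> would be divisible by
    \<open>p\<close>.\<close>
  obtain a where a: "a \<in> Is" "principal_div XX (r a) (C.hyp p) + D (C.hyp p) = 0" using D_eq by blast
  obtain A E' where A: "A ~= 0" "E' ~= 0" "C.rep (?f a) A 1 E'" using section_rep[OF a(1)] by (elim exE conjE)
  have "principal_div XX (?f a) (C.hyp p) = int (multiplicity p A)"
   using C.principal_div_hyp[OF p(1) A(3,2,1)] by simp
  then have "multiplicity p A = 0" using section_div[OF a(1) p(1)] a(2) by simp
  then have npA: "~ p dvd A" using A(1) p(1) multiplicity_eq_zero_iff[of A p] not_prime_unit by auto
  have "\<exists>\<alpha> \<beta> \<gamma>. C.rep (S a b) \<alpha> \<beta> \<gamma> & ev \<gamma> v ~= 0"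
   by (rule C.reg_rep[OF op[OF b(1)] reg[OF Is(2)[OF a(1)] b(1)] b(2)])
  then obtain \<alpha> \<beta> \<gamma> where R: "C.rep (S a b) \<alpha> \<beta> \<gamma>" "ev \<gamma> v ~= 0" by (elim exE conjE)
  have \<beta>: "ev \<beta> v ~= 0" using R unfolding C.rep_def by blast
  have \<gamma>: "\<gamma> ~= 0" using R(2) by auto
  have "C.rep (%x. S a b x * ?f b x) (\<alpha> * B) (\<beta> * 1) (\<gamma> * E)" by (rule C.rep_mult[OF R(1) B(3)])
  moreover have "germ_eq XX (points XX) (%x. S a b x * ?f b x) (?f a)"
   unfolding germ_eq_def
  proof (intro exI[of _ "U b Int U j0"] conjI ballI)
   show "openin (zar XX) (U b Int U j0)" using op[OF b(1)] op[OF j0(1)] by blast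
   have "U b Int U j0 ~= {}" by (rule opens_meet[OF op[OF b(1)] _ op[OF j0(1)] j0(2)]) (use b(2) in blast)
   then show "U b Int U j0 Int points XX ~= {}" using openin_subset[OF op[OF j0(1)]] by blast
   fix x assume x: "x \<in> U b Int U j0"
   then show "S a b x * ?f b x = ?f a x" using cocycle[OF Is(2)[OF a(1)] b(1) j0(1), of x] by simp
  qed
  moreover have "\<gamma> * E ~= 0" using \<gamma> B(2) by simp
  ultimately obtain G where G: "G ~= 0" "C.rep (?f a) (\<alpha> * B) (\<beta> * 1) G" using C.rep_germ_eq by blast
  have "A * (\<beta> * 1) = (\<alpha> * B) * 1" by (rule C.rep_unique[OF A(3) G(2) A(2) G(1)])
  then have "p dvd A * \<beta>" using p(2) by simp
  then have "p dvd \<beta>" using prime_dvd_multD[OF p(1)] npA by blast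
  then show False using \<beta> p(3) by auto
 qed
 then show ?thesis using bI B(2,3) by blast
qed

end

text \<open>A section that is nonzero at the origin of the chart restricts to a nonzero section
  without poles on the curve, which forces a nonnegative degree.\<close>

lemma wall_degree:
 assumes rel: "rel D g d" and s: "smooth i j k" "smooth i j k'" "k ~= k'"
  and relation: "!!m. pr m k + pr m k' = b * pr m i + b' * pr m j"
  and wall: "!!J. J \<in> Mx ==> {i, j} \<subseteq> J ==> J = {i, j, k} | J = {i, j, k'}"
 shows "d k + d k' - b * d i - b' * d j >= 0"
proof -
 interpret P: chart_pair2 XX "ph i j k" "ph i j k'" "DD i Int DD j" by (rule wall_pair[OF s relation wall])
 note sd = smI[OF s(1)] and sd' = smI[OF s(2)]
 obtain m where m: "\<forall>l\<in>{i, j, k}. pr m l = d l" using pr_solve[OF sd(1,6), of d] by (elim exE)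
 obtain m' where m': "\<forall>l\<in>{i, j, k'}. pr m' l = d l" using pr_solve[OF sd'(1,6), of d] by (elim exE)
 define t where "t = d k + d k' - b * d i - b' * d j"
 have "\<exists>a\<in>Is. \<exists>P E. E ~= 0 & chart3.rep (ph i j k) (%x. r a x * (g x * chi m x)) P 1 E & ev P (Pt 0 0 0) ~= 0"
  by (rule section_nonzero[OF rel s(1)]) (use m in blast)
 then obtain a P E where P: "a \<in> Is" "E ~= 0" "chart3.rep (ph i j k) (%x. r a x * (g x * chi m x)) P 1 E" "ev P (Pt 0 0 0) ~= 0"
  by (elim bexE exE conjE)
 have "\<exists>P E. P ~= 0 & E ~= 0 & chart3.rep (ph i j k') (%x. r a x * (g x * chi m' x)) P 1 E"
  by (rule section_rep[OF rel s(2) _ P(1)]) (use m' in blast)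
 then obtain P' E' where P': "E' ~= 0" "chart3.rep (ph i j k') (%x. r a x * (g x * chi m' x)) P' 1 E'" by (elim exE conjE)
 have "line P ~= 0" using P(4) poly_line[of P 0] by auto
 have "nat (- t) <= nat t"
 proof (rule P.polynomial_degree_nonneg[OF P(3,2) P'(2,1) `line P ~= 0`])
  show "cX * cY * cZ ~= 0" by (simp add: cX_def cY_def cZ_def)
  fix w assume w: "ev (cX * cY * cZ) w ~= 0"
  have "chi m' (ph i j k w) * pz w ^ nat t = chi m (ph i j k w) * pz w ^ nat (- t)"
   by (rule wall_relation[OF s relation wall _ _ _ w]) (use m m' t_def in auto)
  then show "r a (ph i j k w) * (g (ph i j k w) * chi m' (ph i j k w)) * pz w ^ nat t =
   r a (ph i j k w) * (g (ph i j k w) * chi m (ph i j k w)) * pz w ^ nat (- t)" by simp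
 qed
 then show ?thesis unfolding t_def[symmetric] by linarith
qed

lemma contradiction: False
proof -
 obtain g d where rel: "rel D g d" using rel_exists[OF D_weil] by (elim exE)
 note s = smooth_instances
 have g: "g \<in> rat_units XX" and Dg: "!!Y. prime_divisor XX Y ==> D Y = principal_div XX g Y + TT d Y" and d0: "d 2 = 0" "d 3 = 0" "d 5 = 0"
  using rel by (auto simp: rel_def)
 have z: "\<forall>l\<in>L6. d l = 0"
  by (rule walls_nonneg[OF d0 wall_degree[OF rel s(6,7) _ wall_data(1) wall_cases(1)] wall_degree[OF rel s(8,9) _ wall_data(2) wall_cases(2)]
    wall_degree[OF rel s(1,4) _ wall_data(3) wall_cases(3)] wall_degree[OF rel s(10,11) _ wall_data(4) wall_cases(4)]]) simp_all
 have T0: "TT d Y = 0" for Y unfolding TT_def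
  by (rule sum.neutral, rule ballI) (simp only: z[THEN bspec] if_cancel)
 have const: "\<exists>c W. openin (zar XX) W & W ~= {} & (\<forall>x\<in>W. r i x * g x = c)" if i: "i <= n" for i
 proof (cases "i \<in> Is")
  case True
  have "principal_div XX (%x. r i x * g x) Y >= 0" for Y
   using D_ge[OF True, of Y] Dg[of Y] T0 unfolding pd_mult[OF Is(3)[OF True] g]
   by (cases "prime_divisor XX Y") (auto simp: principal_div_def)
  from global_function_constant[OF rat_mult[OF Is(3)[OF True] g] this]
  obtain c where "germ_eq XX (points XX) (%x. r i x * g x) (%_. c)" by (elim exE)
  then show ?thesis unfolding germ_eq_def by blast
 next
  case False
  then have "germ_eq XX (points XX) (r i) (%_. 0)" using r_local[OF i] i by (simp add: Is_def rat_units_def)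
  then obtain W where W: "openin (zar XX) W" "W ~= {}" "\<forall>x\<in>W. r i x = 0" unfolding germ_eq_def by blast
  show ?thesis by (rule exI[of _ 0], rule exI[of _ W]) (use W in simp)
 qed
 define P where "P = (%i cW. openin (zar XX) (snd cW) & snd cW ~= {} & (\<forall>x\<in>snd cW. r i x * g x = fst cW))"
 define cw where "cw = (%i. SOME cW. P i cW)"
 have cw: "P i (cw i)" if i: "i <= n" for i
 proof -
  obtain c W where "openin (zar XX) W & W ~= {} & (\<forall>x\<in>W. r i x * g x = c)" using const[OF i] by (elim exE)
  then have "P i (c, W)" by (simp add: P_def)
  then show ?thesis unfolding cw_def by (rule someI)
 qed
 \<comment> \<open>Nonempty open sets meet, so the constants for all \<open>i\<close> are attained
   on one common open set.\<close>
 have "\<exists>V. openin (zar XX) V & V ~= {} & V \<subseteq> U j0 & (\<forall>i\<le>N. \<forall>x\<in>V. r i x * g x = fst (cw i))" if "N <= n" for N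
  using that
 proof (induct N)
  case 0
  have "openin (zar XX) (U j0 Int snd (cw 0))" using cw[of 0] op[OF j0(1)] by (auto simp: P_def)
  moreover have "U j0 Int snd (cw 0) ~= {}" by (rule opens_meet[OF op[OF j0(1)] j0(2)]) (use cw[of 0] in \<open>auto simp: P_def\<close>)
  ultimately show ?case using cw[of 0] by (intro exI[of _ "U j0 Int snd (cw 0)"]) (auto simp: P_def)
 next
  case (Suc N)
  then obtain V where V: "openin (zar XX) V" "V ~= {}" "V \<subseteq> U j0" "\<forall>i\<le>N. \<forall>x\<in>V. r i x * g x = fst (cw i)" by auto
  have c: "P (Suc N) (cw (Suc N))" by (rule cw[OF Suc(2)])
  have "openin (zar XX) (V Int snd (cw (Suc N)))" using c V(1) by (auto simp: P_def)
  moreover have "V Int snd (cw (Suc N)) ~= {}" by (rule opens_meet[OF V(1,2)]) (use c in \<open>auto simp: P_def\<close>)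
  ultimately show ?case using c V(3,4) by (intro exI[of _ "V Int snd (cw (Suc N))"]) (auto simp: P_def le_Suc_eq)
 qed
 from this[OF order_refl] obtain V where V: "openin (zar XX) V" "V ~= {}" "V \<subseteq> U j0" "\<forall>i\<le>n. \<forall>x\<in>V. r i x * g x = fst (cw i)"
  by (elim exE conjE)
 have gc: "g x = fst (cw j0)" if x: "x \<in> V" for x
 proof -
  have "r j0 x = 1" using diag[OF j0(1)] x V(3) by blast
  then show ?thesis using V(4) j0(1) x by force
 qed
 have nz: "fst (cw j0) ~= 0"
 proof
  assume "fst (cw j0) = 0"
  then have "germ_eq XX (points XX) g (%_. 0)" unfolding germ_eq_def using V(1,2) openin_subset[OF V(1)] gc by (intro exI[of _ V]) auto
  then show False using g by (simp add: rat_units_def)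
 qed
 have eq: "x = y" if xy: "x \<in> V" "y \<in> V" for x y
 proof (rule separates[OF j0(1)])
  show "x \<in> U j0" "y \<in> U j0" using xy V(3) by auto
  fix i assume i: "i <= n"
  have "r i x * g x = r i y * g y" using V(4) i xy by simp
  then show "r i x = r i y" using gc[OF xy(1)] gc[OF xy(2)] nz by simp
 qed
 \<comment> \<open>The ratios are constant on \<open>V\<close> and separate points, so
   \<open>V\<close> is a single point; but it has to meet the nonempty open complement of this
   point.\<close>
 obtain p where p: "p \<in> V" using V(2) by blast
 then have Vp: "V = {p}" using eq by blast
 have pt: "p \<in> points XX" using openin_subset[OF V(1)] p by blast
 have o: "openin (zar XX) (points XX - {p})" using closed_point[OF pt] by blast
 have "V Int (points XX - {p}) ~= {}"
 proof (rule opens_meet[OF V(1,2) o])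
  have "ph 2 3 5 (Pt 0 0 0) ~= ph 2 3 5 (Pt 0 0 1)" using injD[OF inj_ph[OF s(1)], of "Pt 0 0 0" "Pt 0 0 1"] by auto
  moreover have "ph 2 3 5 (Pt 0 0 0) \<in> points XX" "ph 2 3 5 (Pt 0 0 1) \<in> points XX" using smooth_open_points[OF s(1)] by blast+
  ultimately show "points XX - {p} ~= {}" by blast
 qed
 then show False using Vp by blast
qed

end

section \<open>From an embedding into projective space to ratios of coordinates\<close>

lemma forms_coord: assumes "i <= n" shows "(%z. z i) \<in> forms n 1"
proof -
 let ?e = "%k :: nat. if k = i then 1 else 0 :: nat"
 have "(\<Prod>k\<le>n. z k ^ ?e k) = z i" for z :: "nat => complex"
 proof -
  have "(\<Prod>k\<le>n. z k ^ ?e k) = (\<Prod>k\<le>n. if k = i then z k else 1)" by (rule prod.cong) auto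
  then show ?thesis using assms by simp
 qed
 then have "(%z :: nat => complex. z i) = (%z. \<Sum>e\<in>{?e}. 1 * (\<Prod>k\<le>n. z k ^ e k))" by simp
 moreover have "finite {?e}" "\<forall>e\<in>{?e}. (\<Sum>k\<le>n. e k) = 1" using assms by auto
 ultimately show ?thesis unfolding forms_def by (intro CollectI exI[of _ "{?e}"] exI[of _ "%_. 1"]) simp
qed

definition pp :: "(nat => complex) set => nat => complex" where "pp P = (SOME z. z \<in> P)"

lemma proj_point:
 assumes "P \<in> proj_points n"
 shows "pp P \<in> P" "\<exists>i\<le>n. pp P i ~= 0" "P = {(%i. c * pp P i) | c. c ~= 0}" "z \<in> P ==> \<exists>c. c ~= 0 & z = (%i. c * pp P i)"
  "\<forall>i>n. pp P i = 0"
proof -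
 have "\<exists>w. P = {(%i. c * w i) | c. c ~= 0} & (\<forall>i>n. w i = 0) & (\<exists>i\<le>n. w i ~= 0)" using assms unfolding proj_points_def by blast
 then obtain w where w': "P = {(%i. c * w i) | c. c ~= 0} & (\<forall>i>n. w i = 0) & (\<exists>i\<le>n. w i ~= 0)" by (elim exE)
 note w = w'[THEN conjunct1] w'[THEN conjunct2, THEN conjunct1] w'[THEN conjunct2, THEN conjunct2]
 have iw: "z \<in> P \<longleftrightarrow> (\<exists>c. c ~= 0 & z = (%i. c * w i))" for z unfolding w(1) by blast
 have "w \<in> P" unfolding iw by (rule exI[of _ 1]) simp
 then show p: "pp P \<in> P" unfolding pp_def by (rule someI[of "%z. z \<in> P"])
 then obtain a where a: "a ~= 0" "pp P = (%i. a * w i)" unfolding iw by (elim exE conjE)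
 show "\<exists>i\<le>n. pp P i ~= 0" "\<forall>i>n. pp P i = 0" unfolding a(2) using w(2,3) a(1) by auto
 have *: "z \<in> P \<longleftrightarrow> (\<exists>c. c ~= 0 & z = (%i. c * pp P i))" for z
 proof
  assume "z \<in> P"
  then obtain c where "c ~= 0" "z = (%i. c * w i)" unfolding iw by (elim exE conjE)
  then show "\<exists>c. c ~= 0 & z = (%i. c * pp P i)" unfolding a(2) using a(1) by (intro exI[of _ "c / a"]) simp
 next
  assume "\<exists>c. c ~= 0 & z = (%i. c * pp P i)"
  then obtain c where "c ~= 0" "z = (%i. c * pp P i)" by (elim exE conjE)
  then show "z \<in> P" unfolding a(2) iw using a(1) by (intro exI[of _ "c * a"]) (simp add: mult.assoc)
 qed
 show "z \<in> P ==> \<exists>c. c ~= 0 & z = (%i. c * pp P i)" unfolding * .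
 show "P = {(%i. c * pp P i) | c. c ~= 0}" using * by blast
qed

lemma not_projective_XX: "~ projective XX"
proof
 assume "projective XX"
 then obtain n V f where V: "closedin (zar (proj_space n)) V" and f: "fs_iso XX (fsubspace (proj_space n) V) f"
  unfolding projective_def fs_isomorphic_def by (elim exE conjE)
 let ?Y = "fsubspace (proj_space n) V"
 have hom: "homeomorphic_map (zar XX) (subtopology (zar (proj_space n)) V) f"
  and iso: "!!B g. openin (zar ?Y) B ==> g \<in> reg ?Y B \<longleftrightarrow> g \<circ> f \<in> reg XX {x \<in> points XX. f x \<in> B}"
  using f unfolding fs_iso_def by (simp_all add: fsubspace_def)
 have top: "topspace (zar (proj_space n)) \<subseteq> proj_points n" unfolding proj_space_def by auto
 have VP: "V \<subseteq> proj_points n" using closedin_subset[OF V] top by blast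
 have tsV: "topspace (subtopology (zar (proj_space n)) V) = V" using closedin_subset[OF V] by auto
 have im: "f ` points XX = V" and inj: "inj_on f (points XX)"
  using homeomorphic_imp_surjective_map[OF hom] homeomorphic_imp_injective_map[OF hom] tsV by auto
 have cont: "continuous_map (zar XX) (subtopology (zar (proj_space n)) V) f" by (rule homeomorphic_imp_continuous_map[OF hom])
 define W where "W = (%j. {P \<in> proj_points n. \<forall>z\<in>P. z j ~= 0})"
 have oW: "openin (zar (proj_space n)) (W j)" if "j <= n" for j
  unfolding W_def proj_space_def using forms_coord[OF that] by (auto intro!: topology_generated_by_Basis)
 have oWV: "openin (zar ?Y) (W j Int V)" if "j <= n" for j
  unfolding fsubspace_def using oW[OF that] by (auto simp: openin_subtopology)
 define U where "U = (%j. {x \<in> points XX. f x \<in> W j Int V})"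
 define S where "S = (%i j x. pp (f x) i / pp (f x) j)"
 have ppW: "pp (f x) j ~= 0" "f x \<in> proj_points n" "x \<in> points XX" if "x \<in> U j" for x j
 proof -
  show P: "f x \<in> proj_points n" "x \<in> points XX" using that by (auto simp: U_def W_def)
  show "pp (f x) j ~= 0" using proj_point(1)[OF P(1)] that by (auto simp: U_def W_def)
 qed
 have "proj_data n U S"
 proof
  show "openin (zar XX) (U j)" if "j <= n" for j
   unfolding U_def by (rule openin_continuous_map_preimage[OF cont]) (use oWV[OF that] in \<open>simp add: fsubspace_def\<close>)
  show "\<exists>j\<le>n. x \<in> U j" if x: "x \<in> points XX" for x
  proof -
   have P: "f x \<in> V" using im x by blast
   then have P': "f x \<in> proj_points n" using VP by blast
   obtain j where j: "j <= n" "pp (f x) j ~= 0" using proj_point(2)[OF P'] by (elim exE conjE)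
   have "z j ~= 0" if z: "z \<in> f x" for z
   proof -
    obtain c where "c ~= 0" "z = (%i. c * pp (f x) i)" using proj_point(4)[OF P' z] by (elim exE conjE)
    then show ?thesis using j(2) by simp
   qed
   then have "f x \<in> W j" using P VP by (auto simp: W_def)
   then show ?thesis using j(1) P x by (auto simp: U_def)
  qed
  show "S i j \<in> reg XX (U j)" if ij: "i <= n" "j <= n" for i j
  proof -
   let ?g = "%P. pp P i / pp P j"
   have q: "pp Q i / pp Q j = z i / z j" if Q: "Q \<in> W j" "z \<in> Q" for Q z
   proof -
    have "Q \<in> proj_points n" using Q(1) by (simp add: W_def)
    from proj_point(4)[OF this Q(2)] obtain c where "c ~= 0" "z = (%i. c * pp Q i)" by (elim exE conjE)
    then show ?thesis by simp
   qed
   have "?g \<in> {f. \<forall>P\<in>W j. \<exists>d. \<exists>F\<in>forms n d. \<exists>G\<in>forms n d.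
            (\<forall>z\<in>P. G z ~= 0) & (\<forall>Q\<in>W j. \<forall>z\<in>Q. G z ~= 0 --> f Q = F z / G z)}"
   proof (intro CollectI ballI)
    fix P assume P: "P \<in> W j"
    show "\<exists>d. \<exists>F\<in>forms n d. \<exists>G\<in>forms n d. (\<forall>z\<in>P. G z ~= 0) & (\<forall>Q\<in>W j. \<forall>z\<in>Q. G z ~= 0 --> pp Q i / pp Q j = F z / G z)"
     by (rule exI[of _ 1], rule bexI[OF _ forms_coord[OF ij(1)]], rule bexI[OF _ forms_coord[OF ij(2)]])
       (use P q in \<open>auto simp: W_def\<close>)
   qed
   then have "?g \<in> reg (proj_space n) (W j)" by (simp add: proj_space_def)
   then have "?g \<in> reg ?Y (W j Int V)" unfolding fsubspace_def using oW[OF ij(2)] by auto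
   then have "?g \<circ> f \<in> reg XX (U j)" using iso[OF oWV[OF ij(2)]] by (simp add: U_def)
   then show ?thesis by (simp add: S_def o_def)
  qed
  show "S i k x = S i j x * S j k x" if "x \<in> U j" "x \<in> U k" for i j k x using ppW(1)[OF that(1)] by (simp add: S_def)
  show "S j j x = 1" if "x \<in> U j" for j x using ppW(1)[OF that] by (simp add: S_def)
  show "x = y" if j: "j <= n" and xy: "x \<in> U j" "y \<in> U j" and e: "!!i. i <= n ==> S i j x = S i j y" for j x y
  proof -
   note x = ppW[OF xy(1)] and y = ppW[OF xy(2)]
   define a where "a = pp (f x) j / pp (f y) j"
   have a: "a ~= 0" using x(1) y(1) by (simp add: a_def)
   have ae: "pp (f x) i = a * pp (f y) i" for i
   proof (cases "i <= n")
    case True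
    from e[OF this] x(1) y(1) show ?thesis by (simp add: S_def a_def field_simps)
   next
    case False
    then show ?thesis using proj_point(5)[OF x(2)] proj_point(5)[OF y(2)] by simp
   qed
   have "f x = {(%i. c * (a * pp (f y) i)) | c. c ~= 0}" using proj_point(3)[OF x(2)] unfolding ae .
   also have "... = {(%i. c * pp (f y) i) | c. c ~= 0}"
   proof (intro antisym subsetI; elim CollectE exE conjE)
    fix z c assume "z = (%i. c * (a * pp (f y) i))" "c ~= 0"
    then show "z \<in> {(%i. c * pp (f y) i) | c. c ~= 0}" using a by (intro CollectI exI[of _ "c * a"]) (auto simp: mult.assoc)
   next
    fix z c assume "z = (%i. c * pp (f y) i)" "c ~= 0"
    then show "z \<in> {(%i. c * (a * pp (f y) i)) | c. c ~= 0}" using a by (intro CollectI exI[of _ "c / a"]) auto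
   qed
   also have "... = f y" by (rule proj_point(3)[OF y(2), symmetric])
   finally show "x = y" using inj x(3) y(3) by (auto dest: inj_onD)
  qed
 qed
 then show False by (rule proj_data.contradiction)
qed

section \<open>Completeness\<close>

subsection \<open>Matrices of functions\<close>

context function_ring
begin

text \<open>Gaussian elimination; the function \<open>r\<close> is the product of the pivots, which equal \<open>1\<close> at \<open>z0\<close>.\<close>

lemma kernel_function:
 assumes "finite P" "!!i j. i \<in> P ==> j \<in> P ==> M i j \<in> R"
  and "!!i j. i \<in> P ==> j \<in> P ==> M i j z0 = (if i = j then 1 else 0)"
 shows "\<exists>r\<in>R. r z0 ~= 0 & (\<forall>z v. (\<exists>i\<in>P. v i ~= 0) & (\<forall>i\<in>P. (\<Sum>j\<in>P. M i j z * v j) = 0) --> r z = 0)"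
 using assms
proof (induct P arbitrary: M rule: finite_induct)
 case empty
 show ?case by (rule bexI[OF _ const[of 1]]) simp
next
 case (insert p P)
 \<comment> \<open>The Schur complement of the pivot, before division by it; at \<open>z0\<close> it
   is again the identity matrix.\<close>
 let ?M = "%i j z. M p p z * M i j z - M i p z * M p j z"
 have MR: "?M i j \<in> R" if "i \<in> P" "j \<in> P" for i j
  by (rule diff[OF mult mult]) (use insert(4) that in auto)
 have M0: "?M i j z0 = (if i = j then 1 else 0)" if "i \<in> P" "j \<in> P" for i j
  using insert(5)[of p p] insert(5)[of i j] insert(5)[of i p] that insert(2) by auto
 obtain r where r: "r \<in> R" "r z0 ~= 0"
  "!!z v. (\<exists>i\<in>P. v i ~= 0) & (\<forall>i\<in>P. (\<Sum>j\<in>P. ?M i j z * v j) = 0) ==> r z = 0"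
  using insert(3)[of ?M, OF MR M0] by blast
 show ?case
 proof (intro bexI[of _ "%z. M p p z * r z"] conjI allI impI)
  show "(%z. M p p z * r z) \<in> R" by (rule mult[OF insert(4) r(1)]) auto
  show "M p p z0 * r z0 ~= 0" using insert(5)[of p p] r(2) by simp
  fix z v assume v: "(\<exists>i\<in>insert p P. v i ~= 0) & (\<forall>i\<in>insert p P. (\<Sum>j\<in>insert p P. M i j z * v j) = 0)"
  show "M p p z * r z = 0"
  proof (cases "M p p z = 0")
   case False
   have row: "M i p z * v p + (\<Sum>j\<in>P. M i j z * v j) = 0" if "i \<in> insert p P" for i using v that insert(1,2) by auto
   have "(\<Sum>j\<in>P. ?M i j z * v j) = 0" if i: "i \<in> P" for i
   proof -
    have "(\<Sum>j\<in>P. ?M i j z * v j) = M p p z * (\<Sum>j\<in>P. M i j z * v j) - M i p z * (\<Sum>j\<in>P. M p j z * v j)"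
     by (simp add: sum_distrib_left sum_subtractf algebra_simps)
    also have "(\<Sum>j\<in>P. M i j z * v j) = - M i p z * v p" using row[of i] i by (simp add: add_eq_0_iff2)
    also have "(\<Sum>j\<in>P. M p j z * v j) = - M p p z * v p" using row[of p] by (simp add: add_eq_0_iff2)
    finally show ?thesis by simp
   qed
   \<comment> \<open>A solution supported at \<open>p\<close> alone is excluded by the nonzero
     pivot.\<close>
   moreover have "\<exists>i\<in>P. v i ~= 0"
   proof (rule ccontr)
    assume n: "~ ?thesis"
    then have "(\<Sum>j\<in>P. M p j z * v j) = 0" by (intro sum.neutral) auto
    then have "v p = 0" using row[of p] False by simp
    then show False using v n by auto
   qed
   ultimately have "r z = 0" using r(3)[of v z] by blast
   then show ?thesis by simp
  qed simp
 qed
qed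

end

subsection \<open>Finite sets of characters adapted to the fan\<close>

text \<open>For completeness one needs a projective fan refining the given one: subdividing the cone of
  \<open>v\<^sub>1\<close> and \<open>v\<^sub>5\<close> by the additional vector \<open>v\<^sub>1 + v\<^sub>5\<close> (with index \<open>7\<close>) suffices.\<close>

definition fu :: "nat => mvec => int" where "fu u m = (if u = 7 then pr m 1 + pr m 5 else pr m u)"

definition perp :: "nat set => mvec set" where "perp s = {m. \<forall>i\<in>s. pr m i = 0}"

text \<open>\<open>G J\<close> stands for the support of an equation on chart \<open>J\<close>. Each
  \<open>n\<close> in \<open>P\<close> is to have a chart whose equation, multiplied by the
  character \<open>n\<close>, involves no character outside \<open>P\<close>; these products are the
  rows of a square system. Only \<open>perp s\<close> enters, as the other characters of
  \<open>SG s\<close> vanish on the orbit of \<open>s\<close>.\<close>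

definition good :: "nat set => bool" where
 "good s \<longleftrightarrow> (\<forall>G. (\<forall>J. finite (G J)) --> (\<exists>P. finite P & 0 \<in> P & P \<subseteq> perp s &
   (\<forall>n\<in>P. \<exists>J\<in>Mx. s \<subseteq> J & (\<forall>m\<in>G J. m \<in> SG J & m \<in> perp s --> n + m \<in> P))))"

text \<open>The lattice points of a polyhedron with facet normals \<open>E\<close> and heights
  \<open>t\<close>.\<close>

definition region :: "nat set => nat set => (nat => int) => mvec set" where
 "region s E t = {n \<in> perp s. \<forall>u\<in>E. fu u n >= - t u}"

lemma finite_coords: "finite {n :: mvec. \<bar>vec_nth n 1\<bar> <= N & \<bar>vec_nth n 2\<bar> <= N & \<bar>vec_nth n 3\<bar> <= N}"
proof (rule finite_imageD)
 let ?f = "%n :: mvec. (vec_nth n 1, vec_nth n 2, vec_nth n 3)"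
 show "finite (?f ` {n :: mvec. \<bar>vec_nth n 1\<bar> <= N & \<bar>vec_nth n 2\<bar> <= N & \<bar>vec_nth n 3\<bar> <= N})"
  by (rule finite_subset[of _ "{-N..N} \<times> {-N..N} \<times> {-N..N}"]) auto
 show "inj_on ?f {n :: mvec. \<bar>vec_nth n 1\<bar> <= N & \<bar>vec_nth n 2\<bar> <= N & \<bar>vec_nth n 3\<bar> <= N}"
  by (rule inj_onI) (simp add: vec_eq_iff forall_3)
qed

lemma Mx_no7: "J \<in> Mx ==> 7 ~: J" by (auto simp: Mx_def)

text \<open>A facet is near \<open>n\<close> if its inequality has slack less than \<open>B\<close>,
  which bounds all values on the supports. Near facets belong to \<open>J\<close>, where elements of
  \<open>SG J\<close> are nonnegative, and the others have enough slack, so translation by the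
  support of chart \<open>J\<close> stays inside. The vector with index 7 counts as belonging to the
  cones through 1 and 5.\<close>

lemma goodI:
 assumes "!!B. B >= 0 ==> \<exists>t. (\<forall>u\<in>E. t u >= 0) & finite (region s E t) &
   (\<forall>n\<in>region s E t. \<exists>J\<in>Mx. s \<subseteq> J & (\<forall>u\<in>E. fu u n < - t u + B --> u \<in> J | u = 7 & {1, 5} \<subseteq> J))"
  and E: "finite E"
 shows "good s"
 unfolding good_def
proof (intro allI impI)
 fix G :: "nat set => mvec set" assume G: "\<forall>J. finite (G J)"
 have fM: "finite Mx" by (simp add: Mx_def)
 define B where "B = (\<Sum>J\<in>Mx. \<Sum>m\<in>G J. \<Sum>u\<in>E. \<bar>fu u m\<bar>)"
 have "B >= 0" unfolding B_def by (intro sum_nonneg) auto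
 have B: "\<bar>fu u m\<bar> <= B" if "J \<in> Mx" "m \<in> G J" "u \<in> E" for J m u
 proof -
  have "\<bar>fu u m\<bar> <= (\<Sum>u\<in>E. \<bar>fu u m\<bar>)" by (rule member_le_sum[OF that(3) _ E]) auto
  also have "... <= (\<Sum>m\<in>G J. \<Sum>u\<in>E. \<bar>fu u m\<bar>)"
   by (rule member_le_sum[OF that(2)]) (use G in \<open>auto intro: sum_nonneg\<close>)
  also have "... <= B" unfolding B_def by (rule member_le_sum[OF that(1) _ fM]) (auto intro!: sum_nonneg)
  finally show ?thesis .
 qed
 obtain t where t: "\<forall>u\<in>E. t u >= 0" "finite (region s E t)"
  "\<forall>n\<in>region s E t. \<exists>J\<in>Mx. s \<subseteq> J & (\<forall>u\<in>E. fu u n < - t u + B --> u \<in> J | u = 7 & {1, 5} \<subseteq> J)"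
  using assms(1)[OF `B >= 0`] by (elim exE conjE)
 show "\<exists>P. finite P & 0 \<in> P & P \<subseteq> perp s & (\<forall>n\<in>P. \<exists>J\<in>Mx. s \<subseteq> J & (\<forall>m\<in>G J. m \<in> SG J & m \<in> perp s --> n + m \<in> P))"
 proof (intro exI[of _ "region s E t"] conjI ballI t(2))
  show "0 \<in> region s E t" using t(1) by (simp add: region_def perp_def fu_def)
  show "region s E t \<subseteq> perp s" by (auto simp: region_def)
  fix n assume n: "n \<in> region s E t"
  then obtain J where J: "J \<in> Mx" "s \<subseteq> J" "\<forall>u\<in>E. fu u n < - t u + B --> u \<in> J | u = 7 & {1, 5} \<subseteq> J"
   using t(3)[THEN bspec, OF n] by (elim bexE conjE)
  have "n + m \<in> region s E t" if m: "m \<in> G J" "m \<in> SG J" "m \<in> perp s" for m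
  proof -
   have "fu u (n + m) >= - t u" if u: "u \<in> E" for u
   proof (cases "fu u n < - t u + B")
    case True
    then have "u \<in> J | u = 7 & {1, 5} \<subseteq> J" using J(3) u by blast
    moreover have "7 ~: J" by (rule Mx_no7[OF J(1)])
    ultimately have "fu u m >= 0" using m(2) by (auto simp: SG_def fu_def)
    moreover have "fu u n >= - t u" using n u by (simp add: region_def)
    ultimately show ?thesis by (simp add: fu_def split: if_splits)
   next
    case False
    then show ?thesis using B[OF J(1) m(1) u] by (simp add: fu_def split: if_splits)
   qed
   then show ?thesis using n m(3) by (simp add: region_def perp_def)
  qed
  then show "\<exists>J\<in>Mx. s \<subseteq> J & (\<forall>m\<in>G J. m \<in> SG J & m \<in> perp s --> n + m \<in> region s E t)" using J(1,2) by blast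
 qed
qed

lemma good_Mx: assumes "J \<in> Mx" shows "good J"
proof (rule goodI[where E = "{}"])
 have p: "m = 0" if "m \<in> perp J" for m by (rule pr_unique[OF assms]) (use that in \<open>simp add: perp_def\<close>)
 have "region J {} (%_. 0) \<subseteq> {0}" using p by (auto simp: region_def)
 then have "finite (region J {} (%_. 0))" by (rule finite_subset) simp
 then show "\<exists>t. (\<forall>u\<in>{}. 0 <= t u) & finite (region J {} t) &
  (\<forall>n\<in>region J {} t. \<exists>J'\<in>Mx. J \<subseteq> J' & (\<forall>u\<in>{}. fu u n < - t u + B --> u \<in> J' | u = 7 & {1, 5} \<subseteq> J'))" for B
  using assms by (intro exI[of _ "%_. 0"]) auto
qed simp

text \<open>The star of a wall is a line with two opposite rays, and the polytope is an interval.
  For height \<open>B\<close>, near means negative, and the relation forbids that both pairings are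
  negative.\<close>

lemma good_wall:
 assumes J: "{i, j, k} \<in> Mx" "{i, j, k'} \<in> Mx" and b: "b > 0" "b' > 0"
  and relation: "!!m. pr m i = 0 ==> pr m j = 0 ==> b * pr m k + b' * pr m k' = 0"
 shows "good {i, j}"
proof (rule goodI[where E = "{k, k'}"])
 fix B :: int assume B: "B >= 0"
 have n7: "k ~= 7" "k' ~= 7" using Mx_no7[OF J(1)] Mx_no7[OF J(2)] by blast+
 have "finite (region {i, j} {k, k'} (%_. B))"
 proof (rule finite_imageD)
  show "finite ((%n. pr n k) ` region {i, j} {k, k'} (%_. B))"
  proof (rule finite_subset)
   show "(%n. pr n k) ` region {i, j} {k, k'} (%_. B) \<subseteq> {- B..b' * B}"
   proof
    fix x assume "x \<in> (%n. pr n k) ` region {i, j} {k, k'} (%_. B)"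
    then obtain n where n: "x = pr n k" "pr n i = 0" "pr n j = 0" "pr n k >= - B" "pr n k' >= - B"
     using n7 by (auto simp: region_def perp_def fu_def)
    have "b * pr n k = b' * (- pr n k')" using relation[OF n(2,3)] by simp
    also have "... <= b' * B" using b(2) n(5) by (intro mult_left_mono) auto
    finally have 1: "b * pr n k <= b' * B" .
    have "pr n k <= b' * B"
    proof (cases "pr n k >= 0")
     case True
     then have "1 * pr n k <= b * pr n k" using b(1) by (intro mult_right_mono) auto
     then show ?thesis using 1 by simp
    next
     case False
     moreover have "b' * B >= 0" using b(2) B by simp
     ultimately show ?thesis by simp
    qed
    then show "x \<in> {- B..b' * B}" using n(1,4) by simp
   qed
  qed simp
  show "inj_on (%n. pr n k) (region {i, j} {k, k'} (%_. B))"
   by (rule inj_onI, rule pr_unique[OF J(1)]) (auto simp: region_def perp_def)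
 qed
 moreover have "\<exists>J\<in>Mx. {i, j} \<subseteq> J & (\<forall>u\<in>{k, k'}. fu u n < - B + B --> u \<in> J | u = 7 & {1, 5} \<subseteq> J)"
  if "n \<in> region {i, j} {k, k'} (%_. B)" for n
 proof -
  have r: "b * pr n k + b' * pr n k' = 0" using relation[of n] that by (auto simp: region_def perp_def)
  have "~ (pr n k < 0 & pr n k' < 0)"
  proof
   assume "pr n k < 0 & pr n k' < 0"
   then have "b * pr n k < 0" "b' * pr n k' < 0" using b by (auto simp: mult_pos_neg)
   then show False using r by simp
  qed
  then have "pr n k' >= 0 | pr n k >= 0" by auto
  then show ?thesis
  proof
   assume "pr n k' >= 0"
   then show ?thesis using n7 by (intro bexI[OF _ J(1)]) (auto simp: fu_def)
  next
   assume "pr n k >= 0"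
   then show ?thesis using n7 by (intro bexI[OF _ J(2)]) (auto simp: fu_def)
  qed
 qed
 ultimately show "\<exists>t. (\<forall>u\<in>{k, k'}. 0 <= t u) & finite (region {i, j} {k, k'} t) & (\<forall>n\<in>region {i, j} {k, k'} t.
   \<exists>J\<in>Mx. {i, j} \<subseteq> J & (\<forall>u\<in>{k, k'}. fu u n < - t u + B --> u \<in> J | u = 7 & {1, 5} \<subseteq> J))"
  using B by (intro exI[of _ "%_. B"]) auto
qed simp

text \<open>The star of a ray is a complete plane fan with rays \<open>a\<close>, \<open>c\<close>,
  \<open>b\<close>, \<open>d\<close> in cyclic order, and \<open>h\<close> gives the heights of a
  dual quadrangle. The factor 4 leaves room to exclude that opposite edges, \<open>a\<close> and
  \<open>b\<close> or \<open>c\<close> and \<open>d\<close>, are near the same point; 100 is a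
  generous bound for the coordinates.\<close>

lemma good_ray:
 assumes J: "{i, a, c} \<in> Mx" "{i, a, d} \<in> Mx" "{i, b, c} \<in> Mx" "{i, b, d} \<in> Mx"
  and h: "h a >= 0" "h b >= 0" "h c >= 0" "h d >= 0"
  and bound: "!!n B. pr n i = 0 ==> pr n a >= - (4 * B * h a) ==> pr n b >= - (4 * B * h b) ==>
   pr n c >= - (4 * B * h c) ==> pr n d >= - (4 * B * h d) ==> B >= 0 ==>
   \<bar>vec_nth n 1\<bar> <= 100 * B & \<bar>vec_nth n 2\<bar> <= 100 * B & \<bar>vec_nth n 3\<bar> <= 100 * B &
   ~ (pr n a < - (4 * B * h a) + B & pr n b < - (4 * B * h b) + B) &
   ~ (pr n c < - (4 * B * h c) + B & pr n d < - (4 * B * h d) + B)"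
 shows "good {i}"
proof (rule goodI[where E = "{a, b, c, d}"])
 fix B :: int assume B: "B >= 0"
 define t where "t = (%u. 4 * B * h u)"
 have n7: "a ~= 7" "b ~= 7" "c ~= 7" "d ~= 7" using Mx_no7[OF J(1)] Mx_no7[OF J(4)] by blast+
 have bd: "\<bar>vec_nth n 1\<bar> <= 100 * B & \<bar>vec_nth n 2\<bar> <= 100 * B & \<bar>vec_nth n 3\<bar> <= 100 * B"
  "~ (pr n a < - t a + B & pr n b < - t b + B)" "~ (pr n c < - t c + B & pr n d < - t d + B)"
  if "n \<in> region {i} {a, b, c, d} t" for n
 proof -
  have "pr n i = 0" "pr n a >= - (4 * B * h a)" "pr n b >= - (4 * B * h b)" "pr n c >= - (4 * B * h c)" "pr n d >= - (4 * B * h d)"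
   using that n7 by (auto simp: region_def perp_def fu_def t_def)
  from bound[OF this B] show "\<bar>vec_nth n 1\<bar> <= 100 * B & \<bar>vec_nth n 2\<bar> <= 100 * B & \<bar>vec_nth n 3\<bar> <= 100 * B"
   "~ (pr n a < - t a + B & pr n b < - t b + B)" "~ (pr n c < - t c + B & pr n d < - t d + B)" unfolding t_def by blast+
 qed
 have "finite (region {i} {a, b, c, d} t)" by (rule finite_subset[OF _ finite_coords[of "100 * B"]]) (use bd(1) in blast)
 moreover have "\<exists>J\<in>Mx. {i} \<subseteq> J & (\<forall>u\<in>{a, b, c, d}. fu u n < - t u + B --> u \<in> J | u = 7 & {1, 5} \<subseteq> J)"
  if n: "n \<in> region {i} {a, b, c, d} t" for n
 proof -
  have f: "fu a n = pr n a" "fu b n = pr n b" "fu c n = pr n c" "fu d n = pr n d" using n7 by (simp_all add: fu_def)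
  have "~ pr n b < - t b + B | ~ pr n a < - t a + B" "~ pr n d < - t d + B | ~ pr n c < - t c + B" using bd(2,3)[OF n] by blast+
  then show ?thesis
  proof (elim disjE)
   assume "~ pr n b < - t b + B" "~ pr n d < - t d + B"
   then show ?thesis by (intro bexI[OF _ J(1)]) (auto simp: f)
  next
   assume "~ pr n b < - t b + B" "~ pr n c < - t c + B"
   then show ?thesis by (intro bexI[OF _ J(2)]) (auto simp: f)
  next
   assume "~ pr n a < - t a + B" "~ pr n d < - t d + B"
   then show ?thesis by (intro bexI[OF _ J(3)]) (auto simp: f)
  next
   assume "~ pr n a < - t a + B" "~ pr n c < - t c + B"
   then show ?thesis by (intro bexI[OF _ J(4)]) (auto simp: f)
  qed
 qed
 moreover have "\<forall>u\<in>{a, b, c, d}. t u >= 0" using h B by (auto simp: t_def)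
 ultimately show "\<exists>t. (\<forall>u\<in>{a, b, c, d}. 0 <= t u) & finite (region {i} {a, b, c, d} t) & (\<forall>n\<in>region {i} {a, b, c, d} t.
   \<exists>J\<in>Mx. {i} \<subseteq> J & (\<forall>u\<in>{a, b, c, d}. fu u n < - t u + B --> u \<in> J | u = 7 & {1, 5} \<subseteq> J))"
  by blast
qed simp

text \<open>In the refined fan the rays 2, 5, 7, 1, 6 form a cycle, and 3 and 4 are joined to all of
  them. The six pairs in \<open>bad\<close> are the pairs that span no cone; the heights 5, 7, 3 and
  2 keep the facets of such a pair apart.\<close>

lemma good_empty: "good {}"
proof (rule goodI[where E = "{1, 2, 3, 4, 5, 6, 7}"])
 fix B :: int assume B: "B >= 0"
 define t where "t = (%u :: nat. 4 * B * (if u = 1 then 5 else if u = 5 then 7 else if u = 7 then 3 else 2))"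
 let ?E = "{1, 2, 3, 4, 5, 6, 7} :: nat set"
 define near where "near n u \<longleftrightarrow> fu u n < - t u + B" for n u
 have f: "fu 1 n >= - t 1" "fu 2 n >= - t 2" "fu 3 n >= - t 3" "fu 4 n >= - t 4" "fu 5 n >= - t 5" "fu 6 n >= - t 6" "fu 7 n >= - t 7"
  if "n \<in> region {} ?E t" for n using that by (simp_all add: region_def)
 have bd: "\<bar>vec_nth n 1\<bar> <= 100 * B & \<bar>vec_nth n 2\<bar> <= 100 * B & \<bar>vec_nth n 3\<bar> <= 100 * B" if n: "n \<in> region {} ?E t" for n
  using f[OF n] B by (simp add: fu_def t_def pr_def abs_le_iff)
 have bad: "~ (near n 1 & near n 5)" "~ (near n 1 & near n 2)" "~ (near n 3 & near n 4)"
  "~ (near n 5 & near n 6)" "~ (near n 2 & near n 7)" "~ (near n 6 & near n 7)" if n: "n \<in> region {} ?E t" for n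
  using f[OF n] B by (simp_all add: near_def fu_def t_def pr_def)
 have fin: "finite (region {} ?E t)" by (rule finite_subset[OF _ finite_coords[of "100 * B"]]) (use bd in blast)
 have ch: "\<exists>J\<in>Mx. {} \<subseteq> J & (\<forall>u\<in>?E. fu u n < - t u + B --> u \<in> J | u = 7 & {1, 5} \<subseteq> J)" if n: "n \<in> region {} ?E t" for n
 proof -
  \<comment> \<open>The ray 3 or 4 of the cone to be chosen; its other two rays are found on the
    cycle.\<close>
  obtain x :: nat where x: "x \<in> {3, 4}" "near n 3 --> x = 3" "near n 4 --> x = 4" using bad(3)[OF n] by (cases "near n 3") auto
  have M: "{1, x, 6} \<in> Mx" "{1, x, 5} \<in> Mx" "{2, x, 5} \<in> Mx" "{2, x, 6} \<in> Mx" using x(1) by (elim insertE emptyE; simp add: Mx_def insert_commute)+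
  have *: ?thesis if J: "J \<in> Mx" "x \<in> J" "near n 1 --> 1 \<in> J" "near n 2 --> 2 \<in> J" "near n 5 --> 5 \<in> J" "near n 6 --> 6 \<in> J"
   "near n 7 --> {1, 5} \<subseteq> J" for J
  proof (intro bexI[OF _ J(1)] conjI ballI impI)
   fix u assume u: "u \<in> ?E" and "fu u n < - t u + B"
   then have nu: "near n u" by (simp add: near_def)
   from u show "u \<in> J | u = 7 & {1, 5} \<subseteq> J"
    by (elim insertE emptyE) (use nu J x(2,3) in simp_all)
  qed simp
  show ?thesis
  proof (cases "near n 7")
   case True
   then show ?thesis using bad(5,6)[OF n] by (intro *[OF M(2)]) auto
  next
   case n7: False
   show ?thesis
   proof (cases "near n 1")
    case True
    then show ?thesis using bad(1,2)[OF n] n7 by (intro *[OF M(1)]) auto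
   next
    case n1: False
    show ?thesis
    proof (cases "near n 5")
     case True
     then show ?thesis using bad(4)[OF n] n1 n7 by (intro *[OF M(3)]) auto
    next
     case False
     then show ?thesis using n1 n7 by (intro *[OF M(4)]) auto
    qed
   qed
  qed
 qed
 have nn: "\<forall>u\<in>?E. t u >= 0" using B by (auto simp: t_def)
 show "\<exists>t. (\<forall>u\<in>?E. 0 <= t u) & finite (region {} ?E t) & (\<forall>n\<in>region {} ?E t.
   \<exists>J\<in>Mx. {} \<subseteq> J & (\<forall>u\<in>?E. fu u n < - t u + B --> u \<in> J | u = 7 & {1, 5} \<subseteq> J))"
  by (intro exI[of _ t] conjI nn fin ballI ch)
qed simp

lemma good_rays: "good {1}" "good {2}" "good {3}" "good {4}" "good {5}" "good {6}"
proof -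
 note A = Mx_def insert_commute pr_def
 show "good {1}" by (rule good_ray[of _ 3 5 6 4 "%_. 1"]) (auto simp: A)
 show "good {2}" by (rule good_ray[of _ 3 5 6 4 "%u. if u <= 4 then 1 else 2"]) (auto simp: A)
 show "good {3}" by (rule good_ray[of _ 1 5 6 2 "%u. if u = 5 then 2 else 1"]) (auto simp: A)
 show "good {4}" by (rule good_ray[of _ 1 5 6 2 "%_. 1"]) (auto simp: A)
 show "good {5}" by (rule good_ray[of _ 1 3 4 2 "%_. 1"]) (auto simp: A)
 show "good {6}" by (rule good_ray[of _ 1 3 4 2 "%u. if u = 1 then 2 else 1"]) (auto simp: A)
qed

text \<open>The last two numbers are the coefficients of the opposite rays in the wall relation; 3
  occurs just at the walls of the singular cone.\<close>

lemma good_walls: "good {1, 3}" "good {1, 4}" "good {1, 5}" "good {1, 6}" "good {2, 3}" "good {2, 4}" "good {2, 5}" "good {2, 6}"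
 "good {3, 5}" "good {3, 6}" "good {4, 5}" "good {4, 6}"
proof -
 note A = Mx_def insert_commute pr_def
 show "good {1, 3}" by (rule good_wall[of _ _ 5 6 3 1]) (auto simp: A)
 show "good {1, 4}" by (rule good_wall[of _ _ 5 6 1 1]) (auto simp: A)
 show "good {1, 5}" by (rule good_wall[of _ _ 3 4 1 1]) (auto simp: A)
 show "good {1, 6}" by (rule good_wall[of _ _ 3 4 1 3]) (auto simp: A)
 show "good {2, 3}" by (rule good_wall[of _ _ 5 6 1 1]) (auto simp: A)
 show "good {2, 4}" by (rule good_wall[of _ _ 5 6 1 1]) (auto simp: A)
 show "good {2, 5}" by (rule good_wall[of _ _ 3 4 1 1]) (auto simp: A)
 show "good {2, 6}" by (rule good_wall[of _ _ 3 4 1 1]) (auto simp: A)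
 show "good {3, 5}" by (rule good_wall[of _ _ 1 2 1 1]) (auto simp: A)
 show "good {3, 6}" by (rule good_wall[of _ _ 1 2 1 3]) (auto simp: A)
 show "good {4, 5}" by (rule good_wall[of _ _ 1 2 1 1]) (auto simp: A)
 show "good {4, 6}" by (rule good_wall[of _ _ 1 2 1 1]) (auto simp: A)
qed

lemma good_K: assumes "s \<in> K" shows "good s"
proof -
 obtain J where J: "J \<in> Mx" "s \<subseteq> J" using assms by (auto simp: K_def)
 have sub: "s = {} | s = {a} | s = {b} | s = {c} | s = {a, b} | s = {a, c} | s = {b, c} | s = {a, b, c}" if "s \<subseteq> {a, b, c}" for a b c :: nat
 proof -
  have "s Int {x} = {} | s Int {x} = {x}" for x by blast
  from this[of a] this[of b] this[of c]
  have "(s Int {a}) Un (s Int {b}) Un (s Int {c}) \<in> {{}, {a}, {b}, {c}, {a, b}, {a, c}, {b, c}, {a, b, c}}"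
   by (elim disjE; simp only:) auto
  moreover have "(s Int {a}) Un (s Int {b}) Un (s Int {c}) = s" using that by blast
  ultimately show ?thesis by simp
 qed
 have key: "good s" if e: "J = {a, b, c}"
  and g: "good {a}" "good {b}" "good {c}" "good {a, b}" "good {a, c}" "good {b, c}" for a b c
  using sub[OF J(2)[unfolded e]] good_Mx[OF J(1)[unfolded e]] g good_empty by (elim disjE) simp_all
 consider "J = {2, 4, 5}" | "J = {2, 3, 5}" | "J = {1, 4, 5}" | "J = {1, 3, 5}"
  | "J = {2, 4, 6}" | "J = {2, 3, 6}" | "J = {1, 4, 6}" | "J = {1, 3, 6}" using J(1) unfolding Mx_def by fast
 then show ?thesis by cases (erule key; rule good_rays good_walls)+
qed

subsection \<open>A weak Nullstellensatz for the affine charts\<close>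

text \<open>Functions are total, so the last clause makes membership depend on the values on
  \<open>UU J\<close> only.\<close>

definition idl :: "nat set => (3 chart_point set => complex) set => bool" where
 "idl J I \<longleftrightarrow> I \<subseteq> RR J & (%_. 0) \<in> I & (\<forall>f\<in>I. \<forall>g\<in>I. (%x. f x + g x) \<in> I) &
   (\<forall>h\<in>RR J. \<forall>f\<in>I. (%x. h x * f x) \<in> I) & (\<forall>f\<in>I. \<forall>g. (\<forall>x\<in>UU J. f x = g x) --> g \<in> I)"

lemma RR_cong: assumes "f \<in> RR J" "!!x. x \<in> UU J ==> f x = g x" shows "g \<in> RR J"
proof -
 obtain F c where "finite F" "F \<subseteq> SG J" "!!p. p \<in> UU J ==> f p = (\<Sum>m\<in>F. c m * vl p m)" using assms(1) unfolding RR_def by blast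
 then show ?thesis using assms(2) unfolding RR_def by (intro CollectI exI[of _ F] exI[of _ c]) simp
qed

lemma idlD:
 assumes "idl J I"
 shows "f \<in> I ==> f \<in> RR J" "(%_. 0) \<in> I" "f \<in> I ==> g \<in> I ==> (%x. f x + g x) \<in> I"
  "h \<in> RR J ==> f \<in> I ==> (%x. h x * f x) \<in> I" "f \<in> I ==> (!!x. x \<in> UU J ==> f x = g x) ==> g \<in> I"
 using assms unfolding idl_def by blast+

lemma idl_sum: assumes "idl J I" "finite A" "!!a. a \<in> A ==> f a \<in> I" shows "(%x. \<Sum>a\<in>A. f a x) \<in> I"
 using assms(2,3) by (induct A rule: finite_induct) (auto intro: idlD[OF assms(1)])

lemma maximal_ideal:
 assumes J: "J \<in> K" and I: "idl J I" "(%_. 1) ~: I"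
 shows "\<exists>M. idl J M & I \<subseteq> M & (%_. 1) ~: M & (\<forall>t\<in>RR J. t ~: M --> (\<exists>g\<in>RR J. (%x. 1 - g x * t x) \<in> M))"
proof -
 define A where "A = {N. idl J N & I \<subseteq> N & (%_. 1) ~: N}"
 have "I \<in> A" using I by (simp add: A_def)
 have "\<exists>M\<in>A. \<forall>X\<in>A. M \<subseteq> X --> X = M"
 proof (rule subset_Zorn_nonempty)
  show "A ~= {}" using `I \<in> A` by blast
  fix C assume C: "C ~= {}" "subset.chain A C"
  have CA: "idl J N" "I \<subseteq> N" "(%_. 1) ~: N" if "N \<in> C" for N using C(2) that unfolding subset.chain_def A_def by auto
  have tot: "N \<subseteq> N' | N' \<subseteq> N" if "N \<in> C" "N' \<in> C" for N N' using C(2) that unfolding subset_chain_def by blast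
  have "idl J (\<Union>C)"
   unfolding idl_def
  proof (intro conjI ballI allI impI)
   show "\<Union>C \<subseteq> RR J" using CA(1) idlD(1) by blast
   show "(%_. 0) \<in> \<Union>C" using CA(1) idlD(2) C(1) by blast
   fix f assume "f \<in> \<Union>C"
   then obtain N where N: "N \<in> C" "f \<in> N" by blast
   show "(%x. h x * f x) \<in> \<Union>C" if "h \<in> RR J" for h using idlD(4)[OF CA(1)[OF N(1)] that N(2)] N(1) by blast
   show "g \<in> \<Union>C" if "\<forall>x\<in>UU J. f x = g x" for g using idlD(5)[OF CA(1)[OF N(1)] N(2), of g] that N(1) by blast
   fix g assume "g \<in> \<Union>C"
   then obtain N' where N': "N' \<in> C" "g \<in> N'" by blast
   obtain L where L: "L \<in> C" "f \<in> L" "g \<in> L" using tot[OF N(1) N'(1)] N N' by blast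
   show "(%x. f x + g x) \<in> \<Union>C" using idlD(3)[OF CA(1)[OF L(1)] L(2,3)] L(1) by blast
  qed
  moreover have "I \<subseteq> \<Union>C" using C(1) CA(2) by blast
  moreover have "(%_. 1) ~: \<Union>C" using CA(3) by blast
  ultimately show "\<Union>C \<in> A" by (simp add: A_def)
 qed
 then obtain M where M: "M \<in> A" "!!X. X \<in> A ==> M \<subseteq> X ==> X = M" by blast
 have iM: "idl J M" "I \<subseteq> M" "(%_. 1) ~: M" using M(1) by (simp_all add: A_def)
 have "\<exists>g\<in>RR J. (%x. 1 - g x * t x) \<in> M" if t: "t \<in> RR J" "t ~: M" for t
 proof -
  define N where "N = {h. \<exists>g\<in>RR J. \<exists>f\<in>M. \<forall>x\<in>UU J. h x = g x * t x + f x}"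
  have NI: "h \<in> N" if "g \<in> RR J" "f \<in> M" "!!x. x \<in> UU J ==> h x = g x * t x + f x" for h g f
   using that unfolding N_def by blast
  have NE: "\<exists>g f. g \<in> RR J & f \<in> M & (\<forall>x\<in>UU J. h x = g x * t x + f x)" if "h \<in> N" for h using that unfolding N_def by blast
  have "idl J N"
   unfolding idl_def
  proof (intro conjI ballI allI impI subsetI)
   show "(%_. 0) \<in> N" by (rule NI[OF RR_const[OF J, of 0] idlD(2)[OF iM(1)]]) simp
   fix h assume "h \<in> N"
   from NE[OF this] obtain g f where g: "g \<in> RR J" "f \<in> M" "\<forall>x\<in>UU J. h x = g x * t x + f x" by (elim exE conjE)
   show "h \<in> RR J" by (rule RR_cong[OF RR_add[OF RR_mult[OF J g(1) t(1)] idlD(1)[OF iM(1) g(2)]]]) (use g(3) in simp)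
   show "(%x. h' x * h x) \<in> N" if h': "h' \<in> RR J" for h'
    by (rule NI[OF RR_mult[OF J h' g(1)] idlD(4)[OF iM(1) h' g(2)]]) (use g(3) in \<open>simp add: algebra_simps\<close>)
   show "h' \<in> N" if "\<forall>x\<in>UU J. h x = h' x" for h' by (rule NI[OF g(1,2)]) (use g(3) that in auto)
   fix h' assume "h' \<in> N"
   from NE[OF this] obtain g' f' where g': "g' \<in> RR J" "f' \<in> M" "\<forall>x\<in>UU J. h' x = g' x * t x + f' x" by (elim exE conjE)
   show "(%x. h x + h' x) \<in> N"
    by (rule NI[OF RR_add[OF g(1) g'(1)] idlD(3)[OF iM(1) g(2) g'(2)]]) (use g(3) g'(3) in \<open>simp add: algebra_simps\<close>)
  qed
  moreover have MN: "M \<subseteq> N"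
  proof
   fix f assume "f \<in> M"
   then show "f \<in> N" by (intro NI[OF RR_const[OF J, of 0]]) auto
  qed
  moreover have "t \<in> N" by (rule NI[OF RR_const[OF J, of 1] idlD(2)[OF iM(1)]]) simp
  ultimately have "(%_. 1) \<in> N" using M(2)[of N] iM(2) t(2) by (auto simp: A_def)
  from NE[OF this] obtain g f where g: "g \<in> RR J" "f \<in> M" "\<forall>x\<in>UU J. 1 = g x * t x + f x" by (elim exE conjE)
  have "(%x. 1 - g x * t x) \<in> M" by (rule idlD(5)[OF iM(1) g(2)]) (use g(3) in \<open>auto simp: algebra_simps\<close>)
  then show ?thesis using g(1) by blast
 qed
 then show ?thesis using iM by blast
qed

context
 fixes J M
 assumes J: "J \<in> K" and M: "idl J M" and one: "(%_. 1) ~: M"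
  and maxi: "!!t. t \<in> RR J ==> t ~: M ==> \<exists>g\<in>RR J. (%x. 1 - g x * t x) \<in> M"
begin

lemma const_in_M: "(%_. c) \<in> M ==> c = 0"
proof (rule ccontr)
 assume "(%_. c) \<in> M" "c ~= 0"
 then have "(%x. 1 / c * c) \<in> M" by (intro idlD(4)[OF M RR_const[OF J]])
 then show False using one `c ~= 0` by simp
qed

lemma minus_in_M: assumes "f \<in> M" "g \<in> M" shows "(%x. f x - g x) \<in> M"
 using idlD(3)[OF M assms(1) idlD(4)[OF M RR_const[OF J, of "-1"] assms(2)]] by simp

lemma poly_RR_t: "t \<in> RR J ==> (%x. poly p (t x)) \<in> RR J"
proof (induct p)
 case (pCons a p)
 then show ?case using RR_add[OF RR_const[OF J, of a] RR_mult[OF J pCons(3)]] by simp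
qed (use RR_const[OF J, of 0] in simp)

text \<open>Linear factors of \<open>p\<close> are split off one after the other; a factor
  \<open>t - a\<close> outside \<open>M\<close> is invertible modulo \<open>M\<close> by maximality
  and can be cancelled.\<close>

lemma linear_factor:
 assumes t: "t \<in> RR J" shows "p ~= 0 ==> (%x. poly p (t x)) \<in> M ==> \<exists>a. (%x. t x - a) \<in> M"
proof (induct "degree p" arbitrary: p rule: less_induct)
 case less
 show ?case
 proof (cases "degree p = 0")
  case True
  then obtain c where c: "p = [:c:]" using degree_eq_zeroE by blast
  then have "c = 0" using less(3) const_in_M by simp
  then show ?thesis using less(2) c by simp
 next
  case False
  then have "~ constant (poly p)" by (simp add: constant_degree)
  from fundamental_theorem_of_algebra[OF this] obtain a where "poly p a = 0" by (elim exE)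
  then have "[:- a, 1:] dvd p" by (simp add: poly_eq_0_iff_dvd)
  then obtain q where q: "p = [:- a, 1:] * q" by (elim dvdE)
  have q0: "q ~= 0" using less(2) q by auto
  have "degree p = Suc (degree q)" unfolding q using q0 by (subst degree_mult_eq) auto
  show ?thesis
  proof (cases "(%x. t x - a) \<in> M")
   case False
   have ta: "(%x. t x - a) \<in> RR J" using RR_add[OF t RR_const[OF J, of "- a"]] by simp
   obtain g where g: "g \<in> RR J" "(%x. 1 - g x * (t x - a)) \<in> M" using maxi[OF ta False] by (elim bexE)
   have "(%x. poly q (t x) * (1 - g x * (t x - a)) + g x * poly p (t x)) \<in> M"
    by (rule idlD(3)[OF M idlD(4)[OF M poly_RR_t[OF t] g(2)] idlD(4)[OF M g(1) less(3)]])
   then have "(%x. poly q (t x)) \<in> M" by (rule idlD(5)[OF M]) (simp add: q algebra_simps)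
   then show ?thesis using less(1)[of q] q0 `degree p = Suc (degree q)` by simp
  qed blast
 qed
qed

text \<open>These finite sets exhaust \<open>SG J\<close>, so the coordinate ring has countable
  dimension.\<close>

definition Bx :: "nat => mvec set" where
 "Bx k = {m \<in> SG J. \<bar>vec_nth m 1\<bar> <= int k & \<bar>vec_nth m 2\<bar> <= int k & \<bar>vec_nth m 3\<bar> <= int k}"

lemma finite_Bx: "finite (Bx k)" unfolding Bx_def by (rule finite_subset[OF _ finite_coords[of "int k"]]) auto

lemma RR_Bx: assumes "g \<in> RR J" shows "\<exists>k c. \<forall>x\<in>UU J. g x = (\<Sum>m\<in>Bx k. c m * vl x m)"
proof -
 obtain F c where F: "finite F" "F \<subseteq> SG J" "!!p. p \<in> UU J ==> g p = (\<Sum>m\<in>F. c m * vl p m)" using assms unfolding RR_def by blast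
 define h where "h = (%m :: mvec. nat \<bar>vec_nth m 1\<bar> + nat \<bar>vec_nth m 2\<bar> + nat \<bar>vec_nth m 3\<bar>)"
 define k where "k = sum h F"
 have sub: "F \<subseteq> Bx k"
 proof
  fix m assume m: "m \<in> F"
  then have "h m <= k" unfolding k_def using F(1) by (intro member_le_sum) auto
  then show "m \<in> Bx k" using F(2) m unfolding Bx_def h_def by auto
 qed
 have "g x = (\<Sum>m\<in>Bx k. (if m \<in> F then c m else 0) * vl x m)" if "x \<in> UU J" for x
  unfolding F(3)[OF that] by (rule sum.mono_neutral_cong_left[OF finite_Bx sub]) auto
 then show ?thesis by (intro exI[of _ k] exI[of _ "%m. if m \<in> F then c m else 0"] ballI)
qed

text \<open>Uncountably many inverses \<open>g\<^sub>a\<close> of \<open>t - a\<close> in an algebra of countable dimension satisfy a linear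
  relation, which makes \<open>t\<close> algebraic modulo \<open>M\<close>.\<close>

lemma algebraic_mod_M: assumes t: "t \<in> RR J" shows "\<exists>a. (%x. t x - a) \<in> M"
proof (rule ccontr)
 assume n: "~ ?thesis"
 define Q where "Q = (%a k c. (%x. 1 - (\<Sum>m\<in>Bx k. c m * vl x m) * (t x - a)) \<in> M)"
 have ta: "(%x. t x - a) \<in> RR J" for a using RR_add[OF t RR_const[OF J, of "- a"]] by simp
 have ex: "\<exists>k c. Q a k c" for a
 proof -
  have "(%x. t x - a) ~: M" using n by blast
  then obtain g where g: "g \<in> RR J" "(%x. 1 - g x * (t x - a)) \<in> M" using maxi[OF ta] by blast
  obtain k c where kc: "\<forall>x\<in>UU J. g x = (\<Sum>m\<in>Bx k. c m * vl x m)" using RR_Bx[OF g(1)] by (elim exE)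
  have "Q a k c" unfolding Q_def by (rule idlD(5)[OF M g(2)]) (use kc in simp)
  then show ?thesis by blast
 qed
 \<comment> \<open>There are countably many \<open>k\<close> for uncountably many \<open>a\<close>,
   so infinitely many inverses have their support in one \<open>Bx k\<close>.\<close>
 have "\<exists>k. infinite {a. \<exists>c. Q a k c}"
 proof (rule ccontr)
  assume "~ ?thesis"
  then have "countable {a. \<exists>c. Q a k c}" for k using countable_finite by metis
  then have "countable (\<Union>k. {a. \<exists>c. Q a k c})" by (rule countable_UN[OF countableI_type])
  moreover have "UNIV = (\<Union>k. {a. \<exists>c. Q a k c})"
  proof (rule UNIV_eq_I)
   fix a show "a \<in> (\<Union>k. {a. \<exists>c. Q a k c})" using ex[of a] by simp
  qed
  ultimately show False using uncountable_UNIV_complex by simp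
 qed
 then obtain k where "infinite {a. \<exists>c. Q a k c}" by (elim exE)
 from infinite_arbitrarily_large[OF this, of "Suc (card (Bx k))"]
 obtain T where T: "finite T" "card T = Suc (card (Bx k))" "T \<subseteq> {a. \<exists>c. Q a k c}" by (elim exE conjE)
 define c where "c = (%a. SOME c. Q a k c)"
 have c: "Q a k (c a)" if "a \<in> T" for a
 proof -
  have "\<exists>c. Q a k c" using T(3) that by blast
  then show ?thesis unfolding c_def by (rule someI_ex)
 qed
 obtain l where l: "\<exists>a\<in>T. l a ~= 0" "\<forall>m\<in>Bx k. (\<Sum>a\<in>T. l a * c a m) = 0"
  using nontrivial_solution[OF finite_Bx T(1), of k c] T(2) by auto
 define g where "g = (%a x. \<Sum>m\<in>Bx k. c a m * vl x m)"
 have gM: "(%x. 1 - g a x * (t x - a)) \<in> M" if "a \<in> T" for a using c[OF that] by (simp add: Q_def g_def)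
 have lg: "(\<Sum>a\<in>T. l a * g a x) = 0" for x
 proof -
  have "(\<Sum>a\<in>T. l a * g a x) = (\<Sum>m\<in>Bx k. (\<Sum>a\<in>T. l a * c a m) * vl x m)"
   unfolding g_def sum_distrib_left sum_distrib_right by (subst sum.swap) (simp add: mult.assoc)
  then show ?thesis using l(2) by simp
 qed
 \<comment> \<open>The relation between the inverses of the \<open>t - a\<close>, multiplied by the
   product of all \<open>t - b\<close>, becomes \<open>p\<close>. It is nonzero, since at a point
   \<open>a\<close> with \<open>l a\<close> nonzero only the summand of \<open>w a\<close>
   survives.\<close>
 define w where "w = (%a. \<Prod>b\<in>T - {a}. [:- b, 1:])"
 define p where "p = (\<Sum>a\<in>T. smult (l a) (w a))"
 have w: "poly (w a) y * (y - a) = (\<Prod>b\<in>T. y - b)" if "a \<in> T" for a y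
  using prod.remove[OF T(1) that, of "%b. y - b"] by (simp add: w_def poly_prod mult.commute)
 have "p ~= 0"
 proof -
  obtain a where a: "a \<in> T" "l a ~= 0" using l(1) by blast
  have z: "poly (w b) a = 0" if "b \<in> T - {a}" for b
   using a(1) that T(1) by (auto simp: w_def poly_prod prod_zero_iff)
  have "poly p a = l a * poly (w a) a + (\<Sum>b\<in>T - {a}. l b * poly (w b) a)"
   unfolding p_def poly_sum by (subst sum.remove[OF T(1) a(1)]) simp
  also have "(\<Sum>b\<in>T - {a}. l b * poly (w b) a) = 0" by (rule sum.neutral) (use z in simp)
  finally have "poly p a = l a * poly (w a) a" by simp
  moreover have "poly (w a) a ~= 0" using T(1) by (auto simp: w_def poly_prod prod_zero_iff)
  ultimately show ?thesis using a(2) by auto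
 qed
 have "(%x. \<Sum>a\<in>T. (l a * poly (w a) (t x)) * (1 - g a x * (t x - a))) \<in> M"
 proof (rule idl_sum[OF M T(1)])
  fix a assume a: "a \<in> T"
  show "(%x. (l a * poly (w a) (t x)) * (1 - g a x * (t x - a))) \<in> M"
   by (rule idlD(4)[OF M RR_mult[OF J RR_const[OF J] poly_RR_t[OF t]] gM[OF a]])
 qed
 then have "(%x. poly p (t x)) \<in> M"
 proof (rule idlD(5)[OF M])
  fix x
  have "(\<Sum>a\<in>T. (l a * poly (w a) (t x)) * (1 - g a x * (t x - a))) =
   (\<Sum>a\<in>T. l a * poly (w a) (t x) - l a * g a x * (\<Prod>b\<in>T. t x - b))"
   by (rule sum.cong[OF refl]) (simp add: w[symmetric] algebra_simps)
  also have "... = poly p (t x) - (\<Sum>a\<in>T. l a * g a x) * (\<Prod>b\<in>T. t x - b)"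
   by (simp add: sum_subtractf sum_distrib_right p_def poly_sum)
  finally show "(\<Sum>a\<in>T. (l a * poly (w a) (t x)) * (1 - g a x * (t x - a))) = poly p (t x)" using lg by simp
 qed
 then show False using linear_factor[OF t `p ~= 0`] n by blast
qed

text \<open>The scalars to which the characters are congruent modulo \<open>M\<close> form a
  semigroup homomorphism, and this is a point of the chart.\<close>

lemma maximal_ideal_zero: "\<exists>y\<in>UU J. \<forall>f\<in>M. f y = 0"
proof -
 define a where "a = (%m. SOME a. (%x. vl x m - a) \<in> M)"
 have a: "(%x. vl x m - a m) \<in> M" if "m \<in> SG J" for m
  using someI_ex[OF algebraic_mod_M[OF RR_vl[OF that]]] by (simp add: a_def)
 define z where "z = (%m. if m \<in> SG J then a m else 0)"
 have "z \<in> ch J"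
  unfolding ch_iff[OF J]
 proof (intro conjI ballI allI impI)
  have "(%_. 1 - a 0) \<in> M" by (rule idlD(5)[OF M a[OF SG_0]]) (use vl_0 UU_PP[OF J] in auto)
  then show "z 0 = 1" using const_in_M[of "1 - a 0"] by (simp add: z_def)
  fix m m' assume m: "m \<in> SG J" "m' \<in> SG J"
  have "(%x. vl x m * (vl x m' - a m') + a m' * (vl x m - a m)) \<in> M"
   by (rule idlD(3)[OF M idlD(4)[OF M RR_vl[OF m(1)] a[OF m(2)]] idlD(4)[OF M RR_const[OF J] a[OF m(1)]]])
  from minus_in_M[OF this a[OF SG_add[OF m]]]
  have "(%_. a (m + m') - a m * a m') \<in> M"
  proof (rule idlD(5)[OF M])
   fix x assume "x \<in> UU J"
   from vl_add[OF J this m] show "vl x m * (vl x m' - a m') + a m' * (vl x m - a m) - (vl x (m + m') - a (m + m')) = a (m + m') - a m * a m'"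
    by (simp only:) (simp add: ring_distribs mult.commute)
  qed
  then show "z (m + m') = z m * z m'" using const_in_M[of "a (m + m') - a m * a m'"] m SG_add[OF m] by (simp add: z_def)
 qed (simp add: z_def)
 then have y: "tp J z \<in> UU J" and vy: "!!m. m \<in> SG J ==> vl (tp J z) m = a m" by (auto simp: UU_def vl_tp[OF J] z_def)
 have "f (tp J z) = 0" if fM: "f \<in> M" for f
 proof -
  obtain F c where F: "finite F" "F \<subseteq> SG J" "!!p. p \<in> UU J ==> f p = (\<Sum>m\<in>F. c m * vl p m)"
   using idlD(1)[OF M fM] unfolding RR_def by blast
  have "(%x. \<Sum>m\<in>F. c m * (vl x m - a m)) \<in> M"
  proof (rule idl_sum[OF M F(1)])
   fix m assume "m \<in> F"
   then have "m \<in> SG J" using F(2) by blast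
   from idlD(4)[OF M RR_const[OF J] a[OF this]] show "(%x. c m * (vl x m - a m)) \<in> M" .
  qed
  from minus_in_M[OF fM this] have "(%_. f (tp J z)) \<in> M"
  proof (rule idlD(5)[OF M])
   fix x assume x: "x \<in> UU J"
   have "f (tp J z) = (\<Sum>m\<in>F. c m * a m)" unfolding F(3)[OF y] by (rule sum.cong[OF refl]) (use F(2) vy in auto)
   then show "f x - (\<Sum>m\<in>F. c m * (vl x m - a m)) = f (tp J z)" unfolding F(3)[OF x] by (simp add: algebra_simps sum_subtractf)
  qed
  then show ?thesis by (rule const_in_M)
 qed
 then show ?thesis using y by blast
qed

end

lemma weak_nullstellensatz:
 assumes J: "J \<in> K" and I: "idl J I" and nz: "!!x. x \<in> UU J ==> \<exists>f\<in>I. f x ~= 0"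
 shows "(%_. 1) \<in> I"
proof (rule ccontr)
 assume "(%_. 1) ~: I"
 from maximal_ideal[OF J I this] obtain M where M: "idl J M" "I \<subseteq> M" "(%_. 1) ~: M"
  "\<forall>t\<in>RR J. t ~: M --> (\<exists>g\<in>RR J. (%x. 1 - g x * t x) \<in> M)" by (elim exE conjE)
 have "\<exists>y\<in>UU J. \<forall>f\<in>M. f y = 0" by (rule maximal_ideal_zero[OF J M(1,3)]) (use M(4) in blast)
 then show False using nz M(2) by blast
qed

subsection \<open>Equations with coefficients in a ring of functions\<close>

text \<open>Take \<open>s\<close> with the fewest rays. A character of \<open>SG s\<close> that is
  nonzero at \<open>x\<close> puts \<open>x\<close> into the chart of the face on which it vanishes,
  so by minimality it is orthogonal to \<open>s\<close>.\<close>

lemma orbit_cone: assumes "x \<in> points XX" shows "\<exists>s\<in>K. x \<in> UU s & (\<forall>m\<in>SG s. vl x m ~= 0 \<longleftrightarrow> m \<in> perp s)"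
proof -
 obtain I where I: "I \<in> K" "x \<in> UU I" using assms unfolding points_XX by (auto simp: PP_def)
 have "\<exists>s. (s \<in> K & x \<in> UU s) & (\<forall>s'. s' \<in> K & x \<in> UU s' --> card s <= card s')"
  by (rule ex_has_least_nat[of "%s. s \<in> K & x \<in> UU s" I card]) (use I in blast)
 then obtain s where s: "s \<in> K" "x \<in> UU s" and min: "!!s'. s' \<in> K ==> x \<in> UU s' ==> card s <= card s'" by (elim exE conjE) blast
 have "vl x m ~= 0 \<longleftrightarrow> m \<in> perp s" if m: "m \<in> SG s" for m
 proof
  assume nz: "vl x m ~= 0"
  define J where "J = {i \<in> s. pr m i = 0}"
  have "J \<subseteq> s" by (auto simp: J_def)
  then have JK: "J \<in> K" using K_subset[OF s(1)] by blast
  have "sep m s J" using m by (auto simp: sep_def J_def SG_def)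
  then have "x \<in> UU J" using UU_sep[OF s(1) JK _ s(2)] nz by blast
  then have "card s <= card J" using min JK by blast
  then have "J = s" using card_seteq[OF finite_K[OF s(1)] `J \<subseteq> s`] by blast
  then show "m \<in> perp s" by (auto simp: perp_def J_def)
 next
  assume "m \<in> perp s"
  then have "- m \<in> SG s" by (auto simp: perp_def SG_def)
  from vl_add[OF s(1,2) m this] have "vl x m * vl x (- m) = 1" using vl_0[of x] s UU_PP by auto
  then show "vl x m ~= 0" by auto
 qed
 then show ?thesis using s by blast
qed

context function_ring
begin

text \<open>The equation provided by the Nullstellensatz has the coefficient of \<open>\<chi>\<^sup>0\<close> equal to \<open>1\<close>, and all
  others equal to \<open>0\<close>, at \<open>z0\<close>.\<close>

lemma unit_equation:
 assumes J: "J \<in> K"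
  and loc: "!!x. x \<in> UU J ==> \<exists>q\<in>QQ J. q x z0 ~= 0 & (\<forall>y z. (y, z) \<in> A & y \<in> UU J --> q y z = 0)"
 shows "\<exists>F \<rho>. finite F & F \<subseteq> SG J & (\<forall>m. \<rho> m \<in> R) & (\<forall>m. \<rho> m z0 = (if m = 0 then 1 else 0)) & (\<forall>m. m ~: F --> \<rho> m = (%_. 0)) &
  (\<forall>y z. (y, z) \<in> A & y \<in> UU J --> (\<Sum>m\<in>F. \<rho> m z * vl y m) = 0)"
proof -
 define van where "van q \<longleftrightarrow> (\<forall>y z. (y, z) \<in> A & y \<in> UU J --> q y z = (0 :: complex))" for q
 \<comment> \<open>The restrictions to \<open>z0\<close> of functions that vanish on
   \<open>A\<close>; by \<open>loc\<close> they have no common zero.\<close>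
 define I where "I = {f. \<exists>q\<in>QQ J. van q & (\<forall>x\<in>UU J. f x = q x z0)}"
 have II: "f \<in> I" if "q \<in> QQ J" "van q" "!!x. x \<in> UU J ==> f x = q x z0" for f q using that unfolding I_def by blast
 have IE: "\<exists>q. q \<in> QQ J & van q & (\<forall>x\<in>UU J. f x = q x z0)" if "f \<in> I" for f using that unfolding I_def by blast
 have "idl J I"
  unfolding idl_def
 proof (intro conjI ballI allI impI subsetI)
  show "(%_. 0) \<in> I" by (rule II[OF QQ_R[OF J const[of 0]]]) (auto simp: van_def)
  fix f assume "f \<in> I"
  from IE[OF this] obtain q where q: "q \<in> QQ J" "van q" "\<forall>x\<in>UU J. f x = q x z0" by (elim exE conjE)
  obtain F c where F': "finite F" "F \<subseteq> SG J" "\<forall>m\<in>F. c m \<in> R" "\<forall>x\<in>UU J. \<forall>z. q x z = (\<Sum>m\<in>F. c m z * vl x m)" using QQ_ex[OF q(1)] by (elim exE conjE)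
 note F = F'(1,2) F'(3)[rule_format] F'(4)[rule_format]
  show "f \<in> RR J" by (rule RR_I[of F "%m. m" J f "%m. c m z0"]) (use F q(3) in auto)
  show "(%x. h x * f x) \<in> I" if h: "h \<in> RR J" for h
   by (rule II[OF QQ_mult[OF J QQ_RR[OF h] q(1)]]) (use q(2,3) in \<open>auto simp: van_def\<close>)
  show "g \<in> I" if "\<forall>x\<in>UU J. f x = g x" for g by (rule II[OF q(1,2)]) (use q(3) that in auto)
  fix g assume "g \<in> I"
  from IE[OF this] obtain q' where q': "q' \<in> QQ J" "van q'" "\<forall>x\<in>UU J. g x = q' x z0" by (elim exE conjE)
  show "(%x. f x + g x) \<in> I" by (rule II[OF QQ_add[OF q(1) q'(1)]]) (use q(2,3) q'(2,3) in \<open>auto simp: van_def\<close>)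
 qed
 moreover have "\<exists>f\<in>I. f x ~= 0" if x: "x \<in> UU J" for x
 proof -
  obtain q where q: "q \<in> QQ J" "q x z0 ~= 0" "van q" using loc[OF x] unfolding van_def by (elim bexE conjE)
  show ?thesis by (rule bexI[of _ "%x. q x z0"]) (use q II[OF q(1,3)] in auto)
 qed
 ultimately have "(%_. 1) \<in> I" by (rule weak_nullstellensatz[OF J])
 from IE[OF this] obtain q where q: "q \<in> QQ J" "van q" "\<forall>x\<in>UU J. 1 = q x z0" by (elim exE conjE)
 obtain F c where F': "finite F" "F \<subseteq> SG J" "\<forall>m\<in>F. c m \<in> R" "\<forall>x\<in>UU J. \<forall>z. q x z = (\<Sum>m\<in>F. c m z * vl x m)" using QQ_ex[OF q(1)] by (elim exE conjE)
 note F = F'(1,2) F'(3)[rule_format] F'(4)[rule_format]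
 have UJ: "openin (zar XX) (UU J)" "UU J ~= {}" using open_UU[OF J] tor_UU[OF _ J, of "Pt 1 1 1"] by auto
 have eq: "(\<Sum>m\<in>F. c m z0 * vl p m) = (\<Sum>m\<in>{0}. 1 * vl p m)" if "p \<in> UU J" for p
 proof -
  have "p \<in> PP" using that UU_PP[OF J] by blast
  then show ?thesis using F(4)[OF that, of z0] q(3) that by (simp add: vl_0)
 qed
 \<comment> \<open>Independence of characters allows comparing coefficients in
   \<open>1 = q x z0\<close>.\<close>
 have s1: "m = 0" if "m \<in> F" "c m z0 ~= 0" for m
  using laurent_support[where F' = "{0}" and c = "%m. c m z0" and c' = "%_. 1", OF F(1) _ UJ eq that] by simp
 have s2: "0 \<in> F"
  by (rule laurent_support[where F = "{0}" and c' = "%m. c m z0" and c = "%_. 1", OF _ F(1) UJ eq[symmetric]]) auto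
 have c0: "c 0 z0 = 1"
 proof -
  obtain p where p: "p \<in> UU J" using UJ by blast
  have "vl p 0 = 1" using vl_0[of p] p UU_PP[OF J] by blast
  have "(\<Sum>m\<in>F - {0}. c m z0 * vl p m) = 0" by (rule sum.neutral) (use s1 in force)
  then have "(\<Sum>m\<in>F. c m z0 * vl p m) = c 0 z0 * vl p 0"
   using sum.remove[OF F(1) s2, of "%m. c m z0 * vl p m"] by simp
  then show ?thesis using eq[OF p] `vl p 0 = 1` by simp
 qed
 define \<rho> where "\<rho> = (%m. if m \<in> F then c m else (%_. 0))"
 have e: "(\<Sum>m\<in>F. \<rho> m z * vl y m) = (\<Sum>m\<in>F. c m z * vl y m)" for y z by (rule sum.cong) (auto simp: \<rho>_def)
 show ?thesis
 proof (intro exI[of _ F] exI[of _ \<rho>] conjI allI impI)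
  show "\<rho> m \<in> R" for m using F(3) const[of 0] by (simp add: \<rho>_def)
  show "\<rho> m z0 = (if m = 0 then 1 else 0)" for m using s1[of m] s2 c0 by (auto simp: \<rho>_def)
  show "(\<Sum>m\<in>F. \<rho> m z * vl y m) = 0" if "(y, z) \<in> A & y \<in> UU J" for y z
   using q(2) F(4)[of y z] that unfolding e van_def by simp
 qed (use F in \<open>auto simp: \<rho>_def\<close>)
qed

text \<open>The orbits are treated one by one. On the orbit of \<open>s\<close> exactly the
  characters of \<open>SG s\<close> in \<open>perp s\<close> are nonzero, so an equation may be
  multiplied by such a character, and its terms outside \<open>perp s\<close> drop out. The product
  over all \<open>s\<close> takes care of the whole of \<open>A\<close>.\<close>

lemma projection_equation:
 assumes A: "!!x z. (x, z) \<in> A ==> x \<in> points XX"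
  and loc: "!!J x. J \<in> Mx ==> x \<in> UU J ==> \<exists>q\<in>QQ J. q x z0 ~= 0 & (\<forall>y z. (y, z) \<in> A & y \<in> UU J --> q y z = 0)"
 shows "\<exists>r\<in>R. r z0 ~= 0 & (\<forall>x z. (x, z) \<in> A --> r z = 0)"
proof -
 define Pd where "Pd J F \<rho> \<longleftrightarrow> finite F & F \<subseteq> SG J & (\<forall>m. \<rho> m \<in> R) & (\<forall>m. \<rho> m z0 = (if m = 0 then 1 else 0)) & (\<forall>m. m ~: F --> \<rho> m = (%_. 0)) &
  (\<forall>y z. (y, z) \<in> A & y \<in> UU J --> (\<Sum>m\<in>F. \<rho> m z * vl y m) = 0)" for J F \<rho>
 define fr where "fr J = (SOME fr. Pd J (fst fr) (snd fr))" for J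
 have fr: "Pd J (fst (fr J)) (snd (fr J))" if J: "J \<in> Mx" for J
 proof -
  have "\<exists>F \<rho>. Pd J F \<rho>" unfolding Pd_def by (rule unit_equation[OF MxK[OF J]]) (rule loc[OF J])
  then obtain F \<rho> where "Pd J F \<rho>" by (elim exE)
  then have "Pd J (fst (F, \<rho>)) (snd (F, \<rho>))" by simp
  then show ?thesis unfolding fr_def by (rule someI[of "%fr. Pd J (fst fr) (snd fr)"])
 qed
 define F where "F J = (if J \<in> Mx then fst (fr J) else {})" for J
 define \<rho> where "\<rho> J = snd (fr J)" for J
 have Fr: "finite (F J)" "F J \<subseteq> SG J" "!!m. \<rho> J m \<in> R" "!!m. \<rho> J m z0 = (if m = 0 then 1 else 0)" "!!m. m ~: F J ==> \<rho> J m = (%_. 0)"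
  "!!y z. (y, z) \<in> A ==> y \<in> UU J ==> (\<Sum>m\<in>F J. \<rho> J m z * vl y m) = 0" if "J \<in> Mx" for J
  using fr[OF that] that unfolding Pd_def F_def \<rho>_def by simp_all
 have "\<exists>r\<in>R. r z0 ~= 0 & (\<forall>x z. (x, z) \<in> A & x \<in> UU s & (\<forall>m\<in>SG s. vl x m ~= 0 \<longleftrightarrow> m \<in> perp s) --> r z = 0)" if s: "s \<in> K" for s
 proof -
  have "\<forall>J. finite (F J)" using Fr(1) by (auto simp: F_def)
  then have "\<exists>P. finite P & 0 \<in> P & P \<subseteq> perp s & (\<forall>n\<in>P. \<exists>J\<in>Mx. s \<subseteq> J & (\<forall>m\<in>F J. m \<in> SG J & m \<in> perp s --> n + m \<in> P))"
   using good_K[OF s] unfolding good_def by blast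
  then obtain P where P: "finite P" "0 \<in> P" "P \<subseteq> perp s"
   "\<forall>n\<in>P. \<exists>J\<in>Mx. s \<subseteq> J & (\<forall>m\<in>F J. m \<in> SG J & m \<in> perp s --> n + m \<in> P)" by (elim exE conjE)
  obtain j where j: "!!n. n \<in> P ==> j n \<in> Mx & s \<subseteq> j n & (\<forall>m\<in>F (j n). m \<in> SG (j n) & m \<in> perp s --> n + m \<in> P)"
   using bchoice[of P "%n J. J \<in> Mx & s \<subseteq> J & (\<forall>m\<in>F J. m \<in> SG J & m \<in> perp s --> n + m \<in> P)"] P(4) by blast
  have pS: "perp s \<subseteq> SG s" by (auto simp: perp_def SG_def)
  have padd: "n + m \<in> perp s \<longleftrightarrow> m \<in> perp s" if "n \<in> perp s" for n m using that by (auto simp: perp_def)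
  \<comment> \<open>Row \<open>i\<close> is the equation of chart \<open>j i\<close> times the
    character \<open>i\<close>, so the coefficient of \<open>i'\<close> is that of
    \<open>i' - i\<close>; at \<open>z0\<close> only \<open>i' = i\<close> is left.\<close>
  have "\<exists>r\<in>R. r z0 ~= 0 & (\<forall>z v. (\<exists>i\<in>P. v i ~= 0) & (\<forall>i\<in>P. (\<Sum>i'\<in>P. \<rho> (j i) (i' - i) z * v i') = 0) --> r z = 0)"
   by (rule kernel_function[OF P(1)]) (use Fr(3,4) j in auto)
  then obtain r where r: "r \<in> R" "r z0 ~= 0"
   "!!z v. (\<exists>i\<in>P. v i ~= 0) & (\<forall>i\<in>P. (\<Sum>i'\<in>P. \<rho> (j i) (i' - i) z * v i') = 0) ==> r z = 0" by blast
  have "r z = 0" if xz: "(x, z) \<in> A" and x: "x \<in> UU s" and orb: "\<forall>m\<in>SG s. vl x m ~= 0 \<longleftrightarrow> m \<in> perp s" for x z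
  proof (rule r(3)[where v = "vl x"], intro conjI ballI)
   show "\<exists>i\<in>P. vl x i ~= 0" using P(2,3) orb pS by blast
   fix n assume n: "n \<in> P"
   define J where "J = j n"
   have J: "J \<in> Mx" "s \<subseteq> J" "!!m. m \<in> F J ==> m \<in> perp s ==> n + m \<in> P" using j[OF n] Fr(2)[of "j n"] unfolding J_def by blast+
   have xJ: "x \<in> UU J" using UU_mono[OF MxK[OF J(1)] J(2)] x by blast
   have np: "n \<in> perp s" using n P(3) by blast
   let ?G = "{m \<in> F J. m \<in> perp s}"
   have "(\<Sum>i\<in>P. \<rho> J (i - n) z * vl x i) = (\<Sum>i\<in>(%m. n + m) ` ?G. \<rho> J (i - n) z * vl x i)"
   proof (rule sum.mono_neutral_right[OF P(1)])
    show "(%m. n + m) ` ?G \<subseteq> P" using J(3) by blast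
    show "\<forall>i\<in>P - (%m. n + m) ` ?G. \<rho> J (i - n) z * vl x i = 0"
    proof
     fix i assume i: "i \<in> P - (%m. n + m) ` ?G"
     have "i - n \<in> perp s" using i P(3) np by (auto simp: perp_def)
     moreover have "i = n + (i - n)" by simp
     ultimately have "i - n ~: F J" using i by blast
     then show "\<rho> J (i - n) z * vl x i = 0" using Fr(5)[OF J(1)] by simp
    qed
   qed
   also have "... = (\<Sum>m\<in>?G. \<rho> J m z * vl x (n + m))"
    by (subst sum.reindex) (auto simp: inj_on_def)
   also have "... = vl x n * (\<Sum>m\<in>?G. \<rho> J m z * vl x m)"
    unfolding sum_distrib_left
   proof (rule sum.cong[OF refl])
    fix m assume "m \<in> ?G"
    then have "vl x (n + m) = vl x n * vl x m" using vl_add[OF s x] np pS by blast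
    then show "\<rho> J m z * vl x (n + m) = vl x n * (\<rho> J m z * vl x m)" by simp
   qed
   also have "(\<Sum>m\<in>?G. \<rho> J m z * vl x m) = (\<Sum>m\<in>F J. \<rho> J m z * vl x m)"
   proof (rule sum.mono_neutral_left[OF Fr(1)[OF J(1)]])
    show "\<forall>m\<in>F J - ?G. \<rho> J m z * vl x m = 0"
    proof
     fix m assume m: "m \<in> F J - ?G"
     then have "m \<in> SG s" "m ~: perp s" using Fr(2)[OF J(1)] SG_mono[OF J(2)] by auto
     then show "\<rho> J m z * vl x m = 0" using orb by auto
    qed
   qed blast
   also have "... = 0" by (rule Fr(6)[OF J(1) xz xJ])
   finally show "(\<Sum>i'\<in>P. \<rho> (j n) (i' - n) z * vl x i') = 0" unfolding J_def by simp
  qed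
  then show ?thesis using r(1,2) by blast
 qed
 then obtain r where r: "!!s. s \<in> K ==> r s \<in> R & r s z0 ~= 0 &
  (\<forall>x z. (x, z) \<in> A & x \<in> UU s & (\<forall>m\<in>SG s. vl x m ~= 0 \<longleftrightarrow> m \<in> perp s) --> r s z = 0)" by metis
 have "K \<subseteq> Pow L6" unfolding K_def Mx_def by auto
 then have fK: "finite K" by (rule finite_subset) simp
 show ?thesis
 proof (intro bexI[of _ "%z. \<Prod>s\<in>K. r s z"] conjI allI impI)
  show "(\<Prod>s\<in>K. r s z0) ~= 0" using fK r by (simp add: prod_zero_iff)
  show "(%z. \<Prod>s\<in>K. r s z) \<in> R" by (rule prod[OF fK]) (use r in blast)
  fix x z assume xz: "(x, z) \<in> A"
  obtain s where s: "s \<in> K" "x \<in> UU s" "\<forall>m\<in>SG s. vl x m ~= 0 \<longleftrightarrow> m \<in> perp s" using orbit_cone[OF A[OF xz]] by (elim bexE conjE)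
  have "r s z = 0" using r[OF s(1)] xz s(2,3) by blast
  then show "(\<Prod>s\<in>K. r s z) = 0" using fK s(1) by (auto simp: prod_zero_iff)
 qed
qed

end

subsection \<open>Affine charts of the second factor\<close>

lemma poly_funsI:
 assumes "finite A" "!!z. f z = (\<Sum>a\<in>A. d a * (\<Prod>i<n. z i ^ g a i))" shows "f \<in> poly_funs n"
 unfolding poly_funs_def
proof (intro CollectI exI conjI)
 show "finite (g ` A)" using assms(1) by simp
 show "f = (%z. \<Sum>e\<in>g ` A. (\<Sum>a\<in>{a\<in>A. g a = e}. d a) * (\<Prod>i<n. z i ^ e i))"
 proof
  fix z
  have "f z = (\<Sum>e\<in>g ` A. \<Sum>a\<in>{a\<in>A. g a = e}. d a * (\<Prod>i<n. z i ^ g a i))"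
   unfolding assms(2) by (rule sum.image_gen[OF assms(1)])
  also have "... = (\<Sum>e\<in>g ` A. (\<Sum>a\<in>{a\<in>A. g a = e}. d a) * (\<Prod>i<n. z i ^ e i))"
   by (intro sum.cong) (auto simp: sum_distrib_right)
  finally show "f z = (\<Sum>e\<in>g ` A. (\<Sum>a\<in>{a\<in>A. g a = e}. d a) * (\<Prod>i<n. z i ^ e i))" .
 qed
qed

lemma poly_funs_ex: "f \<in> poly_funs n ==> \<exists>E c. finite E & f = (%z. \<Sum>e\<in>E. c e * (\<Prod>i<n. z i ^ e i))"
 unfolding poly_funs_def by blast

lemma poly_funs_ring: "function_ring (poly_funs n)"
proof
 show "(%_. c) \<in> poly_funs n" for c by (rule poly_funsI[where A = "{%_. 0}" and d = "%_. c" and g = "%e. e"]) auto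
 fix f g assume f: "f \<in> poly_funs n" and g: "g \<in> poly_funs n"
 obtain E c where E: "finite E" "f = (%z. \<Sum>e\<in>E. c e * (\<Prod>i<n. z i ^ e i))" using poly_funs_ex[OF f] by (elim exE conjE)
 obtain E' c' where E': "finite E'" "g = (%z. \<Sum>e\<in>E'. c' e * (\<Prod>i<n. z i ^ e i))" using poly_funs_ex[OF g] by (elim exE conjE)
 show "(%z. f z + g z) \<in> poly_funs n"
  by (rule poly_funsI[where A = "E <+> E'" and d = "case_sum c c'" and g = "case_sum (%e. e) (%e. e)"]) (auto simp: E E' sum.Plus)
 show "(%z. f z * g z) \<in> poly_funs n"
 proof (rule poly_funsI[where A = "E \<times> E'" and d = "%(e, e'). c e * c' e'" and g = "%(e, e') i. e i + e' i"])
  fix z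
  have "f z * g z = (\<Sum>e\<in>E. \<Sum>e'\<in>E'. (c e * (\<Prod>i<n. z i ^ e i)) * (c' e' * (\<Prod>i<n. z i ^ e' i)))"
   unfolding E(2) E'(2) by (rule sum_product)
  also have "... = (\<Sum>e\<in>E. \<Sum>e'\<in>E'. (c e * c' e') * (\<Prod>i<n. z i ^ (e i + e' i)))"
   by (intro sum.cong refl) (simp add: power_add prod.distrib)
  finally show "f z * g z = (\<Sum>a\<in>E \<times> E'. (case a of (e, e') => c e * c' e') * (\<Prod>i<n. z i ^ (case a of (e, e') => %i. e i + e' i) i))"
   by (simp add: sum.cartesian_product case_prod_beta)
 qed (use E E' in auto)
qed

lemma affine_top: "openin (zar (affine_space n)) H \<longleftrightarrow>
  openin (topology_generated_by {{z \<in> {z. \<forall>i\<ge>n. z i = 0}. f z ~= 0} | f. f \<in> poly_funs n}) H"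
 by (simp add: affine_space_def Let_def)

lemma affine_open: "f \<in> poly_funs n ==> openin (zar (affine_space n)) {z. (\<forall>i\<ge>n. z i = 0) & f z ~= 0}"
 unfolding affine_top by (rule topology_generated_by_Basis) auto

lemma affine_local:
 assumes "openin (zar (affine_space n)) H" "w \<in> H"
 shows "\<exists>f\<in>poly_funs n. f w ~= 0 & (\<forall>v. (\<forall>i\<ge>n. v i = 0) & f v ~= 0 --> v \<in> H)"
proof -
 interpret P: function_ring "poly_funs n" by (rule poly_funs_ring)
 have "generate_topology_on {{z \<in> {z. \<forall>i\<ge>n. z i = 0}. f z ~= 0} | f. f \<in> poly_funs n} H"
  using assms(1) unfolding affine_top by (simp add: openin_topology_generated_by_iff)
 then show ?thesis using assms(2)
 proof (induct H rule: generate_topology_on.induct)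
  case (Int A B)
  then have w: "w \<in> A" "w \<in> B" by auto
  obtain f where f: "f \<in> poly_funs n" "f w ~= 0" "\<forall>v. (\<forall>i\<ge>n. v i = 0) & f v ~= 0 --> v \<in> A" using Int(2)[OF w(1)] by (elim bexE conjE)
  obtain g where g: "g \<in> poly_funs n" "g w ~= 0" "\<forall>v. (\<forall>i\<ge>n. v i = 0) & g v ~= 0 --> v \<in> B" using Int(4)[OF w(2)] by (elim bexE conjE)
  show ?case by (rule bexI[OF _ P.mult[OF f(1) g(1)]]) (use f g in auto)
 next
  case (UN \<K>)
  then obtain A where A: "A \<in> \<K>" "w \<in> A" by blast
  obtain f where f: "f \<in> poly_funs n" "f w ~= 0" "\<forall>v. (\<forall>i\<ge>n. v i = 0) & f v ~= 0 --> v \<in> A" using UN(2)[OF A] by (elim bexE conjE)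
  show ?case by (rule bexI[OF _ f(1)]) (use f A in auto)
 next
  case (Basis B)
  then obtain f where f: "f \<in> poly_funs n" "B = {z \<in> {z. \<forall>i\<ge>n. z i = 0}. f z ~= 0}" by blast
  show ?case by (rule bexI[OF _ f(1)]) (use f Basis(2) in auto)
 qed simp
qed

locale affine_chart =
 fixes Z :: "(nat => complex) fun_space" and U0 n W \<psi>
 assumes openU0: "openin (zar Z) U0" and closedW: "closedin (zar (affine_space n)) W"
  and iso: "fs_iso (fsubspace Z U0) (fsubspace (affine_space n) W) \<psi>"
begin

definition CR :: "((nat => complex) => complex) set" where "CR = {r. \<exists>a\<in>poly_funs n. \<forall>z\<in>U0. r z = a (\<psi> z)}"

lemma CR_I: "a \<in> poly_funs n ==> (%z. a (\<psi> z)) \<in> CR" by (auto simp: CR_def)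

sublocale function_ring CR
proof -
 interpret P: function_ring "poly_funs n" by (rule poly_funs_ring)
 show "function_ring CR"
 proof
  show "(%_. c) \<in> CR" for c unfolding CR_def using P.const[of c] by (intro CollectI bexI[of _ "%_. c"]) auto
  fix f g assume "f \<in> CR" "g \<in> CR"
  then obtain a b where ab: "a \<in> poly_funs n" "\<forall>z\<in>U0. f z = a (\<psi> z)" "b \<in> poly_funs n" "\<forall>z\<in>U0. g z = b (\<psi> z)" unfolding CR_def by blast
  show "(%z. f z + g z) \<in> CR" unfolding CR_def by (intro CollectI bexI[OF _ P.add[OF ab(1,3)]]) (use ab in auto)
  show "(%z. f z * g z) \<in> CR" unfolding CR_def by (intro CollectI bexI[OF _ P.mult[OF ab(1,3)]]) (use ab in auto)
 qed
qed

lemma iso_reg: "openin (zar (fsubspace (affine_space n) W)) B ==>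
  f \<in> reg (fsubspace (affine_space n) W) B \<longleftrightarrow> f \<circ> \<psi> \<in> reg (fsubspace Z U0) {x \<in> points (fsubspace Z U0). \<psi> x \<in> B}"
 using iso unfolding fs_iso_def by (elim conjE allE[of _ B] allE[of _ f] impE)

lemma U0_points: "U0 \<subseteq> points Z" using openin_subset[OF openU0] .

lemma W_zero: "w \<in> W ==> \<forall>i\<ge>n. w i = 0"
proof -
 have "topspace (zar (affine_space n)) \<subseteq> {z. \<forall>i\<ge>n. z i = 0}" by (auto simp: affine_space_def Let_def)
 then show "w \<in> W ==> \<forall>i\<ge>n. w i = 0" using closedin_subset[OF closedW] by blast
qed

lemma hom: "homeomorphic_map (subtopology (zar Z) U0) (subtopology (zar (affine_space n)) W) \<psi>"
 using iso by (simp add: fs_iso_def fsubspace_def)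

lemma top_simps: "topspace (subtopology (zar Z) U0) = U0" "topspace (subtopology (zar (affine_space n)) W) = W"
 using U0_points closedin_subset[OF closedW] by auto

lemma psi_image: "\<psi> ` U0 = W" using homeomorphic_imp_surjective_map[OF hom] top_simps by simp

lemma psi_inj: "inj_on \<psi> U0" using homeomorphic_imp_injective_map[OF hom] top_simps by simp

lemma open_CR: assumes "r \<in> CR" shows "openin (zar Z) {z \<in> U0. r z ~= 0}"
proof -
 obtain a where a: "a \<in> poly_funs n" "\<forall>z\<in>U0. r z = a (\<psi> z)" using assms unfolding CR_def by blast
 have c: "continuous_map (subtopology (zar Z) U0) (zar (affine_space n)) \<psi>"
  using homeomorphic_imp_continuous_map[OF hom] by (simp add: continuous_map_in_subtopology)
 have "openin (subtopology (zar Z) U0) {z \<in> topspace (subtopology (zar Z) U0). \<psi> z \<in> {z. (\<forall>i\<ge>n. z i = 0) & a z ~= 0}}"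
  by (rule openin_continuous_map_preimage[OF c affine_open[OF a(1)]])
 also have "{z \<in> topspace (subtopology (zar Z) U0). \<psi> z \<in> {z. (\<forall>i\<ge>n. z i = 0) & a z ~= 0}} = {z \<in> U0. r z ~= 0}"
  unfolding top_simps using a(2) W_zero psi_image by auto
 finally show ?thesis using openin_open_subtopology[OF openU0] by blast
qed

lemma open_chart_image: assumes "openin (zar Z) N" shows "\<exists>H. openin (zar (affine_space n)) H & \<psi> ` (N Int U0) = H Int W"
proof -
 have "openin (subtopology (zar Z) U0) (N Int U0)" by (rule openin_subtopology_Int[OF assms])
 then have "openin (subtopology (zar (affine_space n)) W) (\<psi> ` (N Int U0))"
  using homeomorphic_imp_open_map[OF hom] unfolding open_map_def by blast
 then show ?thesis unfolding openin_subtopology .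
qed

lemma CR_local: assumes "openin (zar Z) N" "z0 \<in> N" "z0 \<in> U0" shows "\<exists>b\<in>CR. b z0 ~= 0 & (\<forall>z\<in>U0. b z ~= 0 --> z \<in> N)"
proof -
 obtain H where H: "openin (zar (affine_space n)) H" "\<psi> ` (N Int U0) = H Int W" using open_chart_image[OF assms(1)] by (elim exE conjE)
 have "\<psi> z0 \<in> H" using H(2) assms(2,3) by blast
 from affine_local[OF H(1) this] obtain f where f: "f \<in> poly_funs n" "f (\<psi> z0) ~= 0" "\<forall>v. (\<forall>i\<ge>n. v i = 0) & f v ~= 0 --> v \<in> H" by (elim bexE conjE)
 have "z \<in> N" if z: "z \<in> U0" "f (\<psi> z) ~= 0" for z
 proof -
  have "\<psi> z \<in> W" using psi_image z(1) by blast
  then have "\<psi> z \<in> \<psi> ` (N Int U0)" unfolding H(2) using f(3) z(2) W_zero by blast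
  then show ?thesis using psi_inj z(1) by (auto dest: inj_onD)
 qed
 then show ?thesis using f(2) by (intro bexI[OF _ CR_I[OF f(1)]]) auto
qed

lemma CR_reg:
 assumes V: "openin (zar Z) V" "z0 \<in> V" "z0 \<in> U0" and g: "g \<in> reg Z V"
 shows "\<exists>a\<in>CR. \<exists>b\<in>CR. b z0 ~= 0 & (\<forall>z\<in>U0. b z ~= 0 --> z \<in> V & g z = a z / b z)"
proof -
 define B where "B = V Int U0"
 let ?g = "%w. g (inv_into U0 \<psi> w)"
 have inv: "inv_into U0 \<psi> (\<psi> z) = z" if "z \<in> U0" for z by (rule inv_into_f_f[OF psi_inj that])
 have oB: "openin (zar (fsubspace (affine_space n) W)) (\<psi> ` B)"
  using open_chart_image[OF V(1)] unfolding B_def fsubspace_def by (auto simp: openin_subtopology)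
 have pB: "{z \<in> points (fsubspace Z U0). \<psi> z \<in> \<psi> ` B} = B"
  using psi_inj U0_points unfolding B_def fsubspace_def by (auto dest: inj_onD)
 have "?g \<circ> \<psi> \<in> reg (fsubspace Z U0) B"
  unfolding fsubspace_def using V(1) g by (auto simp: B_def inv intro!: exI[of _ V] exI[of _ g])
 then have "?g \<in> reg (fsubspace (affine_space n) W) (\<psi> ` B)" unfolding iso_reg[OF oB] pB .
 then have all: "\<forall>p\<in>\<psi> ` B. \<exists>H h. openin (zar (affine_space n)) H & p \<in> H & h \<in> reg (affine_space n) H & (\<forall>q\<in>H Int \<psi> ` B. ?g q = h q)"
  by (simp add: fsubspace_def)
 have p: "\<psi> z0 \<in> \<psi> ` B" using V by (simp add: B_def)
 from all[THEN bspec, OF p] obtain H h where H: "openin (zar (affine_space n)) H" "\<psi> z0 \<in> H" and h: "h \<in> reg (affine_space n) H" "\<forall>q\<in>H Int \<psi> ` B. ?g q = h q"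
  by (elim exE conjE)
 have "\<forall>p\<in>H. \<exists>a\<in>poly_funs n. \<exists>b\<in>poly_funs n. b p ~= 0 & (\<forall>q\<in>H. b q ~= 0 --> h q = a q / b q)"
  using h(1) by (simp add: affine_space_def Let_def)
 from this[THEN bspec, OF H(2)] obtain a b where ab: "a \<in> poly_funs n" "b \<in> poly_funs n" "b (\<psi> z0) ~= 0" "\<forall>q\<in>H. b q ~= 0 --> h q = a q / b q"
  by (elim bexE conjE)
 obtain f where f: "f \<in> poly_funs n" "f (\<psi> z0) ~= 0" "\<forall>v. (\<forall>i\<ge>n. v i = 0) & f v ~= 0 --> v \<in> H"
  using affine_local[OF H] by (elim bexE conjE)
 obtain c where c: "c \<in> CR" "c z0 ~= 0" "\<forall>z\<in>U0. c z ~= 0 --> z \<in> V" using CR_local[OF V] by (elim bexE conjE)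
 show ?thesis
 proof (rule bexI[of _ "%z. c z * f (\<psi> z) * a (\<psi> z)"], rule bexI[of _ "%z. c z * f (\<psi> z) * b (\<psi> z)"], intro conjI ballI impI)
  show "(%z. c z * f (\<psi> z) * a (\<psi> z)) \<in> CR" "(%z. c z * f (\<psi> z) * b (\<psi> z)) \<in> CR"
   by (rule mult[OF mult[OF c(1) CR_I[OF f(1)]]], rule CR_I, rule ab)+
  show "c z0 * f (\<psi> z0) * b (\<psi> z0) ~= 0" using c f ab by simp
  fix z assume z: "z \<in> U0" "c z * f (\<psi> z) * b (\<psi> z) ~= 0"
  then show zV: "z \<in> V" using c(3) by simp
  have "\<psi> z \<in> W" using psi_image z(1) by blast
  then have "\<psi> z \<in> H" using f(3) W_zero z(2) by auto
  moreover have "\<psi> z \<in> \<psi> ` B" using z(1) zV by (simp add: B_def)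
  ultimately have "g z = h (\<psi> z)" using h(2) inv[OF z(1)] by auto
  also have "... = a (\<psi> z) / b (\<psi> z)" using ab(4) `\<psi> z \<in> H` z(2) by auto
  finally show "g z = c z * f (\<psi> z) * a (\<psi> z) / (c z * f (\<psi> z) * b (\<psi> z))" using z(2) by simp
 qed
qed

text \<open>This ensures that points over \<open>z0\<close> belong to the product space, whose
  topology is generated by loci where a sum of products of regular functions is nonzero.\<close>

lemma nonzero_reg: assumes "z0 \<in> U0" shows "\<exists>V g. openin (zar Z) V & z0 \<in> V & g \<in> reg Z V & g z0 ~= 0"
proof -
 interpret P: function_ring "poly_funs n" by (rule poly_funs_ring)
 let ?T = "topspace (zar (affine_space n))"
 have "(%_. 1) \<in> reg (affine_space n) ?T"
  unfolding affine_space_def Let_def using P.const[of 1] by (auto intro!: bexI[of _ "%_. 1"])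
 then have "(%_. 1) \<in> reg (fsubspace (affine_space n) W) W"
  unfolding fsubspace_def using closedin_subset[OF closedW] by (auto intro!: exI[of _ ?T] exI[of _ "%_. 1"])
 moreover have "openin (zar (fsubspace (affine_space n) W)) W"
  unfolding fsubspace_def using openin_topspace[of "subtopology (zar (affine_space n)) W"] top_simps by simp
 ultimately have "(%_. 1) \<circ> \<psi> \<in> reg (fsubspace Z U0) {z \<in> points (fsubspace Z U0). \<psi> z \<in> W}"
  using iso_reg[of W "%_. 1"] by blast
 moreover have "z0 \<in> {z \<in> points (fsubspace Z U0). \<psi> z \<in> W}" using assms psi_image U0_points by (auto simp: fsubspace_def)
 ultimately have "\<exists>V g. openin (zar Z) V & z0 \<in> V & g \<in> reg Z V &
   (\<forall>q\<in>V Int {z \<in> points (fsubspace Z U0). \<psi> z \<in> W}. ((%_. 1) \<circ> \<psi>) q = g q)"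
  unfolding fsubspace_def by (simp only: fun_space.simps mem_Collect_eq)
 then obtain V g where V: "openin (zar Z) V" "z0 \<in> V" "g \<in> reg Z V"
  "\<forall>q\<in>V Int {z \<in> points (fsubspace Z U0). \<psi> z \<in> W}. ((%_. 1) \<circ> \<psi>) q = g q" by (elim exE conjE)
 have "((%_. 1 :: complex) \<circ> \<psi>) z0 = g z0"
  by (rule V(4)[THEN bspec]) (use V(2) `z0 \<in> {z \<in> points (fsubspace Z U0). \<psi> z \<in> W}` in blast)
 then have "g z0 ~= 0" by auto
 then show ?thesis by (intro exI[of _ V] exI[of _ g] conjI V(1-3))
qed

lemma RR_reg:
 assumes J: "J \<in> K" and U: "openin (zar XX) U" "x0 \<in> U" "x0 \<in> UU J" and f: "f \<in> reg XX U"
 shows "\<exists>a\<in>RR J. \<exists>b\<in>RR J. b x0 ~= 0 & (\<forall>x\<in>UU J. b x ~= 0 --> f x = a x / b x)"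
proof -
 obtain h where h: "h \<in> RR J" "h x0 ~= 0" "{q \<in> UU J. h q ~= 0} \<subseteq> U" using open_local[OF U J] by (elim bexE conjE)
 have "x0 \<in> UU J Int U" using U by blast
 from f[unfolded reg_XX, THEN bspec, OF J, THEN bspec, OF this]
 obtain a b where ab: "a \<in> RR J" "b \<in> RR J" "b x0 ~= 0" "\<forall>q\<in>UU J Int U. b q ~= 0 --> f q = a q / b q"
  by (elim bexE conjE)
 show ?thesis
  by (intro bexI[OF _ RR_mult[OF J h(1) ab(1)]] bexI[OF _ RR_mult[OF J h(1) ab(2)]]) (use h ab in auto)
qed

text \<open>\<open>d\<close> also encodes the domain: where it is nonzero, \<open>x\<close> lies in
  \<open>U\<close> and \<open>z\<close> in \<open>V\<close>. In the case \<open>k = 0\<close> only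
  this has to be arranged.\<close>

lemma fraction:
 assumes J: "J \<in> K" and U: "openin (zar XX) U" "x0 \<in> U" "x0 \<in> UU J" and V: "openin (zar Z) V" "z0 \<in> V" "z0 \<in> U0"
  and fg: "!!i. i < k ==> f i \<in> reg XX U" "!!i. i < (k::nat) ==> g i \<in> reg Z V"
 shows "\<exists>q\<in>QQ J. \<exists>d\<in>QQ J. d x0 z0 ~= 0 & (\<forall>x\<in>UU J. \<forall>z\<in>U0. d x z ~= 0 --> x \<in> U & z \<in> V & (\<Sum>i<k. f i x * g i z) = q x z / d x z)"
 using fg
proof (induct k)
 case 0
 obtain h where h: "h \<in> RR J" "h x0 ~= 0" "{q \<in> UU J. h q ~= 0} \<subseteq> U" using open_local[OF U J] by (elim bexE conjE)
 obtain c where c: "c \<in> CR" "c z0 ~= 0" "\<forall>z\<in>U0. c z ~= 0 --> z \<in> V" using CR_local[OF V] by (elim bexE conjE)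
 show ?case
  by (rule bexI[OF _ QQ_R[OF J const[of 0]]], rule bexI[OF _ QQ_mult[OF J QQ_RR[OF h(1)] QQ_R[OF J c(1)]]]) (use h c in auto)
next
 case (Suc k)
 have "\<exists>q\<in>QQ J. \<exists>d\<in>QQ J. d x0 z0 ~= 0 & (\<forall>x\<in>UU J. \<forall>z\<in>U0. d x z ~= 0 --> x \<in> U & z \<in> V & (\<Sum>i<k. f i x * g i z) = q x z / d x z)"
  by (rule Suc(1)) (simp_all add: Suc(2,3))
 then obtain q d where q: "q \<in> QQ J" "d \<in> QQ J" "d x0 z0 ~= 0"
  "\<forall>x\<in>UU J. \<forall>z\<in>U0. d x z ~= 0 --> x \<in> U & z \<in> V & (\<Sum>i<k. f i x * g i z) = q x z / d x z" by (elim bexE conjE)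
 obtain a b where ab: "a \<in> RR J" "b \<in> RR J" "b x0 ~= 0" "\<forall>x\<in>UU J. b x ~= 0 --> f k x = a x / b x"
  using RR_reg[OF J U Suc(2)[OF lessI]] by (elim bexE conjE)
 obtain a' b' where ab': "a' \<in> CR" "b' \<in> CR" "b' z0 ~= 0" "\<forall>z\<in>U0. b' z ~= 0 --> z \<in> V & g k z = a' z / b' z"
  using CR_reg[OF V Suc(3)[OF lessI]] by (elim bexE conjE)
 let ?b = "%x z. b x * b' z" and ?a = "%x z. a x * a' z"
 have bQ: "?b \<in> QQ J" "?a \<in> QQ J" using QQ_mult[OF J QQ_RR[OF ab(2)] QQ_R[OF J ab'(2)]] QQ_mult[OF J QQ_RR[OF ab(1)] QQ_R[OF J ab'(1)]] by auto
 show ?case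
 proof (rule bexI[OF _ QQ_add[OF QQ_mult[OF J q(1) bQ(1)] QQ_mult[OF J bQ(2) q(2)]]],
   rule bexI[OF _ QQ_mult[OF J q(2) bQ(1)]], intro conjI ballI impI)
  show "d x0 z0 * (b x0 * b' z0) ~= 0" using q(3) ab(3) ab'(3) by simp
  fix x z assume xz: "x \<in> UU J" "z \<in> U0" and nz: "d x z * (b x * b' z) ~= 0"
  have d: "x \<in> U" "z \<in> V" "(\<Sum>i<k. f i x * g i z) = q x z / d x z" using q(4) xz nz by auto
  show "x \<in> U" "z \<in> V" by fact+
  have fg: "f k x = a x / b x" "g k z = a' z / b' z" using ab(4) ab'(4) xz nz by auto
  show "(\<Sum>i<Suc k. f i x * g i z) = (q x z * (b x * b' z) + a x * a' z * d x z) / (d x z * (b x * b' z))"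
   unfolding sum.lessThan_Suc d(3) fg using nz by (simp add: field_simps)
 qed
qed

text \<open>A generator of the topology is rewritten by \<open>fraction\<close>: near the point it
  contains the locus where numerator times denominator is nonzero. Intersections correspond to
  products.\<close>

lemma product_local:
 assumes H: "openin (prod_zar XX Z) H" "(x0, z0) \<in> H" and J: "J \<in> K" "x0 \<in> UU J" "z0 \<in> U0"
 shows "\<exists>q\<in>QQ J. q x0 z0 ~= 0 & (\<forall>x\<in>UU J. \<forall>z\<in>U0. q x z ~= 0 --> (x, z) \<in> H)"
proof -
 let ?gen = "{{(x, y). x \<in> U & y \<in> V & (\<Sum>i<k. f i x * g i y) ~= 0} | U V (k::nat) f g.
    openin (zar XX) U & openin (zar Z) V & (\<forall>i<k. f i \<in> reg XX U & g i \<in> reg Z V)}"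
 have "generate_topology_on ?gen H" using H(1) unfolding prod_zar_def by (simp add: openin_topology_generated_by_iff)
 then show ?thesis using H(2)
 proof (induct H rule: generate_topology_on.induct)
  case (Int A B)
  then have w: "(x0, z0) \<in> A" "(x0, z0) \<in> B" by auto
  obtain f where f: "f \<in> QQ J" "f x0 z0 ~= 0" "\<forall>x\<in>UU J. \<forall>z\<in>U0. f x z ~= 0 --> (x, z) \<in> A" using Int(2)[OF w(1)] by (elim bexE conjE)
  obtain g where g: "g \<in> QQ J" "g x0 z0 ~= 0" "\<forall>x\<in>UU J. \<forall>z\<in>U0. g x z ~= 0 --> (x, z) \<in> B" using Int(4)[OF w(2)] by (elim bexE conjE)
  show ?case by (rule bexI[OF _ QQ_mult[OF J(1) f(1) g(1)]]) (use f g in auto)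
 next
  case (UN \<K>)
  then obtain A where A: "A \<in> \<K>" "(x0, z0) \<in> A" by blast
  obtain f where f: "f \<in> QQ J" "f x0 z0 ~= 0" "\<forall>x\<in>UU J. \<forall>z\<in>U0. f x z ~= 0 --> (x, z) \<in> A" using UN(2)[OF A] by (elim bexE conjE)
  show ?case by (rule bexI[OF _ f(1)]) (use f A in auto)
 next
  case (Basis B)
  from Basis(1) obtain U V k f g where B: "B = {(x, y). x \<in> U & y \<in> V & (\<Sum>i<(k::nat). f i x * g i y) ~= 0}"
   and UV: "openin (zar XX) U" "openin (zar Z) V" "\<forall>i<k. f i \<in> reg XX U & g i \<in> reg Z V" by (elim CollectE exE conjE)
  have x0: "x0 \<in> U" "z0 \<in> V" "(\<Sum>i<k. f i x0 * g i z0) ~= 0" using Basis(2) unfolding B by auto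
  have "\<exists>q\<in>QQ J. \<exists>d\<in>QQ J. d x0 z0 ~= 0 & (\<forall>x\<in>UU J. \<forall>z\<in>U0. d x z ~= 0 --> x \<in> U & z \<in> V & (\<Sum>i<k. f i x * g i z) = q x z / d x z)"
   by (rule fraction[OF J(1) UV(1) x0(1) J(2) UV(2) x0(2) J(3)]) (use UV(3) in auto)
  then obtain q d where q: "q \<in> QQ J" "d \<in> QQ J" "d x0 z0 ~= 0"
   "\<forall>x\<in>UU J. \<forall>z\<in>U0. d x z ~= 0 --> x \<in> U & z \<in> V & (\<Sum>i<k. f i x * g i z) = q x z / d x z" by (elim bexE conjE)
  have "q x0 z0 ~= 0" using q(3,4) J(2,3) x0(3) by auto
  moreover have "(x, z) \<in> B" if "x \<in> UU J" "z \<in> U0" "q x z * d x z ~= 0" for x z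
   using q(4)[THEN bspec, OF that(1), THEN bspec, OF that(2)] that(3) unfolding B by auto
  ultimately show ?case using q(3) by (intro bexI[OF _ QQ_mult[OF J(1) q(1,2)]]) auto
 qed simp
qed

end

lemma complete_variety_XX: "complete_variety XX"
 unfolding complete_variety_def closed_map_def
proof (intro allI impI)
 fix Z :: "(nat => complex) fun_space" and A
 assume Z: "prevariety Z" and A: "closedin (prod_zar XX Z) A"
 have "topspace (prod_zar XX Z) \<subseteq> points XX \<times> points Z"
  unfolding prod_zar_def topology_generated_by_topspace
 proof (rule Union_least, elim CollectE exE conjE)
  fix S U V and k :: nat and f g
  assume "S = {(x, y). x \<in> U & y \<in> V & (\<Sum>i<k. f i x * g i y) ~= 0}" "openin (zar XX) U" "openin (zar Z) V"
  then show "S \<subseteq> points XX \<times> points Z" using openin_subset[of "zar XX" U] openin_subset[of "zar Z" V] by auto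
 qed
 then have AP: "A \<subseteq> points XX \<times> points Z" using closedin_subset[OF A] by blast
 have "openin (zar Z) (points Z - snd ` A)"
 proof (subst openin_subopen, intro ballI)
  fix z0 assume z0: "z0 \<in> points Z - snd ` A"
  obtain \<U> where \<U>: "\<Union>\<U> = points Z" "\<forall>U\<in>\<U>. openin (zar Z) U &
      (\<exists>n W. closedin (zar (affine_space n)) W & fs_isomorphic (fsubspace Z U) (fsubspace (affine_space n) W))"
   using Z unfolding prevariety_def by (elim conjE exE)
  obtain U0 where U0: "U0 \<in> \<U>" "z0 \<in> U0" using \<U>(1) z0 by blast
  obtain n W \<psi> where ch: "openin (zar Z) U0" "closedin (zar (affine_space n)) W" "fs_iso (fsubspace Z U0) (fsubspace (affine_space n) W) \<psi>"
   using \<U>(2)[THEN bspec, OF U0(1)] unfolding fs_isomorphic_def by (elim conjE exE)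
  interpret C: affine_chart Z U0 n W \<psi> by unfold_locales (rule ch)+
  let ?A = "{(x, z) \<in> A. z \<in> U0}"
  have "\<exists>r\<in>C.CR. r z0 ~= 0 & (\<forall>x z. (x, z) \<in> ?A --> r z = 0)"
  proof (rule C.projection_equation)
   show "x \<in> points XX" if "(x, z) \<in> ?A" for x z using that AP by auto
   fix J x assume J: "J \<in> Mx" "x \<in> UU J"
   have xP: "x \<in> points XX" using UU_PP[OF MxK[OF J(1)]] J(2) points_XX by blast
   have n: "(x, z0) ~: A" using z0 by force
   have o: "openin (prod_zar XX Z) (topspace (prod_zar XX Z) - A)" using A by blast
   have "(x, z0) \<in> topspace (prod_zar XX Z)"
   proof -
    have 1: "(%_. 1) \<in> reg XX (points XX)"
     unfolding reg_XX
    proof (intro ballI)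
     fix I p assume I: "I \<in> K"
     show "\<exists>a\<in>RR I. \<exists>b\<in>RR I. b p ~= 0 & (\<forall>q\<in>UU I Int points XX. b q ~= 0 --> 1 = a q / b q)"
      by (intro bexI[OF _ RR_const[OF I, of 1]]) simp
    qed
    obtain V g where V: "openin (zar Z) V" "z0 \<in> V" "g \<in> reg Z V" "g z0 ~= 0" using C.nonzero_reg[OF U0(2)] by (elim exE conjE)
    have "openin (prod_zar XX Z) {(x, y). x \<in> points XX & y \<in> V & (\<Sum>i<(1::nat). 1 * g y) ~= 0}"
     unfolding prod_zar_def
    proof (rule topology_generated_by_Basis, intro CollectI exI conjI)
     show "{(x, y). x \<in> points XX & y \<in> V & (\<Sum>i<(1::nat). 1 * g y) ~= 0} =
      {(x, y). x \<in> points XX & y \<in> V & (\<Sum>i<(1::nat). (%_ _. 1) i x * (%_. g) i y) ~= 0}" by simp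
    qed (use V 1 in auto)
    from openin_subset[OF this] show ?thesis using V xP by auto
   qed
   then have "(x, z0) \<in> topspace (prod_zar XX Z) - A" using n by blast
   from C.product_local[OF o this MxK[OF J(1)] J(2) U0(2)]
   obtain q where q: "q \<in> C.QQ J" "q x z0 ~= 0" "\<forall>y\<in>UU J. \<forall>z\<in>U0. q y z ~= 0 --> (y, z) \<in> topspace (prod_zar XX Z) - A" by (elim bexE conjE)
   show "\<exists>q\<in>C.QQ J. q x z0 ~= 0 & (\<forall>y z. (y, z) \<in> ?A & y \<in> UU J --> q y z = 0)"
    by (rule bexI[OF _ q(1)]) (use q(2,3) in blast)
  qed
  then obtain r where r: "r \<in> C.CR" "r z0 ~= 0" "\<forall>x z. (x, z) \<in> ?A --> r z = 0" by (elim bexE conjE)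
  show "\<exists>T. openin (zar Z) T & z0 \<in> T & T \<subseteq> points Z - snd ` A"
  proof (intro exI[of _ "{z \<in> U0. r z ~= 0}"] conjI)
   show "openin (zar Z) {z \<in> U0. r z ~= 0}" by (rule C.open_CR[OF r(1)])
   show "z0 \<in> {z \<in> U0. r z ~= 0}" using U0(2) r(2) by blast
   show "{z \<in> U0. r z ~= 0} \<subseteq> points Z - snd ` A"
   proof
    fix z assume z: "z \<in> {z \<in> U0. r z ~= 0}"
    have "(x, z) ~: A" for x using r(3) z by auto
    then show "z \<in> points Z - snd ` A" using C.U0_points z by auto
   qed
  qed
 qed
 moreover have "snd ` A \<subseteq> points Z" using AP by auto
 ultimately show "closedin (zar Z) (snd ` A)" by (simp add: closedin_def)
qed

theorem mainTheorem2:
  defines "X \<equiv> toric_variety example_fan"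
  shows "rational_fan example_fan \<and> simplicial_fan example_fan \<and> complete_fan example_fan \<and>
         q_factorial X \<and> complete_variety X \<and>
         krull_dim (zar X) = 3 \<and> picard_number X = 3 \<and>
         \<not> projective X \<and>
         nef_cone X = {\<one>\<^bsub>tensor_real (class_group X)\<^esub>}"
  unfolding X_def
  by (intro conjI rational_example_fan simplicial_example_fan complete_example_fan q_factorial_XX
      complete_variety_XX krull_dim_XX picard_number_XX not_projective_XX nef_cone_XX)

end
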